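(* There exists a Monte-Carlo data structure that works against an adaptive adversary, with the following procedures: - Initialize$(A,g,x^{(0)},\epsilon)$: Given a matrix $A\in\mathbb{R}^{n\times d}$, a scaling $g\in\mathbb{R}^n$, an initial vector $x^{(0)}$ and a target accuracy $\epsilon\in(0,1/10)$, the data structure preprocesses in $O(\mathrm{nnz}(A)\log^5n)$ time. - Scale$(i,u)$: Given $i\in[n]$ and $u\in\mathbb{R}$, sets $g_i=u$ in $O(d\log^5n)$ amortized time. - Query$(h^{(t)},\delta^{(t)})$: Let $g^{(t)}\in\mathbb{R}^n$ be the scale vector $g$ during the $t$-th call to Query and let $h^{(t)}\in\mathbb{R}^d$, $\delta^{(t)}\in\mathbb{R}^n$ be the vectors given during that query. Define $$x^{(t)}=x^{(0)}+\sum_{k\in[t]}G^{(k)}Ah^{(k)}+\sum_{k\in[t]}\delta^{(k)} .$$ Then, with high probability in $n$, the data structure outputs a vector $y\in\mathbb{R}^n$ such that $y\approx_\epsilon x^{(t)}$. Furthermore, the total cost over $T$ steps is $$O\left(T\left(n\log n+\sum_{k\in[T]}\Big(\big\|(X^{(k)})^{-1}G^{(k)}Ah^{(k)}\big\|_2^2+\big\|(X^{(k)})^{-1}\delta^{(k)}\big\|_2^2\Big)\cdot\epsilon^{-2}\cdot d\log^6n\right)\right).$$ - ComputeExact$(i)$: Outputs $x_i^{(t)}\in\mathbb{R}$ exactly in amortized time $O(d\log n)$. Here the vectors $x^{(t)}$ are assumed to have positive entries.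
   Context: $G^{(k)}=\mathrm{Diag}(g^{(k)})$, $X^{(k)}=\mathrm{Diag}(x^{(k)})$; $\mathrm{nnz}(A)$ is the number of nonzero entries of $A$; $[t]=\{1,\dots,t\}$. $y\approx_\epsilon x$ means $e^{-\epsilon}x\le y\le e^{\epsilon}x$ entrywise. $A$ is non-degenerate (full column rank and no zero rows). "With high probability in $n$" means with probability at least $1-1/\mathrm{poly}(n)$ for any polynomial, by choice of the constants in the runtime. "Works against an adaptive adversary" means that the inputs of each operation may depend on the outputs of previous operations of the data structure. *)

theory Defs
  imports "HOL-Probability.Probability" "Jordan_Normal_Form.DL_Rank"
begin

unbundle no vec_syntax
hide_type (open) Finite_Cartesian_Product.vec
hide_const (open) Finite_Cartesian_Product.vec

text \<open>
  A randomised real RAM: running time is the number of executed instructions and branch tests.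
  Words have \<open>w\<close> bits, and reals are stored in a second memory with exact
  arithmetic and comparison. Words can be converted to reals but not conversely, so there is no
  rounding of reals. Addresses of indirect accesses are words. The input of a procedure is
  randomly accessible and read-only; its output is a write-only array of reals.
  The first operand of an instruction is the destination, and for \<open>WStore\<close>, \<open>RStore\<close> and
  \<open>ROutput\<close> the word register holding its address. Word results are reduced modulo
  \<open>2 ^ w\<close>; subtraction of words is truncated at 0. \<open>WRand\<close> draws a uniform word.
\<close>

datatype word_op = WAdd | WSub | WMul | WDiv | WMod
datatype real_op = RAdd | RSub | RMul | RDiv

datatype instr =
    WConst nat nat
  | WArith word_op nat nat nat
  | WLoad nat nat
  | WStore nat nat
  | WInput nat nat
  | WRand nat
  | RArith real_op nat nat nat
  | RLoad nat nat
  | RStore nat nat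
  | RInput nat nat
  | ROfWord nat nat
  | ROutput nat nat

datatype test = WLess nat nat | RLess nat nat

datatype prog =
    Basic instr
  | Seq prog prog
  | Cond test prog prog
  | Loop test prog

record mstate =
  wmem :: "nat \<Rightarrow> nat"
  rmem :: "nat \<Rightarrow> real"
  outp :: "nat \<Rightarrow> real"
  clock :: nat

type_synonym input = "(nat \<Rightarrow> nat) \<times> (nat \<Rightarrow> real)"

primrec word_fun :: "word_op \<Rightarrow> nat \<Rightarrow> nat \<Rightarrow> nat" where
  "word_fun WAdd = (+)"
| "word_fun WSub = (-)"
| "word_fun WMul = (*)"
| "word_fun WDiv = (div)"
| "word_fun WMod = (mod)"

primrec real_fun :: "real_op \<Rightarrow> real \<Rightarrow> real \<Rightarrow> real" where
  "real_fun RAdd = (+)"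
| "real_fun RSub = (-)"
| "real_fun RMul = (*)"
| "real_fun RDiv = (/)"

definition tick :: "mstate \<Rightarrow> mstate" where
  "tick s = s\<lparr>clock := Suc (clock s)\<rparr>"

definition put_word :: "nat \<Rightarrow> nat \<Rightarrow> nat \<Rightarrow> mstate \<Rightarrow> mstate" where
  "put_word w a k s = s\<lparr>wmem := (wmem s)(a := k mod 2 ^ w)\<rparr>"

definition put_real :: "nat \<Rightarrow> real \<Rightarrow> mstate \<Rightarrow> mstate" where
  "put_real a r s = s\<lparr>rmem := (rmem s)(a := r)\<rparr>"

primrec effect :: "nat \<Rightarrow> input \<Rightarrow> instr \<Rightarrow> mstate \<Rightarrow> mstate spmf" where
  "effect w inp (WConst a k) s = return_spmf (put_word w a k s)"
| "effect w inp (WArith f a b c) s =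
     return_spmf (put_word w a (word_fun f (wmem s b) (wmem s c)) s)"
| "effect w inp (WLoad a b) s = return_spmf (put_word w a (wmem s (wmem s b)) s)"
| "effect w inp (WStore a b) s = return_spmf (put_word w (wmem s a) (wmem s b) s)"
| "effect w inp (WInput a b) s = return_spmf (put_word w a (fst inp (wmem s b)) s)"
| "effect w inp (WRand a) s = map_spmf (\<lambda>k. put_word w a k s) (spmf_of_set {..<2 ^ w})"
| "effect w inp (RArith f a b c) s =
     return_spmf (put_real a (real_fun f (rmem s b) (rmem s c)) s)"
| "effect w inp (RLoad a b) s = return_spmf (put_real a (rmem s (wmem s b)) s)"
| "effect w inp (RStore a b) s = return_spmf (put_real (wmem s a) (rmem s b) s)"
| "effect w inp (RInput a b) s = return_spmf (put_real a (snd inp (wmem s b)) s)"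
| "effect w inp (ROfWord a b) s = return_spmf (put_real a (real (wmem s b)) s)"
| "effect w inp (ROutput a b) s =
     return_spmf (s\<lparr>outp := (outp s)(wmem s a := rmem s b)\<rparr>)"

primrec holds :: "test \<Rightarrow> mstate \<Rightarrow> bool" where
  "holds (WLess a b) s = (wmem s a < wmem s b)"
| "holds (RLess a b) s = (rmem s a < rmem s b)"

partial_function (spmf) iterate ::
    "test \<Rightarrow> (mstate \<Rightarrow> mstate spmf) \<Rightarrow> mstate \<Rightarrow> mstate spmf" where
  "iterate b f s =
     (if holds b s then bind_spmf (f (tick s)) (\<lambda>s'. iterate b f s')
      else return_spmf (tick s))"

text \<open>Non-termination is the mass missing from the resulting subprobability distribution.\<close>

primrec exec :: "nat \<Rightarrow> input \<Rightarrow> prog \<Rightarrow> mstate \<Rightarrow> mstate spmf" where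
  "exec w inp (Basic i) = (\<lambda>s. effect w inp i (tick s))"
| "exec w inp (Seq p q) = (\<lambda>s. bind_spmf (exec w inp p s) (exec w inp q))"
| "exec w inp (Cond b p q) =
     (\<lambda>s. if holds b s then exec w inp p (tick s) else exec w inp q (tick s))"
| "exec w inp (Loop b p) = iterate b (exec w inp p)"

text \<open>A call keeps both memories, starts with a blank output array, and times itself.\<close>

definition call :: "nat \<Rightarrow> input \<Rightarrow> prog \<Rightarrow> mstate \<Rightarrow> mstate spmf" where
  "call w inp p s = exec w inp p (s\<lparr>outp := (\<lambda>_. 0), clock := 0\<rparr>)"

definition blank :: mstate where
  "blank = \<lparr>wmem = (\<lambda>_. 0), rmem = (\<lambda>_. 0), outp = (\<lambda>_. 0), clock = 0\<rparr>"

definition to_input :: "nat list \<Rightarrow> real list \<Rightarrow> input" where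
  "to_input ks rs = (nth_default 0 ks, nth_default 0 rs)"

text \<open>Words have \<open>O(log n)\<close> bits; the factor \<open>W\<close> is a constant chosen with the data structure.\<close>

definition word_length :: "nat \<Rightarrow> nat \<Rightarrow> nat" where
  "word_length W n = W * nat \<lceil>log 2 (real n)\<rceil>"

text \<open>Row-major order, so the matrix is passed in sparse form with \<open>nnz A\<close> entries.\<close>

definition nonzeros :: "real mat \<Rightarrow> (nat \<times> nat) list" where
  "nonzeros A =
     filter (\<lambda>ij. A $$ ij \<noteq> 0) (List.product [0..<dim_row A] [0..<dim_col A])"

definition nnz :: "real mat \<Rightarrow> nat" where
  "nnz A = card {(i, j). i < dim_row A \<and> j < dim_col A \<and> A $$ (i, j) \<noteq> 0}"

definition nondegenerate :: "real mat \<Rightarrow> bool" where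
  "nondegenerate A \<longleftrightarrow>
     vec_space.rank (dim_row A) A = dim_col A \<and>
     (\<forall>i<dim_row A. row A i \<noteq> 0\<^sub>v (dim_col A))"

definition Diag :: "real vec \<Rightarrow> real mat" where
  "Diag v = mat_diag (dim_vec v) (\<lambda>i. v $ i)"

definition Diag_inv :: "real vec \<Rightarrow> real mat" where
  "Diag_inv v = mat_diag (dim_vec v) (\<lambda>i. inverse (v $ i))"

definition sqnorm2 :: "real vec \<Rightarrow> real" where
  "sqnorm2 v = (\<Sum>i<dim_vec v. (v $ i)\<^sup>2)"

definition approx :: "real \<Rightarrow> real vec \<Rightarrow> real vec \<Rightarrow> bool" where
  "approx \<epsilon> y x \<longleftrightarrow>
     dim_vec y = dim_vec x \<and>
     (\<forall>i<dim_vec x. exp (- \<epsilon>) * x $ i \<le> y $ i \<and> y $ i \<le> exp \<epsilon> * x $ i)"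

text \<open>Indices are counted from 0.\<close>

datatype request =
    is_Scale: Scale nat real
  | is_Query: Query "real vec" "real vec"
  | is_Exact: ComputeExact nat

text \<open>The triples \<open>(g, h, \<delta>)\<close> of the successive Query calls, \<open>g\<close> being the scaling in force.\<close>

fun queries :: "real vec \<Rightarrow> request list \<Rightarrow> (real vec \<times> real vec \<times> real vec) list" where
  "queries g [] = []"
| "queries g (Scale i u # qs) = queries (g |\<^sub>v i \<mapsto> u) qs"
| "queries g (Query h \<delta> # qs) = (g, h, \<delta>) # queries g qs"
| "queries g (ComputeExact i # qs) = queries g qs"

text \<open>The \<open>k\<close>-th query of the mathematical description is the list element with index \<open>k - 1\<close>.\<close>

definition xvec ::
    "real mat \<Rightarrow> real vec \<Rightarrow> (real vec \<times> real vec \<times> real vec) list \<Rightarrow> nat \<Rightarrow> real vec" where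
  "xvec A x0 L t = vec (dim_row A) (\<lambda>i.
     x0 $ i
     + (\<Sum>k\<in>{1..t}. case L ! (k - 1) of (g, h, \<delta>) \<Rightarrow> (Diag g *\<^sub>v (A *\<^sub>v h)) $ i)
     + (\<Sum>k\<in>{1..t}. case L ! (k - 1) of (g, h, \<delta>) \<Rightarrow> \<delta> $ i))"

definition energy ::
    "real mat \<Rightarrow> real vec \<Rightarrow> (real vec \<times> real vec \<times> real vec) list \<Rightarrow> real" where
  "energy A x0 L =
     (\<Sum>k\<in>{1..length L}. case L ! (k - 1) of (g, h, \<delta>) \<Rightarrow>
        sqnorm2 (Diag_inv (xvec A x0 L k) *\<^sub>v (Diag g *\<^sub>v (A *\<^sub>v h)))
        + sqnorm2 (Diag_inv (xvec A x0 L k) *\<^sub>v \<delta>))"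

primrec well_formed :: "nat \<Rightarrow> nat \<Rightarrow> request \<Rightarrow> bool" where
  "well_formed n d (Scale i u) \<longleftrightarrow> i < n"
| "well_formed n d (Query h \<delta>) \<longleftrightarrow> h \<in> carrier_vec d \<and> \<delta> \<in> carrier_vec n"
| "well_formed n d (ComputeExact i) \<longleftrightarrow> i < n"

definition admissible :: "real mat \<Rightarrow> real vec \<Rightarrow> real vec \<Rightarrow> request list \<Rightarrow> bool" where
  "admissible A g x0 qs \<longleftrightarrow>
     (\<forall>q\<in>set qs. well_formed (dim_row A) (dim_col A) q) \<and>
     (\<forall>t\<le>length (queries g qs). \<forall>i<dim_row A. xvec A x0 (queries g qs) t $ i > 0)"

record data_structure =
  init_prog :: prog
  scale_prog :: prog
  query_prog :: prog
  exact_prog :: prog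

text \<open>
  The adversary chooses the next request as a function of all earlier outputs. It is deterministic;
  a randomised adversary is a mixture of deterministic ones.
\<close>

type_synonym adversary = "real vec list \<Rightarrow> request"

definition admissible_adversary ::
    "real mat \<Rightarrow> real vec \<Rightarrow> real vec \<Rightarrow> adversary \<Rightarrow> bool" where
  "admissible_adversary A g x0 adv \<longleftrightarrow>
     (\<forall>ys. admissible A g x0 (map (\<lambda>m. adv (take m ys)) [0..<Suc (length ys)]))"

definition initialize ::
    "data_structure \<Rightarrow> nat \<Rightarrow> real mat \<Rightarrow> real vec \<Rightarrow> real vec \<Rightarrow> real \<Rightarrow> mstate spmf" where
  "initialize D w A g x0 \<epsilon> =
     call w
       (to_input
         (dim_row A # dim_col A # length (nonzeros A)
           # concat (map (\<lambda>(i, j). [i, j]) (nonzeros A)))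
         (\<epsilon> # list_of_vec g @ list_of_vec x0 @ map (\<lambda>ij. A $$ ij) (nonzeros A)))
       (init_prog D) blank"

primrec serve :: "data_structure \<Rightarrow> nat \<Rightarrow> request \<Rightarrow> mstate \<Rightarrow> mstate spmf" where
  "serve D w (Scale i u) = call w (to_input [i] [u]) (scale_prog D)"
| "serve D w (Query h \<delta>) =
     call w (to_input [] (list_of_vec h @ list_of_vec \<delta>)) (query_prog D)"
| "serve D w (ComputeExact i) = call w (to_input [i] []) (exact_prog D)"

fun answer :: "nat \<Rightarrow> request \<Rightarrow> mstate \<Rightarrow> real vec" where
  "answer n (Scale i u) s = vec 0 (outp s)"
| "answer n (Query h \<delta>) s = vec n (outp s)"
| "answer n (ComputeExact i) s = vec 1 (outp s)"

text \<open>A log lists the calls made so far: request, output, and running time.\<close>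

type_synonym log = "(request \<times> real vec \<times> nat) list"

abbreviation requests :: "log \<Rightarrow> request list" where
  "requests \<equiv> map fst"

abbreviation outputs :: "log \<Rightarrow> real vec list" where
  "outputs \<equiv> map (\<lambda>(q, y, c). y)"

definition query_outputs :: "log \<Rightarrow> real vec list" where
  "query_outputs tr = outputs (filter (\<lambda>(q, y, c). is_Query q) tr)"

definition time_of :: "(request \<Rightarrow> bool) \<Rightarrow> log \<Rightarrow> nat" where
  "time_of P tr = (\<Sum>(q, y, c)\<leftarrow>tr. if P q then c else 0)"

definition number_of :: "(request \<Rightarrow> bool) \<Rightarrow> log \<Rightarrow> nat" where
  "number_of P tr = length (filter P (requests tr))"

primrec play ::
    "data_structure \<Rightarrow> nat \<Rightarrow> real mat \<Rightarrow> real vec \<Rightarrow> real vec \<Rightarrow> real \<Rightarrow> adversary \<Rightarrow> nat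
      \<Rightarrow> (mstate \<times> log) spmf" where
  "play D w A g x0 \<epsilon> adv 0 = map_spmf (\<lambda>s. (s, [])) (initialize D w A g x0 \<epsilon>)"
| "play D w A g x0 \<epsilon> adv (Suc m) =
     bind_spmf (play D w A g x0 \<epsilon> adv m) (\<lambda>(s, tr).
       let q = adv (outputs tr) in
       map_spmf (\<lambda>s'. (s', tr @ [(q, answer (dim_row A) q s', clock s')])) (serve D w q s))"

definition logs ::
    "data_structure \<Rightarrow> nat \<Rightarrow> real mat \<Rightarrow> real vec \<Rightarrow> real vec \<Rightarrow> real \<Rightarrow> adversary \<Rightarrow> nat
      \<Rightarrow> log spmf" where
  "logs D w A g x0 \<epsilon> adv m = map_spmf snd (play D w A g x0 \<epsilon> adv m)"

definition query_bound :: "real mat \<Rightarrow> real vec \<Rightarrow> real vec \<Rightarrow> real \<Rightarrow> log \<Rightarrow> real" where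
  "query_bound A g x0 \<epsilon> tr =
     (let n = real (dim_row A); d = real (dim_col A);
          L = queries g (requests tr); T = real (length L)
      in T * (n * ln n + energy A x0 L * (1 / \<epsilon>\<^sup>2) * d * ln n ^ 6))"

definition scale_exact_bound :: "real mat \<Rightarrow> log \<Rightarrow> real" where
  "scale_exact_bound A tr =
     (let n = real (dim_row A); d = real (dim_col A)
      in real (number_of is_Scale tr) * (d * ln n ^ 5)
         + real (number_of is_Exact tr) * (d * ln n))"

end

theory Submission
  imports Defs
begin

text \<open>
  For each row \<open>i\<close> the structure reports the value \<open>x_i\<close> had when it was last synchronised. At dyadic
  level \<open>l\<close> it accumulates the relative changes since the last multiple of \<open>2 ^ l\<close> and, at each such
  multiple, resynchronises the rows whose accumulated change exceeds \<open>\<epsilon> / (8 L)\<close>. Any interval of queries is a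
  union of at most \<open>2 L\<close> dyadic ones, so a row that has not been synchronised has drifted by a factor
  at most \<open>1 \<plusminus> \<epsilon> / 2\<close>. Large rows are found by descending a binary tree whose nodes hold
  random-sign sketches. After \<open>2 ^ L\<close> queries everything is recomputed with fresh signs.

  As long as no test errs, the outputs are those of a deterministic process that ignores the signs.
  Hence an adaptive adversary learns nothing about the signs before the first error, and a union bound over
  the tests of that process is enough. For the running time this is needed only in polynomially many
  epochs: later a single epoch either has tiny energy, and then no test can err, or its worst-case cost is
  paid for by the factor \<open>T\<close> in front of the energy.
\<close>

text \<open>A query moves all rows at once, but its cost must be O(n log n) plus a term in the
  energy, so it cannot touch the sketches. They therefore store the weighted rows
  \<open>g_i / b_i * A_i\<close> (\<open>b\<close> is the reported vector), and a test multiplies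
  them by the sum of the \<open>h\<close> over the window. Weights change inside a window, by Scale
  and by synchronisation; one more column per level carries the discrepancy, so that the decoded
  number is always the true accumulated change. The part due to the \<open>\<delta>\<close> is kept
  entry by entry, in windows of its own; hence 8 and not 4 in the threshold. The energy is relative
  to the current \<open>x\<close>, the windows to stale values. After a jump of a row the two cannot
  be compared, but then the energy of the jump is itself bounded below. Changes in a window of
  \<open>2 ^ l\<close> queries are compared with its energy by Cauchy-Schwarz; this loses
  \<open>2 ^ l\<close>, and the sum over the levels is the factor \<open>T\<close>. \<open>L\<close>
  is twice the rounded logarithm of \<open>n\<close>, so that a rebuild, spread over
  \<open>2 ^ L\<close> queries, costs O(n log n) for each. The leaf tests are exact, so only missed
  rows, not false alarms, can influence an output.\<close>

section \<open>A small language compiled to the machine\<close>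

datatype wexp = N nat | V nat | Op word_op wexp wexp | InW wexp

datatype rexp = Rd nat wexp | OfW wexp | InR wexp | Bop real_op rexp rexp | Sq rexp
  | Lt rexp rexp | Sum nat wexp rexp

primrec evalW :: "input \<Rightarrow> (nat \<Rightarrow> nat) \<Rightarrow> wexp \<Rightarrow> nat" where
  "evalW inp W (N c) = c"
| "evalW inp W (V x) = W x"
| "evalW inp W (Op f a b) = word_fun f (evalW inp W a) (evalW inp W b)"
| "evalW inp W (InW e) = fst inp (evalW inp W e)"

text \<open>The machine reduces words modulo \<open>2 ^ w\<close>, the evaluation does not.
  Wrap-around is excluded here in every intermediate result, so that the two agree.\<close>

primrec fitsW :: "nat \<Rightarrow> input \<Rightarrow> (nat \<Rightarrow> nat) \<Rightarrow> wexp \<Rightarrow> bool" where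
  "fitsW w inp W (N c) \<longleftrightarrow> c < 2 ^ w"
| "fitsW w inp W (V x) \<longleftrightarrow> W x < 2 ^ w"
| "fitsW w inp W (Op f a b) \<longleftrightarrow> fitsW w inp W a \<and> fitsW w inp W b \<and>
     word_fun f (evalW inp W a) (evalW inp W b) < 2 ^ w"
| "fitsW w inp W (InW e) \<longleftrightarrow> fitsW w inp W e \<and> fst inp (evalW inp W e) < 2 ^ w"

primrec costW :: "wexp \<Rightarrow> nat" where
  "costW (N c) = 1"
| "costW (V x) = 2"
| "costW (Op f a b) = costW a + costW b + 1"
| "costW (InW e) = costW e + 1"

text \<open>Odd word addresses and real addresses of residue 15 modulo 16 are temporaries. Variables
  get the even words and array \<open>a < 15\<close> the reals of residue \<open>a\<close>, so
  arrays need no fixed length and never meet each other or a temporary.\<close>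

definition hw :: "nat \<Rightarrow> nat" where "hw k = 2 * k + 1"
definition hr :: "nat \<Rightarrow> nat" where "hr k = 16 * k + 15"

lemma hw_hr_inj [simp]: "hw i = hw j \<longleftrightarrow> i = j" "hr i = hr j \<longleftrightarrow> i = j"
  by (auto simp: hw_def hr_def)

text \<open>There is no move between registers, so a variable is copied by adding it to a zeroed
  temporary. The second operand is computed one temporary further up and cannot destroy the
  first.\<close>

primrec compW :: "wexp \<Rightarrow> nat \<Rightarrow> prog" where
  "compW (N c) k = Basic (WConst (hw k) c)"
| "compW (V x) k = Seq (Basic (WConst (hw k) 0)) (Basic (WArith WAdd (hw k) (hw k) (2 * x)))"
| "compW (Op f a b) k =
     Seq (compW a k) (Seq (compW b (Suc k)) (Basic (WArith f (hw k) (hw k) (hw (Suc k)))))"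
| "compW (InW e) k = Seq (compW e k) (Basic (WInput (hw k) (hw k)))"

definition addr :: "nat \<Rightarrow> wexp \<Rightarrow> wexp" where
  "addr a e = Op WAdd (Op WMul (N 16) e) (N a)"

definition seqs :: "prog list \<Rightarrow> prog" where
  "seqs ps = foldr Seq (butlast ps) (last ps)"

lemma seqs_simps [simp]:
  "seqs [p] = p" "seqs (p # q # ps) = Seq p (seqs (q # ps))"
  by (simp_all add: seqs_def)

lemma rel_spmf_set1: "rel_spmf R p q \<Longrightarrow> x \<in> set_spmf p \<Longrightarrow> \<exists>y\<in>set_spmf q. R x y"
  using rel_funD[OF set_spmf_parametric] by (metis rel_setD1)

text \<open>
  Counted loop: hidden words \<open>k, \<dots>, k + 4\<close> hold the limit, the counter, the constant 1, the saved
  value of the index variable and the constant 0.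
\<close>

definition count_loop :: "nat \<Rightarrow> wexp \<Rightarrow> (nat \<Rightarrow> prog) \<Rightarrow> nat \<Rightarrow> prog" where
  "count_loop x e c k = seqs [compW e k, Basic (WConst (hw (k+1)) 0), Basic (WConst (hw (k+2)) 1),
     Basic (WConst (hw (k+4)) 0), Basic (WArith WAdd (hw (k+3)) (2 * x) (hw (k+4))),
     Loop (WLess (hw (k+1)) (hw k))
       (seqs [Basic (WArith WAdd (2 * x) (hw (k+1)) (hw (k+4))), c (k+5),
              Basic (WArith WAdd (hw (k+1)) (hw (k+1)) (hw (k+2)))]),
     Basic (WArith WAdd (2 * x) (hw (k+3)) (hw (k+4)))]"

primrec compR :: "rexp \<Rightarrow> nat \<Rightarrow> prog" where
  "compR (Rd a e) k = Seq (compW (addr a e) k) (Basic (RLoad (hr k) (hw k)))"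
| "compR (OfW e) k = Seq (compW e k) (Basic (ROfWord (hr k) (hw k)))"
| "compR (InR e) k = Seq (compW e k) (Basic (RInput (hr k) (hw k)))"
| "compR (Bop f a b) k =
     Seq (compR a k) (Seq (compR b (Suc k)) (Basic (RArith f (hr k) (hr k) (hr (Suc k)))))"
| "compR (Sq a) k = Seq (compR a k) (Basic (RArith RMul (hr k) (hr k) (hr k)))"
| "compR (Lt a b) k = seqs [compR a k, compR b (Suc k),
     Cond (RLess (hr k) (hr (Suc k))) (Basic (WConst (hw k) 1)) (Basic (WConst (hw k) 0)),
     Basic (ROfWord (hr k) (hw k))]"
| "compR (Sum x e b) k = seqs [Basic (WConst (hw k) 0), Basic (ROfWord (hr k) (hw k)),
     count_loop x e (\<lambda>j. Seq (compR b j) (Basic (RArith RAdd (hr k) (hr k) (hr j)))) (Suc k)]"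

type_synonym store = "(nat \<Rightarrow> nat) \<times> (nat \<Rightarrow> nat \<Rightarrow> real) \<times> (nat \<Rightarrow> real)"

primrec evalR :: "input \<Rightarrow> (nat \<Rightarrow> nat \<Rightarrow> real) \<Rightarrow> rexp \<Rightarrow> (nat \<Rightarrow> nat) \<Rightarrow> real" where
  "evalR inp h (Rd a e) = (\<lambda>W. h a (evalW inp W e))"
| "evalR inp h (OfW e) = (\<lambda>W. real (evalW inp W e))"
| "evalR inp h (InR e) = (\<lambda>W. snd inp (evalW inp W e))"
| "evalR inp h (Bop f a b) = (\<lambda>W. real_fun f (evalR inp h a W) (evalR inp h b W))"
| "evalR inp h (Sq a) = (\<lambda>W. (evalR inp h a W)\<^sup>2)"
| "evalR inp h (Lt a b) = (\<lambda>W. of_bool (evalR inp h a W < evalR inp h b W))"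
| "evalR inp h (Sum x e b) = (\<lambda>W. \<Sum>i<evalW inp W e. evalR inp h b (W(x := i)))"

primrec fitsR :: "nat \<Rightarrow> input \<Rightarrow> rexp \<Rightarrow> (nat \<Rightarrow> nat) \<Rightarrow> bool" where
  "fitsR w inp (Rd a e) = (\<lambda>W. a < 15 \<and> fitsW w inp W (addr a e))"
| "fitsR w inp (OfW e) = (\<lambda>W. fitsW w inp W e)"
| "fitsR w inp (InR e) = (\<lambda>W. fitsW w inp W e)"
| "fitsR w inp (Bop f a b) = (\<lambda>W. fitsR w inp a W \<and> fitsR w inp b W)"
| "fitsR w inp (Sq a) = (\<lambda>W. fitsR w inp a W)"
| "fitsR w inp (Lt a b) = (\<lambda>W. fitsR w inp a W \<and> fitsR w inp b W)"
| "fitsR w inp (Sum x e b) = (\<lambda>W. fitsW w inp W e \<and> W x < 2 ^ w \<and>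
     (\<forall>i<evalW inp W e. fitsR w inp b (W(x := i))))"

primrec costR :: "input \<Rightarrow> rexp \<Rightarrow> (nat \<Rightarrow> nat) \<Rightarrow> nat" where
  "costR inp (Rd a e) = (\<lambda>W. costW e + 5)"
| "costR inp (OfW e) = (\<lambda>W. costW e + 1)"
| "costR inp (InR e) = (\<lambda>W. costW e + 1)"
| "costR inp (Bop f a b) = (\<lambda>W. costR inp a W + costR inp b W + 1)"
| "costR inp (Sq a) = (\<lambda>W. costR inp a W + 1)"
| "costR inp (Lt a b) = (\<lambda>W. costR inp a W + costR inp b W + 3)"
| "costR inp (Sum x e b) = (\<lambda>W. costW e + 8 + (\<Sum>i<evalW inp W e. costR inp b (W(x := i)) + 4))"

text \<open>Residue 15 is masked: it holds temporaries, and a program may leave rubbish there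
  without changing the view.\<close>

definition view :: "mstate \<Rightarrow> store" where
  "view s = (\<lambda>x. wmem s (2 * x), \<lambda>a i. if a < 15 then rmem s (16 * i + a) else 0, outp s)"

definition hid :: "nat \<Rightarrow> mstate \<Rightarrow> mstate \<Rightarrow> bool" where
  "hid k s s' \<longleftrightarrow> (\<forall>j<k. wmem s' (hw j) = wmem s (hw j) \<and> rmem s' (hr j) = rmem s (hr j))"

lemma hid_refl [simp]: "hid k s s"
  by (simp add: hid_def)

text \<open>
  Programs are indexed by the first hidden register they may overwrite; \<open>view\<close> is the part of the
  machine state which is visible to the language.
\<close>

type_synonym cmd = "nat \<Rightarrow> prog"

definition runs :: "nat \<Rightarrow> input \<Rightarrow> cmd \<Rightarrow> store \<Rightarrow> store spmf \<Rightarrow> nat \<Rightarrow> bool" where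
  "runs w inp c st D T \<longleftrightarrow> (\<forall>k s. view s = st \<longrightarrow>
     rel_spmf (\<lambda>s' st'. view s' = st' \<and> hid k s s' \<and> clock s' \<le> clock s + T) (exec w inp (c k) s) D)"

lemma hr_neq [simp]: "a < 15 \<Longrightarrow> 16 * i + a \<noteq> hr k"
proof
  assume a: "a < 15" and "16 * i + a = hr k"
  then have "(16 * i + a) mod 16 = (16 * k + 15) mod 16" by (simp add: hr_def)
  then show False using a by simp
qed

lemma addr_eq [simp]: "a < 15 \<Longrightarrow> b < 15 \<Longrightarrow> 16 * i + a = 16 * j + b \<longleftrightarrow> a = b \<and> i = (j::nat)"
proof
  assume a: "a < 15" "b < 15" and e: "16 * i + a = 16 * j + b"
  then have "(16 * i + a) mod 16 = (16 * j + b) mod 16" by simp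
  then have "a = b" using a by simp
  then show "a = b \<and> i = j" using e by simp
qed auto

lemma even_neq_hw [simp]: "2 * x \<noteq> hw k" "hw k \<noteq> 2 * x"
  unfolding hw_def by presburger+

lemma compW_exec:
  assumes "fitsW w inp (\<lambda>x. wmem s (2 * x)) e"
  shows "\<exists>wm. exec w inp (compW e k) s = return_spmf (s\<lparr>wmem := wm, clock := clock s + costW e\<rparr>) \<and>
    wm (hw k) = evalW inp (\<lambda>x. wmem s (2 * x)) e \<and> (\<forall>x. wm (2 * x) = wmem s (2 * x)) \<and>
    (\<forall>j<k. wm (hw j) = wmem s (hw j))"
  using assms
proof (induction e arbitrary: k s)
  case (N c)
  then show ?case by (intro exI[of _ "(wmem s)(hw k := c)"])
      (auto simp: tick_def put_word_def fun_eq_iff intro!: mstate.equality)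
next
  case (V x)
  then show ?case
    by (intro exI[of _ "(wmem s)(hw k := wmem s (2 * x))"])
      (auto simp: tick_def put_word_def fun_eq_iff intro!: mstate.equality)
next
  case (Op f a b)
  from Op.IH(1)[of s k] Op.prems obtain wm where wm:
    "exec w inp (compW a k) s = return_spmf (s\<lparr>wmem := wm, clock := clock s + costW a\<rparr>)"
    "wm (hw k) = evalW inp (\<lambda>x. wmem s (2 * x)) a" "\<And>x. wm (2 * x) = wmem s (2 * x)"
    "\<And>j. j < k \<Longrightarrow> wm (hw j) = wmem s (hw j)" by auto
  from Op.IH(2)[of "s\<lparr>wmem := wm, clock := clock s + costW a\<rparr>" "Suc k"] Op.prems wm obtain wm' where wm':
    "exec w inp (compW b (Suc k)) (s\<lparr>wmem := wm, clock := clock s + costW a\<rparr>) =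
      return_spmf (s\<lparr>wmem := wm', clock := clock s + costW a + costW b\<rparr>)"
    "wm' (hw (Suc k)) = evalW inp (\<lambda>x. wmem s (2 * x)) b" "\<And>x. wm' (2 * x) = wmem s (2 * x)"
    "\<And>j. j < Suc k \<Longrightarrow> wm' (hw j) = wm (hw j)" by auto
  have "wm' (hw k) = evalW inp (\<lambda>x. wmem s (2 * x)) a" using wm'(4)[of k] wm(2) by simp
  then show ?case using wm wm' Op.prems
    by (intro exI[of _ "wm'(hw k := evalW inp (\<lambda>x. wmem s (2 * x)) (Op f a b))"])
      (auto simp: tick_def put_word_def fun_eq_iff intro!: mstate.equality)
next
  case (InW e)
  from InW.IH[of s k] InW.prems obtain wm where wm:
    "exec w inp (compW e k) s = return_spmf (s\<lparr>wmem := wm, clock := clock s + costW e\<rparr>)"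
    "wm (hw k) = evalW inp (\<lambda>x. wmem s (2 * x)) e" "\<And>x. wm (2 * x) = wmem s (2 * x)"
    "\<And>j. j < k \<Longrightarrow> wm (hw j) = wmem s (hw j)" by auto
  then show ?case using InW.prems
    by (intro exI[of _ "wm(hw k := evalW inp (\<lambda>x. wmem s (2 * x)) (InW e))"])
      (auto simp: tick_def put_word_def fun_eq_iff intro!: mstate.equality)
qed

lemma compW_view:
  assumes "view s = (W, h, ot)" "fitsW w inp W e"
  shows "\<exists>s'. exec w inp (compW e k) s = return_spmf s' \<and> view s' = (W, h, ot) \<and> hid k s s' \<and>
    wmem s' (hw k) = evalW inp W e \<and> rmem s' = rmem s \<and> clock s' = clock s + costW e"
proof -
  from assms have W: "W = (\<lambda>x. wmem s (2 * x))" by (simp add: view_def)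
  obtain wm where wm:
    "exec w inp (compW e k) s = return_spmf (s\<lparr>wmem := wm, clock := clock s + costW e\<rparr>)"
    "wm (hw k) = evalW inp W e" "\<And>x. wm (2 * x) = wmem s (2 * x)"
    "\<And>j. j < k \<Longrightarrow> wm (hw j) = wmem s (hw j)"
    using compW_exec[of w inp s e k] assms unfolding W by blast
  then show ?thesis using assms
    by (intro exI[of _ "s\<lparr>wmem := wm, clock := clock s + costW e\<rparr>"]) (auto simp: view_def hid_def cong: if_cong)
qed

definition updx :: "nat \<Rightarrow> nat \<Rightarrow> store \<Rightarrow> store" where
  "updx x i st = (case st of (W, h, ot) \<Rightarrow> (W(x := i), h, ot))"

lemma updx_simp [simp]: "updx x i (W, h, ot) = (W(x := i), h, ot)"
  by (simp add: updx_def)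

lemma updx_updx [simp]: "updx x i (updx x j st) = updx x i st"
  by (cases st) (simp add: updx_def)

text \<open>Like \<open>hid\<close>, but with the real temporary \<open>q\<close> exempt: it is the
  accumulator of an enclosing \<open>Sum\<close>, which the loop body is meant to change.\<close>

definition hidq :: "nat \<Rightarrow> nat \<Rightarrow> mstate \<Rightarrow> mstate \<Rightarrow> bool" where
  "hidq q k s s' \<longleftrightarrow>
     (\<forall>j<k. wmem s' (hw j) = wmem s (hw j) \<and> (j \<noteq> q \<longrightarrow> rmem s' (hr j) = rmem s (hr j)))"

text \<open>The registers \<open>a\<close> and \<open>b\<close> fix the number of rounds, so the
  loop equals \<open>n\<close> explicit rounds followed by one failing test, and no limit in the
  definition of \<open>iterate\<close> has to be taken.\<close>

lemma iterate_count:
  assumes J0: "J 0 s st0" and c0: "wmem s a = 0" and lim: "wmem s b = n"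
    and D0: "D 0 = return_spmf st0"
    and D: "\<And>i. i < n \<Longrightarrow> D (Suc i) = bind_spmf (D i) (F i)"
    and step: "\<And>i st s1. i < n \<Longrightarrow> st \<in> set_spmf (D i) \<Longrightarrow> J i s1 st \<Longrightarrow> wmem s1 a = i \<Longrightarrow>
       wmem s1 b = n \<Longrightarrow>
       rel_spmf (\<lambda>s2 st'. J (Suc i) s2 st' \<and> wmem s2 a = Suc i \<and> wmem s2 b = n \<and>
          clock s2 \<le> clock s1 + T i) (f (tick s1)) (F i st)"
    and tk: "\<And>s1 st. J n s1 st \<Longrightarrow> J n (tick s1) st"
  shows "rel_spmf (\<lambda>s' st'. J n s' st' \<and> clock s' \<le> clock s + (\<Sum>i<n. T i) + 1)
           (iterate (WLess a b) f s) (D n)"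
proof -
  let ?R = "\<lambda>i s' st'. J i s' st' \<and> wmem s' a = i \<and> wmem s' b = n"
  define p where "p i = rec_nat (return_spmf s) (\<lambda>j q. bind_spmf q (\<lambda>s1. f (tick s1))) i" for i
  have p_Suc: "p (Suc i) = bind_spmf (p i) (\<lambda>s1. f (tick s1))" and p0: "p 0 = return_spmf s" for i
    by (simp_all add: p_def)
  have rel: "i \<le> n \<Longrightarrow> rel_spmf (\<lambda>s' st'. st' \<in> set_spmf (D i) \<and> ?R i s' st' \<and>
      clock s' \<le> clock s + (\<Sum>i<i. T i)) (p i) (D i)" for i
  proof (induction i)
    case 0
    then show ?case using J0 c0 lim D0 by (simp add: p0)
  next
    case (Suc i)
    have "rel_spmf (\<lambda>s' st'. st' \<in> set_spmf (D (Suc i)) \<and> ?R (Suc i) s' st' \<and>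
      clock s' \<le> clock s + (\<Sum>i<Suc i. T i)) (bind_spmf (p i) (\<lambda>s1. f (tick s1))) (bind_spmf (D i) (F i))"
    proof (rule rel_spmf_bindI[OF Suc.IH])
      show "i \<le> n" using Suc.prems by simp
    next
      fix s1 st1
      assume a: "st1 \<in> set_spmf (D i) \<and> ?R i s1 st1 \<and> clock s1 \<le> clock s + (\<Sum>i<i. T i)"
      have r: "rel_spmf (\<lambda>s2 st'. J (Suc i) s2 st' \<and> wmem s2 a = Suc i \<and> wmem s2 b = n \<and>
          clock s2 \<le> clock s1 + T i) (f (tick s1)) (F i st1)"
        using step[of i st1 s1] a Suc.prems by auto
      have "rel_spmf (\<lambda>s2 st'. (J (Suc i) s2 st' \<and> wmem s2 a = Suc i \<and> wmem s2 b = n \<and>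
          clock s2 \<le> clock s1 + T i) \<and> st' \<in> set_spmf (F i st1)) (f (tick s1)) (F i st1)"
        using r by (rule rel_spmf_mono_strong) auto
      then show "rel_spmf (\<lambda>s' st'. st' \<in> set_spmf (D (Suc i)) \<and> ?R (Suc i) s' st' \<and>
        clock s' \<le> clock s + (\<Sum>i<Suc i. T i)) (f (tick s1)) (F i st1)"
        by (rule rel_spmf_mono) (use a Suc.prems D in \<open>auto simp: set_bind_spmf\<close>)
    qed
    then show ?case using D[of i] Suc.prems by (simp add: p_Suc)
  qed
  have it: "i \<le> n \<Longrightarrow> iterate (WLess a b) f s = bind_spmf (p i) (iterate (WLess a b) f)" for i
  proof (induction i)
    case 0
    then show ?case by (simp add: p0)
  next
    case (Suc i)
    have "iterate (WLess a b) f s = bind_spmf (p i) (iterate (WLess a b) f)"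
      using Suc by simp
    also have "\<dots> = bind_spmf (p i) (\<lambda>s1. bind_spmf (f (tick s1)) (iterate (WLess a b) f))"
    proof (rule bind_spmf_cong[OF refl])
      fix s1 assume "s1 \<in> set_spmf (p i)"
      then have "wmem s1 a = i \<and> wmem s1 b = n"
        using rel[of i] Suc.prems by (auto dest: rel_spmf_set1)
      then have "holds (WLess a b) s1" using Suc.prems by simp
      then show "iterate (WLess a b) f s1 = bind_spmf (f (tick s1)) (iterate (WLess a b) f)"
        by (subst iterate.simps) simp
    qed
    finally show ?case by (simp add: p_Suc)
  qed
  have "rel_spmf (\<lambda>s' st'. J n s' st' \<and> clock s' \<le> clock s + (\<Sum>i<n. T i) + 1)
          (bind_spmf (p n) (iterate (WLess a b) f)) (bind_spmf (D n) return_spmf)"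
  proof (rule rel_spmf_bindI[OF rel[OF order_refl]])
    fix s1 st1
    assume a: "st1 \<in> set_spmf (D n) \<and> ?R n s1 st1 \<and> clock s1 \<le> clock s + (\<Sum>i<n. T i)"
    then have "iterate (WLess a b) f s1 = return_spmf (tick s1)"
      by (subst iterate.simps) simp
    then show "rel_spmf (\<lambda>s' st'. J n s' st' \<and> clock s' \<le> clock s + (\<Sum>i<n. T i) + 1)
      (iterate (WLess a b) f s1) (return_spmf st1)" using a tk by (simp add: tick_def)
  qed
  then show ?thesis using it[of n] by simp
qed

lemma view_wconst [simp]:
  "view (put_word w (hw k) c s) = view s" "view (tick s) = view s"
  "view (put_real (hr k) r s) = view s" "view (s\<lparr>clock := t\<rparr>) = view s"
  by (auto simp: view_def put_word_def put_real_def tick_def fun_eq_iff)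

lemma put_sel [simp]:
  "wmem (put_real a r s) = wmem s" "rmem (put_word w b c s) = rmem s" "outp (put_real a r s) = outp s"
  "outp (put_word w b c s) = outp s" "clock (put_real a r s) = clock s"
  "clock (put_word w b c s) = clock s" "wmem (tick s) = wmem s" "rmem (tick s) = rmem s"
  "outp (tick s) = outp s" "clock (tick s) = Suc (clock s)"
  "wmem (put_word w b c s) = (wmem s)(b := c mod 2 ^ w)" "rmem (put_real a r s) = (rmem s)(a := r)"
  by (simp_all add: put_word_def put_real_def tick_def)

lemma view_wmem: "view s = (W, h, ot) \<Longrightarrow> wmem s (2 * x) = W x"
  by (auto simp: view_def)

lemma view_updx: "view s = st \<Longrightarrow> j < 2 ^ w \<Longrightarrow> view (put_word w (2 * x) j s) = updx x j st"
  by (auto simp: view_def put_word_def updx_def fun_eq_iff)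

lemma view_rmem: "view s = (W, h, ot) \<Longrightarrow> a < 15 \<Longrightarrow> rmem s (16 * i + a) = h a i"
  by (auto simp: view_def)

lemma one_less_two_power: "w > 0 \<Longrightarrow> (1::nat) < 2 ^ w"
  using one_less_power[of "2::nat" w] by simp

lemma count_loop_exec:
  assumes v: "view s = (W, h, ot)" and fit: "fitsW w inp W e" "W x < 2 ^ w" and w: "w > 0"
    and n: "evalW inp W e = n"
    and D0: "D 0 = return_spmf (W, h, ot)"
    and D: "\<And>i. i < n \<Longrightarrow> D (Suc i) = bind_spmf (D i) (F i)"
    and A0: "A 0 (rmem s (hr q))"
    and body: "\<And>i st s1. i < n \<Longrightarrow> st \<in> set_spmf (D i) \<Longrightarrow> view s1 = updx x i st \<Longrightarrow>
       A i (rmem s1 (hr q)) \<Longrightarrow>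
       rel_spmf (\<lambda>s2 st'. view s2 = updx x i st' \<and> A (Suc i) (rmem s2 (hr q)) \<and>
          hidq q (k + 5) s1 s2 \<and> clock s2 \<le> clock s1 + T i) (exec w inp (c (k + 5)) s1) (F i st)"
  shows "rel_spmf (\<lambda>s' st'. view s' = updx x (W x) st' \<and> hidq q k s s' \<and> A n (rmem s' (hr q)) \<and>
     clock s' \<le> clock s + (costW e + 6 + (\<Sum>i<n. T i + 3))) (exec w inp (count_loop x e c k) s) (D n)"
proof -
  from compW_view[OF v fit(1), of k] obtain s1 where s1:
    "exec w inp (compW e k) s = return_spmf s1" "view s1 = (W, h, ot)" "hid k s s1"
    "wmem s1 (hw k) = n" "rmem s1 = rmem s" "clock s1 = clock s + costW e" using n by auto
  have one: "(1::nat) < 2 ^ w" using w by (rule one_less_two_power)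
  define s2 where "s2 = put_word w (hw (k+3)) (W x) (tick (put_word w (hw (k+4)) 0 (tick
     (put_word w (hw (k+2)) 1 (tick (put_word w (hw (k+1)) 0 (tick s1)))))))"
  have s2v: "view s2 = (W, h, ot)" using s1 by (simp add: s2_def)
  have s2c: "clock s2 = clock s1 + 4" by (simp add: s2_def)
  have s2w: "wmem s2 (hw (k+1)) = 0" "wmem s2 (hw k) = n" "wmem s2 (hw (k+2)) = 1"
    "wmem s2 (hw (k+3)) = W x" "wmem s2 (hw (k+4)) = 0"
    using s1 fit(2) w by (simp_all add: s2_def)
  have s2h: "hidq q k s s2" using s1(3,5) by (simp add: s2_def hid_def hidq_def)
  have s2r: "rmem s2 = rmem s" using s1 by (simp add: s2_def)
  let ?body = "seqs [Basic (WArith WAdd (2 * x) (hw (k+1)) (hw (k+4))), c (k+5),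
              Basic (WArith WAdd (hw (k+1)) (hw (k+1)) (hw (k+2)))]"
  \<comment> \<open>Setting \<open>x\<close> to 0 on both sides erases the loop variable: the model
    state does not follow it, while the loop overwrites it in each round and restores it at the
    end.\<close>
  let ?J = "\<lambda>i s' st. updx x 0 (view s') = updx x 0 st \<and> hidq q k s s' \<and> A i (rmem s' (hr q)) \<and>
     wmem s' (hw (k+2)) = 1 \<and> wmem s' (hw (k+3)) = W x \<and> wmem s' (hw (k+4)) = 0"
  have nb: "n < 2 ^ w" using fit(1) n by (cases e) auto
  have vx: "updx x i st1 = updx x i st2" if "updx x 0 st1 = updx x 0 st2" for i st1 st2
    using that by (metis updx_updx)
  have it: "rel_spmf (\<lambda>s' st'. ?J n s' st' \<and> clock s' \<le> clock s2 + (\<Sum>i<n. T i + 3) + 1)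
     (iterate (WLess (hw (k+1)) (hw k)) (exec w inp ?body) s2) (D n)"
  proof (rule iterate_count[where J = ?J, OF _ s2w(1,2) D0 D])
    show "?J 0 s2 (W, h, ot)" using s2v s2h s2w s2r A0 by simp
  next
    fix s1 st assume "?J n s1 st"
    then show "?J n (tick s1) st" by (simp add: hidq_def)
  next
    fix i st s1
    assume i: "i < n" and st: "st \<in> set_spmf (D i)" and J: "?J i s1 st"
      and ctr: "wmem s1 (hw (k+1)) = i" "wmem s1 (hw k) = n"
    define s3 where "s3 = put_word w (2 * x) i (tick (tick s1))"
    have vs3: "view s3 = updx x i st"
      using J vx[of "view s1" st i] view_updx[of "tick (tick s1)" "view s1" i w x] i nb
      by (simp add: s3_def)
    have "rel_spmf (\<lambda>s2 st'. view s2 = updx x i st' \<and> A (Suc i) (rmem s2 (hr q)) \<and>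
          hidq q (k + 5) s3 s2 \<and> clock s2 \<le> clock s3 + T i) (exec w inp (c (k + 5)) s3) (F i st)"
      by (rule body[OF i st vs3]) (use J in \<open>simp add: s3_def\<close>)
    then have "rel_spmf (\<lambda>s4 st'. ?J (Suc i) s4 st' \<and> wmem s4 (hw (k+1)) = Suc i \<and> wmem s4 (hw k) = n \<and>
        clock s4 \<le> clock s1 + (T i + 3))
       (bind_spmf (exec w inp (c (k + 5)) s3)
         (\<lambda>s. return_spmf (put_word w (hw (k+1)) (wmem s (hw (k+1)) + wmem s (hw (k+2))) (tick s))))
       (bind_spmf (F i st) return_spmf)"
    proof (rule rel_spmf_bindI, goal_cases)
      case (1 s4 st')
      have "wmem s4 (hw (k+1)) = i" "wmem s4 (hw (k+2)) = 1" "wmem s4 (hw (k+3)) = W x"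
        "wmem s4 (hw (k+4)) = 0" "wmem s4 (hw k) = n"
        using 1 J ctr by (simp_all add: hidq_def s3_def)
      moreover have "hidq q k s s4"
        using 1 J by (auto simp add: hidq_def s3_def)
      moreover have "clock s3 = clock s1 + 2" by (simp add: s3_def)
      ultimately show ?case using 1 i nb by (auto simp: hidq_def)
    qed
    moreover have "exec w inp ?body (tick s1) = (bind_spmf (exec w inp (c (k + 5)) s3)
         (\<lambda>s. return_spmf (put_word w (hw (k+1)) (wmem s (hw (k+1)) + wmem s (hw (k+2))) (tick s))))"
      using ctr J by (simp add: s3_def)
    ultimately show "rel_spmf (\<lambda>s2 st'. ?J (Suc i) s2 st' \<and> wmem s2 (hw (k+1)) = Suc i \<and>
        wmem s2 (hw k) = n \<and> clock s2 \<le> clock s1 + (T i + 3)) (exec w inp ?body (tick s1)) (F i st)"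
      by simp
  qed
  have ex: "exec w inp (count_loop x e c k) s = bind_spmf
     (iterate (WLess (hw (k+1)) (hw k)) (exec w inp ?body) s2)
     (\<lambda>s. return_spmf (put_word w (2 * x) (wmem s (hw (k+3)) + wmem s (hw (k+4))) (tick s)))"
    using view_wmem[OF s1(2), of x] by (simp add: count_loop_def s1(1) s2_def fit(2))
  have "rel_spmf (\<lambda>s' st'. view s' = updx x (W x) st' \<and> hidq q k s s' \<and> A n (rmem s' (hr q)) \<and>
     clock s' \<le> clock s + (costW e + 6 + (\<Sum>i<n. T i + 3)))
     (exec w inp (count_loop x e c k) s) (bind_spmf (D n) return_spmf)"
    unfolding ex
  proof (rule rel_spmf_bindI[OF it], goal_cases)
    case (1 s' st')
    let ?s = "put_word w (2 * x) (wmem s' (hw (k+3)) + wmem s' (hw (k+4))) (tick s')"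
    have "view ?s = updx x (W x) st'"
      using 1 vx[of "view s'" st' "W x"] view_updx[of "tick s'" "view s'" "W x" w x] fit(2) by simp
    then show ?case using 1 s2c s1(6) by (auto simp: hidq_def)
  qed
  then show ?thesis by simp
qed

lemma compR_exec:
  assumes "view s = (W, h, ot)" "fitsR w inp e W" "w > 0"
  shows "rel_spmf (\<lambda>s' _. view s' = (W, h, ot) \<and> hid k s s' \<and> rmem s' (hr k) = evalR inp h e W \<and>
    clock s' \<le> clock s + costR inp e W) (exec w inp (compR e k) s) (return_spmf ())"
  using assms
proof (induction e arbitrary: k s W)
  case (Rd a e)
  then have a: "a < 15" and f: "fitsW w inp W (addr a e)" by auto
  from compW_view[OF Rd(1) f, of k] obtain s1 where s1:
    "exec w inp (compW (addr a e) k) s = return_spmf s1" "view s1 = (W, h, ot)" "hid k s s1"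
    "wmem s1 (hw k) = evalW inp W (addr a e)" "clock s1 = clock s + costW (addr a e)" by auto
  have "rmem s1 (16 * evalW inp W e + a) = h a (evalW inp W e)"
    using s1(2) a by (rule view_rmem)
  moreover have "evalW inp W (addr a e) = 16 * evalW inp W e + a" "costW (addr a e) = costW e + 4"
    by (simp_all add: addr_def)
  ultimately show ?case using s1 by (simp add: hid_def)
next
  case (OfW e)
  from compW_view[OF OfW(1), of w inp e k] OfW(2) obtain s1 where s1:
    "exec w inp (compW e k) s = return_spmf s1" "view s1 = (W, h, ot)" "hid k s s1"
    "wmem s1 (hw k) = evalW inp W e" "clock s1 = clock s + costW e" by auto
  then show ?case by (simp add: hid_def)
next
  case (InR e)
  from compW_view[OF InR(1), of w inp e k] InR(2) obtain s1 where s1: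
    "exec w inp (compW e k) s = return_spmf s1" "view s1 = (W, h, ot)" "hid k s s1"
    "wmem s1 (hw k) = evalW inp W e" "clock s1 = clock s + costW e" by auto
  then show ?case by (simp add: hid_def)
next
  case (Bop f a b)
  have "rel_spmf (\<lambda>s' _. view s' = (W, h, ot) \<and> hid k s s' \<and>
     rmem s' (hr k) = evalR inp h (Bop f a b) W \<and> clock s' \<le> clock s + costR inp (Bop f a b) W)
     (exec w inp (compR (Bop f a b) k) s) (bind_spmf (return_spmf ()) (\<lambda>_. bind_spmf (return_spmf ()) return_spmf))"
    unfolding compR.simps exec.simps
  proof (rule rel_spmf_bindI[OF Bop.IH(1)[of s W k]], goal_cases)
    case (4 s1)
    show ?case
    proof (rule rel_spmf_bindI[OF Bop.IH(2)[of s1 W "Suc k"]], goal_cases)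
      case (4 s2)
      then have "rmem s2 (hr k) = rmem s1 (hr k)" by (auto simp: hid_def)
      then show ?case using 4 \<open>_ \<and> hid k s s1 \<and> _\<close> by (auto simp: hid_def)
    qed (use 4 Bop.prems in auto)
  qed (use Bop.prems in auto)
  then show ?case by simp
next
  case (Sq a)
  have "rel_spmf (\<lambda>s' _. view s' = (W, h, ot) \<and> hid k s s' \<and>
     rmem s' (hr k) = evalR inp h (Sq a) W \<and> clock s' \<le> clock s + costR inp (Sq a) W)
     (exec w inp (compR (Sq a) k) s) (bind_spmf (return_spmf ()) return_spmf)"
    unfolding compR.simps exec.simps
    by (rule rel_spmf_bindI[OF Sq.IH[of s W k]]) (use Sq.prems in \<open>auto simp: hid_def power2_eq_square\<close>)
  then show ?case by simp
next
  case (Lt a b)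
  have w1: "(1::nat) mod 2 ^ w = 1" using one_less_two_power[OF Lt.prems(3)] Lt.prems(3) by simp
  have "rel_spmf (\<lambda>s' _. view s' = (W, h, ot) \<and> hid k s s' \<and>
     rmem s' (hr k) = evalR inp h (Lt a b) W \<and> clock s' \<le> clock s + costR inp (Lt a b) W)
     (exec w inp (compR (Lt a b) k) s) (bind_spmf (return_spmf ()) (\<lambda>_. bind_spmf (return_spmf ()) return_spmf))"
    unfolding compR.simps seqs_simps exec.simps
  proof (rule rel_spmf_bindI[OF Lt.IH(1)[of s W k]], goal_cases)
    case (4 s1)
    show ?case
    proof (rule rel_spmf_bindI[OF Lt.IH(2)[of s1 W "Suc k"]], goal_cases)
      case (4 s2)
      then have "rmem s2 (hr k) = rmem s1 (hr k)" by (auto simp: hid_def)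
      then show ?case using 4 \<open>_ \<and> hid k s s1 \<and> _\<close> w1 by (auto simp: hid_def)
    qed (use 4 Lt.prems in auto)
  qed (use Lt.prems in auto)
  then show ?case by simp
next
  case (Sum x e b)
  let ?n = "evalW inp W e"
  let ?c = "\<lambda>j. Seq (compR b j) (Basic (RArith RAdd (hr k) (hr k) (hr j)))"
  define s1 where "s1 = put_real (hr k) 0 (tick (put_word w (hw k) 0 (tick s)))"
  have s1: "view s1 = (W, h, ot)" "rmem s1 (hr k) = 0" "hid k s s1" "clock s1 = clock s + 2"
    using Sum.prems by (simp_all add: s1_def hid_def)
  have "rel_spmf (\<lambda>s' st'. view s' = updx x (W x) st' \<and> hidq k (Suc k) s1 s' \<and>
      rmem s' (hr k) = (\<Sum>i<?n. evalR inp h b (W(x := i))) \<and>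
     clock s' \<le> clock s1 + (costW e + 6 + (\<Sum>i<?n. (costR inp b (W(x := i)) + 1) + 3)))
     (exec w inp (count_loop x e ?c (Suc k)) s1) (return_spmf (W, h, ot))"
  proof (rule count_loop_exec[where D = "\<lambda>_. return_spmf (W, h, ot)" and F = "\<lambda>i st. return_spmf st"
        and A = "\<lambda>m r. r = (\<Sum>i<m. evalR inp h b (W(x := i)))"
        and T = "\<lambda>i. costR inp b (W(x := i)) + 1" and W = W and h = h and ot = ot], goal_cases)
    case (9 i st s2)
    have "rel_spmf (\<lambda>s' st'. view s' = updx x i st' \<and>
        rmem s' (hr k) = (\<Sum>i<Suc i. evalR inp h b (W(x := i))) \<and>
        hidq k (Suc k + 5) s2 s' \<and> clock s' \<le> clock s2 + (costR inp b (W(x := i)) + 1))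
        (exec w inp (?c (Suc k + 5)) s2) (bind_spmf (return_spmf ()) (\<lambda>_. return_spmf st))"
      unfolding exec.simps
    proof (rule rel_spmf_bindI[OF Sum.IH[of s2 "W(x := i)" "Suc k + 5"]], goal_cases)
      case (4 s3)
      then have "rmem s3 (hr k) = rmem s2 (hr k)" by (auto simp: hid_def)
      then show ?case using 4 \<open>st \<in> _\<close> \<open>rmem s2 (hr k) = _\<close> by (auto simp: hid_def hidq_def fun_upd_def)
    qed (use 9 Sum.prems in \<open>auto simp: fun_upd_def\<close>)
    then show ?case by (simp add: fun_upd_def)
  qed (use Sum.prems s1 in \<open>simp_all\<close>)
  then have "rel_spmf (\<lambda>s' _. view s' = (W, h, ot) \<and> hid k s s' \<and>
     rmem s' (hr k) = evalR inp h (Sum x e b) W \<and> clock s' \<le> clock s + costR inp (Sum x e b) W)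
     (exec w inp (count_loop x e ?c (Suc k)) s1) (return_spmf ())"
    unfolding rel_spmf_return_spmf2
  proof (elim conjE, intro conjI ballI)
    fix s' assume a: "\<forall>s'\<in>set_spmf (exec w inp (count_loop x e ?c (Suc k)) s1).
      view s' = updx x (W x) (W, h, ot) \<and> hidq k (Suc k) s1 s' \<and>
      rmem s' (hr k) = (\<Sum>i<?n. evalR inp h b (W(x := i))) \<and>
      clock s' \<le> clock s1 + (costW e + 6 + (\<Sum>i<?n. (costR inp b (W(x := i)) + 1) + 3))"
      and "s' \<in> set_spmf (exec w inp (count_loop x e ?c (Suc k)) s1)"
    then have a: "view s' = (W, h, ot)" "hidq k (Suc k) s1 s'"
      "rmem s' (hr k) = (\<Sum>i<?n. evalR inp h b (W(x := i)))"
      "clock s' \<le> clock s1 + (costW e + 6 + (\<Sum>i<?n. (costR inp b (W(x := i)) + 1) + 3))"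
      by auto
    show "view s' = (W, h, ot)" "rmem s' (hr k) = evalR inp h (Sum x e b) W" using a by auto
    show "hid k s s'" using a(2) s1(3) by (auto simp: hid_def hidq_def)
    show "clock s' \<le> clock s + costR inp (Sum x e b) W" using a(4) s1(4)
      by (simp add: algebra_simps)
  qed
  then show ?case by (simp add: s1_def)
qed

section \<open>Commands and their cost rules\<close>

definition cSeq :: "cmd \<Rightarrow> cmd \<Rightarrow> cmd" (infixr \<open>;;\<close> 60) where
  "(c1 ;; c2) k = Seq (c1 k) (c2 k)"

definition cSkip :: cmd where
  "cSkip k = Basic (WConst (hw k) 0)"

definition cSetW :: "nat \<Rightarrow> wexp \<Rightarrow> cmd" where
  "cSetW x e k = seqs [compW e k, Basic (WConst (hw (k+1)) 0),
     Basic (WArith WAdd (2 * x) (hw k) (hw (k+1)))]"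

definition cSetR :: "nat \<Rightarrow> wexp \<Rightarrow> rexp \<Rightarrow> cmd" where
  "cSetR a e r k = seqs [compR r k, compW (addr a e) (k+1), Basic (RStore (hw (k+1)) (hr k))]"

definition cOut :: "wexp \<Rightarrow> rexp \<Rightarrow> cmd" where
  "cOut e r k = seqs [compR r k, compW e (k+1), Basic (ROutput (hw (k+1)) (hr k))]"

definition cIfW :: "wexp \<Rightarrow> wexp \<Rightarrow> cmd \<Rightarrow> cmd \<Rightarrow> cmd" where
  "cIfW a b c1 c2 k = seqs [compW a k, compW b (k+1), Cond (WLess (hw k) (hw (k+1))) (c1 k) (c2 k)]"

definition cIfR :: "rexp \<Rightarrow> rexp \<Rightarrow> cmd \<Rightarrow> cmd \<Rightarrow> cmd" where
  "cIfR a b c1 c2 k = seqs [compR a k, compR b (k+1), Cond (RLess (hr k) (hr (k+1))) (c1 k) (c2 k)]"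

definition cFor :: "nat \<Rightarrow> wexp \<Rightarrow> cmd \<Rightarrow> cmd" where
  "cFor x e c = count_loop x e c"

definition cLet :: "nat \<Rightarrow> wexp \<Rightarrow> cmd \<Rightarrow> cmd" where
  "cLet x e c k = seqs [compW e k, Basic (WConst (hw (k+1)) 0),
     Basic (WArith WAdd (hw (k+2)) (2 * x) (hw (k+1))), Basic (WArith WAdd (2 * x) (hw k) (hw (k+1))),
     c (k+3), Basic (WArith WAdd (2 * x) (hw (k+2)) (hw (k+1)))]"

definition cBit :: "nat \<Rightarrow> wexp \<Rightarrow> cmd" where
  "cBit a e k = seqs [Basic (WRand (hw k)), Basic (WConst (hw (k+1)) 2),
     Basic (WArith WMod (hw k) (hw k) (hw (k+1))), Basic (ROfWord (hr k) (hw k)),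
     compW (addr a e) (k+1), Basic (RStore (hw (k+1)) (hr k))]"

lemma runsD: "runs w inp c st D T \<Longrightarrow> view s = st \<Longrightarrow>
    rel_spmf (\<lambda>s' st'. view s' = st' \<and> hid k s s' \<and> clock s' \<le> clock s + T) (exec w inp (c k) s) D"
  by (simp add: runs_def)

lemma runs_mono: "runs w inp c st D T \<Longrightarrow> T \<le> T' \<Longrightarrow> runs w inp c st D T'"
  unfolding runs_def by (fastforce elim!: rel_spmf_mono)

lemma runs_seq:
  assumes "runs w inp c1 st D1 T1" "\<And>st1. st1 \<in> set_spmf D1 \<Longrightarrow> runs w inp c2 st1 (D2 st1) T2"
  shows "runs w inp (c1 ;; c2) st (bind_spmf D1 D2) (T1 + T2)"
  unfolding runs_def cSeq_def exec.simps
proof (intro allI impI)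
  fix k s assume "view s = st"
  then have "rel_spmf (\<lambda>s' st'. view s' = st' \<and> hid k s s' \<and> clock s' \<le> clock s + T1)
      (exec w inp (c1 k) s) D1" using assms(1) by (simp add: runs_def)
  then have "rel_spmf (\<lambda>s' st'. (view s' = st' \<and> hid k s s' \<and> clock s' \<le> clock s + T1) \<and>
      st' \<in> set_spmf D1) (exec w inp (c1 k) s) D1"
    by (rule rel_spmf_mono_strong) auto
  then show "rel_spmf (\<lambda>s' st'. view s' = st' \<and> hid k s s' \<and> clock s' \<le> clock s + (T1 + T2))
      (exec w inp (c1 k) s \<bind> exec w inp (c2 k)) (D1 \<bind> D2)"
  proof (rule rel_spmf_bindI)
    fix s1 st1
    assume a: "(view s1 = st1 \<and> hid k s s1 \<and> clock s1 \<le> clock s + T1) \<and> st1 \<in> set_spmf D1"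
    then have "rel_spmf (\<lambda>s' st'. view s' = st' \<and> hid k s1 s' \<and> clock s' \<le> clock s1 + T2)
      (exec w inp (c2 k) s1) (D2 st1)" using assms(2)[of st1] by (simp add: runs_def)
    then show "rel_spmf (\<lambda>s' st'. view s' = st' \<and> hid k s s' \<and> clock s' \<le> clock s + (T1 + T2))
      (exec w inp (c2 k) s1) (D2 st1)"
      by (rule rel_spmf_mono) (use a in \<open>auto simp: hid_def\<close>)
  qed
qed

lemma runs_seq_det:
  assumes "runs w inp c1 st (return_spmf st1) T1" "runs w inp c2 st1 D T2"
  shows "runs w inp (c1 ;; c2) st D (T1 + T2)"
  using runs_seq[OF assms(1), of c2 "\<lambda>_. D" T2] assms(2) by simp

lemma runs_skip: "runs w inp cSkip st (return_spmf st) 1"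
  by (auto simp: runs_def cSkip_def hid_def)

lemma runs_setW:
  assumes "fitsW w inp W e" "w > 0"
  shows "runs w inp (cSetW x e) (W, h, ot) (return_spmf (W(x := evalW inp W e), h, ot)) (costW e + 2)"
  unfolding runs_def
proof (intro allI impI)
  fix k s assume v: "view s = (W, h, ot)"
  from compW_view[OF v assms(1), of k] obtain s1 where s1:
    "exec w inp (compW e k) s = return_spmf s1" "view s1 = (W, h, ot)" "hid k s s1"
    "wmem s1 (hw k) = evalW inp W e" "clock s1 = clock s + costW e" by auto
  have f: "evalW inp W e < 2 ^ w" using assms(1) by (cases e) auto
  define s2 where "s2 = put_word w (2 * x) (evalW inp W e) (tick (put_word w (hw (k+1)) 0 (tick s1)))"
  have "view s2 = updx x (evalW inp W e) (W, h, ot)" unfolding s2_def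
    by (rule view_updx[OF _ f]) (simp add: s1)
  then show "rel_spmf (\<lambda>s' st'. view s' = st' \<and> hid k s s' \<and> clock s' \<le> clock s + (costW e + 2))
      (exec w inp (cSetW x e k) s) (return_spmf (W(x := evalW inp W e), h, ot))"
    using s1 by (simp add: cSetW_def hid_def flip: s2_def) (simp add: s2_def)
qed

lemma view_put_real:
  "view s = (W, h, ot) \<Longrightarrow> a < 15 \<Longrightarrow> view (put_real (16 * i + a) r s) = (W, h(a := (h a)(i := r)), ot)"
  by (auto simp: view_def intro!: ext)

lemma view_put_outp: "view s = (W, h, ot) \<Longrightarrow> view (tick s\<lparr>outp := f\<rparr>) = (W, h, f)"
  by (auto simp: view_def intro!: ext)

lemma costW_addr [simp]: "costW (addr a e) = costW e + 4"
  by (simp add: addr_def)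

lemma evalW_addr [simp]: "evalW inp W (addr a e) = 16 * evalW inp W e + a"
  by (simp add: addr_def)

lemma runs_setR:
  assumes "fitsR w inp r W" "fitsW w inp W (addr a e)" "a < 15" "w > 0"
  shows "runs w inp (cSetR a e r) (W, h, ot)
    (return_spmf (W, h(a := (h a)(evalW inp W e := evalR inp h r W)), ot)) (costR inp r W + costW e + 5)"
  unfolding runs_def
proof (intro allI impI)
  fix k s assume v: "view s = (W, h, ot)"
  have "rel_spmf (\<lambda>s' st'. view s' = st' \<and> hid k s s' \<and> clock s' \<le> clock s + (costR inp r W + costW e + 5))
      (exec w inp (cSetR a e r k) s)
      (bind_spmf (return_spmf ()) (\<lambda>_. return_spmf (W, h(a := (h a)(evalW inp W e := evalR inp h r W)), ot)))"
    unfolding cSetR_def seqs_simps exec.simps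
  proof (rule rel_spmf_bindI[OF compR_exec[OF v assms(1,4), of k]])
    fix s1 assume s1: "view s1 = (W, h, ot) \<and> hid k s s1 \<and> rmem s1 (hr k) = evalR inp h r W \<and>
        clock s1 \<le> clock s + costR inp r W"
    then obtain s2 where s2: "exec w inp (compW (addr a e) (k+1)) s1 = return_spmf s2"
      "view s2 = (W, h, ot)" "hid (k+1) s1 s2" "wmem s2 (hw (k+1)) = 16 * evalW inp W e + a"
      "rmem s2 = rmem s1" "clock s2 = clock s1 + (costW e + 4)"
      using compW_view[OF _ assms(2), of s1 h ot "k+1"] by auto
    have "view (put_real (16 * evalW inp W e + a) (evalR inp h r W) (tick s2)) =
      (W, h(a := (h a)(evalW inp W e := evalR inp h r W)), ot)"
      by (rule view_put_real) (use s2 assms in simp_all)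
    moreover have "hid k s (put_real (16 * evalW inp W e + a) (evalR inp h r W) (tick s2))"
      using s1 s2 hr_neq[OF assms(3), of "evalW inp W e", THEN not_sym] by (auto simp: hid_def)
    ultimately show "rel_spmf (\<lambda>s' st'. view s' = st' \<and> hid k s s' \<and> clock s' \<le> clock s + (costR inp r W + costW e + 5))
      (exec w inp (compW (addr a e) (k+1)) s1 \<bind> (\<lambda>s. effect w inp (RStore (hw (k+1)) (hr k)) (tick s)))
      (return_spmf (W, h(a := (h a)(evalW inp W e := evalR inp h r W)), ot))"
      using s1 s2 by simp
  qed
  then show "rel_spmf (\<lambda>s' st'. view s' = st' \<and> hid k s s' \<and> clock s' \<le> clock s + (costR inp r W + costW e + 5))
      (exec w inp (cSetR a e r k) s) (return_spmf (W, h(a := (h a)(evalW inp W e := evalR inp h r W)), ot))"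
    by simp
qed

lemma runs_out:
  assumes "fitsR w inp r W" "fitsW w inp W e" "w > 0"
  shows "runs w inp (cOut e r) (W, h, ot)
    (return_spmf (W, h, ot(evalW inp W e := evalR inp h r W))) (costR inp r W + costW e + 1)"
  unfolding runs_def
proof (intro allI impI)
  fix k s assume v: "view s = (W, h, ot)"
  have "rel_spmf (\<lambda>s' st'. view s' = st' \<and> hid k s s' \<and> clock s' \<le> clock s + (costR inp r W + costW e + 1))
      (exec w inp (cOut e r k) s)
      (bind_spmf (return_spmf ()) (\<lambda>_. return_spmf (W, h, ot(evalW inp W e := evalR inp h r W))))"
    unfolding cOut_def seqs_simps exec.simps
  proof (rule rel_spmf_bindI[OF compR_exec[OF v assms(1,3), of k]])
    fix s1 assume s1: "view s1 = (W, h, ot) \<and> hid k s s1 \<and> rmem s1 (hr k) = evalR inp h r W \<and>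
        clock s1 \<le> clock s + costR inp r W"
    then obtain s2 where s2: "exec w inp (compW e (k+1)) s1 = return_spmf s2"
      "view s2 = (W, h, ot)" "hid (k+1) s1 s2" "wmem s2 (hw (k+1)) = evalW inp W e"
      "rmem s2 = rmem s1" "clock s2 = clock s1 + costW e"
      using compW_view[OF _ assms(2), of s1 h ot "k+1"] by auto
    then show "rel_spmf (\<lambda>s' st'. view s' = st' \<and> hid k s s' \<and> clock s' \<le> clock s + (costR inp r W + costW e + 1))
      (exec w inp (compW e (k+1)) s1 \<bind> (\<lambda>s. effect w inp (ROutput (hw (k+1)) (hr k)) (tick s)))
      (return_spmf (W, h, ot(evalW inp W e := evalR inp h r W)))"
      using s1 by (auto simp: hid_def view_put_outp) (simp add: view_def)
  qed
  then show "rel_spmf (\<lambda>s' st'. view s' = st' \<and> hid k s s' \<and> clock s' \<le> clock s + (costR inp r W + costW e + 1))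
      (exec w inp (cOut e r k) s) (return_spmf (W, h, ot(evalW inp W e := evalR inp h r W)))"
    by simp
qed

lemma runs_ifW:
  assumes "fitsW w inp W a" "fitsW w inp W b"
    and "evalW inp W a < evalW inp W b \<Longrightarrow> runs w inp c1 (W, h, ot) D T"
    and "\<not> evalW inp W a < evalW inp W b \<Longrightarrow> runs w inp c2 (W, h, ot) D T"
  shows "runs w inp (cIfW a b c1 c2) (W, h, ot) D (costW a + costW b + 1 + T)"
  unfolding runs_def
proof (intro allI impI)
  fix k s assume v: "view s = (W, h, ot)"
  from compW_view[OF v assms(1), of k] obtain s1 where s1:
    "exec w inp (compW a k) s = return_spmf s1" "view s1 = (W, h, ot)" "hid k s s1"
    "wmem s1 (hw k) = evalW inp W a" "clock s1 = clock s + costW a" by auto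
  from compW_view[OF s1(2) assms(2), of "k+1"] obtain s2 where s2:
    "exec w inp (compW b (k+1)) s1 = return_spmf s2" "view s2 = (W, h, ot)" "hid (k+1) s1 s2"
    "wmem s2 (hw (k+1)) = evalW inp W b" "clock s2 = clock s1 + costW b" by auto
  have w2: "wmem s2 (hw k) = evalW inp W a" using s1 s2 by (simp add: hid_def)
  define c where "c = (if evalW inp W a < evalW inp W b then c1 else c2)"
  have "runs w inp c (W, h, ot) D T" using assms(3,4) by (simp add: c_def)
  then have "rel_spmf (\<lambda>s' st'. view s' = st' \<and> hid k (tick s2) s' \<and> clock s' \<le> clock (tick s2) + T)
      (exec w inp (c k) (tick s2)) D" by (rule runsD) (use s2(2) in simp)
  moreover have "exec w inp (cIfW a b c1 c2 k) s = exec w inp (c k) (tick s2)"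
    using s1 s2 w2 by (simp add: cIfW_def c_def)
  ultimately show "rel_spmf (\<lambda>s' st'. view s' = st' \<and> hid k s s' \<and>
      clock s' \<le> clock s + (costW a + costW b + 1 + T)) (exec w inp (cIfW a b c1 c2 k) s) D"
    by (auto elim!: rel_spmf_mono) (use s1 s2 in \<open>auto simp: hid_def\<close>)
qed

lemma runs_ifR:
  assumes "fitsR w inp a W" "fitsR w inp b W" "w > 0"
    and "evalR inp h a W < evalR inp h b W \<Longrightarrow> runs w inp c1 (W, h, ot) D T"
    and "\<not> evalR inp h a W < evalR inp h b W \<Longrightarrow> runs w inp c2 (W, h, ot) D T"
  shows "runs w inp (cIfR a b c1 c2) (W, h, ot) D (costR inp a W + costR inp b W + 1 + T)"
  unfolding runs_def
proof (intro allI impI)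
  fix k s assume v: "view s = (W, h, ot)"
  define c where "c = (if evalR inp h a W < evalR inp h b W then c1 else c2)"
  have c: "runs w inp c (W, h, ot) D T" using assms(4,5) by (simp add: c_def)
  have "rel_spmf (\<lambda>s' st'. view s' = st' \<and> hid k s s' \<and>
      clock s' \<le> clock s + (costR inp a W + costR inp b W + 1 + T))
      (exec w inp (cIfR a b c1 c2 k) s) (bind_spmf (return_spmf ()) (\<lambda>_. bind_spmf (return_spmf ()) (\<lambda>_. D)))"
    unfolding cIfR_def seqs_simps exec.simps
  proof (rule rel_spmf_bindI[OF compR_exec[OF v assms(1,3), of k]])
    fix s1 assume s1: "view s1 = (W, h, ot) \<and> hid k s s1 \<and> rmem s1 (hr k) = evalR inp h a W \<and>
        clock s1 \<le> clock s + costR inp a W"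
    show "rel_spmf (\<lambda>s' st'. view s' = st' \<and> hid k s s' \<and>
      clock s' \<le> clock s + (costR inp a W + costR inp b W + 1 + T))
      (bind_spmf (exec w inp (compR b (k+1)) s1)
        (\<lambda>s. if holds (RLess (hr k) (hr (k+1))) s then exec w inp (c1 k) (tick s)
           else exec w inp (c2 k) (tick s))) (bind_spmf (return_spmf ()) (\<lambda>_. D))"
    proof (rule rel_spmf_bindI[OF compR_exec[OF conjunct1[OF s1] assms(2,3), of "k+1"]])
      fix s2 assume s2: "view s2 = (W, h, ot) \<and> hid (k+1) s1 s2 \<and> rmem s2 (hr (k+1)) = evalR inp h b W \<and>
        clock s2 \<le> clock s1 + costR inp b W"
      have "rmem s2 (hr k) = evalR inp h a W" using s1 s2 by (simp add: hid_def)
      then have "(if holds (RLess (hr k) (hr (k+1))) s2 then exec w inp (c1 k) (tick s2)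
           else exec w inp (c2 k) (tick s2)) = exec w inp (c k) (tick s2)" using s2 by (simp add: c_def)
      moreover have "rel_spmf (\<lambda>s' st'. view s' = st' \<and> hid k (tick s2) s' \<and> clock s' \<le> clock (tick s2) + T)
        (exec w inp (c k) (tick s2)) D" by (rule runsD[OF c]) (use s2 in simp)
      ultimately show "rel_spmf (\<lambda>s' st'. view s' = st' \<and> hid k s s' \<and>
        clock s' \<le> clock s + (costR inp a W + costR inp b W + 1 + T))
        (if holds (RLess (hr k) (hr (k+1))) s2 then exec w inp (c1 k) (tick s2)
           else exec w inp (c2 k) (tick s2)) D"
        by (auto elim!: rel_spmf_mono simp del: holds.simps) (use s1 s2 in \<open>auto simp: hid_def\<close>)
    qed
  qed
  then show "rel_spmf (\<lambda>s' st'. view s' = st' \<and> hid k s s' \<and>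
      clock s' \<le> clock s + (costR inp a W + costR inp b W + 1 + T))
      (exec w inp (cIfR a b c1 c2 k) s) D" by simp
qed

lemma runs_let:
  assumes "fitsW w inp W e" "W x < 2 ^ w" "runs w inp c (W(x := evalW inp W e), h, ot) D T"
  shows "runs w inp (cLet x e c) (W, h, ot) (map_spmf (updx x (W x)) D) (costW e + 4 + T)"
  unfolding runs_def
proof (intro allI impI)
  fix k s assume v: "view s = (W, h, ot)"
  from compW_view[OF v assms(1), of k] obtain s1 where s1:
    "exec w inp (compW e k) s = return_spmf s1" "view s1 = (W, h, ot)" "hid k s s1"
    "wmem s1 (hw k) = evalW inp W e" "clock s1 = clock s + costW e" by auto
  have f: "evalW inp W e < 2 ^ w" using assms(1) by (cases e) auto
  define s2 where "s2 = put_word w (2 * x) (evalW inp W e)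
    (tick (put_word w (hw (k+2)) (W x) (tick (put_word w (hw (k+1)) 0 (tick s1)))))"
  have v2: "view s2 = updx x (evalW inp W e) (W, h, ot)" unfolding s2_def
    by (rule view_updx[OF _ f]) (simp add: s1)
  have s2: "clock s2 = clock s1 + 3" "wmem s2 (hw (k+2)) = W x" "wmem s2 (hw (k+1)) = 0" "hid k s s2"
    using s1 assms(2) by (simp_all add: s2_def hid_def)
  have ex: "exec w inp (cLet x e c k) s = exec w inp (c (k+3)) s2 \<bind>
     (\<lambda>s. return_spmf (put_word w (2 * x) (wmem s (hw (k+2)) + wmem s (hw (k+1))) (tick s)))"
    using s1 view_wmem[OF s1(2), of x] assms(2) by (simp add: cLet_def s2_def)
  have "rel_spmf (\<lambda>s' st'. view s' = st' \<and> hid (k+3) s2 s' \<and> clock s' \<le> clock s2 + T)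
      (exec w inp (c (k+3)) s2) D" using assms(3) v2 by (simp add: runs_def)
  then have "rel_spmf (\<lambda>s' st'. view s' = st' \<and> hid k s s' \<and> clock s' \<le> clock s + (costW e + 4 + T))
     (exec w inp (c (k+3)) s2 \<bind>
     (\<lambda>s. return_spmf (put_word w (2 * x) (wmem s (hw (k+2)) + wmem s (hw (k+1))) (tick s))))
     (bind_spmf D (\<lambda>st. return_spmf (updx x (W x) st)))"
  proof (rule rel_spmf_bindI)
    fix s3 st3 assume a: "view s3 = st3 \<and> hid (k+3) s2 s3 \<and> clock s3 \<le> clock s2 + T"
    then have w3: "wmem s3 (hw (k+2)) = W x" "wmem s3 (hw (k+1)) = 0" using s2 by (simp_all add: hid_def)
    have "view (put_word w (2 * x) (W x) (tick s3)) = updx x (W x) st3"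
      by (rule view_updx[OF _ assms(2)]) (use a in simp)
    then show "rel_spmf (\<lambda>s' st'. view s' = st' \<and> hid k s s' \<and> clock s' \<le> clock s + (costW e + 4 + T))
      (return_spmf (put_word w (2 * x) (wmem s3 (hw (k+2)) + wmem s3 (hw (k+1))) (tick s3)))
      (return_spmf (updx x (W x) st3))" using a w3 s2 s1 by (simp add: hid_def)
  qed
  then show "rel_spmf (\<lambda>s' st'. view s' = st' \<and> hid k s s' \<and> clock s' \<le> clock s + (costW e + 4 + T))
     (exec w inp (cLet x e c k) s) (map_spmf (updx x (W x)) D)"
    unfolding ex by (simp add: map_spmf_conv_bind_spmf)
qed

lemma runs_for:
  assumes "fitsW w inp W e" "W x < 2 ^ w" "w > 0" and n: "evalW inp W e = n"
    and D0: "D 0 = return_spmf (W, h, ot)"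
    and D: "\<And>i. i < n \<Longrightarrow> D (Suc i) = bind_spmf (D i) (F i)"
    and body: "\<And>i st. i < n \<Longrightarrow> st \<in> set_spmf (D i) \<Longrightarrow>
       runs w inp c (updx x i st) (map_spmf (updx x i) (F i st)) (T i)"
  shows "runs w inp (cFor x e c) (W, h, ot) (map_spmf (updx x (W x)) (D n))
     (costW e + 6 + (\<Sum>i<n. T i + 3))"
  unfolding runs_def cFor_def
proof (intro allI impI)
  fix k s assume v: "view s = (W, h, ot)"
  have "rel_spmf (\<lambda>s' st'. view s' = updx x (W x) st' \<and> hidq 0 k s s' \<and>
       rmem s' (hr 0) = rmem s (hr 0) \<and> clock s' \<le> clock s + (costW e + 6 + (\<Sum>i<n. T i + 3)))
       (exec w inp (count_loop x e c k) s) (D n)"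
  proof (rule count_loop_exec[where A = "\<lambda>_ r. r = rmem s (hr 0)" and F = F and T = T and h = h and ot = ot, OF v assms(1-3) n D0 D])
    fix i st s1 assume a: "i < n" "st \<in> set_spmf (D i)" "view s1 = updx x i st" "rmem s1 (hr 0) = rmem s (hr 0)"
    then have "rel_spmf (\<lambda>s' st'. view s' = st' \<and> hid (k+5) s1 s' \<and> clock s' \<le> clock s1 + T i)
      (exec w inp (c (k+5)) s1) (map_spmf (updx x i) (F i st))" using body[of i st] by (simp add: runs_def)
    then show "rel_spmf (\<lambda>s2 st'. view s2 = updx x i st' \<and> rmem s2 (hr 0) = rmem s (hr 0) \<and>
          hidq 0 (k + 5) s1 s2 \<and> clock s2 \<le> clock s1 + T i) (exec w inp (c (k + 5)) s1) (F i st)"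
      unfolding spmf_rel_map by (rule rel_spmf_mono) (use a in \<open>auto simp: hid_def hidq_def\<close>)
  qed auto
  then show "rel_spmf (\<lambda>s' st'. view s' = st' \<and> hid k s s' \<and> clock s' \<le> clock s + (costW e + 6 + (\<Sum>i<n. T i + 3)))
     (exec w inp (count_loop x e c k) s) (map_spmf (updx x (W x)) (D n))"
    unfolding spmf_rel_map by (rule rel_spmf_mono) (auto simp: hid_def hidq_def)
qed

lemma runs_for_det:
  assumes "fitsW w inp W e" "W x < 2 ^ w" "w > 0" and n: "evalW inp W e = n"
    and S0: "S 0 = (W, h, ot)"
    and body: "\<And>i. i < n \<Longrightarrow> runs w inp c (updx x i (S i)) (return_spmf (updx x i (S (Suc i)))) (T i)"
  shows "runs w inp (cFor x e c) (W, h, ot) (return_spmf (updx x (W x) (S n)))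
     (costW e + 6 + (\<Sum>i<n. T i + 3))"
  using runs_for[where D = "\<lambda>i. return_spmf (S i)" and F = "\<lambda>i st. return_spmf (S (Suc i))" and T = T,
      OF assms(1-4)] S0 body by simp

lemma runs_for_heap:
  assumes "fitsW w inp W e" "W x < 2 ^ w" "w > 0" and n: "evalW inp W e = n"
    and body: "\<And>i. i < n \<Longrightarrow>
       runs w inp c (W(x := i), h i, ot) (return_spmf (W(x := i), h (Suc i), ot)) (T i)"
  shows "runs w inp (cFor x e c) (W, h 0, ot) (return_spmf (W, h n, ot))
     (costW e + 6 + (\<Sum>i<n. T i + 3))"
  using runs_for_det[where S = "\<lambda>i. (W, h i, ot)" and T = T, OF assms(1-4)] body by simp

text \<open>Writing a word as \<open>2 * k + of_bool b\<close> is a bijection because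
  \<open>2 ^ w\<close> is even; the lowest bit is therefore a fair coin.\<close>

lemma coin_word:
  assumes "w > 0"
  shows "map_spmf (\<lambda>k. k mod 2) (spmf_of_set {..<(2::nat) ^ w}) = map_spmf of_bool coin_spmf"
proof -
  have "bij_betw (\<lambda>(b, k). 2 * k + of_bool b) (UNIV \<times> {..<(2::nat) ^ (w - 1)}) {..<2 ^ w}"
  proof (rule bij_betwI[where g = "\<lambda>k. (odd k, k div 2)"])
    have "(2::nat) ^ w = 2 * 2 ^ (w - 1)" using assms by (cases w) auto
    then show "(\<lambda>(b, k). 2 * k + of_bool b) \<in> UNIV \<times> {..<(2::nat) ^ (w - 1)} \<rightarrow> {..<2 ^ w}"
      "(\<lambda>k. (odd k, k div 2)) \<in> {..<2 ^ w} \<rightarrow> UNIV \<times> {..<(2::nat) ^ (w - 1)}"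
      by auto
  qed auto
  then have "map_pmf (\<lambda>(b, k). 2 * k + of_bool b) (pmf_of_set (UNIV \<times> {..<(2::nat) ^ (w - 1)})) =
      pmf_of_set {..<(2::nat) ^ w}"
    by (intro map_pmf_of_set_bij_betw) (auto simp: lessThan_empty_iff)
  moreover have "pair_pmf (pmf_of_set UNIV) (pmf_of_set {..<(2::nat) ^ (w - 1)}) =
      pmf_of_set ((UNIV :: bool set) \<times> {..<(2::nat) ^ (w - 1)})"
    by (rule pmf_eqI)
      (auto simp: pmf_pair card_cartesian_product indicator_def lessThan_empty_iff pmf_of_set)
  ultimately have "map_pmf (\<lambda>k. k mod 2) (pmf_of_set {..<(2::nat) ^ w}) =
      map_pmf (\<lambda>k. k mod 2) (map_pmf (\<lambda>(b, k). 2 * k + of_bool b)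
        (pair_pmf (pmf_of_set UNIV) (pmf_of_set {..<(2::nat) ^ (w - 1)})))" by simp
  also have "\<dots> = map_pmf of_bool (map_pmf fst (pair_pmf (pmf_of_set UNIV) (pmf_of_set {..<(2::nat) ^ (w - 1)})))"
    by (simp add: pmf.map_comp o_def case_prod_beta)
  also have "\<dots> = map_pmf of_bool (pmf_of_set UNIV)" by (simp add: map_fst_pair_pmf)
  finally have "spmf_of_pmf (map_pmf (\<lambda>k. k mod 2) (pmf_of_set {..<(2::nat) ^ w})) =
     spmf_of_pmf (map_pmf of_bool (pmf_of_set UNIV))" by simp
  then show ?thesis
    by (simp add: spmf_of_pmf_pmf_of_set lessThan_empty_iff flip: map_spmf_of_pmf)
qed

lemma runs_bit:
  assumes "fitsW w inp W (addr a e)" "a < 15" "w \<ge> 2"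
  shows "runs w inp (cBit a e) (W, h, ot)
    (map_spmf (\<lambda>b. (W, h(a := (h a)(evalW inp W e := of_bool b)), ot)) coin_spmf) (costW e + 9)"
  unfolding runs_def
proof (intro allI impI)
  fix k s assume v: "view s = (W, h, ot)"
  let ?u = "spmf_of_set {..<(2::nat) ^ w}"
  let ?s = "\<lambda>j j'. put_real (hr k) (real j') (tick (put_word w (hw k) j' (tick
     (put_word w (hw (k+1)) 2 (tick (put_word w (hw k) j (tick s)))))))"
  define p where "p s = bind_spmf (exec w inp (compW (addr a e) (k+1)) s)
     (\<lambda>s. return_spmf (put_real (wmem s (hw (k+1))) (rmem s (hr k)) (tick s)))" for s
  have two: "(2::nat) < 2 ^ w" using assms(3) power_strict_increasing[of 1 w "2::nat"] by simp
  \<comment> \<open>The raw random word survives only in a register that its parity overwrites, so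
    it may be replaced by a constant; what follows depends on the parity alone.\<close>
  have P: "put_word w a k1 (tick (put_word w b c (tick (put_word w a k2 (tick s))))) =
     put_word w a k1 (tick (put_word w b c (tick (put_word w a k3 (tick s)))))" if "a \<noteq> b" for a b c k1 k2 k3
    using that by (simp add: put_word_def tick_def fun_upd_twist)
  have "exec w inp (cBit a e k) s = bind_spmf ?u (\<lambda>j. p (?s j (j mod 2)))"
    unfolding cBit_def
    by (simp add: bind_map_spmf o_def p_def)
      (rule bind_spmf_cong[OF refl], use two in \<open>simp add: set_spmf_of_set\<close>)
  also have "\<dots> = bind_spmf ?u (\<lambda>j. p (?s 0 (j mod 2)))"
    by (subst P[where ?k3.0 = 0]) simp_all
  also have "\<dots> = bind_spmf (map_spmf (\<lambda>k. k mod 2) ?u) (\<lambda>b. p (?s 0 b))"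
    by (simp add: bind_map_spmf o_def)
  also have "\<dots> = bind_spmf coin_spmf (\<lambda>b. p (?s 0 (of_bool b)))"
    using assms(3) by (subst coin_word) (simp_all add: bind_map_spmf o_def)
  finally have ex: "exec w inp (cBit a e k) s = bind_spmf coin_spmf (\<lambda>b. p (?s 0 (of_bool b)))" .
  have "rel_spmf (\<lambda>s' st'. view s' = st' \<and> hid k s s' \<and> clock s' \<le> clock s + (costW e + 9))
    (bind_spmf coin_spmf (\<lambda>b. p (?s 0 (of_bool b))))
    (bind_spmf coin_spmf (\<lambda>b. return_spmf (W, h(a := (h a)(evalW inp W e := of_bool b)), ot)))"
  proof (rule rel_spmf_bindI[where R = "(=)"])
    fix b b' :: bool assume "b = b'"
    define s1 where "s1 = ?s 0 (of_bool b)"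
    have v1: "view s1 = (W, h, ot)" using v by (simp add: s1_def)
    have s1: "rmem s1 (hr k) = of_bool b" "hid k s s1" "clock s1 = clock s + 4"
      by (auto simp: s1_def hid_def)
    obtain s2 where s2: "exec w inp (compW (addr a e) (k+1)) s1 = return_spmf s2"
      "view s2 = (W, h, ot)" "hid (k+1) s1 s2" "wmem s2 (hw (k+1)) = 16 * evalW inp W e + a"
      "rmem s2 = rmem s1" "clock s2 = clock s1 + (costW e + 4)"
      using compW_view[OF v1 assms(1), of "k+1"] by auto
    have "view (put_real (16 * evalW inp W e + a) (of_bool b) (tick s2)) =
      (W, h(a := (h a)(evalW inp W e := of_bool b)), ot)"
      by (rule view_put_real) (use s2 assms in simp_all)
    moreover have "hid k s (put_real (16 * evalW inp W e + a) (of_bool b) (tick s2))"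
      using s1 s2 hr_neq[OF assms(2), of "evalW inp W e", THEN not_sym] by (auto simp: hid_def)
    ultimately show "rel_spmf (\<lambda>s' st'. view s' = st' \<and> hid k s s' \<and> clock s' \<le> clock s + (costW e + 9))
      (p (?s 0 (of_bool b))) (return_spmf (W, h(a := (h a)(evalW inp W e := of_bool b')), ot))"
      unfolding s1_def[symmetric] using s1 s2 \<open>b = b'\<close> by (simp add: p_def)
  qed (simp add: spmf_rel_eq)
  then show "rel_spmf (\<lambda>s' st'. view s' = st' \<and> hid k s s' \<and> clock s' \<le> clock s + (costW e + 9))
    (exec w inp (cBit a e k) s) (map_spmf (\<lambda>b. (W, h(a := (h a)(evalW inp W e := of_bool b)), ot)) coin_spmf)"
    unfolding ex by (simp add: map_spmf_conv_bind_spmf)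
qed

lemma runs_cong: "runs w inp c st D T \<Longrightarrow> D = D' \<Longrightarrow> T \<le> T' \<Longrightarrow> runs w inp c st D' T'"
  using runs_mono by blast

lemma runs_for_fold:
  assumes "fitsW w inp W e" "W x < 2 ^ w" "w > 0" "evalW inp W e = n"
    and "\<And>i h. i < n \<Longrightarrow> runs w inp c (W(x := i), h, ot) (return_spmf (W(x := i), f i h, ot)) (T i h)"
  shows "runs w inp (cFor x e c) (W, h, ot) (return_spmf (W, fold f [0..<n] h, ot))
     (costW e + 6 + (\<Sum>i<n. T i (fold f [0..<i] h) + 3))"
  using runs_for_heap[where h = "\<lambda>i. fold f [0..<i] h" and T = "\<lambda>i. T i (fold f [0..<i] h)", OF assms(1-4)]
    assms(5) by simp

section \<open>The data structure as a program\<close>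

definition ix2 :: "wexp \<Rightarrow> wexp \<Rightarrow> wexp \<Rightarrow> wexp" where
  "ix2 a b c = Op WAdd (Op WMul a b) c"

lemma ix2_simps [simp]:
  "evalW inp W (ix2 a b c) = evalW inp W a * evalW inp W b + evalW inp W c"
  "costW (ix2 a b c) = costW a + costW b + costW c + 2"
  "fitsW w inp W (ix2 a b c) \<longleftrightarrow> fitsW w inp W a \<and> fitsW w inp W b \<and> fitsW w inp W c \<and>
     evalW inp W a * evalW inp W b + evalW inp W c < 2 ^ w"
  by (auto simp: ix2_def)

definition fitsA :: "nat \<Rightarrow> nat \<Rightarrow> nat \<Rightarrow> bool" where
  "fitsA w a x \<longleftrightarrow> 16 < (2::nat) ^ w \<and> 16 * x + a < 2 ^ w"

lemma fits_addr [simp]: "fitsW w inp W e \<Longrightarrow> fitsA w a (evalW inp W e) \<Longrightarrow> fitsW w inp W (addr a e)"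
  by (auto simp: addr_def fitsA_def)

text \<open>
  Word variables: 0 \<open>n\<close>, 1 \<open>d\<close>, 2 \<open>K\<close> (sketches per node), 3 \<open>L\<close> (window levels), 4 \<open>d + L\<close>,
  5 queries since the last rebuild, 6 \<open>2 ^ L\<close>, 7 \<open>2 n\<close>, 8 bound on the depth of the tree,
  9 \<open>\<lceil>log n\<rceil>\<close>; from 10 on index variables: 10 row, 11 column, 12 sketch, 13 node, 14 level,
  15 power of 2, 16 sketch column, 17 cell, 18 height.

  Arrays: 0 scalars (squared threshold, weight change, increment), 1 \<open>A\<close>, 2 \<open>g\<close>, 3 offset of \<open>x\<close>,
  4 reported vector, 5 weights, 6 sum of the \<open>h\<close>, 7 this sum at the start of the windows,
  8 sketches, 9 signs, 10 window sums of \<open>\<delta>\<close>, 11 positive nodes.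

  The leaf of row \<open>i\<close> is node \<open>n + i\<close>, the parent of node \<open>v\<close> is \<open>v div 2\<close>, the root is node 1.
\<close>

definition cell :: "wexp \<Rightarrow> wexp \<Rightarrow> wexp \<Rightarrow> wexp" where
  "cell v r c = ix2 (ix2 v (V 2) r) (V 4) c"

definition row_dot :: rexp where
  "row_dot = Sum 11 (V 1) (Bop RMul (Rd 1 (ix2 (V 10) (V 1) (V 11))) (Rd 6 (V 11)))"

text \<open>Adds the signed increment to one column in the sketches of the leaf and of all nodes
  above it. The number of rounds is fixed; a shorter path arrives at node 0 and stays there. That
  node is never tested and only collects garbage.\<close>

definition add_entry :: cmd where
  "add_entry = cLet 13 (Op WAdd (V 0) (V 10)) (cFor 18 (V 8)
     (cFor 12 (V 2) (cSetR 8 (cell (V 13) (V 12) (V 16))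
        (Bop RAdd (Rd 8 (cell (V 13) (V 12) (V 16))) (Bop RMul (Rd 9 (ix2 (V 12) (V 0) (V 10))) (Rd 0 (N 2)))))
      ;; cSetW 13 (Op WDiv (V 13) (N 2))))"

text \<open>Brings the weight \<open>g / b\<close> of a row up to date. The column
  \<open>V 1 + V 14\<close> receives the change of weight times the value of the row on the window
  of that level, which cancels the effect of the new weight on \<open>sketch_value\<close>.\<close>

definition reweight :: cmd where
  "reweight = cSetR 0 (N 1) (Bop RSub (Bop RDiv (Rd 2 (V 10)) (Rd 4 (V 10))) (Rd 5 (V 10)))
     ;; cSetR 5 (V 10) (Bop RDiv (Rd 2 (V 10)) (Rd 4 (V 10)))
     ;; cFor 16 (V 1) (cSetR 0 (N 2) (Bop RMul (Rd 0 (N 1)) (Rd 1 (ix2 (V 10) (V 1) (V 16)))) ;; add_entry)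
     ;; cFor 14 (V 3) (cSetR 0 (N 2) (Bop RMul (Rd 0 (N 1)) (Sum 11 (V 1)
           (Bop RMul (Rd 1 (ix2 (V 10) (V 1) (V 11))) (Bop RSub (Rd 6 (V 11)) (Rd 7 (ix2 (V 14) (V 1) (V 11)))))))
         ;; cLet 16 (Op WAdd (V 1) (V 14)) add_entry)"

definition exact_value :: rexp where
  "exact_value = Bop RAdd (Rd 3 (V 10)) (Bop RMul (Rd 2 (V 10)) row_dot)"

definition sync :: cmd where
  "sync = cSetR 4 (V 10) exact_value ;; reweight"

text \<open>Sketching is linear, so the stored columns times the \<open>h\<close> summed over the
  window sketch the whole window at the present weights. The subtracted column removes what is due
  to weights changed since the window began.\<close>

definition sketch_value :: rexp where
  "sketch_value = Bop RSub (Sum 11 (V 1) (Bop RMul (Rd 8 (cell (V 13) (V 12) (V 11)))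
        (Bop RSub (Rd 6 (V 11)) (Rd 7 (ix2 (V 14) (V 1) (V 11))))))
      (Rd 8 (cell (V 13) (V 12) (Op WAdd (V 1) (V 14))))"

text \<open>Nodes are visited by increasing number, so a parent comes before its children. A child
  of a negative node is marked negative unseen; node 0, the parent of the root, is permanently
  positive.\<close>

definition check_node :: cmd where
  "check_node = cLet 13 (Op WAdd (V 17) (N 1))
     (cIfR (OfW (N 0)) (Rd 11 (Op WDiv (V 13) (N 2)))
        (cSetR 11 (V 13) (Sum 12 (V 2) (Lt (Rd 0 (N 0)) (Sq sketch_value))))
        (cSetR 11 (V 13) (OfW (N 0))))"

definition check_leaf :: cmd where
  "check_leaf = cIfR (OfW (N 0))
     (Bop RAdd (Rd 11 (Op WAdd (V 0) (V 10))) (Lt (Rd 0 (N 0)) (Sq (Rd 10 (ix2 (V 14) (V 0) (V 10))))))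
     sync cSkip"

definition reset :: cmd where
  "reset = cFor 11 (V 1) (cSetR 7 (ix2 (V 14) (V 1) (V 11)) (Rd 6 (V 11)))
     ;; cFor 13 (V 7) (cFor 12 (V 2) (cSetR 8 (cell (V 13) (V 12) (Op WAdd (V 1) (V 14))) (OfW (N 0))))
     ;; cFor 10 (V 0) (cSetR 10 (ix2 (V 14) (V 0) (V 10)) (OfW (N 0)))"

definition check :: cmd where
  "check = cFor 17 (Op WSub (V 7) (N 1)) check_node ;; cFor 10 (V 0) check_leaf ;; reset"

definition draw_signs :: cmd where
  "draw_signs = cFor 17 (Op WMul (V 2) (V 0)) (cBit 9 (V 17) ;;
     cSetR 9 (V 17) (Bop RSub (OfW (N 1)) (Bop RMul (OfW (N 2)) (Rd 9 (V 17)))))"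

text \<open>With sketches, windows and weights set to 0, \<open>reweight\<close> sees the full
  weight as the change and so inserts the whole row.\<close>

definition rebuild :: cmd where
  "rebuild = cFor 17 (Op WMul (Op WMul (V 7) (V 2)) (V 4)) (cSetR 8 (V 17) (OfW (N 0)))
     ;; cFor 17 (Op WMul (V 3) (V 0)) (cSetR 10 (V 17) (OfW (N 0)))
     ;; cFor 14 (V 3) (cFor 11 (V 1) (cSetR 7 (ix2 (V 14) (V 1) (V 11)) (Rd 6 (V 11))))
     ;; cFor 10 (V 0) (cSetR 4 (V 10) exact_value ;; cSetR 5 (V 10) (OfW (N 0)))
     ;; draw_signs ;; cFor 10 (V 0) reweight"

definition absorb :: cmd where
  "absorb = cFor 11 (V 1) (cSetR 6 (V 11) (Bop RAdd (Rd 6 (V 11)) (InR (V 11))))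
     ;; cFor 10 (V 0) (cSetR 3 (V 10) (Bop RAdd (Rd 3 (V 10)) (InR (Op WAdd (V 1) (V 10)))))
     ;; cFor 14 (V 3) (cFor 10 (V 0) (cSetR 10 (ix2 (V 14) (V 0) (V 10)) (Bop RAdd (Rd 10 (ix2 (V 14) (V 0) (V 10)))
          (Bop RDiv (InR (Op WAdd (V 1) (V 10))) (Rd 4 (V 10))))))"

definition check_levels :: cmd where
  "check_levels = cLet 15 (N 1) (cFor 14 (V 3)
     (cIfW (Op WMod (V 5) (V 15)) (N 1) check cSkip ;; cSetW 15 (Op WMul (V 15) (N 2))))"

definition query_cmd :: cmd where
  "query_cmd = absorb ;; cSetW 5 (Op WAdd (V 5) (N 1))
     ;; cIfW (V 5) (V 6) check_levels (rebuild ;; cSetW 5 (N 0))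
     ;; cFor 10 (V 0) (cOut (V 10) (Rd 4 (V 10)))"

definition scale_cmd :: cmd where
  "scale_cmd = cLet 10 (InW (N 0))
     (cSetR 3 (V 10) (Bop RAdd (Rd 3 (V 10)) (Bop RMul (Bop RSub (Rd 2 (V 10)) (InR (N 0))) row_dot))
     ;; cSetR 2 (V 10) (InR (N 0)) ;; reweight)"

definition exact_cmd :: cmd where
  "exact_cmd = cLet 10 (InW (N 0)) (cOut (N 0) exact_value)"

text \<open>The logarithm is found by doubling a word until it reaches \<open>n\<close>. Only
  counted loops are available, so \<open>n\<close> rounds are run, idle from then on.\<close>

definition init_words :: "nat \<Rightarrow> cmd" where
  "init_words \<kappa> = cSetW 0 (InW (N 0)) ;; cSetW 1 (InW (N 1)) ;; cSetW 15 (N 1)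
     ;; cFor 10 (V 0) (cIfW (V 15) (V 0)
          (cSetW 15 (Op WMul (V 15) (N 2)) ;; cSetW 9 (Op WAdd (V 9) (N 1))) cSkip)
     ;; cSetW 2 (Op WMul (N \<kappa>) (V 9)) ;; cSetW 3 (Op WAdd (V 9) (V 9)) ;; cSetW 4 (Op WAdd (V 1) (V 3))
     ;; cSetW 7 (Op WAdd (V 0) (V 0)) ;; cSetW 8 (Op WAdd (V 9) (N 2)) ;; cSetW 6 (N 1)
     ;; cFor 10 (V 3) (cSetW 6 (Op WMul (V 6) (N 2)))"

definition init_row :: cmd where
  "init_row = cSetR 2 (V 10) (InR (Op WAdd (N 1) (V 10)))
     ;; cSetR 3 (V 10) (InR (Op WAdd (Op WAdd (N 1) (V 0)) (V 10)))
     ;; cSetR 4 (V 10) (Rd 3 (V 10)) ;; cSetR 5 (V 10) (Bop RDiv (Rd 2 (V 10)) (Rd 4 (V 10)))"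

text \<open>The weights are in place and all windows are empty, so a nonzero entry touches a single
  column; this keeps the cost proportional to the number of nonzero entries.\<close>

definition init_entry :: cmd where
  "init_entry = cLet 10 (InW (Op WAdd (V 17) (Op WAdd (V 17) (N 3))))
     (cLet 16 (InW (Op WAdd (V 17) (Op WAdd (V 17) (N 4))))
       (cSetR 1 (ix2 (V 10) (V 1) (V 16)) (InR (Op WAdd (Op WAdd (V 7) (N 1)) (V 17)))
        ;; cSetR 0 (N 2) (Bop RMul (Rd 5 (V 10)) (Rd 1 (ix2 (V 10) (V 1) (V 16)))) ;; add_entry))"

definition init_data :: cmd where
  "init_data = cSetR 0 (N 0) (Sq (Bop RDiv (InR (N 0)) (Bop RMul (OfW (N 8)) (OfW (V 3)))))
     ;; cSetR 11 (N 0) (OfW (N 1)) ;; cFor 10 (V 0) init_row ;; draw_signs ;; cFor 17 (InW (N 2)) init_entry"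

section \<open>Effect and cost of the procedures\<close>

definition coin_sign :: "real pmf" where
  "coin_sign = map_pmf (\<lambda>b. 1 - 2 * of_bool b) (pmf_of_set UNIV)"

definition signs :: "nat \<Rightarrow> (nat \<Rightarrow> real) spmf" where
  "signs m = spmf_of_pmf (Pi_pmf {..<m} 0 (\<lambda>_. coin_sign))"

lemma signs_Suc:
  "signs (Suc m) = bind_spmf (signs m) (\<lambda>f. map_spmf (\<lambda>b. f(m := 1 - 2 * of_bool b)) coin_spmf)"
proof -
  have "Pi_pmf (insert m {..<m}) 0 (\<lambda>_. coin_sign) =
    map_pmf (\<lambda>(y, f). f(m := y)) (pair_pmf coin_sign (Pi_pmf {..<m} 0 (\<lambda>_. coin_sign)))"
    by (rule Pi_pmf_insert) auto
  also have "\<dots> = bind_pmf (Pi_pmf {..<m} 0 (\<lambda>_. coin_sign)) (\<lambda>f. map_pmf (\<lambda>y. f(m := y)) coin_sign)"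
    by (subst pair_commute_pmf) (simp add: pair_pmf_def map_bind_pmf map_pmf_def bind_assoc_pmf bind_return_pmf)
  finally have "Pi_pmf {..<Suc m} 0 (\<lambda>_. coin_sign) =
     bind_pmf (Pi_pmf {..<m} 0 (\<lambda>_. coin_sign)) (\<lambda>f. map_pmf (\<lambda>b. f(m := 1 - 2 * of_bool b)) (pmf_of_set UNIV))"
    by (simp add: lessThan_Suc coin_sign_def pmf.map_comp o_def)
  then show ?thesis
    by (simp add: signs_def spmf_of_pmf_bind flip: map_spmf_of_pmf)
qed

text \<open>\<open>mem\<close> lets the addresses of the largest array, the sketches, fit into a
  word after the interleaving by 16. \<open>L_DEP\<close> lets the \<open>L * d\<close> operations
  that \<open>reweight\<close> spends on the window columns be absorbed into the cost of the
  tree.\<close>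

locale sizes =
  fixes w n d K L DEP R :: nat
  assumes pos: "1 \<le> d" "d \<le> n" "1 \<le> K" "1 \<le> L" "1 \<le> DEP"
    and L_DEP: "L \<le> 2 * DEP"
    and mem: "16 * (2 * n * K * (d + L)) + 16 \<le> 2 ^ w" and DEPw: "DEP < 2 ^ w" and Rw: "R < 2 ^ w"
    and R_L: "R = 2 ^ L"
begin

abbreviation "D1 \<equiv> d + L"
definition "M = 2 * n * K * (d + L)"

definition params :: "(nat \<Rightarrow> nat) \<Rightarrow> bool" where
  "params W \<longleftrightarrow> W 0 = n \<and> W 1 = d \<and> W 2 = K \<and> W 3 = L \<and> W 4 = D1 \<and> W 6 = R \<and> W 7 = 2 * n \<and>
     W 8 = DEP \<and> (\<forall>x. W x < 2 ^ w)"

lemma params_upd [simp]: "params W \<Longrightarrow> x \<ge> 9 \<Longrightarrow> i < 2 ^ w \<Longrightarrow> params (W(x := i))"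
  by (auto simp: params_def)

lemma paramsD [simp]:
  assumes "params W"
  shows "W 0 = n" "W (Suc 0) = d" "W 2 = K" "W 3 = L" "W 4 = D1" "W 6 = R" "W 7 = 2 * n" "W 8 = DEP"
    "W x < 2 ^ w"
  using assms by (auto simp: params_def)

lemma n_pos: "1 \<le> n" using pos by simp

lemma le_M: "n \<le> M" "d \<le> M" "K \<le> M" "L \<le> M" "n * d \<le> M" "K * n \<le> M" "L * n \<le> M" "L * d \<le> M"
  "2 * n \<le> M" "2 * n * K \<le> M" "D1 \<le> M"
proof -
  have K: "x \<le> K * x" for x using pos mult_right_mono[of 1 K x] by simp
  have D: "x \<le> D1 * x" for x using pos mult_right_mono[of 1 D1 x] by simp
  have N: "x \<le> n * x" for x using n_pos mult_right_mono[of 1 n x] by simp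
  show nk: "2 * n * K \<le> M" using D[of "2 * n * K"] by (simp add: M_def mult.commute)
  show n2: "2 * n \<le> M" by (rule order_trans[OF _ nk]) (use K[of "2 * n"] in \<open>simp add: mult.commute\<close>)
  then show "n \<le> M" "d \<le> M" using pos by linarith+
  show kn: "K * n \<le> M" by (rule order_trans[OF _ nk]) (simp add: mult.commute)
  show "K \<le> M" by (rule order_trans[OF _ kn]) (use N[of K] in \<open>simp add: mult.commute\<close>)
  have "K * (n * D1) \<le> M" by (simp add: M_def mult_ac)
  then have nD: "n * D1 \<le> M" using K[of "n * D1"] by linarith
  then show "n * d \<le> M" and Ln: "L * n \<le> M" by (simp_all add: algebra_simps)
  show D1: "D1 \<le> M" using nD N[of D1] by linarith
  then show "L \<le> M" by simp
  show "L * d \<le> M" using Ln pos mult_left_mono[of d n L] by linarith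
qed

lemma small: "x \<le> M \<Longrightarrow> 16 * x + 15 < 2 ^ w" "x \<le> M \<Longrightarrow> x < 2 ^ w"
  using mem by (auto simp: M_def)

lemma w_pos [simp]: "w > 0" and w16: "16 < (2::nat) ^ w" and w2: "w \<ge> 2"
proof -
  have "16 * 1 \<le> 16 * M" using le_M(1) n_pos by linarith
  then show w16: "16 < (2::nat) ^ w" using small(1)[of M] by linarith
  show "w > 0" using w16 by (cases w) auto
  show "w \<ge> 2" using w16 by (cases w; cases "w - 1") auto
qed

lemma ix2_less: "i < a \<Longrightarrow> j < b \<Longrightarrow> i * b + j < a * (b::nat)"
proof -
  assume "i < a" "j < b"
  then have "i * b + j < Suc i * b" "Suc i * b \<le> a * b" by (simp, intro mult_right_mono) auto
  then show ?thesis by linarith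
qed

lemma cell_less: "v < 2 * n \<Longrightarrow> r < K \<Longrightarrow> c < D1 \<Longrightarrow> (v * K + r) * D1 + c < M"
  unfolding M_def by (intro ix2_less)

lemma fitsA_M: "a < 15 \<Longrightarrow> x \<le> M \<Longrightarrow> fitsA w a x"
  using small(1)[of x] w16 by (simp add: fitsA_def)

lemma index_le_M:
  "i < n \<Longrightarrow> j < d \<Longrightarrow> i * d + j \<le> M" "l < L \<Longrightarrow> j < d \<Longrightarrow> l * d + j \<le> M"
  "l < L \<Longrightarrow> i < n \<Longrightarrow> l * n + i \<le> M" "r < K \<Longrightarrow> i < n \<Longrightarrow> r * n + i \<le> M" "i < n \<Longrightarrow> n + i \<le> M"
  "i < n \<Longrightarrow> i \<le> M" "j < d \<Longrightarrow> j \<le> M" "i < 2 * n \<Longrightarrow> i \<le> M" "l < L \<Longrightarrow> l \<le> M" "r < K \<Longrightarrow> r \<le> M"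
  "l < L \<Longrightarrow> d + l \<le> M" "c < D1 \<Longrightarrow> c \<le> M"
  using le_M ix2_less[of i n j d] ix2_less[of l L j d] ix2_less[of l L i n] ix2_less[of r K i n] by linarith+

lemmas fitsA_index [simp] = index_le_M[THEN fitsA_M[rotated]]
lemmas less_index [simp] = index_le_M[THEN small(2)]

lemma fits_cell [simp]:
  assumes "evalW inp W v < 2 * n" "evalW inp W r < K" "evalW inp W c < D1"
    "fitsW w inp W v" "fitsW w inp W r" "fitsW w inp W c" "params W"
  shows "fitsW w inp W (cell v r c)"
    "evalW inp W (cell v r c) = (evalW inp W v * K + evalW inp W r) * D1 + evalW inp W c"
proof -
  let ?v = "evalW inp W v" and ?r = "evalW inp W r" and ?c = "evalW inp W c"
  have *: "(?v * K + ?r) * D1 + ?c \<le> M" using cell_less assms by (meson less_imp_le)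
  have "?v * K + ?r \<le> (?v * K + ?r) * D1" using pos by simp
  then have "?v * K + ?r \<le> M" "?v * K \<le> M" using * by linarith+
  then show "fitsW w inp W (cell v r c)" using assms *[THEN small(2)] le_M(3,11)[THEN small(2)]
    by (simp add: cell_def small(2))
  show "evalW inp W (cell v r c) = (?v * K + ?r) * D1 + ?c" using assms by (simp add: cell_def)
qed

lemma costW_cell [simp]: "costW (cell v r c) = costW v + costW r + costW c + 8"
  by (simp add: cell_def)

lemma fitsA_cell [simp]:
  "a < 15 \<Longrightarrow> v < 2 * n \<Longrightarrow> r < K \<Longrightarrow> c < D1 \<Longrightarrow> fitsA w a ((v * K + r) * D1 + c)"
  using cell_less by (intro fitsA_M) (auto intro: less_imp_le)

lemma const_less [simp]: "k < DEP \<Longrightarrow> k < 2 ^ w" "0 < (2::nat) ^ w" "Suc 0 < 2 ^ w" "2 < (2::nat) ^ w"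
  using DEPw w16 by linarith+

lemmas size_less [simp] = le_M(1-4,9,11)[THEN small(2)] DEPw Rw

lemma fitsA_scal [simp]: "fitsA w 0 0" "fitsA w 0 (Suc 0)" "fitsA w 0 2"
  using le_M(9) n_pos by (auto intro!: fitsA_M)

type_synonym heap = "nat \<Rightarrow> nat \<Rightarrow> real"

definition node :: "nat \<Rightarrow> nat \<Rightarrow> nat" where
  "node i k = (n + i) div 2 ^ k"

definition sk :: "nat \<Rightarrow> nat \<Rightarrow> nat \<Rightarrow> nat" where
  "sk v r c = (v * K + r) * D1 + c"

definition put :: "nat \<Rightarrow> nat \<Rightarrow> real \<Rightarrow> heap \<Rightarrow> heap" where
  "put a x y h = h(a := (h a)(x := y))"

lemma node_less [simp]: "i < n \<Longrightarrow> node i k < 2 * n"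
  by (auto simp: node_def intro: le_less_trans[OF div_le_dividend])

lemma node_Suc: "node i (Suc k) = node i k div 2"
  unfolding node_def power_Suc2 by (rule div_mult2_eq)

definition addH :: "nat \<Rightarrow> nat \<Rightarrow> heap \<Rightarrow> heap" where
  "addH i c = fold (\<lambda>k. fold (\<lambda>r h. put 8 (sk (node i k) r c)
      (h 8 (sk (node i k) r c) + h 9 (r * n + i) * h 0 2) h) [0..<K]) [0..<DEP]"

lemma runs_add_entry:
  assumes W: "params W" and i: "W 10 < n" and c: "W 16 < D1"
  shows "runs w inp add_entry (W, h, ot) (return_spmf (W, addH (W 10) (W 16) h, ot)) (100 * DEP * K)"
proof -
  let ?i = "W 10" and ?c = "W 16"
  let ?f = "\<lambda>k. fold (\<lambda>r h. put 8 (sk (node ?i k) r ?c)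
      (h 8 (sk (node ?i k) r ?c) + h 9 (r * n + ?i) * h 0 2) h) [0..<K]"
  have body: "runs w inp (cSetR 8 (cell (V 13) (V 12) (V 16))
        (Bop RAdd (Rd 8 (cell (V 13) (V 12) (V 16))) (Bop RMul (Rd 9 (ix2 (V 12) (V 0) (V 10))) (Rd 0 (N 2)))))
     (W(13 := node ?i k, 18 := k', 12 := r), h, ot)
     (return_spmf (W(13 := node ?i k, 18 := k', 12 := r),
       put 8 (sk (node ?i k) r ?c) (h 8 (sk (node ?i k) r ?c) + h 9 (r * n + ?i) * h 0 2) h, ot)) 61"
    if "r < K" "k' < DEP" for k k' r h
    by (rule runs_cong[OF runs_setR]) (use that i c W in \<open>simp_all add: put_def sk_def\<close>)
  have loop_r: "runs w inp (cFor 12 (V 2) (cSetR 8 (cell (V 13) (V 12) (V 16))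
        (Bop RAdd (Rd 8 (cell (V 13) (V 12) (V 16))) (Bop RMul (Rd 9 (ix2 (V 12) (V 0) (V 10))) (Rd 0 (N 2))))))
     (W(13 := node ?i k, 18 := k'), h, ot) (return_spmf (W(13 := node ?i k, 18 := k'), ?f k h, ot)) (8 + 64 * K)"
    if "k' < DEP" for k k' h
    by (rule runs_cong[OF runs_for_fold[where T = "\<lambda>_ _. 61" and n = K]], rule_tac [5] body)
      (use that i c W in \<open>simp_all add: put_def sk_def\<close>)
  have step: "runs w inp (cFor 12 (V 2) (cSetR 8 (cell (V 13) (V 12) (V 16))
        (Bop RAdd (Rd 8 (cell (V 13) (V 12) (V 16))) (Bop RMul (Rd 9 (ix2 (V 12) (V 0) (V 10))) (Rd 0 (N 2)))))
      ;; cSetW 13 (Op WDiv (V 13) (N 2)))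
     (updx 18 k (W(13 := node ?i k), fold ?f [0..<k] h, ot))
     (return_spmf (updx 18 k (W(13 := node ?i (Suc k)), fold ?f [0..<Suc k] h, ot))) (14 + 64 * K)"
    if "k < DEP" for k
    unfolding updx_simp
    by (rule runs_cong[OF runs_seq_det[OF loop_r runs_setW]])
      (use that i c W in \<open>auto simp: node_Suc fun_upd_def intro!: le_less_trans[OF div_le_dividend]\<close>)
  have "runs w inp (cFor 18 (V 8) (cFor 12 (V 2) (cSetR 8 (cell (V 13) (V 12) (V 16))
        (Bop RAdd (Rd 8 (cell (V 13) (V 12) (V 16))) (Bop RMul (Rd 9 (ix2 (V 12) (V 0) (V 10))) (Rd 0 (N 2)))))
      ;; cSetW 13 (Op WDiv (V 13) (N 2)))) (W(13 := n + ?i), h, ot)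
      (return_spmf (updx 18 ((W(13 := n + ?i)) 18) (W(13 := node ?i DEP), fold ?f [0..<DEP] h, ot)))
      (8 + DEP * (17 + 64 * K))"
    by (rule runs_cong[OF runs_for_det[where n = DEP and T = "\<lambda>_. 14 + 64 * K" and
        S = "\<lambda>k. (W(13 := node ?i k), fold ?f [0..<k] h, ot)"]], rule_tac [6] step)
      (use i W in \<open>simp_all add: node_def\<close>)
  moreover have "DEP * (17 + 64 * K) = 17 * DEP + 64 * (DEP * K)" "DEP \<le> DEP * K" "1 \<le> DEP * K"
    using pos by (simp_all add: algebra_simps Suc_le_eq)
  then have "9 + (8 + DEP * (17 + 64 * K)) \<le> 100 * DEP * K" by linarith
  ultimately show ?thesis unfolding add_entry_def addH_def
    by (intro runs_cong[OF runs_let[where T = "8 + DEP * (17 + 64 * K)" and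
        D = "return_spmf (W(13 := node ?i DEP, 18 := W 18), fold ?f [0..<DEP] h, ot)"]])
      (use i c W in simp_all)
qed

definition rwH1 :: "nat \<Rightarrow> heap \<Rightarrow> heap" where
  "rwH1 i h = put 5 i (h 2 i / h 4 i) (put 0 1 (h 2 i / h 4 i - h 5 i) h)"

definition rwH2 :: "nat \<Rightarrow> heap \<Rightarrow> heap" where
  "rwH2 i = fold (\<lambda>c h. addH i c (put 0 2 (h 0 1 * h 1 (i * d + c)) h)) [0..<d]"

definition rwH3 :: "nat \<Rightarrow> heap \<Rightarrow> heap" where
  "rwH3 i = fold (\<lambda>l h. addH i (d + l)
     (put 0 2 (h 0 1 * (\<Sum>j<d. h 1 (i * d + j) * (h 6 j - h 7 (l * d + j)))) h)) [0..<L]"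

definition rwH :: "nat \<Rightarrow> heap \<Rightarrow> heap" where
  "rwH i h = rwH3 i (rwH2 i (rwH1 i h))"

lemma one_le [simp]: "Suc 0 \<le> K" "Suc 0 \<le> DEP" "Suc 0 \<le> d" "Suc 0 \<le> n" "Suc 0 \<le> L" "K > 0" "DEP > 0" "d > 0" "n > 0" "L > 0"
  using pos by auto

text \<open>The cost of writing all columns of one row into all sketches on its path: the unit for
  Scale and for a synchronisation.\<close>

definition X :: nat where "X = D1 * (DEP * K)"

lemma le_DK: "1 \<le> DEP * K" "D1 \<le> X" "L * d \<le> 2 * X" "1 \<le> X" "d \<le> X" "L \<le> X"
  unfolding X_def
proof -
  show a: "1 \<le> DEP * K" by (simp add: Suc_le_eq)
  show b: "D1 \<le> D1 * (DEP * K)" using mult_left_mono[OF a, of D1] by simp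
  then show "d \<le> D1 * (DEP * K)" "L \<le> D1 * (DEP * K)" by linarith+
  show "1 \<le> D1 * (DEP * K)" using b pos by linarith
  have "L * d \<le> 2 * DEP * d" using L_DEP by (intro mult_right_mono) auto
  also have "\<dots> \<le> 2 * (DEP * (d * K))" by simp
  also have "\<dots> \<le> 2 * (D1 * (DEP * K))" by (simp add: algebra_simps)
  finally show "L * d \<le> 2 * (D1 * (DEP * K))" .
qed

lemma runs_reweight:
  assumes W: "params W" and i: "W 10 < n"
  shows "runs w inp reweight (W, h, ot) (return_spmf (W, rwH (W 10) h, ot)) (500 * X)"
proof -
  let ?i = "W 10"
  have s1: "runs w inp (cSetR 0 (N 1) (Bop RSub (Bop RDiv (Rd 2 (V 10)) (Rd 4 (V 10))) (Rd 5 (V 10))))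
      (W, h, ot) (return_spmf (W, put 0 1 (h 2 ?i / h 4 ?i - h 5 ?i) h, ot)) 29" for h
    by (rule runs_cong[OF runs_setR]) (use W i in \<open>simp_all add: put_def\<close>)
  have s2: "runs w inp (cSetR 5 (V 10) (Bop RDiv (Rd 2 (V 10)) (Rd 4 (V 10))))
      (W, h, ot) (return_spmf (W, put 5 ?i (h 2 ?i / h 4 ?i) h, ot)) 22" for h
    by (rule runs_cong[OF runs_setR]) (use W i in \<open>simp_all add: put_def\<close>)
  have b1: "runs w inp (cSetR 0 (N 2) (Bop RMul (Rd 0 (N 1)) (Rd 1 (ix2 (V 10) (V 1) (V 16)))))
      (W(16 := c), h, ot) (return_spmf (W(16 := c), put 0 2 (h 0 1 * h 1 (?i * d + c)) h, ot)) 26"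
    if "c < d" for c h
    by (rule runs_cong[OF runs_setR]) (use W i that in \<open>simp_all add: put_def\<close>)
  have a1: "runs w inp add_entry (W(16 := c), h, ot)
      (return_spmf (W(16 := c), addH ?i c h, ot)) (100 * DEP * K)" if "c < D1" for c h
    using runs_add_entry[of "W(16 := c)" inp h ot] W i that by simp
  have s3: "runs w inp (cFor 16 (V 1) (cSetR 0 (N 2) (Bop RMul (Rd 0 (N 1)) (Rd 1 (ix2 (V 10) (V 1) (V 16)))) ;; add_entry))
      (W, h, ot) (return_spmf (W, rwH2 ?i h, ot)) (8 + d * (29 + 100 * DEP * K))" for h
    unfolding rwH2_def
    by (rule runs_cong[OF runs_for_fold[where T = "\<lambda>_ _. 26 + 100 * DEP * K" and n = d]],
        rule_tac [5] runs_seq_det[OF b1 a1]) (use W i in simp_all)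
  have b2: "runs w inp (cSetR 0 (N 2) (Bop RMul (Rd 0 (N 1)) (Sum 11 (V 1)
           (Bop RMul (Rd 1 (ix2 (V 10) (V 1) (V 11))) (Bop RSub (Rd 6 (V 11)) (Rd 7 (ix2 (V 14) (V 1) (V 11))))))))
      (W(14 := l), h, ot) (return_spmf (W(14 := l),
        put 0 2 (h 0 1 * (\<Sum>j<d. h 1 (?i * d + j) * (h 6 j - h 7 (l * d + j)))) h, ot)) (25 + 39 * d)"
    if "l < L" for l h
    by (rule runs_cong[OF runs_setR]) (use W i that in \<open>simp_all add: put_def\<close>)
  have a2: "runs w inp (cLet 16 (Op WAdd (V 1) (V 14)) add_entry) (W(14 := l), h, ot)
      (return_spmf (W(14 := l), addH ?i (d + l) h, ot)) (9 + 100 * DEP * K)" if "l < L" for l h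
    by (rule runs_cong[OF runs_let[OF _ _ runs_add_entry]])
      (use W i that in \<open>simp_all, auto simp: fun_upd_def\<close>)
  have s4: "runs w inp (cFor 14 (V 3) (cSetR 0 (N 2) (Bop RMul (Rd 0 (N 1)) (Sum 11 (V 1)
           (Bop RMul (Rd 1 (ix2 (V 10) (V 1) (V 11))) (Bop RSub (Rd 6 (V 11)) (Rd 7 (ix2 (V 14) (V 1) (V 11)))))))
         ;; cLet 16 (Op WAdd (V 1) (V 14)) add_entry))
      (W, h, ot) (return_spmf (W, rwH3 ?i h, ot)) (8 + L * (37 + 39 * d + 100 * DEP * K))" for h
    unfolding rwH3_def
    by (rule runs_cong[OF runs_for_fold[where T = "\<lambda>_ _. (25 + 39 * d) + (9 + 100 * DEP * K)" and n = L]],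
        rule_tac [5] runs_seq_det[OF b2 a2]) (use W i in \<open>simp_all add: algebra_simps\<close>)
  have e: "d * (29 + 100 * DEP * K) + L * (37 + 39 * d + 100 * DEP * K) = 29 * d + 37 * L + 39 * (L * d) + 100 * X"
    by (simp add: X_def algebra_simps)
  have "29 + (22 + (8 + d * (29 + 100 * DEP * K) + (8 + L * (37 + 39 * d + 100 * DEP * K)))) \<le> 500 * X"
    using e le_DK by linarith
  then show ?thesis
    unfolding reweight_def
    by (intro runs_cong[OF runs_seq_det[OF s1 runs_seq_det[OF s2 runs_seq_det[OF s3 s4]]]])
      (simp_all add: rwH_def rwH1_def put_def)
qed

definition syncH :: "nat \<Rightarrow> heap \<Rightarrow> heap" where
  "syncH i h = rwH i (put 4 i (h 3 i + h 2 i * (\<Sum>j<d. h 1 (i * d + j) * h 6 j)) h)"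

lemma runs_sync:
  assumes W: "params W" and i: "W 10 < n"
  shows "runs w inp sync (W, h, ot) (return_spmf (W, syncH (W 10) h, ot)) (600 * X)"
proof -
  have s: "runs w inp (cSetR 4 (V 10) exact_value) (W, h, ot) (return_spmf (W,
      put 4 (W 10) (h 3 (W 10) + h 2 (W 10) * (\<Sum>j<d. h 1 (W 10 * d + j) * h 6 j)) h, ot)) (33 + 25 * d)"
    by (rule runs_cong[OF runs_setR])
      (use W i in \<open>simp_all add: put_def exact_value_def row_dot_def\<close>)
  show ?thesis unfolding sync_def syncH_def
    by (rule runs_cong[OF runs_seq_det[OF s runs_reweight[OF W i]] refl]) (use le_DK in linarith)
qed

definition skv :: "nat \<Rightarrow> nat \<Rightarrow> nat \<Rightarrow> heap \<Rightarrow> real" where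
  "skv l v r h = (\<Sum>j<d. h 8 (sk v r j) * (h 6 j - h 7 (l * d + j))) - h 8 (sk v r (d + l))"

definition posH :: "nat \<Rightarrow> nat \<Rightarrow> heap \<Rightarrow> heap" where
  "posH l u h = put 11 (Suc u)
     (if 0 < h 11 (Suc u div 2) then \<Sum>r<K. of_bool (h 0 0 < (skv l (Suc u) r h)\<^sup>2) else 0) h"

lemma runs_check_node:
  assumes W: "params W" and l: "W 14 < L" and u: "W 17 < 2 * n - 1"
  shows "runs w inp check_node (W, h, ot) (return_spmf (W, posH (W 14) (W 17) h, ot))
     (30 + of_bool (0 < h 11 (Suc (W 17) div 2)) * (130 * K * d))"
proof -
  let ?l = "W 14" 
  define v where v_def: "v = Suc (W 17)"
  have v: "v < 2 * n" using u by (simp add: v_def)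
  have vd: "v div 2 < 2 * n" using v by linarith
  note [simp] = less_index(8)[OF vd] index_le_M(8)[OF v, THEN fitsA_M[rotated]]
    index_le_M(8)[OF vd, THEN fitsA_M[rotated]]
  have 1: "runs w inp (cSetR 11 (V 13) (Sum 12 (V 2) (Lt (Rd 0 (N 0)) (Sq sketch_value))))
     (W(13 := v), h, ot) (return_spmf (W(13 := v),
       put 11 v (\<Sum>r<K. of_bool (h 0 0 < (skv ?l v r h)\<^sup>2)) h, ot)) (17 + K * (47 + 45 * d))"
    by (rule runs_cong[OF runs_setR])
      (use W l v in \<open>simp_all add: put_def sketch_value_def skv_def sk_def cong: sum.cong_simp
         del: sum_of_bool_eq\<close>)
  have 2: "runs w inp (cSetR 11 (V 13) (OfW (N 0))) (W(13 := v), h, ot)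
     (return_spmf (W(13 := v), put 11 v 0 h, ot)) 9"
    by (rule runs_cong[OF runs_setR]) (use W l v in \<open>simp_all add: put_def\<close>)
  have 3: "runs w inp (cIfR (OfW (N 0)) (Rd 11 (Op WDiv (V 13) (N 2)))
        (cSetR 11 (V 13) (Sum 12 (V 2) (Lt (Rd 0 (N 0)) (Sq sketch_value))))
        (cSetR 11 (V 13) (OfW (N 0)))) (W(13 := v), h, ot)
     (return_spmf (W(13 := v), posH ?l (W 17) h, ot))
     (12 + (if 0 < h 11 (v div 2) then 17 + K * (47 + 45 * d) else 9))"
    by (rule runs_cong[OF runs_ifR[where T = "if 0 < h 11 (v div 2) then 17 + K * (47 + 45 * d) else 9"
          and D = "return_spmf (W(13 := v), posH ?l (W 17) h, ot)"]])
      (use W l v 1 2 in \<open>simp_all add: posH_def flip: v_def\<close>)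
  have Kd: "K \<le> K * d" "1 \<le> K * d" by (simp_all add: Suc_le_eq)
  have e: "17 + K * (47 + 45 * d) = 17 + 47 * K + 45 * (K * d)" by (simp add: algebra_simps)
  define Q where "Q = K * d"
  have "costW (Op WAdd (V 17) (N 1)) + 4 + (12 + (if 0 < h 11 (v div 2) then 17 + K * (47 + 45 * d) else 9))
     \<le> 30 + of_bool (0 < h 11 (v div 2)) * (130 * (K * d))"
    unfolding e using Kd unfolding Q_def[symmetric] by simp
  then show ?thesis unfolding check_node_def
    by (intro runs_cong[OF runs_let[where D = "return_spmf (W(13 := v), posH ?l (W 17) h, ot)" and
      T = "12 + (if 0 < h 11 (v div 2) then 17 + K * (47 + 45 * d) else 9)"]])
      (use W l v 3 in \<open>simp_all add: v_def mult.assoc\<close>)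
qed

definition leafH :: "nat \<Rightarrow> nat \<Rightarrow> heap \<Rightarrow> heap" where
  "leafH l i h = (if 0 < h 11 (n + i) + of_bool (h 0 0 < (h 10 (l * n + i))\<^sup>2) then syncH i h else h)"

lemma runs_check_leaf:
  assumes W: "params W" and l: "W 14 < L" and i: "W 10 < n"
  shows "runs w inp check_leaf (W, h, ot) (return_spmf (W, leafH (W 14) (W 10) h, ot))
     (40 + of_bool (0 < h 11 (n + W 10) + of_bool (h 0 0 < (h 10 (W 14 * n + W 10))\<^sup>2)) * (600 * X))"
proof -
  let ?c = "0 < h 11 (n + W 10) + of_bool (h 0 0 < (h 10 (W 14 * n + W 10))\<^sup>2)"
  have "runs w inp (if ?c then sync else cSkip) (W, h, ot) (return_spmf (W, leafH (W 14) (W 10) h, ot))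
      (if ?c then 600 * X else 1)"
    using runs_sync[OF W i] runs_skip by (simp add: leafH_def)
  then show ?thesis unfolding check_leaf_def
    by (intro runs_cong[OF runs_ifR[where T = "if ?c then 600 * X else 1"
          and D = "return_spmf (W, leafH (W 14) (W 10) h, ot)"]])
      (use W l i in \<open>simp_all split: if_splits\<close>)
qed

definition resetH :: "nat \<Rightarrow> heap \<Rightarrow> heap" where
  "resetH l h = fold (\<lambda>i. put 10 (l * n + i) 0) [0..<n]
     (fold (\<lambda>v. fold (\<lambda>r. put 8 (sk v r (d + l)) 0) [0..<K]) [0..<2 * n]
     (fold (\<lambda>j h. put 7 (l * d + j) (h 6 j) h) [0..<d] h))"

lemma runs_reset:
  assumes W: "params W" and l: "W 14 < L"
  shows "runs w inp reset (W, h, ot) (return_spmf (W, resetH (W 14) h, ot)) (200 * (n * K))"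
proof -
  let ?l = "W 14"
  have b1: "runs w inp (cSetR 7 (ix2 (V 14) (V 1) (V 11)) (Rd 6 (V 11))) (W(11 := j), h, ot)
     (return_spmf (W(11 := j), put 7 (?l * d + j) (h 6 j) h, ot)) 20" if "j < d" for j h
    by (rule runs_cong[OF runs_setR]) (use W l that in \<open>simp_all add: put_def\<close>)
  have b2: "runs w inp (cSetR 8 (cell (V 13) (V 12) (Op WAdd (V 1) (V 14))) (OfW (N 0)))
     (W(13 := v, 12 := r), h, ot) (return_spmf (W(13 := v, 12 := r), put 8 (sk v r (d + ?l)) 0 h, ot)) 24"
    if "v < 2 * n" "r < K" for v r h
    by (rule runs_cong[OF runs_setR]) (use W l that in \<open>simp_all add: put_def sk_def\<close>)
  have b3: "runs w inp (cSetR 10 (ix2 (V 14) (V 0) (V 10)) (OfW (N 0))) (W(10 := i), h, ot)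
     (return_spmf (W(10 := i), put 10 (?l * n + i) 0 h, ot)) 15" if "i < n" for i h
    by (rule runs_cong[OF runs_setR]) (use W l that in \<open>simp_all add: put_def\<close>)
  have s1: "runs w inp (cFor 11 (V 1) (cSetR 7 (ix2 (V 14) (V 1) (V 11)) (Rd 6 (V 11)))) (W, h, ot)
    (return_spmf (W, fold (\<lambda>j h. put 7 (?l * d + j) (h 6 j) h) [0..<d] h, ot)) (8 + d * 23)" for h
    by (rule runs_cong[OF runs_for_fold[where T = "\<lambda>_ _. 20" and n = d]], rule_tac [5] b1) (use W in simp_all)
  have s2': "runs w inp (cFor 12 (V 2) (cSetR 8 (cell (V 13) (V 12) (Op WAdd (V 1) (V 14))) (OfW (N 0))))
     (W(13 := v), h, ot) (return_spmf (W(13 := v), fold (\<lambda>r. put 8 (sk v r (d + ?l)) 0) [0..<K] h, ot)) (8 + K * 27)"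
    if "v < 2 * n" for v h
    by (rule runs_cong[OF runs_for_fold[where T = "\<lambda>_ _. 24" and n = K]], rule_tac [5] b2) (use W that in simp_all)
  have s2: "runs w inp (cFor 13 (V 7) (cFor 12 (V 2) (cSetR 8 (cell (V 13) (V 12) (Op WAdd (V 1) (V 14))) (OfW (N 0)))))
     (W, h, ot) (return_spmf (W, fold (\<lambda>v. fold (\<lambda>r. put 8 (sk v r (d + ?l)) 0) [0..<K]) [0..<2 * n] h, ot))
     (8 + 2 * n * (11 + K * 27))" for h
    by (rule runs_cong[OF runs_for_fold[where T = "\<lambda>_ _. 8 + K * 27" and n = "2 * n"]], rule_tac [5] s2') (use W in simp_all)
  have s3: "runs w inp (cFor 10 (V 0) (cSetR 10 (ix2 (V 14) (V 0) (V 10)) (OfW (N 0)))) (W, h, ot)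
    (return_spmf (W, fold (\<lambda>i. put 10 (?l * n + i) 0) [0..<n] h, ot)) (8 + n * 18)" for h
    by (rule runs_cong[OF runs_for_fold[where T = "\<lambda>_ _. 15" and n = n]], rule_tac [5] b3) (use W in simp_all)
  have nK: "n \<le> n * K" "Suc 0 \<le> n * K" "d \<le> n * K" using pos by (simp_all add: Suc_le_eq le_trans[of d n])
  have "2 * n * (11 + K * 27) = 22 * n + 54 * (n * K)" by (simp add: algebra_simps)
  then have "8 + d * 23 + (8 + 2 * n * (11 + K * 27) + (8 + n * 18)) \<le> 200 * (n * K)"
    using nK by linarith
  then show ?thesis unfolding reset_def resetH_def
    by (intro runs_cong[OF runs_seq_det[OF s1 runs_seq_det[OF s2 s3]] refl])
qed

definition nodesH :: "nat \<Rightarrow> heap \<Rightarrow> nat \<Rightarrow> heap" where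
  "nodesH l h m = fold (posH l) [0..<m] h"

definition leavesH :: "nat \<Rightarrow> heap \<Rightarrow> nat \<Rightarrow> heap" where
  "leavesH l h m = fold (leafH l) [0..<m] h"

definition checkH :: "nat \<Rightarrow> heap \<Rightarrow> heap" where
  "checkH l h = resetH l (leavesH l (nodesH l h (2 * n - 1)) n)"

definition tested :: "nat \<Rightarrow> heap \<Rightarrow> nat" where
  "tested l h = card {u. u < 2 * n - 1 \<and> 0 < nodesH l h u 11 (Suc u div 2)}"

definition synced :: "nat \<Rightarrow> heap \<Rightarrow> nat" where
  "synced l h = card {i. i < n \<and> 0 < leavesH l h i 11 (n + i) +
     of_bool (leavesH l h i 0 0 < (leavesH l h i 10 (l * n + i))\<^sup>2)}"

definition check_cost :: "nat \<Rightarrow> heap \<Rightarrow> nat" where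
  "check_cost l h = 500 * (n * K) + 130 * K * d * tested l h +
     600 * X * synced l (nodesH l h (2 * n - 1))"

lemma sum_of_bool_cost:
  "(\<Sum>u<m. a + of_bool (P u) * c + 3) = m * (a + 3) + c * card {u. u < m \<and> P u}"
proof -
  have "{..<m} \<inter> {u. P u} = {u. u < m \<and> P u}" by auto
  then have "card {u. u < m \<and> P u} = card ({..<m} \<inter> {u. P u})" by simp
  then show ?thesis by (simp add: sum.distrib algebra_simps)
qed

lemma runs_check:
  assumes W: "params W" and l: "W 14 < L"
  shows "runs w inp check (W, h, ot) (return_spmf (W, checkH (W 14) h, ot)) (check_cost (W 14) h)"
proof -
  let ?l = "W 14"
  have n1: "n + n - Suc 0 < 2 ^ w" "2 * n - Suc 0 < 2 ^ w" using size_less(5) by linarith+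
  have b1: "runs w inp check_node (W(17 := u), h, ot) (return_spmf (W(17 := u), posH ?l u h, ot))
     (30 + of_bool (0 < h 11 (Suc u div 2)) * (130 * K * d))" if "u < 2 * n - 1" for u h
    using runs_check_node[of "W(17 := u)" inp h ot] W l that n1 by simp
  have "runs w inp (cFor 17 (Op WSub (V 7) (N 1)) check_node) (W, h, ot)
     (return_spmf (W, fold (posH ?l) [0..<2 * n - 1] h, ot)) (costW (Op WSub (V 7) (N 1)) + 6 +
      (\<Sum>u<2 * n - 1. 30 + of_bool (0 < fold (posH ?l) [0..<u] h 11 (Suc u div 2)) * (130 * K * d) + 3))" for h
    by (rule runs_for_fold[where n = "2 * n - 1"], rule_tac [5] b1) (use W n1 in simp_all)
  note this[unfolded sum_of_bool_cost]
  then have s1: "runs w inp (cFor 17 (Op WSub (V 7) (N 1)) check_node) (W, h, ot)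
     (return_spmf (W, nodesH ?l h (2 * n - 1), ot)) (10 + (2 * n - 1) * 33 + 130 * K * d * tested ?l h)" for h
    by (rule runs_cong) (simp_all add: tested_def nodesH_def)
  have b2: "runs w inp check_leaf (W(10 := i), h, ot) (return_spmf (W(10 := i), leafH ?l i h, ot))
     (40 + of_bool (0 < h 11 (n + i) + of_bool (h 0 0 < (h 10 (?l * n + i))\<^sup>2)) * (600 * X))"
     if "i < n" for i h
    using runs_check_leaf[of "W(10 := i)" inp h ot] W l that by simp
  have "runs w inp (cFor 10 (V 0) check_leaf) (W, h, ot)
     (return_spmf (W, fold (leafH ?l) [0..<n] h, ot)) (costW (V 0) + 6 +
      (\<Sum>i<n. 40 + of_bool (0 < fold (leafH ?l) [0..<i] h 11 (n + i) + of_bool (fold (leafH ?l) [0..<i] h 0 0 <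
          (fold (leafH ?l) [0..<i] h 10 (?l * n + i))\<^sup>2)) * (600 * X) + 3))" for h
    by (rule runs_for_fold[where n = n], rule_tac [5] b2) (use W in simp_all)
  note this[unfolded sum_of_bool_cost]
  then have s2: "runs w inp (cFor 10 (V 0) check_leaf) (W, h, ot)
     (return_spmf (W, leavesH ?l h n, ot)) (8 + n * 43 + 600 * X * synced ?l h)" for h
    by (rule runs_cong) (simp_all add: synced_def leavesH_def)
  have nK: "n \<le> n * K" "1 \<le> n * K" by (simp_all add: Suc_le_eq)
  have "18 + (2 * n - 1) * 33 + n * 43 + 200 * (n * K) \<le> 500 * (n * K)" using nK by linarith
  then show ?thesis unfolding check_def checkH_def check_cost_def
    by (intro runs_cong[OF runs_seq_det[OF s1 runs_seq_det[OF s2 runs_reset[OF W l]]]]) simp_all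
qed

definition with_signs :: "heap \<Rightarrow> nat \<Rightarrow> (nat \<Rightarrow> real) \<Rightarrow> heap" where
  "with_signs h m f = h(9 := \<lambda>x. if x < m then f x else h 9 x)"

lemma Kn_less [simp]: "K * n < 2 ^ w" "L * n < 2 ^ w" "2 * n * K < 2 ^ w" "M < 2 ^ w"
  using le_M[THEN small(2)] small(2)[of M] by simp_all

lemma runs_draw_signs:
  assumes W: "params W"
  shows "runs w inp draw_signs (W, h, ot) (map_spmf (\<lambda>f. (W, with_signs h (K * n) f, ot)) (signs (K * n)))
     (11 + K * n * 34)"
proof -
  let ?D = "\<lambda>m. map_spmf (\<lambda>f. (W, with_signs h m f, ot)) (signs m)"
  let ?F = "\<lambda>m (W1, h1, ot1). map_spmf (\<lambda>b. (W1, put 9 m (1 - 2 * of_bool b) h1, ot1)) coin_spmf"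
  have body: "runs w inp (cBit 9 (V 17) ;; cSetR 9 (V 17) (Bop RSub (OfW (N 1)) (Bop RMul (OfW (N 2)) (Rd 9 (V 17)))))
     (W(17 := x), h1, ot1) (map_spmf (\<lambda>b. (W(17 := x), put 9 x (1 - 2 * of_bool b) h1, ot1)) coin_spmf) (11 + 20)"
    if x: "x < K * n" for x h1 ot1
  proof -
    have x': "x \<le> M" using x le_M(6) by simp
    note [simp] = small(2)[OF x'] fitsA_M[OF _ x']
    have b: "runs w inp (cBit 9 (V 17)) (W(17 := x), h1, ot1)
        (map_spmf (\<lambda>b. (W(17 := x), put 9 x (of_bool b) h1, ot1)) coin_spmf) 11"
      by (rule runs_cong[OF runs_bit]) (use W w2 in \<open>simp_all add: put_def\<close>)
    have c: "runs w inp (cSetR 9 (V 17) (Bop RSub (OfW (N 1)) (Bop RMul (OfW (N 2)) (Rd 9 (V 17)))))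
        (W(17 := x), h2, ot1) (return_spmf (W(17 := x), put 9 x (1 - 2 * h2 9 x) h2, ot1)) 20" for h2
      by (rule runs_cong[OF runs_setR]) (use W in \<open>simp_all add: put_def\<close>)
    have "runs w inp (cBit 9 (V 17) ;; cSetR 9 (V 17) (Bop RSub (OfW (N 1)) (Bop RMul (OfW (N 2)) (Rd 9 (V 17)))))
       (W(17 := x), h1, ot1) (bind_spmf (map_spmf (\<lambda>b. (W(17 := x), put 9 x (of_bool b) h1, ot1)) coin_spmf)
          (\<lambda>(W1, h1, ot1). return_spmf (W1, put 9 x (1 - 2 * h1 9 x) h1, ot1))) (11 + 20)"
      by (rule runs_seq[OF b]) (use c in auto)
    then show ?thesis
      by (rule runs_cong) (simp_all add: map_spmf_conv_bind_spmf put_def)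
  qed
  have "runs w inp draw_signs (W, h, ot) (map_spmf (updx 17 (W 17)) (?D (K * n)))
     (costW (Op WMul (V 2) (V 0)) + 6 + (\<Sum>x<K * n. (11 + 20) + 3))"
    unfolding draw_signs_def
  proof (rule runs_for[where D = ?D and F = ?F])
    show "?D 0 = return_spmf (W, h, ot)" by (simp add: signs_def with_signs_def)
    show "?D (Suc m) = ?D m \<bind> ?F m" for m
      by (simp add: signs_Suc map_spmf_bind_spmf bind_map_spmf o_def spmf.map_comp)
         (intro bind_spmf_cong map_spmf_cong refl, auto simp: with_signs_def put_def fun_eq_iff less_Suc_eq)
    fix m st assume "m < K * n" "st \<in> set_spmf (?D m)"
    then show "runs w inp (cBit 9 (V 17) ;; cSetR 9 (V 17) (Bop RSub (OfW (N 1)) (Bop RMul (OfW (N 2)) (Rd 9 (V 17)))))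
     (updx 17 m st) (map_spmf (updx 17 m) (?F m st)) (11 + 20)"
      using body[of m] by (auto simp: spmf.map_comp o_def)
  qed (use W in auto)
  then show ?thesis by (rule runs_cong) (simp_all add: spmf.map_comp o_def)
qed

definition clearH :: "heap \<Rightarrow> heap" where
  "clearH h = fold (\<lambda>i h. put 5 i 0 (put 4 i (h 3 i + h 2 i * (\<Sum>j<d. h 1 (i * d + j) * h 6 j)) h)) [0..<n]
     (fold (\<lambda>l. fold (\<lambda>j h. put 7 (l * d + j) (h 6 j) h) [0..<d]) [0..<L]
     (fold (\<lambda>x. put 10 x 0) [0..<L * n] (fold (\<lambda>x. put 8 x 0) [0..<M] h)))"

definition reweight_allH :: "heap \<Rightarrow> heap" where
  "reweight_allH = fold rwH [0..<n]"

lemma runs_rebuild: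
  assumes W: "params W"
  shows "runs w inp rebuild (W, h, ot)
    (map_spmf (\<lambda>f. (W, reweight_allH (with_signs (clearH h) (K * n) f), ot)) (signs (K * n))) (2000 * (n * X))"
proof -
  have zero: "runs w inp (cSetR a (V 17) (OfW (N 0))) (W(17 := x), h, ot) (return_spmf (W(17 := x), put a x 0 h, ot)) 9"
    if "x < M" "a < 15" for a x h
  proof -
    have x': "x \<le> M" using that by simp
    note [simp] = small(2)[OF x'] fitsA_M[OF _ x']
    show ?thesis by (rule runs_cong[OF runs_setR]) (use W that in \<open>simp_all add: put_def\<close>)
  qed
  have Meq: "2 * n * K * D1 = M" by (simp add: M_def)
  have s1: "runs w inp (cFor 17 (Op WMul (Op WMul (V 7) (V 2)) (V 4)) (cSetR 8 (V 17) (OfW (N 0))))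
     (W, h, ot) (return_spmf (W, fold (\<lambda>x. put 8 x 0) [0..<M] h, ot)) (14 + M * 12)" for h
    by (rule runs_cong[OF runs_for_fold[where n = M and T = "\<lambda>_ _. 9"]], rule_tac [5] zero)
      (use W Meq Kn_less(3) in simp_all)
  have Ln: "x < L * n \<Longrightarrow> x < M" for x using le_M(7) by simp
  have s2: "runs w inp (cFor 17 (Op WMul (V 3) (V 0)) (cSetR 10 (V 17) (OfW (N 0))))
     (W, h, ot) (return_spmf (W, fold (\<lambda>x. put 10 x 0) [0..<L * n] h, ot)) (11 + L * n * 12)" for h
    by (rule runs_cong[OF runs_for_fold[where n = "L * n" and T = "\<lambda>_ _. 9"]], rule_tac [5] zero)
      (use W Ln in simp_all)
  have b3: "runs w inp (cSetR 7 (ix2 (V 14) (V 1) (V 11)) (Rd 6 (V 11))) (W(14 := l, 11 := j), h, ot)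
     (return_spmf (W(14 := l, 11 := j), put 7 (l * d + j) (h 6 j) h, ot)) 20" if "l < L" "j < d" for l j h
    by (rule runs_cong[OF runs_setR]) (use W that in \<open>simp_all add: put_def\<close>)
  have s3': "runs w inp (cFor 11 (V 1) (cSetR 7 (ix2 (V 14) (V 1) (V 11)) (Rd 6 (V 11)))) (W(14 := l), h, ot)
    (return_spmf (W(14 := l), fold (\<lambda>j h. put 7 (l * d + j) (h 6 j) h) [0..<d] h, ot)) (8 + d * 23)" if "l < L" for l h
    by (rule runs_cong[OF runs_for_fold[where T = "\<lambda>_ _. 20" and n = d]], rule_tac [5] b3) (use W that in simp_all)
  have s3: "runs w inp (cFor 14 (V 3) (cFor 11 (V 1) (cSetR 7 (ix2 (V 14) (V 1) (V 11)) (Rd 6 (V 11))))) (W, h, ot)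
    (return_spmf (W, fold (\<lambda>l. fold (\<lambda>j h. put 7 (l * d + j) (h 6 j) h) [0..<d]) [0..<L] h, ot)) (8 + L * (11 + d * 23))" for h
    by (rule runs_cong[OF runs_for_fold[where T = "\<lambda>_ _. 8 + d * 23" and n = L]], rule_tac [5] s3') (use W in simp_all)
  have b4: "runs w inp (cSetR 4 (V 10) exact_value) (W(10 := i), h, ot) (return_spmf (W(10 := i),
      put 4 i (h 3 i + h 2 i * (\<Sum>j<d. h 1 (i * d + j) * h 6 j)) h, ot)) (33 + 25 * d)" if "i < n" for i h
    by (rule runs_cong[OF runs_setR])
      (use W that in \<open>simp_all add: put_def exact_value_def row_dot_def\<close>)
  have b4': "runs w inp (cSetR 5 (V 10) (OfW (N 0))) (W(10 := i), h, ot) (return_spmf (W(10 := i), put 5 i 0 h, ot)) 9"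
    if "i < n" for i h
    by (rule runs_cong[OF runs_setR]) (use W that in \<open>simp_all add: put_def\<close>)
  have s4: "runs w inp (cFor 10 (V 0) (cSetR 4 (V 10) exact_value ;; cSetR 5 (V 10) (OfW (N 0)))) (W, h, ot)
    (return_spmf (W, fold (\<lambda>i h. put 5 i 0 (put 4 i (h 3 i + h 2 i * (\<Sum>j<d. h 1 (i * d + j) * h 6 j)) h)) [0..<n] h, ot))
    (8 + n * (45 + 25 * d))" for h
    by (rule runs_cong[OF runs_for_fold[where T = "\<lambda>_ _. (33 + 25 * d) + 9" and n = n]],
        rule_tac [5] runs_seq_det[OF b4 b4']) (use W in simp_all)
  have b6: "runs w inp reweight (W(10 := i), h, ot) (return_spmf (W(10 := i), rwH i h, ot)) (500 * X)" if "i < n" for i h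
    using runs_reweight[of "W(10 := i)"] W that by simp
  have s6: "runs w inp (cFor 10 (V 0) reweight) (W, h, ot) (return_spmf (W, reweight_allH h, ot)) (8 + n * (500 * X + 3))" for h
    unfolding reweight_allH_def
    by (rule runs_cong[OF runs_for_fold[where T = "\<lambda>_ _. 500 * X" and n = n]], rule_tac [5] b6) (use W in simp_all)
  have s56: "runs w inp (draw_signs ;; cFor 10 (V 0) reweight) (W, h, ot)
     (map_spmf (\<lambda>f. (W, reweight_allH (with_signs h (K * n) f), ot)) (signs (K * n)))
     ((11 + K * n * 34) + (8 + n * (500 * X + 3)))" for h
  proof -
    have "runs w inp (draw_signs ;; cFor 10 (V 0) reweight) (W, h, ot)
       (bind_spmf (map_spmf (\<lambda>f. (W, with_signs h (K * n) f, ot)) (signs (K * n)))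
         (\<lambda>(W1, h1, ot1). return_spmf (W1, reweight_allH h1, ot1)))
       ((11 + K * n * 34) + (8 + n * (500 * X + 3)))"
      by (rule runs_seq[OF runs_draw_signs[OF W]]) (use s6 in auto)
    then show ?thesis by (rule runs_cong) (simp_all add: map_spmf_conv_bind_spmf)
  qed
  have "1 \<le> n * X" using le_DK(4) by (simp add: Suc_le_eq)
  moreover have "n * d \<le> n * X" "n * L \<le> n * X" "n * 1 \<le> n * X" by (intro mult_left_mono le_DK; simp)+
  moreover have "M \<le> 2 * (n * X)" and "K * n \<le> n * X"
  proof -
    have "K * D1 \<le> X" by (simp add: X_def)
    then have "2 * n * (K * D1) \<le> 2 * n * X" by (intro mult_left_mono) simp_all
    then show "M \<le> 2 * (n * X)" by (simp add: M_def mult.assoc)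
    have "K * 1 \<le> K * D1" by (rule mult_le_mono2) (use pos in linarith)
    then have "K \<le> X" using \<open>K * D1 \<le> X\<close> by linarith
    then show "K * n \<le> n * X" using mult_le_mono2[of K X n] by (simp add: mult.commute)
  qed
  moreover have "L * (11 + d * 23) = 11 * L + 23 * (L * d)" "n * (45 + 25 * d) = 45 * n + 25 * (n * d)"
    "n * (500 * X + 3) = 500 * (n * X) + 3 * n" "L * n * 12 = 12 * (n * L)" by (simp_all add: algebra_simps)
  moreover have "L * d \<le> L * n" using pos by (intro mult_left_mono) simp_all
  moreover have "L \<le> n * L" by simp
  ultimately have "(14 + M * 12) + ((11 + L * n * 12) + ((8 + L * (11 + d * 23)) + ((8 + n * (45 + 25 * d)) +
     ((11 + K * n * 34) + (8 + n * (500 * X + 3)))))) \<le> 2000 * (n * X)" by (simp only: mult.commute[of n L])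
  then show ?thesis unfolding rebuild_def
    by (intro runs_cong[OF runs_seq_det[OF s1 runs_seq_det[OF s2 runs_seq_det[OF s3 runs_seq_det[OF s4 s56]]]]])
      (simp_all add: clearH_def)
qed

definition absorbH :: "(nat \<Rightarrow> real) \<Rightarrow> heap \<Rightarrow> heap" where
  "absorbH u h = fold (\<lambda>l. fold (\<lambda>i h. put 10 (l * n + i) (h 10 (l * n + i) + u (d + i) / h 4 i) h) [0..<n]) [0..<L]
     (fold (\<lambda>i h. put 3 i (h 3 i + u (d + i)) h) [0..<n] (fold (\<lambda>j h. put 6 j (h 6 j + u j) h) [0..<d] h))"

lemma runs_absorb:
  assumes W: "params W"
  shows "runs w inp absorb (W, h, ot) (return_spmf (W, absorbH (snd inp) h, ot)) (200 * (n * L))"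
proof -
  let ?u = "snd inp"
  have di [simp]: "d + i < 2 ^ w" if "i < n" for i
    using index_le_M(5)[OF that] pos by (intro small(2)) linarith
  have b1: "runs w inp (cSetR 6 (V 11) (Bop RAdd (Rd 6 (V 11)) (InR (V 11)))) (W(11 := j), h, ot)
      (return_spmf (W(11 := j), put 6 j (h 6 j + ?u j) h, ot)) 18" if "j < d" for j h
    by (rule runs_cong[OF runs_setR]) (use W that in \<open>simp_all add: put_def\<close>)
  have s1: "runs w inp (cFor 11 (V 1) (cSetR 6 (V 11) (Bop RAdd (Rd 6 (V 11)) (InR (V 11))))) (W, h, ot)
      (return_spmf (W, fold (\<lambda>j h. put 6 j (h 6 j + ?u j) h) [0..<d] h, ot)) (8 + d * 21)" for h
    by (rule runs_cong[OF runs_for_fold[where T = "\<lambda>_ _. 18" and n = d]], rule_tac [5] b1) (use W in simp_all)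
  have b2: "runs w inp (cSetR 3 (V 10) (Bop RAdd (Rd 3 (V 10)) (InR (Op WAdd (V 1) (V 10))))) (W(10 := i), h, ot)
      (return_spmf (W(10 := i), put 3 i (h 3 i + ?u (d + i)) h, ot)) 21" if "i < n" for i h
    by (rule runs_cong[OF runs_setR]) (use W that in \<open>simp_all add: put_def\<close>)
  have s2: "runs w inp (cFor 10 (V 0) (cSetR 3 (V 10) (Bop RAdd (Rd 3 (V 10)) (InR (Op WAdd (V 1) (V 10)))))) (W, h, ot)
      (return_spmf (W, fold (\<lambda>i h. put 3 i (h 3 i + ?u (d + i)) h) [0..<n] h, ot)) (8 + n * 24)" for h
    by (rule runs_cong[OF runs_for_fold[where T = "\<lambda>_ _. 21" and n = n]], rule_tac [5] b2) (use W in simp_all)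
  have b3: "runs w inp (cSetR 10 (ix2 (V 14) (V 0) (V 10)) (Bop RAdd (Rd 10 (ix2 (V 14) (V 0) (V 10)))
          (Bop RDiv (InR (Op WAdd (V 1) (V 10))) (Rd 4 (V 10))))) (W(14 := l, 10 := i), h, ot)
      (return_spmf (W(14 := l, 10 := i), put 10 (l * n + i) (h 10 (l * n + i) + ?u (d + i) / h 4 i) h, ot)) 41"
    if "l < L" "i < n" for l i h
    by (rule runs_cong[OF runs_setR]) (use W that in \<open>simp_all add: put_def\<close>)
  have s3': "runs w inp (cFor 10 (V 0) (cSetR 10 (ix2 (V 14) (V 0) (V 10)) (Bop RAdd (Rd 10 (ix2 (V 14) (V 0) (V 10)))
          (Bop RDiv (InR (Op WAdd (V 1) (V 10))) (Rd 4 (V 10)))))) (W(14 := l), h, ot)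
      (return_spmf (W(14 := l), fold (\<lambda>i h. put 10 (l * n + i) (h 10 (l * n + i) + ?u (d + i) / h 4 i) h) [0..<n] h, ot)) (8 + n * 44)"
    if "l < L" for l h
    by (rule runs_cong[OF runs_for_fold[where T = "\<lambda>_ _. 41" and n = n]], rule_tac [5] b3) (use W that in simp_all)
  have s3: "runs w inp (cFor 14 (V 3) (cFor 10 (V 0) (cSetR 10 (ix2 (V 14) (V 0) (V 10)) (Bop RAdd (Rd 10 (ix2 (V 14) (V 0) (V 10)))
          (Bop RDiv (InR (Op WAdd (V 1) (V 10))) (Rd 4 (V 10))))))) (W, h, ot)
      (return_spmf (W, fold (\<lambda>l. fold (\<lambda>i h. put 10 (l * n + i) (h 10 (l * n + i) + ?u (d + i) / h 4 i) h) [0..<n]) [0..<L] h, ot))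
      (8 + L * (11 + n * 44))" for h
    by (rule runs_cong[OF runs_for_fold[where T = "\<lambda>_ _. 8 + n * 44" and n = L]], rule_tac [5] s3') (use W in simp_all)
  have nL: "n \<le> n * L" "1 \<le> n * L" "L \<le> n * L" by (simp_all add: Suc_le_eq)
  have "L * (11 + n * 44) = 11 * L + 44 * (n * L)" by (simp add: algebra_simps)
  then have "(8 + d * 21) + ((8 + n * 24) + (8 + L * (11 + n * 44))) \<le> 200 * (n * L)"
    using nL pos(2) by linarith
  then show ?thesis unfolding absorb_def absorbH_def
    by (intro runs_cong[OF runs_seq_det[OF s1 runs_seq_det[OF s2 s3]] refl])
qed

definition levelH :: "nat \<Rightarrow> nat \<Rightarrow> heap \<Rightarrow> heap" where
  "levelH t l h = (if t mod 2 ^ l = 0 then checkH l h else h)"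

definition levelsH :: "nat \<Rightarrow> heap \<Rightarrow> nat \<Rightarrow> heap" where
  "levelsH t h m = fold (levelH t) [0..<m] h"

definition levels_cost :: "nat \<Rightarrow> heap \<Rightarrow> nat" where
  "levels_cost t h = (\<Sum>l<L. of_bool (t mod 2 ^ l = 0) * check_cost l (levelsH t h l))"

lemma runs_check_levels:
  assumes W: "params W"
  shows "runs w inp check_levels (W, h, ot) (return_spmf (W, levelsH (W 5) h L, ot)) (40 * L + levels_cost (W 5) h)"
proof -
  let ?t = "W 5"
  have p: "(2::nat) ^ l < 2 ^ w" if "l \<le> L" for l
    using Rw R_L power_increasing[OF that, of "2::nat"] by simp
  have b: "runs w inp (cIfW (Op WMod (V 5) (V 15)) (N 1) check cSkip) (W(15 := 2 ^ l, 14 := l), h, ot)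
     (return_spmf (W(15 := 2 ^ l, 14 := l), levelH ?t l h, ot)) (7 + (1 + of_bool (?t mod 2 ^ l = 0) * check_cost l h))"
    if "l < L" for l h
  proof -
    have "runs w inp (if ?t mod 2 ^ l = 0 then check else cSkip) (W(15 := 2 ^ l, 14 := l), h, ot)
      (return_spmf (W(15 := 2 ^ l, 14 := l), levelH ?t l h, ot)) (1 + of_bool (?t mod 2 ^ l = 0) * check_cost l h)"
      using runs_mono[OF runs_check[of "W(15 := 2 ^ l, 14 := l)" inp h ot], of "Suc (check_cost l h)"]
        runs_skip W that p[of l] by (simp add: levelH_def)
    moreover have "?t mod 2 ^ l < 2 ^ w" using le_less_trans[OF mod_less_eq_dividend] W by simp
    ultimately show ?thesis
      by (intro runs_cong[OF runs_ifW[where T = "1 + of_bool (?t mod 2 ^ l = 0) * check_cost l h" and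
           D = "return_spmf (W(15 := 2 ^ l, 14 := l), levelH ?t l h, ot)"]])
         (use W that p[of l] in \<open>simp_all split: if_splits\<close>)
  qed
  have b': "runs w inp (cSetW 15 (Op WMul (V 15) (N 2))) (W(15 := 2 ^ l, 14 := l), h, ot)
     (return_spmf (W(15 := 2 ^ Suc l, 14 := l), h, ot)) 6" if "l < L" for l h
    by (rule runs_cong[OF runs_setW]) (use W that p[of "Suc l"] p[of l] in \<open>simp_all add: mult.commute fun_upd_twist\<close>)
  have "runs w inp (cFor 14 (V 3) (cIfW (Op WMod (V 5) (V 15)) (N 1) check cSkip ;; cSetW 15 (Op WMul (V 15) (N 2))))
     (W(15 := 1), h, ot) (return_spmf (updx 14 ((W(15 := 1)) 14) (W(15 := 2 ^ L), levelsH ?t h L, ot)))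
     (costW (V 3) + 6 + (\<Sum>l<L. (7 + (1 + of_bool (?t mod 2 ^ l = 0) * check_cost l (levelsH ?t h l)) + 6) + 3))"
  proof (rule runs_for_det[where S = "\<lambda>l. (W(15 := 2 ^ l), levelsH ?t h l, ot)"])
    fix l assume l: "l < L"
    show "runs w inp (cIfW (Op WMod (V 5) (V 15)) (N 1) check cSkip ;; cSetW 15 (Op WMul (V 15) (N 2)))
      (updx 14 l (W(15 := 2 ^ l), levelsH ?t h l, ot))
      (return_spmf (updx 14 l (W(15 := 2 ^ Suc l), levelsH ?t h (Suc l), ot)))
      (7 + (1 + of_bool (?t mod 2 ^ l = 0) * check_cost l (levelsH ?t h l)) + 6)"
      using runs_seq_det[OF b b', OF l l, of "levelsH ?t h l"] by (simp add: levelsH_def)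
  qed (use W in \<open>simp_all add: levelsH_def\<close>)
  moreover have "(\<Sum>l<L. (7 + (1 + of_bool (?t mod 2 ^ l = 0) * check_cost l (levelsH ?t h l)) + 6) + 3)
      = 17 * L + levels_cost ?t h"
    unfolding levels_cost_def by (simp add: sum.distrib del: sum_of_bool_mult_eq)
  ultimately have "runs w inp (cFor 14 (V 3) (cIfW (Op WMod (V 5) (V 15)) (N 1) check cSkip ;; cSetW 15 (Op WMul (V 15) (N 2))))
     (W(15 := 1), h, ot) (return_spmf (W(15 := 2 ^ L, 14 := W 14), levelsH ?t h L, ot))
     (8 + (17 * L + levels_cost ?t h))" by (simp add: mult.commute)
  then have "runs w inp check_levels (W, h, ot) (map_spmf (updx 15 (W 15)) (return_spmf (W(15 := 2 ^ L, 14 := W 14), levelsH ?t h L, ot)))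
     (costW (N 1) + 4 + (8 + (17 * L + levels_cost ?t h)))" unfolding check_levels_def
    by (intro runs_let) (use W in simp_all)
  then show ?thesis
    by (rule runs_cong) (simp_all add: fun_upd_twist, use pos(4) in linarith)
qed

definition reportH :: "heap \<Rightarrow> (nat \<Rightarrow> real) \<Rightarrow> nat \<Rightarrow> real" where
  "reportH h ot = (\<lambda>x. if x < n then h 4 x else ot x)"

lemma runs_report:
  assumes W: "params W"
  shows "runs w inp (cFor 10 (V 0) (cOut (V 10) (Rd 4 (V 10)))) (W, h, ot) (return_spmf (W, h, reportH h ot)) (8 + n * 13)"
proof -
  have "runs w inp (cFor 10 (V 0) (cOut (V 10) (Rd 4 (V 10)))) (W, h, ot)
    (return_spmf (updx 10 (W 10) (W, h, \<lambda>x. if x < n then h 4 x else ot x))) (costW (V 0) + 6 + (\<Sum>i<n. 10 + 3))"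
  proof (rule runs_for_det[where S = "\<lambda>m. (W, h, \<lambda>x. if x < m then h 4 x else ot x)"])
    fix i assume "i < n"
    then show "runs w inp (cOut (V 10) (Rd 4 (V 10))) (updx 10 i (W, h, \<lambda>x. if x < i then h 4 x else ot x))
      (return_spmf (updx 10 i (W, h, \<lambda>x. if x < Suc i then h 4 x else ot x))) 10"
      unfolding updx_simp
      by (intro runs_cong[OF runs_out]) (use W in \<open>auto simp: fun_eq_iff less_Suc_eq\<close>)
  qed (use W in simp_all)
  then show ?thesis by (rule runs_cong) (simp_all add: reportH_def)
qed

lemma runs_query:
  assumes W: "params W" and t: "W 5 < R"
  shows "Suc (W 5) < R \<Longrightarrow> runs w inp query_cmd (W, h, ot)
      (return_spmf (W(5 := Suc (W 5)), levelsH (Suc (W 5)) (absorbH (snd inp) h) L,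
         reportH (levelsH (Suc (W 5)) (absorbH (snd inp) h) L) ot))
      (300 * (n * L) + levels_cost (Suc (W 5)) (absorbH (snd inp) h))" (is "_ \<Longrightarrow> ?A")
    and "\<not> Suc (W 5) < R \<Longrightarrow> runs w inp query_cmd (W, h, ot)
      (map_spmf (\<lambda>f. let h' = reweight_allH (with_signs (clearH (absorbH (snd inp) h)) (K * n) f) in
         (W(5 := 0), h', reportH h' ot)) (signs (K * n))) (300 * (n * L) + 2000 * (n * X))" (is "_ \<Longrightarrow> ?B")
proof -
  let ?W = "W(5 := Suc (W 5))" and ?h = "absorbH (snd inp) h"
  have t': "Suc (W 5) < 2 ^ w" using t Rw by linarith
  have pu: "params (W(5 := i))" if "i < 2 ^ w" for i
    using W that unfolding params_def by (simp del: paramsD)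
  have P: "params ?W" by (rule pu[OF t'])
  have s: "runs w inp (cSetW 5 (Op WAdd (V 5) (N 1))) (W, h, ot) (return_spmf (?W, h, ot)) 6" for h
    by (rule runs_cong[OF runs_setW]) (use W t' in simp_all)
  have nL: "n \<le> n * L" "1 \<le> n * L" "L \<le> n * L" by (simp_all add: Suc_le_eq)
  {
    assume less: "Suc (W 5) < R"
    have "runs w inp (cIfW (V 5) (V 6) check_levels (rebuild ;; cSetW 5 (N 0))) (?W, ?h, ot)
       (return_spmf (?W, levelsH (Suc (W 5)) ?h L, ot))
       (costW (V 5) + costW (V 6) + 1 + (40 * L + levels_cost (Suc (W 5)) ?h))"
      by (rule runs_ifW) (use less W t' runs_check_levels[OF P, of inp ?h ot] in simp_all)
    from runs_seq_det[OF runs_absorb[OF W] runs_seq_det[OF s runs_seq_det[OF this runs_report[OF P]]]]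
    show ?A unfolding query_cmd_def
      by (rule runs_mono) (unfold costW.simps, use nL in linarith)
  next
    assume nless: "\<not> Suc (W 5) < R"
    have s0: "runs w inp (cSetW 5 (N 0)) (?W, h, ot) (return_spmf (W(5 := 0), h, ot)) 3" for h
      by (rule runs_cong[OF runs_setW]) simp_all
    have "runs w inp (rebuild ;; cSetW 5 (N 0)) (?W, ?h, ot)
       (map_spmf (\<lambda>f. (W(5 := 0), reweight_allH (with_signs (clearH ?h) (K * n) f), ot)) (signs (K * n)))
       (2000 * (n * X) + 3)"
    proof -
      have "runs w inp (rebuild ;; cSetW 5 (N 0)) (?W, ?h, ot)
         (bind_spmf (map_spmf (\<lambda>f. (?W, reweight_allH (with_signs (clearH ?h) (K * n) f), ot)) (signs (K * n)))
           (\<lambda>(W1, h1, ot1). return_spmf (W(5 := 0), h1, ot1))) (2000 * (n * X) + 3)"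
        by (rule runs_seq[OF runs_rebuild[OF P]]) (use s0 in auto)
      then show ?thesis by (rule runs_cong) (simp_all add: map_spmf_conv_bind_spmf)
    qed
    then have i: "runs w inp (cIfW (V 5) (V 6) check_levels (rebuild ;; cSetW 5 (N 0))) (?W, ?h, ot)
       (map_spmf (\<lambda>f. (W(5 := 0), reweight_allH (with_signs (clearH ?h) (K * n) f), ot)) (signs (K * n)))
       (costW (V 5) + costW (V 6) + 1 + (2000 * (n * X) + 3))"
      by (intro runs_ifW) (use nless W t' in simp_all)
    have r: "runs w inp (cIfW (V 5) (V 6) check_levels (rebuild ;; cSetW 5 (N 0)) ;; cFor 10 (V 0) (cOut (V 10) (Rd 4 (V 10)))) (?W, ?h, ot)
       (map_spmf (\<lambda>f. let h' = reweight_allH (with_signs (clearH ?h) (K * n) f) in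
         (W(5 := 0), h', reportH h' ot)) (signs (K * n)))
       (costW (V 5) + costW (V 6) + 1 + (2000 * (n * X) + 3) + (8 + n * 13))"
    proof -
      have "runs w inp (cIfW (V 5) (V 6) check_levels (rebuild ;; cSetW 5 (N 0)) ;; cFor 10 (V 0) (cOut (V 10) (Rd 4 (V 10)))) (?W, ?h, ot)
         (bind_spmf (map_spmf (\<lambda>f. (W(5 := 0), reweight_allH (with_signs (clearH ?h) (K * n) f), ot)) (signs (K * n)))
           (\<lambda>(W1, h1, ot1). return_spmf (W1, h1, reportH h1 ot1)))
         (costW (V 5) + costW (V 6) + 1 + (2000 * (n * X) + 3) + (8 + n * 13))"
      proof (rule runs_seq[OF i])
        have p0: "params (W(5 := 0))" by (rule pu) simp
        fix st1 assume "st1 \<in> set_spmf (map_spmf (\<lambda>f. (W(5 := 0),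
            reweight_allH (with_signs (clearH ?h) (K * n) f), ot)) (signs (K * n)))"
        then obtain h1 where "st1 = (W(5 := 0), h1, ot)" by auto
        then show "runs w inp (cFor 10 (V 0) (cOut (V 10) (Rd 4 (V 10)))) st1
           ((\<lambda>(W1, h1, ot1). return_spmf (W1, h1, reportH h1 ot1)) st1) (8 + n * 13)"
          using runs_report[OF p0] by simp
      qed
      then show ?thesis by (rule runs_cong) (simp_all add: map_spmf_conv_bind_spmf Let_def)
    qed
    from runs_seq_det[OF runs_absorb[OF W] runs_seq_det[OF s r]]
    show ?B unfolding query_cmd_def
      by (rule runs_mono) (unfold costW.simps, use nL in linarith)
  }
qed

definition scaleH :: "nat \<Rightarrow> real \<Rightarrow> heap \<Rightarrow> heap" where
  "scaleH i u h = rwH i (put 2 i u (put 3 i (h 3 i + (h 2 i - u) * (\<Sum>j<d. h 1 (i * d + j) * h 6 j)) h))"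

lemma runs_scale:
  assumes W: "params W" and i: "fst inp 0 < n"
  shows "runs w inp scale_cmd (W, h, ot) (return_spmf (W, scaleH (fst inp 0) (snd inp 0) h, ot)) (700 * X)"
proof -
  let ?i = "fst inp 0"
  have P: "params (W(10 := ?i))" using W i by simp
  have s1: "runs w inp (cSetR 3 (V 10) (Bop RAdd (Rd 3 (V 10)) (Bop RMul (Bop RSub (Rd 2 (V 10)) (InR (N 0))) row_dot)))
     (W(10 := ?i), h, ot) (return_spmf (W(10 := ?i),
        put 3 ?i (h 3 ?i + (h 2 ?i - snd inp 0) * (\<Sum>j<d. h 1 (?i * d + j) * h 6 j)) h, ot)) (36 + 25 * d)"
    by (rule runs_cong[OF runs_setR]) (use W i in \<open>simp_all add: put_def row_dot_def\<close>)
  have s2: "runs w inp (cSetR 2 (V 10) (InR (N 0))) (W(10 := ?i), h, ot)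
     (return_spmf (W(10 := ?i), put 2 ?i (snd inp 0) h, ot)) 9" for h
    by (rule runs_cong[OF runs_setR]) (use W i in \<open>simp_all add: put_def\<close>)
  have s3: "runs w inp reweight (W(10 := ?i), h, ot) (return_spmf (W(10 := ?i), rwH ?i h, ot)) (500 * X)" for h
    using runs_reweight[OF P] i by simp
  have "runs w inp scale_cmd (W, h, ot) (map_spmf (updx 10 (W 10)) (return_spmf (W(10 := ?i), scaleH ?i (snd inp 0) h, ot)))
     (costW (InW (N 0)) + 4 + ((36 + 25 * d) + (9 + 500 * X)))"
    unfolding scale_cmd_def scaleH_def
    by (rule runs_let) (use W i runs_seq_det[OF s1 runs_seq_det[OF s2 s3]] in simp_all)
  then show ?thesis by (rule runs_cong) (use le_DK in simp_all)
qed

lemma runs_exact: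
  assumes W: "params W" and i: "fst inp 0 < n"
  shows "runs w inp exact_cmd (W, h, ot) (return_spmf (W, h, ot(0 := h 3 (fst inp 0) + h 2 (fst inp 0) *
     (\<Sum>j<d. h 1 (fst inp 0 * d + j) * h 6 j)))) (100 * d)"
proof -
  let ?i = "fst inp 0"
  have s: "runs w inp (cOut (N 0) exact_value) (W(10 := ?i), h, ot) (return_spmf (W(10 := ?i), h, ot(0 := h 3 ?i + h 2 ?i *
     (\<Sum>j<d. h 1 (?i * d + j) * h 6 j)))) (28 + 25 * d)"
    by (rule runs_cong[OF runs_out]) (use W i in \<open>simp_all add: exact_value_def row_dot_def\<close>)
  have "runs w inp exact_cmd (W, h, ot) (map_spmf (updx 10 (W 10)) (return_spmf (W(10 := ?i), h, ot(0 := h 3 ?i + h 2 ?i *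
     (\<Sum>j<d. h 1 (?i * d + j) * h 6 j))))) (costW (InW (N 0)) + 4 + (28 + 25 * d))"
    unfolding exact_cmd_def by (rule runs_let) (use W i s in simp_all)
  then show ?thesis by (rule runs_cong) (simp_all, use pos(1) in linarith)
qed

end

context sizes
begin

definition init_rowH :: "(nat \<Rightarrow> real) \<Rightarrow> nat \<Rightarrow> heap \<Rightarrow> heap" where
  "init_rowH u i h = put 5 i (u (1 + i) / u (1 + n + i)) (put 4 i (u (1 + n + i))
     (put 3 i (u (1 + n + i)) (put 2 i (u (1 + i)) h)))"

definition init_rowsH :: "(nat \<Rightarrow> real) \<Rightarrow> heap \<Rightarrow> heap" where
  "init_rowsH u h = fold (init_rowH u) [0..<n] (put 11 0 1 (put 0 0 ((u 0 / (8 * real L))\<^sup>2) h))"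

definition init_entryH :: "input \<Rightarrow> nat \<Rightarrow> heap \<Rightarrow> heap" where
  "init_entryH inp e h = (let i = fst inp (2 * e + 3); c = fst inp (2 * e + 4); x = snd inp (2 * n + 1 + e)
     in addH i c (put 0 2 (h 5 i * x) (put 1 (i * d + c) x h)))"

lemma upd_less: "\<forall>x. W x < m \<Longrightarrow> i < m \<Longrightarrow> \<forall>x. (W(a := i)) x < (m :: nat)"
  by simp

lemma runs_init_words:
  assumes lg: "\<And>x. 2 ^ x < n \<longleftrightarrow> x < lg" and K: "K = \<kappa> * lg" "L = lg + lg" "DEP = lg + 2"
    and inp: "fst inp 0 = n" "fst inp 1 = d"
  shows "\<exists>W. params W \<and> W 5 = 0 \<and> runs w inp (init_words \<kappa>) (\<lambda>_. 0, h, ot) (return_spmf (W, h, ot)) (63 + 20 * n + 9 * L)"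
proof -
  have lgn: "lg \<le> n" using lg[of n] by (metis less_exp linorder_not_less order_less_imp_not_less nat_le_linear le_neq_implies_less)
  have lg1: "lg \<ge> 1" using K pos by auto
  have p: "(2::nat) ^ l < 2 ^ w" if "l \<le> L" for l
    using Rw R_L power_increasing[OF that, of "2::nat"] by simp
  have b [simp]: "lg < 2 ^ w" "\<kappa> < 2 ^ w" "Suc lg < 2 ^ w" "\<And>x. x < lg \<Longrightarrow> Suc x < 2 ^ w"
  proof -
    have "lg \<le> M" using K le_M(4) by simp
    then show lgw: "lg < 2 ^ w" by (rule small(2))
    have "\<kappa> * 1 \<le> \<kappa> * lg" using lg1 by (intro mult_le_mono2)
    then have "\<kappa> \<le> M" using K le_M(3) by linarith
    then show "\<kappa> < 2 ^ w" by (rule small(2))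
    have "Suc lg \<le> L" using K lg1 by simp
    then show "Suc lg < 2 ^ w" using size_less(4) by linarith
    show "\<And>x. x < lg \<Longrightarrow> Suc x < 2 ^ w" using lgw by linarith
  qed
  let ?W0 = "(\<lambda>_::nat. 0::nat)(0 := n, 1 := d)"
  \<comment> \<open>Both words stop at \<open>lg\<close>, because \<open>2 ^ x < n\<close> holds
    exactly for \<open>x < lg\<close>.\<close>
  let ?S = "\<lambda>m. (?W0(15 := 2 ^ min m lg, 9 := min m lg), h, ot)"
  have w1: "runs w inp (cSetW 0 (InW (N 0))) (\<lambda>_. 0, h, ot) (return_spmf ((\<lambda>_::nat. 0::nat)(0 := n), h, ot)) 4"
    by (rule runs_cong[OF runs_setW]) (use inp in simp_all)
  have w2': "runs w inp (cSetW 1 (InW (N 1))) ((\<lambda>_::nat. 0::nat)(0 := n), h, ot) (return_spmf (?W0, h, ot)) 4"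
    by (rule runs_cong[OF runs_setW]) (use inp in simp_all)
  have w3: "runs w inp (cSetW 15 (N 1)) (?W0, h, ot) (return_spmf (?W0(15 := 1), h, ot)) 3"
    by (rule runs_cong[OF runs_setW]) simp_all
  have "runs w inp (cFor 10 (V 0) (cIfW (V 15) (V 0)
          (cSetW 15 (Op WMul (V 15) (N 2)) ;; cSetW 9 (Op WAdd (V 9) (N 1))) cSkip)) (?W0(15 := 1), h, ot)
     (return_spmf (updx 10 ((?W0(15 := 1)) 10) (?S n))) (costW (V 0) + 6 + (\<Sum>i<n. 17 + 3))"
  proof (rule runs_for_det[where S = ?S])
    fix m assume m: "m < n"
    let ?W = "?W0(15 := 2 ^ min m lg, 9 := min m lg, 10 := m)"
    have q: "(2::nat) ^ min m lg < 2 ^ w" "m < 2 ^ w" "min m lg < 2 ^ w"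
      using p[of "min m lg"] K m b(1) by (auto simp: min_def)
    have "runs w inp (cIfW (V 15) (V 0)
          (cSetW 15 (Op WMul (V 15) (N 2)) ;; cSetW 9 (Op WAdd (V 9) (N 1))) cSkip) (?W, h, ot)
      (return_spmf (?W0(15 := 2 ^ min (Suc m) lg, 9 := min (Suc m) lg, 10 := m), h, ot)) (costW (V 15) + costW (V 0) + 1 + 12)"
    proof (rule runs_ifW)
      assume "evalW inp ?W (V 15) < evalW inp ?W (V 0)"
      then have ml: "m < lg" using lg[of "min m lg"] by auto
      have q2: "(2::nat) * 2 ^ m < 2 ^ w" using p[of "Suc m"] ml K by simp
      have a: "runs w inp (cSetW 15 (Op WMul (V 15) (N 2))) (?W, h, ot) (return_spmf (?W(15 := 2 ^ Suc m), h, ot)) 6"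
        by (rule runs_cong[OF runs_setW]) (use q q2 ml in \<open>simp_all add: min_def mult.commute\<close>)
      have b: "runs w inp (cSetW 9 (Op WAdd (V 9) (N 1))) (?W(15 := 2 ^ Suc m), h, ot)
         (return_spmf (?W(15 := 2 ^ Suc m, 9 := Suc m), h, ot)) 6"
        by (rule runs_cong[OF runs_setW]) (use q ml in \<open>simp_all add: min_def\<close>)
      show "runs w inp (cSetW 15 (Op WMul (V 15) (N 2)) ;; cSetW 9 (Op WAdd (V 9) (N 1))) (?W, h, ot)
         (return_spmf (?W0(15 := 2 ^ min (Suc m) lg, 9 := min (Suc m) lg, 10 := m), h, ot)) 12"
        by (rule runs_cong[OF runs_seq_det[OF a b]]) (use ml in \<open>auto simp: min_def fun_upd_def\<close>)
    next
      assume "\<not> evalW inp ?W (V 15) < evalW inp ?W (V 0)"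
      then have ml: "\<not> m < lg" using lg[of "min m lg"] by auto
      show "runs w inp cSkip (?W, h, ot)
         (return_spmf (?W0(15 := 2 ^ min (Suc m) lg, 9 := min (Suc m) lg, 10 := m), h, ot)) 12"
        by (rule runs_cong[OF runs_skip]) (use ml in \<open>auto simp: min_def\<close>)
    qed (use q in simp_all)
    then show "runs w inp (cIfW (V 15) (V 0)
          (cSetW 15 (Op WMul (V 15) (N 2)) ;; cSetW 9 (Op WAdd (V 9) (N 1))) cSkip) (updx 10 m (?S m))
      (return_spmf (updx 10 m (?S (Suc m)))) 17" by simp
  qed (use lg1 in \<open>auto simp: fun_eq_iff\<close>)
  then have w4: "runs w inp (cFor 10 (V 0) (cIfW (V 15) (V 0)
          (cSetW 15 (Op WMul (V 15) (N 2)) ;; cSetW 9 (Op WAdd (V 9) (N 1))) cSkip)) (?W0(15 := 1), h, ot)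
     (return_spmf (?W0(15 := 2 ^ lg, 9 := lg, 10 := 0), h, ot)) (8 + 20 * n)"
    by (rule runs_cong) (use lgn in \<open>simp_all add: min_def\<close>)
  let ?W1 = "?W0(15 := 2 ^ lg, 9 := lg, 10 := 0)"
  have w5: "runs w inp (cSetW 2 (Op WMul (N \<kappa>) (V 9))) (?W1, h, ot) (return_spmf (?W1(2 := K), h, ot)) 6"
    by (rule runs_cong[OF runs_setW]) (use K size_less(3) in simp_all)
  have w6: "runs w inp (cSetW 3 (Op WAdd (V 9) (V 9))) (?W1(2 := K), h, ot) (return_spmf (?W1(2 := K, 3 := L), h, ot)) 7"
    by (rule runs_cong[OF runs_setW]) (use K size_less(4) in simp_all)
  have w7: "runs w inp (cSetW 4 (Op WAdd (V 1) (V 3))) (?W1(2 := K, 3 := L), h, ot)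
      (return_spmf (?W1(2 := K, 3 := L, 4 := D1), h, ot)) 7"
    by (rule runs_cong[OF runs_setW]) simp_all
  let ?W2 = "?W1(2 := K, 3 := L, 4 := D1)"
  have w8: "runs w inp (cSetW 7 (Op WAdd (V 0) (V 0))) (?W2, h, ot) (return_spmf (?W2(7 := 2 * n), h, ot)) 7"
    by (rule runs_cong[OF runs_setW]) (use size_less(5) in \<open>simp_all add: mult_2\<close>)
  have w9: "runs w inp (cSetW 8 (Op WAdd (V 9) (N 2))) (?W2(7 := 2 * n), h, ot) (return_spmf (?W2(7 := 2 * n, 8 := DEP), h, ot)) 6"
    by (rule runs_cong[OF runs_setW]) (use K DEPw in simp_all)
  let ?W3 = "?W2(7 := 2 * n, 8 := DEP)"
  have w10: "runs w inp (cSetW 6 (N 1)) (?W3, h, ot) (return_spmf (?W3(6 := 1), h, ot)) 3"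
    by (rule runs_cong[OF runs_setW]) simp_all
  have "runs w inp (cFor 10 (V 3) (cSetW 6 (Op WMul (V 6) (N 2)))) (?W3(6 := 1), h, ot)
     (return_spmf (updx 10 ((?W3(6 := 1)) 10) (?W3(6 := 2 ^ L), h, ot))) (costW (V 3) + 6 + (\<Sum>i<L. 6 + 3))"
  proof (rule runs_for_det[where S = "\<lambda>l. (?W3(6 := 2 ^ l), h, ot)"])
    fix l assume l: "l < L"
    show "runs w inp (cSetW 6 (Op WMul (V 6) (N 2))) (updx 10 l (?W3(6 := 2 ^ l), h, ot))
       (return_spmf (updx 10 l (?W3(6 := 2 ^ Suc l), h, ot))) 6" unfolding updx_simp
      by (rule runs_cong[OF runs_setW]) (use p[of l] p[of "Suc l"] l in \<open>auto simp: fun_upd_def mult.commute\<close>)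
  qed simp_all
  then have w11: "runs w inp (cFor 10 (V 3) (cSetW 6 (Op WMul (V 6) (N 2)))) (?W3(6 := 1), h, ot)
     (return_spmf (?W3(6 := 2 ^ L, 10 := 0), h, ot)) (8 + 9 * L)"
    by (rule runs_cong) simp_all
  have "params (?W3(6 := 2 ^ L, 10 := 0))"
    unfolding params_def
  proof (intro conjI allI)
    have "(2::nat) ^ lg < 2 ^ w" "(2::nat) ^ L < 2 ^ w" using p K by auto
    then have "\<forall>x. (?W3(6 := 2 ^ L, 10 := 0)) x < 2 ^ w"
      by (intro upd_less) simp_all
    then show "(?W3(6 := 2 ^ L, 10 := 0)) x < 2 ^ w" for x by blast
  qed (simp_all add: R_L del: paramsD)
  moreover have "(?W3(6 := 2 ^ L, 10 := 0)) 5 = 0" by simp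
  moreover have "runs w inp (init_words \<kappa>) (\<lambda>_. 0, h, ot) (return_spmf (?W3(6 := 2 ^ L, 10 := 0), h, ot)) (63 + 20 * n + 9 * L)"
    unfolding init_words_def
    by (rule runs_mono[OF runs_seq_det[OF w1 runs_seq_det[OF w2' runs_seq_det[OF w3 runs_seq_det[OF w4
      runs_seq_det[OF w5 runs_seq_det[OF w6 runs_seq_det[OF w7 runs_seq_det[OF w8 runs_seq_det[OF w9
      runs_seq_det[OF w10 w11]]]]]]]]]]]) linarith
  ultimately show ?thesis by blast
qed

lemma runs_init_data:
  assumes W: "params W" and len: "fst inp 2 = len" "len \<le> n * d"
    and ent: "\<And>e. e < len \<Longrightarrow> fst inp (2 * e + 3) < n \<and> fst inp (2 * e + 4) < d"
  shows "runs w inp init_data (W, h, ot)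
    (map_spmf (\<lambda>f. (W, fold (init_entryH inp) [0..<len] (with_signs (init_rowsH (snd inp) h) (K * n) f), ot))
       (signs (K * n))) (60 + 66 * n + 34 * (K * n) + len * (75 + 100 * DEP * K))"
proof -
  let ?u = "snd inp"
  have len': "len \<le> M" using len le_M(5) by linarith
  have big: "3 * M + 5 < 2 ^ w" using small(1)[of M] n_pos le_M(1) by linarith
  have r1: "Suc i < 2 ^ w" "Suc n < 2 ^ w" "Suc (n + i) < 2 ^ w" "Suc (2 * n) < 2 ^ w" if "i < n" for i
    using big le_M(1,9) that by linarith+
  have r2: "e + 3 < 2 ^ w" "e + 4 < 2 ^ w" "e + (e + 3) < 2 ^ w" "e + (e + 4) < 2 ^ w" "2 * e + 3 < 2 ^ w" "2 * e + 4 < 2 ^ w" "e < 2 ^ w" "2 * n + 1 + e < 2 ^ w"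
     "3 < (2::nat)^w" "4 < (2::nat)^w"  "Suc (2 * n) < 2 ^ w" "Suc (2 * n + e) < 2 ^ w" if "e < len" for e
    using big le_M(1,9) len' that by linarith+
  have "8 < (2::nat) ^ w" using w16 by linarith
  note [simp] = this
  have d1: "runs w inp (cSetR 0 (N 0) (Sq (Bop RDiv (InR (N 0)) (Bop RMul (OfW (N 8)) (OfW (V 3)))))) (W, h, ot)
     (return_spmf (W, put 0 0 ((?u 0 / (8 * real L))\<^sup>2) h, ot)) 16"
    by (rule runs_cong[OF runs_setR]) (use W in \<open>simp_all add: put_def\<close>)
  have d2: "runs w inp (cSetR 11 (N 0) (OfW (N 1))) (W, h, ot) (return_spmf (W, put 11 0 1 h, ot)) 8" for h
    by (rule runs_cong[OF runs_setR]) (use W fitsA_M[of 11 0] in \<open>simp_all add: put_def\<close>)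
  have row: "runs w inp init_row (W(10 := i), h, ot) (return_spmf (W(10 := i), init_rowH ?u i h, ot)) 63"
    if i: "i < n" for i h
  proof -
    note [simp] = r1[OF i]
    have 1: "runs w inp (cSetR 2 (V 10) (InR (Op WAdd (N 1) (V 10)))) (W(10 := i), h, ot)
      (return_spmf (W(10 := i), put 2 i (?u (1 + i)) h, ot)) 12" for h
      by (rule runs_cong[OF runs_setR]) (use W i in \<open>simp_all add: put_def\<close>)
    have 2: "runs w inp (cSetR 3 (V 10) (InR (Op WAdd (Op WAdd (N 1) (V 0)) (V 10)))) (W(10 := i), h, ot)
      (return_spmf (W(10 := i), put 3 i (?u (1 + n + i)) h, ot)) 15" for h
      by (rule runs_cong[OF runs_setR]) (use W i in \<open>simp_all add: put_def\<close>)
    have 3: "runs w inp (cSetR 4 (V 10) (Rd 3 (V 10))) (W(10 := i), h, ot)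
      (return_spmf (W(10 := i), put 4 i (h 3 i) h, ot)) 14" for h
      by (rule runs_cong[OF runs_setR]) (use W i in \<open>simp_all add: put_def\<close>)
    have 4: "runs w inp (cSetR 5 (V 10) (Bop RDiv (Rd 2 (V 10)) (Rd 4 (V 10)))) (W(10 := i), h, ot)
      (return_spmf (W(10 := i), put 5 i (h 2 i / h 4 i) h, ot)) 22" for h
      by (rule runs_cong[OF runs_setR]) (use W i in \<open>simp_all add: put_def\<close>)
    show ?thesis unfolding init_row_def
      by (rule runs_cong[OF runs_seq_det[OF 1 runs_seq_det[OF 2 runs_seq_det[OF 3 4]]]])
        (simp_all add: init_rowH_def put_def)
  qed
  have d3: "runs w inp (cFor 10 (V 0) init_row) (W, h, ot) (return_spmf (W, fold (init_rowH ?u) [0..<n] h, ot)) (8 + 66 * n)" for h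
    by (rule runs_cong[OF runs_for_fold[where T = "\<lambda>_ _. 63" and n = n]], rule_tac [5] row) (use W in simp_all)
  have entry: "runs w inp init_entry (W(17 := e), h, ot) (return_spmf (W(17 := e), init_entryH inp e h, ot)) (72 + 100 * DEP * K)"
    if e: "e < len" for e h
  proof -
    note [simp] = r2[OF e]
    let ?i = "fst inp (2 * e + 3)" and ?c = "fst inp (2 * e + 4)" and ?x = "?u (2 * n + 1 + e)"
    have ic: "?i < n" "?c < d" "?c < D1" using ent[OF e] by auto
    have ix: "e + (e + 3) = 2 * e + 3" "e + (e + 4) = 2 * e + 4" by simp_all
    let ?W = "W(17 := e, 10 := ?i, 16 := ?c)"
    have 1: "runs w inp (cSetR 1 (ix2 (V 10) (V 1) (V 16)) (InR (Op WAdd (Op WAdd (V 7) (N 1)) (V 17)))) (?W, h, ot)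
       (return_spmf (?W, put 1 (?i * d + ?c) ?x h, ot)) 21" for h
      by (rule runs_cong[OF runs_setR]) (use W ic in \<open>simp_all add: put_def\<close>)
    have 2: "runs w inp (cSetR 0 (N 2) (Bop RMul (Rd 5 (V 10)) (Rd 1 (ix2 (V 10) (V 1) (V 16))))) (?W, h, ot)
       (return_spmf (?W, put 0 2 (h 5 ?i * h 1 (?i * d + ?c)) h, ot)) 27" for h
      by (rule runs_cong[OF runs_setR]) (use W ic in \<open>simp_all add: put_def\<close>)
    have 3: "runs w inp add_entry (?W, h, ot) (return_spmf (?W, addH ?i ?c h, ot)) (100 * DEP * K)" for h
      using runs_add_entry[of ?W inp h ot] W ic by simp
    have 5: "runs w inp (cSetR 1 (ix2 (V 10) (V 1) (V 16)) (InR (Op WAdd (Op WAdd (V 7) (N 1)) (V 17)))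
        ;; cSetR 0 (N 2) (Bop RMul (Rd 5 (V 10)) (Rd 1 (ix2 (V 10) (V 1) (V 16)))) ;; add_entry) (?W, h, ot)
        (return_spmf (?W, init_entryH inp e h, ot)) (48 + 100 * DEP * K)"
      by (rule runs_cong[OF runs_seq_det[OF 1 runs_seq_det[OF 2 3]]]) (simp_all add: init_entryH_def put_def Let_def)
    have "runs w inp (cLet 16 (InW (Op WAdd (V 17) (Op WAdd (V 17) (N 4))))
       (cSetR 1 (ix2 (V 10) (V 1) (V 16)) (InR (Op WAdd (Op WAdd (V 7) (N 1)) (V 17)))
        ;; cSetR 0 (N 2) (Bop RMul (Rd 5 (V 10)) (Rd 1 (ix2 (V 10) (V 1) (V 16)))) ;; add_entry)) (W(17 := e, 10 := ?i), h, ot)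
       (map_spmf (updx 16 ((W(17 := e, 10 := ?i)) 16)) (return_spmf (?W, init_entryH inp e h, ot)))
       (costW (InW (Op WAdd (V 17) (Op WAdd (V 17) (N 4)))) + 4 + (48 + 100 * DEP * K))"
      by (rule runs_let) (use W ic ix 5 in simp_all)
    then have 4: "runs w inp (cLet 16 (InW (Op WAdd (V 17) (Op WAdd (V 17) (N 4))))
       (cSetR 1 (ix2 (V 10) (V 1) (V 16)) (InR (Op WAdd (Op WAdd (V 7) (N 1)) (V 17)))
        ;; cSetR 0 (N 2) (Bop RMul (Rd 5 (V 10)) (Rd 1 (ix2 (V 10) (V 1) (V 16)))) ;; add_entry)) (W(17 := e, 10 := ?i), h, ot)
       (return_spmf (W(17 := e, 10 := ?i), init_entryH inp e h, ot)) (60 + 100 * DEP * K)"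
      by (rule runs_cong) (auto simp: fun_upd_def)
    have "runs w inp init_entry (W(17 := e), h, ot)
       (map_spmf (updx 10 ((W(17 := e)) 10)) (return_spmf (W(17 := e, 10 := ?i), init_entryH inp e h, ot)))
       (costW (InW (Op WAdd (V 17) (Op WAdd (V 17) (N 3)))) + 4 + (60 + 100 * DEP * K))"
      unfolding init_entry_def
      by (rule runs_let) (use W ic ix 4 in simp_all)
    then show ?thesis by (rule runs_cong) (auto simp: fun_upd_def)
  qed
  have d5: "runs w inp (cFor 17 (InW (N 2)) init_entry) (W, h, ot) (return_spmf (W, fold (init_entryH inp) [0..<len] h, ot))
     (8 + len * (75 + 100 * DEP * K))" for h
    by (rule runs_cong[OF runs_for_fold[where T = "\<lambda>_ _. 72 + 100 * DEP * K" and n = len]], rule_tac [5] entry)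
      (use W len len' small(2) in simp_all)
  have d45: "runs w inp (draw_signs ;; cFor 17 (InW (N 2)) init_entry) (W, h, ot)
     (map_spmf (\<lambda>f. (W, fold (init_entryH inp) [0..<len] (with_signs h (K * n) f), ot)) (signs (K * n)))
     ((11 + K * n * 34) + (8 + len * (75 + 100 * DEP * K)))" for h
  proof -
    have "runs w inp (draw_signs ;; cFor 17 (InW (N 2)) init_entry) (W, h, ot)
       (bind_spmf (map_spmf (\<lambda>f. (W, with_signs h (K * n) f, ot)) (signs (K * n)))
         (\<lambda>(W1, h1, ot1). return_spmf (W1, fold (init_entryH inp) [0..<len] h1, ot1)))
       ((11 + K * n * 34) + (8 + len * (75 + 100 * DEP * K)))"
      by (rule runs_seq[OF runs_draw_signs[OF W]]) (use d5 in auto)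
    then show ?thesis by (rule runs_cong) (simp_all add: map_spmf_conv_bind_spmf)
  qed
  show ?thesis unfolding init_data_def init_rowsH_def
    by (rule runs_mono[OF runs_seq_det[OF d1 runs_seq_det[OF d2 runs_seq_det[OF d3 d45]]]]) linarith
qed

end

section \<open>The abstract state and the sketch invariant\<close>

text \<open>\<open>aX\<close> is the exact vector, \<open>aG\<close> the scaling, \<open>aB\<close>
  the reported vector; \<open>aU l\<close> and \<open>aV l\<close> are the relative changes of each
  row in the current window of level \<open>l\<close>, caused by the \<open>h\<close> and by the
  \<open>\<delta>\<close>; \<open>aT\<close> counts the queries since the rebuild, and
  \<open>aS\<close> holds the signs.\<close>

record ast =
  aX :: "nat \<Rightarrow> real"
  aG :: "nat \<Rightarrow> real"
  aB :: "nat \<Rightarrow> real"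
  aU :: "nat \<Rightarrow> nat \<Rightarrow> real"
  aV :: "nat \<Rightarrow> nat \<Rightarrow> real"
  aT :: nat
  aS :: "nat \<Rightarrow> real"

fun all_up :: "(nat \<Rightarrow> bool) \<Rightarrow> nat \<Rightarrow> bool" where
  "all_up P v = (if v = 0 then True else P v \<and> all_up P (v div 2))"

declare all_up.simps [simp del]

context sizes
begin

text \<open>For \<open>v \<ge> 1\<close> this is 0 or 1, according to whether \<open>v\<close> lies
  on the path of row \<open>i\<close>. A true count is needed for \<open>v = 0\<close>, which a
  short path meets repeatedly in \<open>add_entry\<close>.\<close>

definition mult :: "nat \<Rightarrow> nat \<Rightarrow> real" where
  "mult v i = real (card {k. k < DEP \<and> node i k = v})"

definition test :: "real \<Rightarrow> ast \<Rightarrow> nat \<Rightarrow> nat \<Rightarrow> bool" where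
  "test thr s l v \<longleftrightarrow> (\<exists>r<K. thr\<^sup>2 < (\<Sum>i<n. mult v i * aS s (r * n + i) * aU s l i)\<^sup>2)"

definition hit :: "real \<Rightarrow> ast \<Rightarrow> nat \<Rightarrow> nat \<Rightarrow> bool" where
  "hit thr s l i \<longleftrightarrow> all_up (test thr s l) (n + i) \<or> thr\<^sup>2 < (aV s l i)\<^sup>2"

definition absorbA :: "(nat \<Rightarrow> nat \<Rightarrow> real) \<Rightarrow> (nat \<Rightarrow> real) \<Rightarrow> (nat \<Rightarrow> real) \<Rightarrow> ast \<Rightarrow> ast" where
  "absorbA A y \<delta> s = s\<lparr>aX := \<lambda>i. aX s i + aG s i * (\<Sum>j<d. A i j * y j) + \<delta> i,
     aU := \<lambda>l i. aU s l i + aG s i / aB s i * (\<Sum>j<d. A i j * y j),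
     aV := \<lambda>l i. aV s l i + \<delta> i / aB s i\<rparr>"

definition checkA :: "real \<Rightarrow> nat \<Rightarrow> ast \<Rightarrow> ast" where
  "checkA thr l s = s\<lparr>aB := \<lambda>i. if hit thr s l i then aX s i else aB s i,
     aU := (aU s)(l := \<lambda>_. 0), aV := (aV s)(l := \<lambda>_. 0)\<rparr>"

definition rebuildA :: "(nat \<Rightarrow> real) \<Rightarrow> ast \<Rightarrow> ast" where
  "rebuildA f s = s\<lparr>aB := aX s, aU := \<lambda>_ _. 0, aV := \<lambda>_ _. 0, aT := 0, aS := f\<rparr>"

definition rowc :: "heap \<Rightarrow> nat \<Rightarrow> nat \<Rightarrow> real" where
  "rowc h i c = (if c < d then h 1 (i * d + c) else \<Sum>j<d. h 1 (i * d + j) * (h 6 j - h 7 ((c - d) * d + j)))"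

definition wgt :: "ast \<Rightarrow> nat \<Rightarrow> real" where
  "wgt s i = aG s i / aB s i"

text \<open>In a column \<open>d + l\<close> this is what the current weight would give to the
  window of level \<open>l\<close>, minus what was really accumulated. It vanishes at the start of a
  window and changes only with the weight.\<close>

definition entry :: "(nat \<Rightarrow> real) \<Rightarrow> (nat \<Rightarrow> nat \<Rightarrow> real) \<Rightarrow> heap \<Rightarrow> nat \<Rightarrow> nat \<Rightarrow> real" where
  "entry wt U h i c = wt i * rowc h i c - (if c < d then 0 else U (c - d) i)"

definition sketched :: "(nat \<Rightarrow> real) \<Rightarrow> (nat \<Rightarrow> real) \<Rightarrow> (nat \<Rightarrow> nat \<Rightarrow> real) \<Rightarrow> heap \<Rightarrow> bool" where
  "sketched \<sigma> wt U h \<longleftrightarrow> (\<forall>v<2*n. \<forall>r<K. \<forall>c<D1. h 8 (sk v r c) = (\<Sum>i<n. mult v i * \<sigma> (r * n + i) * entry wt U h i c))"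

text \<open>The vector \<open>x\<close> is not stored: array 3 holds \<open>x\<close> minus the
  scaled product of \<open>A\<close> with the sum of all \<open>h\<close>, so that a query needs no
  matrix product.\<close>

definition repr :: "real \<Rightarrow> (nat \<Rightarrow> nat \<Rightarrow> real) \<Rightarrow> heap \<Rightarrow> ast \<Rightarrow> bool" where
  "repr thr A h s \<longleftrightarrow> h 0 0 = thr\<^sup>2 \<and> (\<forall>i<n. \<forall>j<d. h 1 (i * d + j) = A i j) \<and>
     (\<forall>i<n. h 2 i = aG s i \<and> h 3 i = aX s i - aG s i * (\<Sum>j<d. A i j * h 6 j) \<and>
        h 4 i = aB s i \<and> h 5 i = wgt s i) \<and>
     (\<forall>x<K*n. h 9 x = aS s x) \<and> (\<forall>l<L. \<forall>i<n. h 10 (l * n + i) = aV s l i) \<and> h 11 0 = 1 \<and>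
     sketched (aS s) (wgt s) (aU s) h"

lemma ix_inj:
  assumes "j < b" "j' < b" shows "i * b + j = i' * b + j' \<longleftrightarrow> i = i' \<and> j = (j'::nat)"
proof
  assume e: "i * b + j = i' * b + j'"
  have "(i * b + j) div b = i" "(i' * b + j') div b = i'" using assms by auto
  then show "i = i' \<and> j = j'" using e by auto
qed auto

lemma sk_inj: "r < K \<Longrightarrow> r' < K \<Longrightarrow> c < D1 \<Longrightarrow> c' < D1 \<Longrightarrow> sk v r c = sk v' r' c' \<longleftrightarrow> v = v' \<and> r = r' \<and> c = c'"
  unfolding sk_def by (simp add: ix_inj)

lemma put_apply: "put a x y h b = (if b = a then (h a)(x := y) else h b)"
  by (simp add: put_def)

lemma addH_other: "a \<noteq> 8 \<Longrightarrow> addH i c h a = h a"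
proof -
  assume a: "a \<noteq> 8"
  have "fold (\<lambda>r h. put 8 (sk v r c) (h 8 (sk v r c) + h 9 (r * n + i) * h 0 2) h) xs h a = h a" for v xs h
    by (induction xs arbitrary: h) (auto simp: put_apply a)
  then have "fold (\<lambda>k. fold (\<lambda>r h. put 8 (sk (node i k) r c) (h 8 (sk (node i k) r c) + h 9 (r * n + i) * h 0 2) h) [0..<K]) ys h a = h a" for ys h
    by (induction ys arbitrary: h) auto
  then show ?thesis by (simp add: addH_def)
qed

lemma addH_8:
  assumes i: "i < n" and v: "v < 2 * n" and r: "r < K" and c: "c < D1" "c' < D1"
  shows "addH i c h 8 (sk v r c') = h 8 (sk v r c') + (if c' = c then mult v i * h 9 (r * n + i) * h 0 2 else 0)"
proof -
  let ?f = "\<lambda>u r h. put 8 (sk u r c) (h 8 (sk u r c) + h 9 (r * n + i) * h 0 2) h"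
  have oth: "fold (?f u) [0..<m] h a = h a" if "a \<noteq> 8" for u m h a
    by (induction m) (auto simp: put_apply that)
  have inner: "m \<le> K \<Longrightarrow> fold (?f u) [0..<m] h 8 (sk v r c') = h 8 (sk v r c') +
      (if u = v \<and> r < m \<and> c' = c then h 9 (r * n + i) * h 0 2 else 0)" for u m h
  proof (induction m)
    case (Suc m)
    define h' where "h' = fold (?f u) [0..<m] h"
    have "h' 9 = h 9" "h' 0 = h 0" unfolding h'_def by (rule oth; simp)+
    moreover have eq: "fold (?f u) [0..<Suc m] h = ?f u m h'" by (simp add: h'_def)
    moreover have "h' 8 (sk v r c') = h 8 (sk v r c') + (if u = v \<and> r < m \<and> c' = c then h 9 (r * n + i) * h 0 2 else 0)"
      unfolding h'_def using Suc by simp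
    ultimately show ?case unfolding eq using r c Suc.prems by (auto simp: put_apply sk_inj less_Suc_eq)
  qed simp
  have oth': "fold (\<lambda>k. fold (?f (node i k)) [0..<K]) [0..<m] h a = h a" if "a \<noteq> 8" for m h a
    by (induction m) (auto simp: oth that)
  have "fold (\<lambda>k. fold (?f (node i k)) [0..<K]) [0..<m] h 8 (sk v r c') = h 8 (sk v r c') +
      (if c' = c then real (card {k. k < m \<and> node i k = v}) * h 9 (r * n + i) * h 0 2 else 0)" for m
  proof (induction m)
    case (Suc m)
    have "{k. k < Suc m \<and> node i k = v} = {k. k < m \<and> node i k = v} \<union> (if node i m = v then {m} else {})"
      by (auto simp: less_Suc_eq)
    then have "card {k. k < Suc m \<and> node i k = v} = card {k. k < m \<and> node i k = v} + (if node i m = v then 1 else 0)"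
      by auto
    moreover define h' where "h' = fold (\<lambda>k. fold (?f (node i k)) [0..<K]) [0..<m] h"
    have "h' 9 = h 9" "h' 0 = h 0" unfolding h'_def by (rule oth'; simp)+
    moreover have eq: "fold (\<lambda>k. fold (?f (node i k)) [0..<K]) [0..<Suc m] h = fold (?f (node i m)) [0..<K] h'"
      by (simp add: h'_def)
    moreover have "h' 8 (sk v r c') = h 8 (sk v r c') +
      (if c' = c then real (card {k. k < m \<and> node i k = v}) * h 9 (r * n + i) * h 0 2 else 0)"
      unfolding h'_def by (rule Suc)
    ultimately show ?case unfolding eq using inner[of K "node i m" h'] r by (auto simp: algebra_simps)
  qed simp
  then show ?thesis by (simp add: addH_def mult_def)
qed

lemma rwH_other: "a \<notin> {0, 5, 8} \<Longrightarrow> rwH i h a = h a" and rwH_0: "rwH i h 0 0 = h 0 0"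
  and rwH_5: "rwH i h 5 = (h 5)(i := h 2 i / h 4 i)"
proof -
  have f2: "fold (\<lambda>c h. addH i c (put 0 2 (g c h) h)) xs h a = h a" if "a \<notin> {0, 8}" for xs h a and g :: "nat \<Rightarrow> heap \<Rightarrow> real"
    by (induction xs arbitrary: h) (use that in \<open>auto simp: addH_other put_apply\<close>)
  have f3: "fold (\<lambda>l h. addH i (d + l) (put 0 2 (g l h) h)) xs h a = h a" if "a \<notin> {0, 8}" for xs h a and g :: "nat \<Rightarrow> heap \<Rightarrow> real"
    by (induction xs arbitrary: h) (use that in \<open>auto simp: addH_other put_apply\<close>)
  have g2: "fold (\<lambda>c h. addH i c (put 0 2 (g c h) h)) xs h 0 0 = h 0 0" for xs h and g :: "nat \<Rightarrow> heap \<Rightarrow> real"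
    by (induction xs arbitrary: h) (auto simp: addH_other put_apply)
  have g3: "fold (\<lambda>l h. addH i (d + l) (put 0 2 (g l h) h)) xs h 0 0 = h 0 0" for xs h and g :: "nat \<Rightarrow> heap \<Rightarrow> real"
    by (induction xs arbitrary: h) (auto simp: addH_other put_apply)
  show "a \<notin> {0, 5, 8} \<Longrightarrow> rwH i h a = h a" "rwH i h 0 0 = h 0 0"
    by (simp_all add: rwH_def rwH1_def rwH2_def rwH3_def f2 f3 g2 g3 put_apply)
  show "rwH i h 5 = (h 5)(i := h 2 i / h 4 i)"
    unfolding rwH_def rwH2_def rwH3_def
    by (subst f3, simp, subst f2, simp) (simp only: rwH1_def put_def fun_upd_same fun_upd_other)
qed

lemma rwH_8:
  assumes i: "i < n" and v: "v < 2 * n" and r: "r < K" and c: "c < D1"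
  shows "rwH i h 8 (sk v r c) = h 8 (sk v r c) + mult v i * h 9 (r * n + i) * ((h 2 i / h 4 i - h 5 i) * rowc h i c)"
proof -
  let ?w = "h 2 i / h 4 i - h 5 i"
  define h1 where "h1 = rwH1 i h"
  have h1: "h1 a = h a" if "a \<notin> {0, 5}" for a using that by (auto simp: h1_def rwH1_def put_apply)
  have h1_0: "h1 0 1 = ?w" by (simp add: h1_def rwH1_def put_apply)
  let ?f2 = "\<lambda>c h. addH i c (put 0 2 (h 0 1 * h 1 (i * d + c)) h)"
  have 2: "m \<le> d \<Longrightarrow> (\<forall>a. a \<notin> {0, 8} \<longrightarrow> fold ?f2 [0..<m] h1 a = h1 a) \<and> fold ?f2 [0..<m] h1 0 1 = ?w \<and>
     fold ?f2 [0..<m] h1 8 (sk v r c) = h 8 (sk v r c) +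
       (if c < m then mult v i * h 9 (r * n + i) * (?w * h 1 (i * d + c)) else 0)" for m
  proof (induction m)
    case 0
    then show ?case using h1 h1_0 by simp
  next
    case (Suc m)
    then have IH: "\<And>a. a \<notin> {0, 8} \<Longrightarrow> fold ?f2 [0..<m] h1 a = h1 a" "fold ?f2 [0..<m] h1 0 1 = ?w"
      "fold ?f2 [0..<m] h1 8 (sk v r c) = h 8 (sk v r c) +
       (if c < m then mult v i * h 9 (r * n + i) * (?w * h 1 (i * d + c)) else 0)" and m: "m < D1" by auto
    define h' where "h' = fold ?f2 [0..<m] h1"
    have eq: "fold ?f2 [0..<Suc m] h1 = ?f2 m h'" by (simp add: h'_def)
    show ?case using IH h1 unfolding eq unfolding h'_def[symmetric]
      by (auto simp: addH_8[OF i v r m c] addH_other put_apply less_Suc_eq)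
  qed
  define h2 where "h2 = rwH2 i h1"
  have h2: "\<And>a. a \<notin> {0, 5, 8} \<Longrightarrow> h2 a = h a" "h2 0 1 = ?w"
     "h2 8 (sk v r c) = h 8 (sk v r c) + (if c < d then mult v i * h 9 (r * n + i) * (?w * h 1 (i * d + c)) else 0)"
    using 2[of d] h1 by (auto simp: h2_def rwH2_def)
  let ?g = "\<lambda>l h. h 0 1 * (\<Sum>j<d. h 1 (i * d + j) * (h 6 j - h 7 (l * d + j)))"
  let ?f3 = "\<lambda>l h. addH i (d + l) (put 0 2 (?g l h) h)"
  have 3: "m \<le> L \<Longrightarrow> (\<forall>a. a \<notin> {0, 8} \<longrightarrow> fold ?f3 [0..<m] h2 a = h2 a) \<and> fold ?f3 [0..<m] h2 0 1 = ?w \<and>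
     fold ?f3 [0..<m] h2 8 (sk v r c) = h2 8 (sk v r c) +
       (if d \<le> c \<and> c < d + m then mult v i * h 9 (r * n + i) * (?w * rowc h i c) else 0)" for m
  proof (induction m)
    case 0
    then show ?case using h2 by simp
  next
    case (Suc m)
    then have IH: "\<And>a. a \<notin> {0, 8} \<Longrightarrow> fold ?f3 [0..<m] h2 a = h2 a" "fold ?f3 [0..<m] h2 0 1 = ?w"
      "fold ?f3 [0..<m] h2 8 (sk v r c) = h2 8 (sk v r c) +
       (if d \<le> c \<and> c < d + m then mult v i * h 9 (r * n + i) * (?w * rowc h i c) else 0)" and m: "d + m < D1" by auto
    define h' where "h' = fold ?f3 [0..<m] h2"
    have eq: "fold ?f3 [0..<Suc m] h2 = ?f3 m h'" by (simp add: h'_def)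
    show ?case using IH h2(1) unfolding eq unfolding h'_def[symmetric]
      by (auto simp: addH_8[OF i v r m c] addH_other put_apply less_Suc_eq rowc_def)
  qed
  have "rwH i h 8 (sk v r c) = h2 8 (sk v r c) + (if d \<le> c then mult v i * h 9 (r * n + i) * (?w * rowc h i c) else 0)"
    using 3[of L] c by (simp add: rwH_def rwH3_def h2_def h1_def)
  then show ?thesis using h2(3) by (auto simp: rowc_def)
qed

text \<open>The weight changes but \<open>U\<close> does not: the amount added to the sketches is
  the change of \<open>wt i * rowc h i c\<close> in all columns, those of the windows
  included.\<close>

lemma rwH_sketched:
  assumes i: "i < n" and S: "sketched \<sigma> wt U h" and "h 5 i = wt i" and \<sigma>: "\<forall>x<K*n. h 9 x = \<sigma> x"
  shows "sketched \<sigma> (wt(i := h 2 i / h 4 i)) U (rwH i h)"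
  unfolding sketched_def
proof (intro allI impI)
  fix v r c assume a: "v < 2 * n" "r < K" "c < D1"
  have rc: "rowc (rwH i h) i' c = rowc h i' c" for i' by (simp add: rowc_def rwH_other)
  have s: "h 9 (r * n + i) = \<sigma> (r * n + i)" using \<sigma> ix2_less[OF a(2) i] by simp
  let ?w = "wt(i := h 2 i / h 4 i)"
  have "(\<Sum>i'<n. mult v i' * \<sigma> (r * n + i') * entry ?w U (rwH i h) i' c) =
    (\<Sum>i'<n. mult v i' * \<sigma> (r * n + i') * entry wt U h i' c +
       (if i' = i then mult v i * \<sigma> (r * n + i) * ((h 2 i / h 4 i - wt i) * rowc h i c) else 0))"
    by (intro sum.cong) (auto simp: entry_def rc algebra_simps)
  also have "\<dots> = (\<Sum>i'<n. mult v i' * \<sigma> (r * n + i') * entry wt U h i' c) +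
      mult v i * \<sigma> (r * n + i) * ((h 2 i / h 4 i - wt i) * rowc h i c)"
    using i by (simp add: sum.distrib)
  finally show "rwH i h 8 (sk v r c) = (\<Sum>i'<n. mult v i' * \<sigma> (r * n + i') * entry ?w U (rwH i h) i' c)"
    using rwH_8[OF i a] S a assms(3) s by (simp add: sketched_def)
qed

lemma sketched_cong:
  assumes "sketched \<sigma> wt U h" "h' 8 = h 8" "\<And>i c. i < n \<Longrightarrow> c < D1 \<Longrightarrow> entry wt' U' h' i c = entry wt U h i c"
    "\<And>x. x < K * n \<Longrightarrow> \<sigma>' x = \<sigma> x"
  shows "sketched \<sigma>' wt' U' h'"
  using assms ix2_less unfolding sketched_def by (auto intro!: sum.cong)

lemma syncH_repr:
  assumes R: "repr thr A h s" and i: "i < n"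
  shows "repr thr A (syncH i h) (s\<lparr>aB := (aB s)(i := aX s i)\<rparr>)"
proof -
  let ?h = "put 4 i (h 3 i + h 2 i * (\<Sum>j<d. h 1 (i * d + j) * h 6 j)) h"
  have x: "h 3 i + h 2 i * (\<Sum>j<d. h 1 (i * d + j) * h 6 j) = aX s i"
    using R i by (simp add: repr_def)
  have S: "sketched (aS s) (wgt s) (aU s) ?h"
    by (rule sketched_cong[where h = h and wt = "wgt s" and U = "aU s" and \<sigma> = "aS s"])
      (use R in \<open>auto simp: repr_def put_apply entry_def rowc_def\<close>)
  have w: "(wgt s)(i := aG s i / aX s i) = wgt (s\<lparr>aB := (aB s)(i := aX s i)\<rparr>)"
    by (auto simp: wgt_def)
  have "sketched (aS s) ((wgt s)(i := ?h 2 i / ?h 4 i)) (aU s) (rwH i ?h)"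
    by (rule rwH_sketched[OF i S]) (use R i in \<open>auto simp: repr_def put_apply\<close>)
  then have "sketched (aS s) (wgt (s\<lparr>aB := (aB s)(i := aX s i)\<rparr>)) (aU s) (syncH i h)"
    using R i x w by (simp add: put_apply repr_def syncH_def)
  then show ?thesis using R i x w
    by (auto simp: repr_def syncH_def rwH_other rwH_0 rwH_5 put_apply wgt_def)
qed

text \<open>After exchanging the sums over \<open>j\<close> and \<open>i\<close>, the first part is
  the weight times the window of \<open>h\<close>; the window column holds the same term minus
  \<open>aU\<close>, so the weights cancel.\<close>

lemma skv_repr:
  assumes R: "repr thr A h s" and a: "v < 2 * n" "r < K" "l < L"
  shows "skv l v r h = (\<Sum>i<n. mult v i * aS s (r * n + i) * aU s l i)"
proof -
  let ?m = "\<lambda>i. mult v i * aS s (r * n + i)"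
  have 1: "h 8 (sk v r j) = (\<Sum>i<n. ?m i * (wgt s i * h 1 (i * d + j)))" if "j < d" for j
    using R a that by (simp add: repr_def sketched_def entry_def rowc_def)
  have 2: "h 8 (sk v r (d + l)) = (\<Sum>i<n. ?m i * (wgt s i * (\<Sum>j<d. h 1 (i * d + j) * (h 6 j - h 7 (l * d + j))) - aU s l i))"
    using R a by (simp add: repr_def sketched_def entry_def rowc_def)
  have "(\<Sum>j<d. h 8 (sk v r j) * (h 6 j - h 7 (l * d + j))) =
     (\<Sum>j<d. \<Sum>i<n. ?m i * wgt s i * (h 1 (i * d + j) * (h 6 j - h 7 (l * d + j))))"
    by (intro sum.cong refl) (simp add: 1 sum_distrib_right sum_distrib_left mult_ac)
  also have "\<dots> = (\<Sum>i<n. ?m i * wgt s i * (\<Sum>j<d. h 1 (i * d + j) * (h 6 j - h 7 (l * d + j))))"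
    by (subst sum.swap) (simp add: sum_distrib_left mult_ac)
  finally show ?thesis unfolding skv_def 2
    by (simp add: right_diff_distrib sum_subtractf mult_ac)
qed

lemma nodesH_repr:
  assumes R: "repr thr A h s" and l: "l < L" and m: "m \<le> 2 * n - 1"
  shows "repr thr A (nodesH l h m) s \<and> (\<forall>a. a \<noteq> 11 \<longrightarrow> nodesH l h m a = h a) \<and>
    (\<forall>v\<le>m. 0 < nodesH l h m 11 v \<longleftrightarrow> all_up (test thr s l) v)"
  using m
proof (induction m)
  case 0
  then show ?case using R by (simp add: nodesH_def repr_def all_up.simps)
next
  case (Suc m)
  let ?h = "nodesH l h m"
  have IH: "repr thr A ?h s" "\<forall>a. a \<noteq> 11 \<longrightarrow> ?h a = h a" "\<forall>v\<le>m. 0 < ?h 11 v \<longleftrightarrow> all_up (test thr s l) v"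
    using Suc by auto
  have eq: "nodesH l h (Suc m) = posH l m ?h" by (simp add: nodesH_def)
  have R': "repr thr A (posH l m ?h) s"
    unfolding posH_def using IH(1)
    by (auto simp: repr_def put_apply intro: sketched_cong simp: entry_def rowc_def)
  have sm: "Suc m < 2 * n" using Suc.prems by linarith
  have "0 < (\<Sum>r<K. of_bool (?h 0 0 < (skv l (Suc m) r ?h)\<^sup>2) :: real) \<longleftrightarrow> test thr s l (Suc m)"
  proof -
    have "0 < (\<Sum>r<K. of_bool (?h 0 0 < (skv l (Suc m) r ?h)\<^sup>2) :: real) \<longleftrightarrow> (\<exists>r<K. ?h 0 0 < (skv l (Suc m) r ?h)\<^sup>2)"
      by (auto simp: card_gt_0_iff)
    then show ?thesis using skv_repr[OF IH(1) sm _ l] IH(1) by (auto simp: test_def repr_def)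
  qed
  \<comment> \<open>The parent has a smaller number, so its mark is already final.\<close>
  moreover have "Suc m div 2 \<le> m" by linarith
  ultimately have "0 < posH l m ?h 11 (Suc m) \<longleftrightarrow> all_up (test thr s l) (Suc m)"
    using IH(3) by (subst all_up.simps) (auto simp: posH_def put_apply simp del: sum_of_bool_eq)
  moreover have "\<forall>v\<le>m. posH l m ?h 11 v = ?h 11 v" "\<forall>a. a \<noteq> 11 \<longrightarrow> posH l m ?h a = ?h a"
    by (auto simp: posH_def put_apply)
  ultimately show ?case using IH R' unfolding eq
    by (auto simp: le_Suc_eq)
qed

lemma tested_eq:
  assumes R: "repr thr A h s" and l: "l < L"
  shows "tested l h = card {u. u < 2 * n - 1 \<and> all_up (test thr s l) (Suc u div 2)}"
proof -
  have "(0 < nodesH l h u 11 (Suc u div 2)) = all_up (test thr s l) (Suc u div 2)" if "u < 2 * n - 1" for u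
    using nodesH_repr[OF R l, of u] that by auto
  then show ?thesis unfolding tested_def by (intro arg_cong[of _ _ card]) auto
qed

text \<open>Synchronising a row changes \<open>aB\<close> only, never a window or a sign, so all
  rows can be judged by the state \<open>s\<close> before the loop.\<close>

lemma leavesH_repr:
  assumes R: "repr thr A h s" and l: "l < L" and up: "\<forall>i<n. 0 < h 11 (n + i) \<longleftrightarrow> all_up (test thr s l) (n + i)"
    and nn: "\<forall>i<n. 0 \<le> h 11 (n + i)" and m: "m \<le> n"
  shows "repr thr A (leavesH l h m) (s\<lparr>aB := \<lambda>i. if i < m \<and> hit thr s l i then aX s i else aB s i\<rparr>) \<and>
    (\<forall>a. a \<notin> {0, 4, 5, 8} \<longrightarrow> leavesH l h m a = h a)"
  using m
proof (induction m)
  case 0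
  then show ?case using R by (simp add: leavesH_def)
next
  case (Suc m)
  let ?h = "leavesH l h m" and ?s = "\<lambda>m. s\<lparr>aB := \<lambda>i. if i < m \<and> hit thr s l i then aX s i else aB s i\<rparr>"
  have IH: "repr thr A ?h (?s m)" "\<And>a. a \<notin> {0, 4, 5, 8} \<Longrightarrow> ?h a = h a" using Suc by auto
  have eq: "leavesH l h (Suc m) = leafH l m ?h" by (simp add: leavesH_def)
  have "?h 11 = h 11" using IH(2) by simp
  moreover have "?h 0 0 = thr\<^sup>2" "?h 10 (l * n + m) = aV s l m" using IH(1) l Suc.prems by (auto simp: repr_def)
  moreover have "0 \<le> h 11 (n + m)" using nn Suc.prems by auto
  ultimately have c: "0 < ?h 11 (n + m) + of_bool (?h 0 0 < (?h 10 (l * n + m))\<^sup>2) \<longleftrightarrow> hit thr s l m"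
    using up nn Suc.prems by (auto simp: hit_def intro!: add_nonneg_pos)
  show ?case
  proof (cases "hit thr s l m")
    case True
    have "(?s m)\<lparr>aB := (aB (?s m))(m := aX (?s m) m)\<rparr> = ?s (Suc m)"
      using True by (intro ast.equality) (auto simp: less_Suc_eq fun_eq_iff)
    moreover have "syncH m ?h a = ?h a" if "a \<notin> {0, 4, 5, 8}" for a
      using that by (auto simp: syncH_def rwH_other put_apply)
    ultimately show ?thesis using syncH_repr[OF IH(1), of m] Suc.prems IH(2) True c unfolding eq leafH_def by auto
  next
    case False
    then have "?s (Suc m) = ?s m" by (intro ast.equality) (auto simp: less_Suc_eq fun_eq_iff)
    then show ?thesis using IH False c unfolding eq leafH_def by auto
  qed
qed

lemma synced_eq:
  assumes R: "repr thr A h s" and l: "l < L" and up: "\<forall>i<n. 0 < h 11 (n + i) \<longleftrightarrow> all_up (test thr s l) (n + i)"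
    and nn: "\<forall>i<n. 0 \<le> h 11 (n + i)"
  shows "synced l h = card {i. i < n \<and> hit thr s l i}"
proof -
  have "(0 < leavesH l h i 11 (n + i) + of_bool (leavesH l h i 0 0 < (leavesH l h i 10 (l * n + i))\<^sup>2)) = hit thr s l i"
    if i: "i < n" for i
  proof -
    have "leavesH l h i 11 = h 11" "leavesH l h i 0 0 = thr\<^sup>2" "leavesH l h i 10 (l * n + i) = aV s l i"
      using leavesH_repr[OF R l up nn, of i] i l by (auto simp: repr_def)
    moreover have "0 \<le> h 11 (n + i)" using nn i by auto
    ultimately show ?thesis using up i by (auto simp: hit_def intro!: add_nonneg_pos)
  qed
  then show ?thesis unfolding synced_def by (intro arg_cong[of _ _ card] Collect_cong conj_cong refl)
qed

lemma fold_put_other: "a \<noteq> b \<Longrightarrow> fold (\<lambda>x. put b (f x) (g x)) xs h a = h a"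
  by (induction xs arbitrary: h) (auto simp: put_apply)

lemma fold_put_same: "fold (\<lambda>x. put b (f x) (y :: real)) xs h b z = (if \<exists>x\<in>set xs. f x = z then y else h b z)"
  by (induction xs arbitrary: h) (auto simp: put_apply)

lemma resetH_facts:
  assumes l: "l < L"
  shows "a \<notin> {7, 8, 10} \<Longrightarrow> resetH l h a = h a"
    "l' < L \<Longrightarrow> i < n \<Longrightarrow> resetH l h 10 (l' * n + i) = (if l' = l then 0 else h 10 (l' * n + i))"
    "l' < L \<Longrightarrow> j < d \<Longrightarrow> resetH l h 7 (l' * d + j) = (if l' = l then h 6 j else h 7 (l' * d + j))"
    "v < 2 * n \<Longrightarrow> r < K \<Longrightarrow> c < D1 \<Longrightarrow> resetH l h 8 (sk v r c) = (if c = d + l then 0 else h 8 (sk v r c))"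
proof -
  let ?h1 = "fold (\<lambda>j h. put 7 (l * d + j) (h 6 j) h) [0..<d] h"
  let ?h2 = "\<lambda>m. fold (\<lambda>v. fold (\<lambda>r. put 8 (sk v r (d + l)) 0) [0..<K]) [0..<m] ?h1"
  have 1: "(a \<noteq> 7 \<longrightarrow> fold (\<lambda>j h. put 7 (l * d + j) (h 6 j) h) [0..<m] h a = h a) \<and>
     (fold (\<lambda>j h. put 7 (l * d + j) (h 6 j) h) [0..<m] h 6 = h 6) \<and>
     (l' < L \<longrightarrow> j < d \<longrightarrow> m \<le> d \<longrightarrow> fold (\<lambda>j h. put 7 (l * d + j) (h 6 j) h) [0..<m] h 7 (l' * d + j) =
        (if l' = l \<and> j < m then h 6 j else h 7 (l' * d + j)))" for a m l' j
  proof (induction m)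
    case (Suc m)
    define h' where "h' = fold (\<lambda>j h. put 7 (l * d + j) (h 6 j) h) [0..<m] h"
    have eq: "fold (\<lambda>j h. put 7 (l * d + j) (h 6 j) h) [0..<Suc m] h = put 7 (l * d + m) (h' 6 m) h'"
      by (simp add: h'_def)
    show ?case using Suc unfolding eq unfolding h'_def[symmetric]
      by (auto simp: put_apply ix_inj less_Suc_eq)
  qed simp
  have 2: "(a \<noteq> 8 \<longrightarrow> ?h2 m a = ?h1 a)" for a m
    by (induction m) (auto simp: fold_put_other)
  have 3: "r < K \<Longrightarrow> c < D1 \<Longrightarrow> ?h2 m 8 (sk v r c) = (if c = d + l \<and> v < m then 0 else ?h1 8 (sk v r c))" for m v r c
  proof (induction m)
    case (Suc m)
    have eq: "?h2 (Suc m) = fold (\<lambda>r. put 8 (sk m r (d + l)) 0) [0..<K] (?h2 m)" by simp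
    have "(\<exists>x\<in>set [0..<K]. sk m x (d + l) = sk v r c) \<longleftrightarrow> v = m \<and> c = d + l"
      using Suc.prems l by (auto simp: sk_inj)
    then show ?case using Suc unfolding eq fold_put_same by auto
  qed simp
  have r: "resetH l h = fold (\<lambda>i. put 10 (l * n + i) 0) [0..<n] (?h2 (2 * n))" by (simp add: resetH_def)
  show "a \<notin> {7, 8, 10} \<Longrightarrow> resetH l h a = h a"
    using 1[of a d] 2[of a "2 * n"] by (simp add: r fold_put_other)
  show "l' < L \<Longrightarrow> i < n \<Longrightarrow> resetH l h 10 (l' * n + i) = (if l' = l then 0 else h 10 (l' * n + i))"
  proof -
    assume a: "l' < L" "i < n"
    have "(\<exists>x\<in>set [0..<n]. l * n + x = l' * n + i) \<longleftrightarrow> l' = l" using a by (auto simp: ix_inj)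
    then show ?thesis using 1[of 10 d] 2[of 10 "2 * n"] unfolding r fold_put_same by auto
  qed
  show "l' < L \<Longrightarrow> j < d \<Longrightarrow> resetH l h 7 (l' * d + j) = (if l' = l then h 6 j else h 7 (l' * d + j))"
    using 1[of 7 d l' j] 2[of 7 "2 * n"] unfolding r by (simp add: fold_put_other)
  show "v < 2 * n \<Longrightarrow> r < K \<Longrightarrow> c < D1 \<Longrightarrow> resetH l h 8 (sk v r c) = (if c = d + l then 0 else h 8 (sk v r c))"
    using 1[of 8 d] 3[of r c "2 * n" v] unfolding r by (simp add: fold_put_other)
qed

lemma resetH_repr:
  assumes R: "repr thr A h s" and l: "l < L"
  shows "repr thr A (resetH l h) (s\<lparr>aU := (aU s)(l := \<lambda>_. 0), aV := (aV s)(l := \<lambda>_. 0)\<rparr>)"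
proof -
  let ?s = "s\<lparr>aU := (aU s)(l := \<lambda>_. 0), aV := (aV s)(l := \<lambda>_. 0)\<rparr>"
  note f = resetH_facts[OF l]
  have "sketched (aS s) (wgt s) ((aU s)(l := \<lambda>_. 0)) (resetH l h)"
    unfolding sketched_def
  proof (intro allI impI)
    fix v r c assume a: "v < 2 * n" "r < K" "c < D1"
    show "resetH l h 8 (sk v r c) = (\<Sum>i<n. mult v i * aS s (r * n + i) * entry (wgt s) ((aU s)(l := \<lambda>_. 0)) (resetH l h) i c)"
    proof (cases "c = d + l")
      case True
      then have "entry (wgt s) ((aU s)(l := \<lambda>_. 0)) (resetH l h) i c = 0" for i
        using f l by (simp add: entry_def rowc_def)
      then show ?thesis using True f a by simp
    next
      case False
      have "entry (wgt s) ((aU s)(l := \<lambda>_. 0)) (resetH l h) i c = entry (wgt s) (aU s) h i c" for i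
        using f False a by (auto simp: entry_def rowc_def)
      then show ?thesis using False f a R by (simp add: repr_def sketched_def)
    qed
  qed
  moreover have "wgt ?s = wgt s" by (auto simp: wgt_def)
  ultimately show ?thesis using R f by (auto simp: repr_def)
qed

lemma checkH_repr:
  assumes R: "repr thr A h s" and l: "l < L"
  shows "repr thr A (checkH l h) (checkA thr l s)"
    and "tested l h = card {u. u < 2 * n - 1 \<and> all_up (test thr s l) (Suc u div 2)}"
    and "synced l (nodesH l h (2 * n - 1)) = card {i. i < n \<and> hit thr s l i}"
proof -
  let ?h = "nodesH l h (2 * n - 1)"
  have N: "repr thr A ?h s" "\<forall>v\<le>2 * n - 1. 0 < ?h 11 v \<longleftrightarrow> all_up (test thr s l) v"
    using nodesH_repr[OF R l order_refl] by auto
  have up: "\<forall>i<n. 0 < ?h 11 (n + i) \<longleftrightarrow> all_up (test thr s l) (n + i)" using N(2) by auto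
  have nn0: "v \<le> m \<Longrightarrow> 0 \<le> nodesH l h m 11 v" for m v
  proof (induction m)
    case 0
    then show ?case using R by (simp add: nodesH_def repr_def)
  next
    case (Suc m)
    have "nodesH l h (Suc m) = posH l m (nodesH l h m)" by (simp add: nodesH_def)
    then show ?case using Suc by (auto simp: posH_def put_apply le_Suc_eq intro!: sum_nonneg)
  qed
  have nn: "\<forall>i<n. 0 \<le> ?h 11 (n + i)" using nn0 by auto
  have le: "repr thr A (leavesH l ?h n) (s\<lparr>aB := \<lambda>i. if i < n \<and> hit thr s l i then aX s i else aB s i\<rparr>)"
    using leavesH_repr[OF N(1) l up nn order_refl] by simp
  have "repr thr A (checkH l h) (s\<lparr>aB := \<lambda>i. if i < n \<and> hit thr s l i then aX s i else aB s i,
      aU := (aU s)(l := \<lambda>_. 0), aV := (aV s)(l := \<lambda>_. 0)\<rparr>)"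
    using resetH_repr[OF le l] by (simp add: checkH_def)
  moreover have "repr thr A g (s\<lparr>aB := \<lambda>i. if i < n \<and> hit thr s l i then aX s i else aB s i, aU := U, aV := V'\<rparr>) \<longleftrightarrow>
     repr thr A g (s\<lparr>aB := \<lambda>i. if hit thr s l i then aX s i else aB s i, aU := U, aV := V'\<rparr>)" for g U V'
  proof -
    have "sketched \<sigma> wt U g \<longleftrightarrow> sketched \<sigma> wt' U g" if "\<And>i. i < n \<Longrightarrow> wt i = wt' i" for \<sigma> wt wt' U
      using that by (auto simp: sketched_def entry_def)
    from this[of "wgt (s\<lparr>aB := \<lambda>i. if i < n \<and> hit thr s l i then aX s i else aB s i, aU := U, aV := V'\<rparr>)"
       "wgt (s\<lparr>aB := \<lambda>i. if hit thr s l i then aX s i else aB s i, aU := U, aV := V'\<rparr>)"]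
    show ?thesis by (simp add: repr_def wgt_def)
  qed
  ultimately show "repr thr A (checkH l h) (checkA thr l s)" by (simp add: checkA_def)
  show "tested l h = card {u. u < 2 * n - 1 \<and> all_up (test thr s l) (Suc u div 2)}" by (rule tested_eq[OF R l])
  show "synced l ?h = card {i. i < n \<and> hit thr s l i}" by (rule synced_eq[OF N(1) l up nn])
qed

text \<open>The levels do not interact: a check reads and clears only the windows of its own level,
  and every synchronisation writes the same \<open>aX\<close>. Hence this closed form for running
  the checks in sequence.\<close>

definition levelsA :: "real \<Rightarrow> nat \<Rightarrow> ast \<Rightarrow> nat \<Rightarrow> ast" where
  "levelsA thr t s m = s\<lparr>aB := \<lambda>i. if \<exists>l<m. 2 ^ l dvd t \<and> hit thr s l i then aX s i else aB s i,
     aU := \<lambda>l. if l < m \<and> 2 ^ l dvd t then \<lambda>_. 0 else aU s l,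
     aV := \<lambda>l. if l < m \<and> 2 ^ l dvd t then \<lambda>_. 0 else aV s l\<rparr>"

definition tested_count :: "real \<Rightarrow> ast \<Rightarrow> nat \<Rightarrow> nat" where
  "tested_count thr s l = card {u. u < 2 * n - 1 \<and> all_up (test thr s l) (Suc u div 2)}"

definition hit_count :: "real \<Rightarrow> ast \<Rightarrow> nat \<Rightarrow> nat" where
  "hit_count thr s l = card {i. i < n \<and> hit thr s l i}"

definition levels_costA :: "real \<Rightarrow> nat \<Rightarrow> ast \<Rightarrow> nat" where
  "levels_costA thr t s = (\<Sum>l<L. of_bool (2 ^ l dvd t) *
     (500 * (n * K) + 130 * K * d * tested_count thr s l + 600 * X * hit_count thr s l))"

lemma test_cong: "aS s' = aS s \<Longrightarrow> aU s' l = aU s l \<Longrightarrow> test thr s' l = test thr s l"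
  by (simp add: test_def fun_eq_iff)

lemma hit_cong: "aS s' = aS s \<Longrightarrow> aU s' l = aU s l \<Longrightarrow> aV s' l = aV s l \<Longrightarrow> hit thr s' l = hit thr s l"
  by (rule ext) (simp add: hit_def test_cong[of s' s l thr])

lemma levelsH_repr:
  assumes R: "repr thr A h s" and "m \<le> L"
  shows "repr thr A (levelsH t h m) (levelsA thr t s m)"
  using assms(2)
proof (induction m)
  case 0
  then show ?case using R by (simp add: levelsH_def levelsA_def)
next
  case (Suc m)
  let ?s = "levelsA thr t s m"
  have hc: "hit thr ?s m = hit thr s m" by (rule hit_cong) (simp_all add: levelsA_def)
  have "levelsA thr t s (Suc m) = (if 2 ^ m dvd t then checkA thr m ?s else ?s)"
    unfolding checkA_def hc by (auto simp: levelsA_def less_Suc_eq fun_eq_iff intro!: ast.equality)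
  moreover have "levelsH t h (Suc m) = levelH t m (levelsH t h m)" by (simp add: levelsH_def)
  ultimately show ?case using Suc checkH_repr(1)[OF _ , of thr A "levelsH t h m" ?s m]
    by (auto simp: levelH_def dvd_eq_mod_eq_0)
qed

lemma levels_cost_eq:
  assumes R: "repr thr A h s"
  shows "levels_cost t h = levels_costA thr t s"
  unfolding levels_cost_def levels_costA_def
proof (rule sum.cong[OF refl])
  fix l assume "l \<in> {..<L}"
  then have l: "l < L" "l \<le> L" by auto
  let ?s = "levelsA thr t s l"
  have "hit thr ?s l = hit thr s l" "test thr ?s l = test thr s l"
    by (intro hit_cong test_cong; simp add: levelsA_def)+
  then show "of_bool (t mod 2 ^ l = 0) * check_cost l (levelsH t h l) = of_bool (2 ^ l dvd t) *
     (500 * (n * K) + 130 * K * d * tested_count thr s l + 600 * X * hit_count thr s l)"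
    using checkH_repr(2,3)[OF levelsH_repr[OF R l(2)] l(1)]
    by (simp add: check_cost_def tested_count_def hit_count_def dvd_eq_mod_eq_0)
qed

text \<open>By \<open>loc\<close>, round \<open>i\<close> looks at array \<open>b\<close> only in
  the cell that it writes; as the cells are distinct, every round sees original values.\<close>

lemma fold_put_local:
  assumes inj: "inj_on f {..<m}"
    and loc: "\<And>i h h'. (\<And>a. a \<noteq> b \<Longrightarrow> h' a = h a) \<Longrightarrow> h' b (f i) = h b (f i) \<Longrightarrow> G i h' = G i h"
  shows "a \<noteq> b \<Longrightarrow> fold (\<lambda>i h. put b (f i) (G i h) h) [0..<m] h a = h a"
    and "i < m \<Longrightarrow> fold (\<lambda>i h. put b (f i) (G i h) h) [0..<m] h b (f i) = G i h"
    and "(\<And>i. i < m \<Longrightarrow> f i \<noteq> z) \<Longrightarrow> fold (\<lambda>i h. put b (f i) (G i h) h) [0..<m] h b z = h b z"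
proof -
  let ?F = "\<lambda>m. fold (\<lambda>i h. put b (f i) (G i h) h) [0..<m] h"
  have "k \<le> m \<Longrightarrow> (\<forall>a. a \<noteq> b \<longrightarrow> ?F k a = h a) \<and> (\<forall>i<k. ?F k b (f i) = G i h) \<and>
     (\<forall>z. (\<forall>i<k. f i \<noteq> z) \<longrightarrow> ?F k b z = h b z)" for k
  proof (induction k)
    case (Suc k)
    define h' where "h' = ?F k"
    have IH: "\<And>a. a \<noteq> b \<Longrightarrow> h' a = h a" "\<And>i. i < k \<Longrightarrow> h' b (f i) = G i h"
       "\<And>z. (\<And>i. i < k \<Longrightarrow> f i \<noteq> z) \<Longrightarrow> h' b z = h b z" using Suc by (auto simp: h'_def)
    have ne: "f i \<noteq> f k" if "i < k" for i using inj_onD[OF inj, of i k] that Suc.prems by auto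
    have "G k h' = G k h" by (rule loc) (use IH ne in auto)
    moreover have eq: "?F (Suc k) = put b (f k) (G k h') h'" by (simp add: h'_def)
    ultimately show ?case unfolding eq using IH ne
      by (auto simp: put_apply less_Suc_eq)
  qed simp
  from this[of m] show "a \<noteq> b \<Longrightarrow> ?F m a = h a" "i < m \<Longrightarrow> ?F m b (f i) = G i h"
    "(\<And>i. i < m \<Longrightarrow> f i \<noteq> z) \<Longrightarrow> ?F m b z = h b z" by auto
qed

lemma absorbH_facts:
  shows "a \<notin> {3, 6, 10} \<Longrightarrow> absorbH u h a = h a"
    "j < d \<Longrightarrow> absorbH u h 6 j = h 6 j + u j"
    "i < n \<Longrightarrow> absorbH u h 3 i = h 3 i + u (d + i)"
    "l < L \<Longrightarrow> i < n \<Longrightarrow> absorbH u h 10 (l * n + i) = h 10 (l * n + i) + u (d + i) / h 4 i"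
proof -
  define h1 where "h1 = fold (\<lambda>j h. put 6 j (h 6 j + u j) h) [0..<d] h"
  have h1: "\<And>a. a \<noteq> 6 \<Longrightarrow> h1 a = h a" "\<And>j. j < d \<Longrightarrow> h1 6 j = h 6 j + u j"
    using fold_put_local[of "\<lambda>j. j" d 6 "\<lambda>j h. h 6 j + u j"] by (auto simp: h1_def)
  define h2 where "h2 = fold (\<lambda>i h. put 3 i (h 3 i + u (d + i)) h) [0..<n] h1"
  have h2: "\<And>a. a \<noteq> 3 \<Longrightarrow> h2 a = h1 a" "\<And>i. i < n \<Longrightarrow> h2 3 i = h1 3 i + u (d + i)"
    using fold_put_local[of "\<lambda>j. j" n 3 "\<lambda>i h. h 3 i + u (d + i)"] by (auto simp: h2_def)
  let ?g = "\<lambda>l. fold (\<lambda>i h. put 10 (l * n + i) (h 10 (l * n + i) + u (d + i) / h 4 i) h) [0..<n]"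
  have g: "?g l h a = h a" if "a \<noteq> 10" for l h a
    by (rule fold_put_local) (use that in \<open>auto simp: inj_on_def\<close>)
  have g1: "?g l h 10 (l * n + i) = h 10 (l * n + i) + u (d + i) / h 4 i" if "i < n" for l h i
    using fold_put_local(2)[of "\<lambda>i. l * n + i" n 10 "\<lambda>i h. h 10 (l * n + i) + u (d + i) / h 4 i" i h] that
    by (auto simp: inj_on_def)
  have g2: "?g l h 10 (l' * n + i) = h 10 (l' * n + i)" if "i < n" "l \<noteq> l'" for l l' h i
    using fold_put_local(3)[of "\<lambda>i. l * n + i" n 10 "\<lambda>i h. h 10 (l * n + i) + u (d + i) / h 4 i" "l' * n + i" h] that
    by (auto simp: inj_on_def ix_inj)
  have 3: "(\<forall>a. a \<noteq> 10 \<longrightarrow> fold ?g [0..<m] h2 a = h2 a) \<and>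
     (\<forall>l i. i < n \<longrightarrow> fold ?g [0..<m] h2 10 (l * n + i) = h2 10 (l * n + i) + (if l < m then u (d + i) / h2 4 i else 0))" for m
  proof (induction m)
    case (Suc m)
    define h' where "h' = fold ?g [0..<m] h2"
    have eq: "fold ?g [0..<Suc m] h2 = ?g m h'" by (simp add: h'_def)
    have IH: "\<And>a. a \<noteq> 10 \<Longrightarrow> h' a = h2 a"
      "\<And>l i. i < n \<Longrightarrow> h' 10 (l * n + i) = h2 10 (l * n + i) + (if l < m then u (d + i) / h2 4 i else 0)"
      using Suc by (auto simp: h'_def)
    show ?case unfolding eq
    proof (intro conjI allI impI)
      show "?g m h' a = h2 a" if "a \<noteq> 10" for a using g[OF that] IH(1)[OF that] by simp
      show "?g m h' 10 (l * n + i) = h2 10 (l * n + i) + (if l < Suc m then u (d + i) / h2 4 i else 0)" if "i < n" for l i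
        using g1[OF that, of m h'] g2[OF that, of m l h'] IH that by (cases "l = m") (auto simp: less_Suc_eq)
    qed
  qed simp
  have e: "absorbH u h = fold ?g [0..<L] h2" by (simp add: absorbH_def h1_def h2_def)
  show "a \<notin> {3, 6, 10} \<Longrightarrow> absorbH u h a = h a" "j < d \<Longrightarrow> absorbH u h 6 j = h 6 j + u j"
    "i < n \<Longrightarrow> absorbH u h 3 i = h 3 i + u (d + i)"
    "l < L \<Longrightarrow> i < n \<Longrightarrow> absorbH u h 10 (l * n + i) = h 10 (l * n + i) + u (d + i) / h 4 i"
    using 3[of L] h1 h2 unfolding e by auto
qed

text \<open>No sketch has to change: adding \<open>u\<close> to the sum of the \<open>h\<close>
  raises the weighted window and \<open>aU\<close> by the same amount, so every \<open>entry\<close>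
  stays.\<close>

lemma absorbH_repr:
  assumes R: "repr thr A h s"
  shows "repr thr A (absorbH u h) (absorbA A u (\<lambda>i. u (d + i)) s)"
proof -
  let ?s = "absorbA A u (\<lambda>i. u (d + i)) s" and ?h = "absorbH u h"
  note f = absorbH_facts[where u = u and h = h]
  have "entry (wgt ?s) (aU ?s) ?h i c = entry (wgt s) (aU s) h i c" if "i < n" "c < D1" for i c
  proof (cases "c < d")
    case True
    then show ?thesis using f(1) by (simp add: entry_def rowc_def wgt_def absorbA_def)
  next
    case False
    have "(\<Sum>j<d. h 1 (i * d + j) * (?h 6 j - h 7 ((c - d) * d + j))) =
      (\<Sum>j<d. h 1 (i * d + j) * (h 6 j - h 7 ((c - d) * d + j))) + (\<Sum>j<d. A i j * u j)"
      unfolding sum.distrib[symmetric]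
      by (intro sum.cong refl) (use R that f(2) in \<open>auto simp: repr_def algebra_simps\<close>)
    then show ?thesis using False f(1)
      by (simp add: entry_def rowc_def wgt_def absorbA_def algebra_simps)
  qed
  note E = this
  have "sketched (aS ?s) (wgt ?s) (aU ?s) ?h"
    by (rule sketched_cong[where h = h and wt = "wgt s" and U = "aU s" and \<sigma> = "aS s", OF _ _ E])
      (use R f(1) in \<open>auto simp: repr_def absorbA_def\<close>)
  moreover have "(\<Sum>j<d. A i j * ?h 6 j) = (\<Sum>j<d. A i j * h 6 j) + (\<Sum>j<d. A i j * u j)" for i
    unfolding sum.distrib[symmetric] by (intro sum.cong refl) (use f(2) in \<open>auto simp: algebra_simps\<close>)
  moreover have "wgt ?s = wgt s" by (auto simp: wgt_def absorbA_def)
  ultimately show ?thesis using R f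
    by (auto simp: repr_def absorbA_def algebra_simps)
qed

lemma clearH_facts:
  shows "a \<notin> {4, 5, 7, 8, 10} \<Longrightarrow> clearH h a = h a"
    "i < n \<Longrightarrow> clearH h 5 i = 0" "i < n \<Longrightarrow> clearH h 4 i = h 3 i + h 2 i * (\<Sum>j<d. h 1 (i * d + j) * h 6 j)"
    "l < L \<Longrightarrow> j < d \<Longrightarrow> clearH h 7 (l * d + j) = h 6 j" "x < M \<Longrightarrow> clearH h 8 x = 0"
    "x < L * n \<Longrightarrow> clearH h 10 x = 0"
proof -
  define h1 where "h1 = fold (\<lambda>x. put 8 x 0) [0..<M] h"
  have h1: "\<And>a. a \<noteq> 8 \<Longrightarrow> h1 a = h a" "\<And>x. x < M \<Longrightarrow> h1 8 x = 0"
    by (simp add: h1_def fold_put_other, simp add: h1_def fold_put_same)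
  define h2 where "h2 = fold (\<lambda>x. put 10 x 0) [0..<L * n] h1"
  have h2: "\<And>a. a \<noteq> 10 \<Longrightarrow> h2 a = h1 a" "\<And>x. x < L * n \<Longrightarrow> h2 10 x = 0"
    by (simp add: h2_def fold_put_other, simp add: h2_def fold_put_same)
  let ?g = "\<lambda>l. fold (\<lambda>j h. put 7 (l * d + j) (h 6 j) h) [0..<d]"
  have g: "?g l h a = h a" if "a \<noteq> 7" for l h a
    by (rule fold_put_local) (use that in \<open>auto simp: inj_on_def\<close>)
  have g1: "?g l h 7 (l * d + j) = h 6 j" if "j < d" for l h j
    using fold_put_local(2)[of "\<lambda>j. l * d + j" d 7 "\<lambda>j h. h 6 j" j h] that by (auto simp: inj_on_def)
  have g2: "?g l h 7 (l' * d + j) = h 7 (l' * d + j)" if "j < d" "l \<noteq> l'" for l l' h j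
    using fold_put_local(3)[of "\<lambda>j. l * d + j" d 7 "\<lambda>j h. h 6 j" "l' * d + j" h] that
    by (auto simp: inj_on_def ix_inj)
  have 3: "(\<forall>a. a \<noteq> 7 \<longrightarrow> fold ?g [0..<m] h2 a = h2 a) \<and> (\<forall>l<m. \<forall>j<d. fold ?g [0..<m] h2 7 (l * d + j) = h2 6 j)" for m
  proof (induction m)
    case (Suc m)
    define h' where "h' = fold ?g [0..<m] h2"
    have eq: "fold ?g [0..<Suc m] h2 = ?g m h'" by (simp add: h'_def)
    have IH: "\<And>a. a \<noteq> 7 \<Longrightarrow> h' a = h2 a" "\<And>l j. l < m \<Longrightarrow> j < d \<Longrightarrow> h' 7 (l * d + j) = h2 6 j"
      using Suc by (auto simp: h'_def)
    show ?case unfolding eq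
    proof (intro conjI allI impI)
      show "?g m h' a = h2 a" if "a \<noteq> 7" for a using g[OF that] IH(1)[OF that] by simp
      show "?g m h' 7 (l * d + j) = h2 6 j" if "l < Suc m" "j < d" for l j
        using g1[OF that(2), of m h'] g2[OF that(2), of m l h'] IH that by (cases "l = m") (auto simp: less_Suc_eq)
    qed
  qed simp
  define h3 where "h3 = fold ?g [0..<L] h2"
  have h3: "\<And>a. a \<noteq> 7 \<Longrightarrow> h3 a = h2 a" "\<And>l j. l < L \<Longrightarrow> j < d \<Longrightarrow> h3 7 (l * d + j) = h2 6 j"
    using 3[of L] by (auto simp: h3_def)
  let ?e = "\<lambda>h i. h 3 i + h 2 i * (\<Sum>j<d. h 1 (i * d + j) * h 6 j)"
  let ?F = "\<lambda>m. fold (\<lambda>i h. put 5 i 0 (put 4 i (?e h i) h)) [0..<m] h3"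
  have 4: "(\<forall>a. a \<notin> {4, 5} \<longrightarrow> ?F m a = h3 a) \<and> (\<forall>i<m. ?F m 5 i = 0 \<and> ?F m 4 i = ?e h3 i)" for m
  proof (induction m)
    case (Suc m)
    define h' where "h' = ?F m"
    have eq: "?F (Suc m) = put 5 m 0 (put 4 m (?e h' m) h')" by (simp add: h'_def)
    have IH: "\<And>a. a \<notin> {4, 5} \<Longrightarrow> h' a = h3 a" "\<And>i. i < m \<Longrightarrow> h' 5 i = 0 \<and> h' 4 i = ?e h3 i"
      using Suc by (auto simp: h'_def)
    show ?case unfolding eq using IH by (auto simp: put_apply less_Suc_eq)
  qed simp
  have e: "clearH h = ?F n" by (simp add: clearH_def h1_def h2_def h3_def)
  have F: "\<And>a. a \<notin> {4, 5} \<Longrightarrow> clearH h a = h3 a" "\<And>i. i < n \<Longrightarrow> clearH h 5 i = 0 \<and> clearH h 4 i = ?e h3 i"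
    using 4[of n] by (auto simp: e)
  show "a \<notin> {4, 5, 7, 8, 10} \<Longrightarrow> clearH h a = h a"
    "i < n \<Longrightarrow> clearH h 5 i = 0" "i < n \<Longrightarrow> clearH h 4 i = ?e h i"
    "l < L \<Longrightarrow> j < d \<Longrightarrow> clearH h 7 (l * d + j) = h 6 j" "x < M \<Longrightarrow> clearH h 8 x = 0"
    "x < L * n \<Longrightarrow> clearH h 10 x = 0"
    using F h1 h2 h3 by auto
qed

lemma reweight_all_sketched:
  assumes S: "sketched \<sigma> (\<lambda>_. 0) U h" and 5: "\<And>i. i < n \<Longrightarrow> h 5 i = 0" and \<sigma>: "\<forall>x<K*n. h 9 x = \<sigma> x"
  shows "sketched \<sigma> (\<lambda>i. if i < n then h 2 i / h 4 i else 0) U (reweight_allH h)"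
    and "a \<notin> {0, 5, 8} \<Longrightarrow> reweight_allH h a = h a" "reweight_allH h 0 0 = h 0 0"
    and "i < n \<Longrightarrow> reweight_allH h 5 i = h 2 i / h 4 i"
proof -
  let ?F = "\<lambda>m. fold rwH [0..<m] h" and ?w = "\<lambda>m i. if i < m then h 2 i / h 4 i else 0"
  have "m \<le> n \<Longrightarrow> sketched \<sigma> (?w m) U (?F m) \<and> (\<forall>a. a \<notin> {0, 5, 8} \<longrightarrow> ?F m a = h a) \<and> ?F m 0 0 = h 0 0 \<and>
     (\<forall>i<n. ?F m 5 i = ?w m i)" for m
  proof (induction m)
    case 0
    then show ?case using S 5 by simp
  next
    case (Suc m)
    define h' where "h' = ?F m"
    have IH: "sketched \<sigma> (?w m) U h'" "\<And>a. a \<notin> {0, 5, 8} \<Longrightarrow> h' a = h a" "h' 0 0 = h 0 0" "\<And>i. i < n \<Longrightarrow> h' 5 i = ?w m i"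
      using Suc by (auto simp: h'_def)
    have eq: "?F (Suc m) = rwH m h'" by (simp add: h'_def)
    have m: "m < n" using Suc.prems by simp
    have "(?w m)(m := h' 2 m / h' 4 m) = ?w (Suc m)" using IH(2) by (auto simp: less_Suc_eq fun_eq_iff)
    moreover have "sketched \<sigma> ((?w m)(m := h' 2 m / h' 4 m)) U (rwH m h')"
      by (rule rwH_sketched[OF m IH(1)]) (use IH m \<sigma> in auto)
    ultimately have "sketched \<sigma> (?w (Suc m)) U (rwH m h')" by metis
    moreover have "\<forall>i<n. rwH m h' 5 i = ?w (Suc m) i" using IH(2,4) by (auto simp: rwH_5 less_Suc_eq)
    moreover have "\<forall>a. a \<notin> {0, 5, 8} \<longrightarrow> rwH m h' a = h a" using IH(2) rwH_other by simp
    ultimately show ?case using IH(3) unfolding eq by (simp only: rwH_0 simp_thms)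
  qed
  from this[of n] show "sketched \<sigma> (\<lambda>i. if i < n then h 2 i / h 4 i else 0) U (reweight_allH h)"
    "a \<notin> {0, 5, 8} \<Longrightarrow> reweight_allH h a = h a" "reweight_allH h 0 0 = h 0 0"
    "i < n \<Longrightarrow> reweight_allH h 5 i = h 2 i / h 4 i" by (auto simp: reweight_allH_def)
qed

lemma rebuild_repr:
  assumes R: "repr thr A h s"
  shows "repr thr A (reweight_allH (with_signs (clearH h) (K * n) f)) (rebuildA f s)"
proof -
  let ?h = "with_signs (clearH h) (K * n) f" and ?s = "rebuildA f s"
  have o: "a \<noteq> 9 \<Longrightarrow> ?h a = clearH h a" "x < K * n \<Longrightarrow> ?h 9 x = f x" for a x by (auto simp: with_signs_def)
  have x: "h 3 i + h 2 i * (\<Sum>j<d. h 1 (i * d + j) * h 6 j) = aX s i" if "i < n" for i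
    using R that by (simp add: repr_def)
  note c = clearH_facts[where h = h]
  have c10: "clearH h 10 (l * n + i) = 0" if "l < L" "i < n" for l i using c(6) ix2_less[OF that] by simp
  have rc: "rowc ?h i c = 0" if "d \<le> c" "c < D1" for i c
    using that c(1,4) o(1) by (auto simp: rowc_def)
  have "?h 8 (sk v r c) = 0" if "v < 2 * n" "r < K" "c < D1" for v r c
    using c(5) cell_less[OF that] o(1) by (simp add: sk_def)
  \<comment> \<open>Zero sketches are correct for zero weights and empty windows, whatever the new
    signs are.\<close>
  then have S: "sketched f (\<lambda>_. 0) (\<lambda>_ _. 0) ?h"
    by (auto simp: sketched_def entry_def)
  have \<sigma>: "\<forall>x<K*n. ?h 9 x = f x" and h5: "\<And>i. i < n \<Longrightarrow> ?h 5 i = 0" using o c by auto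
  note r = reweight_all_sketched[OF S h5 \<sigma>]
  have w: "(if i < n then ?h 2 i / ?h 4 i else 0) = wgt ?s i" if "i < n" for i
    using that o(1) c(1,3) x R by (simp add: wgt_def rebuildA_def repr_def)
  have "sketched (aS ?s) (wgt ?s) (aU ?s) (reweight_allH ?h)"
    by (rule sketched_cong[OF r(1)]) (use w in \<open>simp_all add: entry_def rebuildA_def\<close>)
  then show ?thesis using R r(2-) o c x c10
    by (auto simp: repr_def rebuildA_def wgt_def)
qed

text \<open>The offset in array 3 compensates the new scaling, so \<open>x\<close> is unchanged; the
  windows keep what was accumulated with the old one.\<close>

lemma scaleH_repr:
  assumes R: "repr thr A h s" and i: "i < n"
  shows "repr thr A (scaleH i u h) (s\<lparr>aG := (aG s)(i := u)\<rparr>)"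
proof -
  let ?h = "put 2 i u (put 3 i (h 3 i + (h 2 i - u) * (\<Sum>j<d. h 1 (i * d + j) * h 6 j)) h)"
  let ?s = "s\<lparr>aG := (aG s)(i := u)\<rparr>"
  have S: "sketched (aS s) (wgt s) (aU s) ?h"
    by (rule sketched_cong[where h = h and wt = "wgt s" and U = "aU s" and \<sigma> = "aS s"])
      (use R in \<open>auto simp: repr_def put_apply entry_def rowc_def\<close>)
  have "sketched (aS s) ((wgt s)(i := ?h 2 i / ?h 4 i)) (aU s) (rwH i ?h)"
    by (rule rwH_sketched[OF i S]) (use R i in \<open>auto simp: repr_def put_apply\<close>)
  moreover have "(wgt s)(i := ?h 2 i / ?h 4 i) = wgt ?s" using R i by (auto simp: wgt_def put_apply repr_def)
  ultimately have "sketched (aS s) (wgt ?s) (aU s) (scaleH i u h)" by (simp add: scaleH_def)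
  then show ?thesis using R i
    by (auto simp: repr_def scaleH_def rwH_other rwH_0 rwH_5 put_apply wgt_def algebra_simps)
qed

definition startA :: "(nat \<Rightarrow> real) \<Rightarrow> (nat \<Rightarrow> real) \<Rightarrow> (nat \<Rightarrow> real) \<Rightarrow> ast" where
  "startA g x f = \<lparr>aX = x, aG = g, aB = x, aU = \<lambda>_ _. 0, aV = \<lambda>_ _. 0, aT = 0, aS = f\<rparr>"

lemma init_repr:
  assumes ent: "\<And>e. e < len \<Longrightarrow> fst inp (2 * e + 3) < n \<and> fst inp (2 * e + 4) < d"
    and val: "\<And>e. e < len \<Longrightarrow> A (fst inp (2 * e + 3)) (fst inp (2 * e + 4)) = snd inp (2 * n + 1 + e)"
    and inj: "inj_on (\<lambda>e. (fst inp (2 * e + 3), fst inp (2 * e + 4))) {..<len}"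
    and all: "\<And>i j. i < n \<Longrightarrow> j < d \<Longrightarrow> A i j \<noteq> 0 \<Longrightarrow> \<exists>e<len. fst inp (2 * e + 3) = i \<and> fst inp (2 * e + 4) = j"
    and thr: "snd inp 0 / (8 * real L) = thr"
  shows "repr thr A (fold (init_entryH inp) [0..<len] (with_signs (init_rowsH (snd inp) (\<lambda>_ _. 0)) (K * n) f))
    (startA (\<lambda>i. snd inp (1 + i)) (\<lambda>i. snd inp (1 + n + i)) f)"
proof -
  let ?u = "snd inp" and ?z = "\<lambda>_ _. 0 :: real" and ?wt = "\<lambda>i. snd inp (1 + i) / snd inp (1 + n + i)"
  let ?i = "\<lambda>e. fst inp (2 * e + 3)" and ?j = "\<lambda>e. fst inp (2 * e + 4)" and ?x = "\<lambda>e. snd inp (2 * n + 1 + e)"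
  define h0 where "h0 = put 11 0 1 (put 0 0 (thr\<^sup>2) ?z)"
  let ?R = "\<lambda>m. fold (init_rowH ?u) [0..<m] h0"
  have rows: "(\<forall>a. a \<notin> {2, 3, 4, 5} \<longrightarrow> ?R m a = h0 a) \<and> (\<forall>i<m. ?R m 2 i = ?u (1 + i) \<and> ?R m 3 i = ?u (1 + n + i) \<and>
     ?R m 4 i = ?u (1 + n + i) \<and> ?R m 5 i = ?wt i)" for m
  proof (induction m)
    case (Suc m)
    define h' where "h' = ?R m"
    have eq: "?R (Suc m) = init_rowH ?u m h'" by (simp add: h'_def)
    show ?case using Suc unfolding eq unfolding h'_def[symmetric] by (auto simp: init_rowH_def put_apply less_Suc_eq)
  qed simp
  define h1 where "h1 = with_signs (?R n) (K * n) f"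
  have h1: "\<And>a. a \<notin> {0, 2, 3, 4, 5, 9, 11} \<Longrightarrow> h1 a = (\<lambda>_. 0)" "h1 0 0 = thr\<^sup>2" "h1 11 0 = 1"
     "\<And>x. x < K * n \<Longrightarrow> h1 9 x = f x" "\<And>i. i < n \<Longrightarrow> h1 2 i = ?u (1 + i) \<and> h1 3 i = ?u (1 + n + i) \<and>
     h1 4 i = ?u (1 + n + i) \<and> h1 5 i = ?wt i"
    using rows[of n] by (auto simp: h1_def with_signs_def h0_def put_apply fun_eq_iff)
  let ?F = "\<lambda>m. fold (init_entryH inp) [0..<m] h1"
  have main: "m \<le> len \<Longrightarrow> (\<forall>a. a \<notin> {0, 1, 8} \<longrightarrow> ?F m a = h1 a) \<and> ?F m 0 0 = thr\<^sup>2 \<and>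
     (\<forall>i<n. \<forall>j<d. ?F m 1 (i * d + j) = (if \<exists>e<m. ?i e = i \<and> ?j e = j then A i j else 0)) \<and>
     sketched f ?wt ?z (?F m)" for m
  proof (induction m)
    case 0
    have "sketched f ?wt ?z h1" using h1(1) by (simp add: sketched_def entry_def rowc_def)
    then show ?case using h1 by simp
  next
    case (Suc m)
    define h' where "h' = ?F m"
    have IH: "\<And>a. a \<notin> {0, 1, 8} \<Longrightarrow> h' a = h1 a" "h' 0 0 = thr\<^sup>2" "sketched f ?wt ?z h'"
      "\<And>i j. i < n \<Longrightarrow> j < d \<Longrightarrow> h' 1 (i * d + j) = (if \<exists>e<m. ?i e = i \<and> ?j e = j then A i j else 0)"
      using Suc by (auto simp: h'_def)
    have m: "m < len" using Suc.prems by simp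
    let ?im = "?i m" and ?jm = "?j m"
    have im: "?im < n" "?jm < d" "?jm < D1" using ent[OF m] by auto
    \<comment> \<open>The list of entries has no repetition, so the cell is still 0, and adding the
      new entry agrees with writing it.\<close>
    have new: "\<not> (\<exists>e<m. ?i e = ?im \<and> ?j e = ?jm)"
    proof
      assume "\<exists>e<m. ?i e = ?im \<and> ?j e = ?jm"
      then obtain e where "e < m" "?i e = ?im" "?j e = ?jm" by blast
      then show False using inj_onD[OF inj, of e m] m by auto
    qed
    define g where "g = put 0 2 (h' 5 ?im * ?x m) (put 1 (?im * d + ?jm) (?x m) h')"
    have eq: "?F (Suc m) = addH ?im ?jm g" by (simp add: h'_def g_def init_entryH_def Let_def)
    have g: "\<And>a. a \<notin> {0, 1} \<Longrightarrow> g a = h' a" "g 0 0 = thr\<^sup>2" "g 0 2 = h' 5 ?im * ?x m"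
      "g 1 = (h' 1)(?im * d + ?jm := ?x m)" using IH(2) by (auto simp: g_def put_def)
    have g1: "g 1 (i * d + j) = (if \<exists>e<Suc m. ?i e = i \<and> ?j e = j then A i j else 0)" if "i < n" "j < d" for i j
      using IH(4)[OF that] val[OF m] that im unfolding g(4) by (auto simp: ix_inj less_Suc_eq)
    have "sketched f ?wt ?z (addH ?im ?jm g)"
      unfolding sketched_def
    proof (intro allI impI)
      fix v r c assume a: "v < 2 * n" "r < K" "c < D1"
      have h67: "addH ?im ?jm g 6 = (\<lambda>_. 0)" "addH ?im ?jm g 7 = (\<lambda>_. 0)" "h' 6 = (\<lambda>_. 0)" "h' 7 = (\<lambda>_. 0)"
        using g IH(1) h1(1) by (simp_all add: addH_other)
      have rc: "rowc (addH ?im ?jm g) i c = rowc h' i c + (if i = ?im \<and> c = ?jm then ?x m else 0)" if "i < n" for i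
        using IH(4)[OF im(1,2)] new im that g(4)
        by (auto simp: rowc_def h67 addH_other ix_inj)
      have "(\<Sum>i<n. mult v i * f (r * n + i) * entry ?wt ?z (addH ?im ?jm g) i c) =
        (\<Sum>i<n. mult v i * f (r * n + i) * entry ?wt ?z h' i c +
          (if i = ?im then (if c = ?jm then mult v ?im * f (r * n + ?im) * (?wt ?im * ?x m) else 0) else 0))"
        by (intro sum.cong refl) (auto simp: entry_def rc distrib_left)
      also have "\<dots> = (\<Sum>i<n. mult v i * f (r * n + i) * entry ?wt ?z h' i c) +
          (if c = ?jm then mult v ?im * f (r * n + ?im) * (?wt ?im * ?x m) else 0)"
        using im by (simp add: sum.distrib)
      also have "\<dots> = h' 8 (sk v r c) + (if c = ?jm then mult v ?im * f (r * n + ?im) * (?wt ?im * ?x m) else 0)"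
        using IH(3) a by (simp add: sketched_def)
      also have "\<dots> = addH ?im ?jm g 8 (sk v r c)"
        using addH_8[OF im(1) a(1,2) im(3) a(3), of g] g(1)[of 8] g(1)[of 9] g(3) IH(1)[of 9] IH(1)[of 5] h1(4,5) im ix2_less[OF a(2) im(1)]
        by auto
      finally show "addH ?im ?jm g 8 (sk v r c) = (\<Sum>i<n. mult v i * f (r * n + i) * entry ?wt ?z (addH ?im ?jm g) i c)" by simp
    qed
    then show ?case unfolding eq using g g1 IH(1) by (simp add: addH_other)
  qed
  have e: "fold (init_entryH inp) [0..<len] (with_signs (init_rowsH (snd inp) (\<lambda>_ _. 0)) (K * n) f) = ?F len"
    by (simp add: h1_def init_rowsH_def h0_def thr)
  have fin: "\<And>a. a \<notin> {0, 1, 8} \<Longrightarrow> ?F len a = h1 a" "?F len 0 0 = thr\<^sup>2" "sketched f ?wt ?z (?F len)"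
    "\<And>i j. i < n \<Longrightarrow> j < d \<Longrightarrow> ?F len 1 (i * d + j) = A i j"
    using main[of len] all by auto
  have "wgt (startA (\<lambda>i. ?u (1 + i)) (\<lambda>i. ?u (1 + n + i)) f) = ?wt" by (auto simp: wgt_def startA_def)
  then show ?thesis unfolding e using fin h1 by (auto simp: repr_def startA_def)
qed

end

section \<open>Random signs\<close>

abbreviation signs_pmf :: "nat \<Rightarrow> (nat \<Rightarrow> real) pmf" where
  "signs_pmf m \<equiv> Pi_pmf {..<m} 0 (\<lambda>_. coin_sign)"

lemma set_coin_sign: "set_pmf coin_sign = {1, -1}"
  by (auto simp: coin_sign_def set_pmf_of_set of_bool_def image_iff UNIV_bool)

lemma set_signs_pmf: "\<sigma> \<in> set_pmf (signs_pmf m) \<Longrightarrow> x < m \<Longrightarrow> \<bar>\<sigma> x\<bar> = 1"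
  using set_Pi_pmf[of "{..<m}" 0 "\<lambda>_. coin_sign"] by (auto simp: PiE_dflt_def set_coin_sign)

lemma map_uminus_coin_sign: "map_pmf uminus coin_sign = coin_sign"
proof -
  have "map_pmf Not (pmf_of_set UNIV) = pmf_of_set (Not ` UNIV)"
    by (rule map_pmf_of_set_inj) (auto simp: inj_def)
  moreover have "Not ` UNIV = (UNIV :: bool set)" by (auto simp: UNIV_bool)
  ultimately have N: "map_pmf Not (pmf_of_set UNIV) = pmf_of_set (UNIV :: bool set)" by simp
  have "map_pmf uminus coin_sign = map_pmf (\<lambda>b. 1 - 2 * of_bool b) (map_pmf Not (pmf_of_set UNIV))"
    by (auto simp: coin_sign_def pmf.map_comp o_def intro!: map_pmf_cong)
  then show ?thesis unfolding N by (simp add: coin_sign_def)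
qed

lemma flip_signs_pmf:
  assumes "x < m"
  shows "map_pmf (\<lambda>\<sigma>. \<sigma>(x := - \<sigma> x)) (signs_pmf m) = signs_pmf m"
proof -
  let ?P = "Pi_pmf ({..<m} - {x}) 0 (\<lambda>_. coin_sign)"
  have eq: "signs_pmf m = map_pmf (\<lambda>(y, \<sigma>). \<sigma>(x := y)) (pair_pmf coin_sign ?P)"
    using Pi_pmf_insert[of "{..<m} - {x}" x 0 "\<lambda>_. coin_sign"] assms by (simp add: insert_absorb)
  have "map_pmf (\<lambda>\<sigma>. \<sigma>(x := - \<sigma> x)) (signs_pmf m) =
      map_pmf (\<lambda>(y, \<sigma>). \<sigma>(x := y)) (map_pmf (map_prod uminus id) (pair_pmf coin_sign ?P))"
    unfolding eq by (simp add: pmf.map_comp o_def case_prod_beta)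
  also have "map_pmf (map_prod uminus id) (pair_pmf coin_sign ?P) = pair_pmf (map_pmf uminus coin_sign) (map_pmf id ?P)"
    by (simp add: map_pair map_prod_def case_prod_beta)
  also have "\<dots> = pair_pmf coin_sign ?P" by (simp add: map_uminus_coin_sign pmf.map_id0)
  also have "map_pmf (\<lambda>(y, \<sigma>). \<sigma>(x := y)) (pair_pmf coin_sign ?P) = signs_pmf m" by (rule eq[symmetric])
  finally show ?thesis .
qed

text \<open>Flipping the sign of row \<open>i\<close> in sketch \<open>r\<close> turns a small sketch into a large one.\<close>

lemma prob_all_sketches_small:
  assumes i: "i < n" and c: "thr\<^sup>2 < (c i)\<^sup>2" and thr: "0 \<le> thr"
  shows "measure_pmf.prob (signs_pmf (K * n)) {\<sigma>. \<forall>r<K. (\<Sum>i<n. \<sigma> (r * n + i) * c i)\<^sup>2 \<le> thr\<^sup>2} \<le> (1/2) ^ K"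
proof -
  let ?p = "signs_pmf (K * n)" and ?s = "\<lambda>r \<sigma>. \<Sum>i<n. \<sigma> (r * n + i) * c i"
  let ?E = "\<lambda>m. {\<sigma>. \<forall>r<m. (?s r \<sigma>)\<^sup>2 \<le> thr\<^sup>2}"
  have c': "thr < \<bar>c i\<bar>" using c thr by (metis abs_le_square_iff abs_of_nonneg not_less)
  have "m \<le> K \<Longrightarrow> measure_pmf.prob ?p (?E m \<inter> set_pmf ?p) \<le> (1/2) ^ m" for m
  proof (induction m)
    case (Suc m)
    let ?x = "m * n + i"
    let ?f = "\<lambda>\<sigma> :: nat \<Rightarrow> real. \<sigma>(?x := - \<sigma> ?x)"
    have "Suc m * n \<le> K * n" using Suc.prems by (intro mult_right_mono) auto
    then have x: "?x < K * n" using i by simp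
    have sm: "?s r (?f \<sigma>) = ?s r \<sigma>" if "r < m" for r \<sigma>
    proof (intro sum.cong refl)
      fix j assume j: "j \<in> {..<n}"
      have "Suc r * n \<le> m * n" using that by (intro mult_right_mono) auto
      then have "r * n + j \<noteq> ?x" using j by auto
      then show "(?f \<sigma>) (r * n + j) * c j = \<sigma> (r * n + j) * c j" by simp
    qed
    have sf: "?s m (?f \<sigma>) = ?s m \<sigma> - 2 * \<sigma> ?x * c i" for \<sigma>
    proof -
      have "?s m (?f \<sigma>) = (\<Sum>j<n. \<sigma> (m * n + j) * c j + (if j = i then - 2 * \<sigma> ?x * c i else 0))"
        by (intro sum.cong) auto
      then show ?thesis using i by (simp add: sum.distrib)
    qed
    have inv: "?f \<sigma> \<in> set_pmf ?p" if "\<sigma> \<in> set_pmf ?p" for \<sigma>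
      using that flip_signs_pmf[OF x] by (metis (no_types, lifting) imageI set_map_pmf)
    have disj: "(?E (Suc m) \<inter> set_pmf ?p) \<inter> (?f -` (?E (Suc m) \<inter> set_pmf ?p)) = {}"
    proof (rule ccontr)
      assume "\<not> ?thesis"
      then obtain \<sigma> where "\<sigma> \<in> set_pmf ?p" "\<sigma> \<in> ?E (Suc m)" "?f \<sigma> \<in> ?E (Suc m)" by blast
      then have \<sigma>: "\<sigma> \<in> set_pmf ?p" "(?s m \<sigma>)\<^sup>2 \<le> thr\<^sup>2" "(?s m (?f \<sigma>))\<^sup>2 \<le> thr\<^sup>2"
        by (blast intro: lessI)+
      then have "\<bar>?s m \<sigma>\<bar> \<le> thr" "\<bar>?s m \<sigma> - 2 * \<sigma> ?x * c i\<bar> \<le> thr"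
        using thr unfolding sf by (simp_all add: abs_le_square_iff[symmetric])
      then have "\<bar>2 * \<sigma> ?x * c i\<bar> \<le> 2 * thr" by linarith
      moreover have "\<bar>\<sigma> ?x\<bar> = 1" by (rule set_signs_pmf[OF \<sigma>(1) x])
      ultimately show False using c' by (simp add: abs_mult)
    qed
    \<comment> \<open>The other sketches use other signs, so they stay small under the flip. The
      event and its flipped copy are disjoint parts of \<open>?E m\<close> with equal probability:
      one more sketch halves the bound.\<close>
    have sub: "(?E (Suc m) \<inter> set_pmf ?p) \<union> (?f -` (?E (Suc m) \<inter> set_pmf ?p)) \<inter> set_pmf ?p \<subseteq> ?E m \<inter> set_pmf ?p"
    proof
      fix \<sigma> assume "\<sigma> \<in> (?E (Suc m) \<inter> set_pmf ?p) \<union> (?f -` (?E (Suc m) \<inter> set_pmf ?p)) \<inter> set_pmf ?p"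
      then have \<sigma>: "\<sigma> \<in> set_pmf ?p" "\<sigma> \<in> ?E (Suc m) \<or> ?f \<sigma> \<in> ?E (Suc m)" by blast+
      have "(?s r \<sigma>)\<^sup>2 \<le> thr\<^sup>2" if r: "r < m" for r
        using \<sigma>(2)
      proof
        assume "\<sigma> \<in> ?E (Suc m)"
        then show ?thesis using r by (blast intro: less_SucI)
      next
        assume "?f \<sigma> \<in> ?E (Suc m)"
        then have "(?s r (?f \<sigma>))\<^sup>2 \<le> thr\<^sup>2" using r by (blast intro: less_SucI)
        then show ?thesis by (simp only: sm[OF r])
      qed
      then show "\<sigma> \<in> ?E m \<inter> set_pmf ?p" using \<sigma>(1) by blast
    qed
    have "measure_pmf.prob ?p (?f -` (?E (Suc m) \<inter> set_pmf ?p)) = measure_pmf.prob ?p (?E (Suc m) \<inter> set_pmf ?p)"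
      using arg_cong[OF flip_signs_pmf[OF x], of "\<lambda>q. measure_pmf.prob q (?E (Suc m) \<inter> set_pmf ?p)"]
      unfolding measure_map_pmf .
    then have "2 * measure_pmf.prob ?p (?E (Suc m) \<inter> set_pmf ?p) =
      measure_pmf.prob ?p (?E (Suc m) \<inter> set_pmf ?p) + measure_pmf.prob ?p (?f -` (?E (Suc m) \<inter> set_pmf ?p) \<inter> set_pmf ?p)"
      by (simp add: measure_Int_set_pmf)
    also have "\<dots> = measure_pmf.prob ?p ((?E (Suc m) \<inter> set_pmf ?p) \<union> (?f -` (?E (Suc m) \<inter> set_pmf ?p)) \<inter> set_pmf ?p)"
      by (rule measure_pmf.finite_measure_Union[symmetric]) (use disj in auto)
    also have "\<dots> \<le> measure_pmf.prob ?p (?E m \<inter> set_pmf ?p)"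
      by (intro measure_pmf.finite_measure_mono sub) auto
    also have "\<dots> \<le> (1/2) ^ m" using Suc by simp
    finally show ?case by simp
  qed (simp add: measure_pmf.prob_le_1)
  from this[of K] show ?thesis by (simp add: measure_Int_set_pmf)
qed

text \<open>Hoeffding's inequality for the block of signs that sketch \<open>r\<close> uses, each
  summand lying between \<open>- \<bar>c\<bar>\<close> and \<open>\<bar>c\<bar>\<close>. The
  intervals must not all be trivial, hence the separate case of a zero sum.\<close>

lemma prob_sketch_large:
  assumes r: "r < K" and thr: "0 < thr" and c: "\<Lambda> * (\<Sum>i<n. (c i)\<^sup>2) \<le> thr\<^sup>2"
  shows "measure_pmf.prob (signs_pmf (K * n)) {\<sigma>. thr\<^sup>2 < (\<Sum>i<n. \<sigma> (r * n + i) * c i)\<^sup>2} \<le> 2 * exp (- \<Lambda> / 2)"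
proof (cases "(\<Sum>i<n. (c i)\<^sup>2) = 0")
  case True
  then have "\<And>i. i < n \<Longrightarrow> c i = 0" by (simp add: sum_nonneg_eq_0_iff)
  then have "(\<Sum>i<n. \<sigma> (r * n + i) * c i) = 0" for \<sigma> by simp
  then have "{\<sigma>. thr\<^sup>2 < (\<Sum>i<n. \<sigma> (r * n + i) * c i)\<^sup>2} = {}" using thr by (auto simp: not_less)
  then show ?thesis by simp
next
  case False
  have S: "0 < (\<Sum>i<n. (c i)\<^sup>2)" (is "0 < ?S") using False sum_nonneg[of "{..<n}" "\<lambda>i. (c i)\<^sup>2"] by simp
  let ?p = "signs_pmf (K * n)"
  let ?I = "(\<lambda>i. r * n + i) ` {..<n}"
  let ?c = "\<lambda>x. c (x - r * n)"
  have "Suc r * n \<le> K * n" using r by (intro mult_right_mono) auto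
  then have sub: "?I \<subseteq> {..<K * n}" by auto
  have inj: "inj_on (\<lambda>i. r * n + i) {..<n}" by (auto simp: inj_on_def)
  have indep: "prob_space.indep_vars (measure_pmf ?p) (\<lambda>_. borel) (\<lambda>x \<sigma>. \<sigma> x * ?c x) ?I"
    by (rule prob_space.indep_vars_compose2[OF measure_pmf.prob_space_axioms
        prob_space.indep_vars_subset[OF measure_pmf.prob_space_axioms indep_vars_Pi_pmf sub]]) auto
  have E: "measure_pmf.expectation ?p (\<lambda>\<sigma>. \<sigma> x * ?c x) = 0" if "x \<in> ?I" for x
  proof -
    have "measure_pmf.expectation ?p (\<lambda>\<sigma>. \<sigma> x) = measure_pmf.expectation (map_pmf (\<lambda>\<sigma>. \<sigma> x) ?p) (\<lambda>y. y)"
      by simp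
    also have "map_pmf (\<lambda>\<sigma>. \<sigma> x) ?p = coin_sign" using that sub by (subst Pi_pmf_component) auto
    also have "measure_pmf.expectation coin_sign (\<lambda>y. y) = 0"
      by (simp add: coin_sign_def integral_pmf_of_set UNIV_bool)
    finally show ?thesis by simp
  qed
  interpret H: Hoeffding_ineq "measure_pmf ?p" ?I "\<lambda>x \<sigma>. \<sigma> x * ?c x" "\<lambda>x. - \<bar>?c x\<bar>" "\<lambda>x. \<bar>?c x\<bar>" "0"
  proof unfold_locales
    show "finite ?I" by simp
    show "prob_space.indep_vars (measure_pmf ?p) (\<lambda>_. borel) (\<lambda>x \<sigma>. \<sigma> x * ?c x) ?I" by (rule indep)
    show "AE \<sigma> in measure_pmf ?p. \<sigma> x * ?c x \<in> {- \<bar>?c x\<bar>..\<bar>?c x\<bar>}" if "x \<in> ?I" for x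
    proof (rule AE_pmfI)
      fix \<sigma> assume "\<sigma> \<in> set_pmf ?p"
      then have "\<bar>\<sigma> x\<bar> = 1" using set_signs_pmf that sub by blast
      then have "\<bar>\<sigma> x * ?c x\<bar> = \<bar>?c x\<bar>" by (simp add: abs_mult)
      then show "\<sigma> x * ?c x \<in> {- \<bar>?c x\<bar>..\<bar>?c x\<bar>}" by (simp add: abs_le_iff) linarith
    qed
    show "0 \<equiv> \<Sum>x\<in>?I. measure_pmf.expectation ?p (\<lambda>\<sigma>. \<sigma> x * ?c x)"
      by (rule eq_reflection) (simp only: E sum.neutral_const cong: sum.cong)
  qed
  have sq: "(\<Sum>x\<in>?I. (\<bar>?c x\<bar> - - \<bar>?c x\<bar>)\<^sup>2) = 4 * ?S"
    by (simp add: sum.reindex[OF inj] sum_distrib_left power2_eq_square)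
  have "measure_pmf.prob ?p {\<sigma>. thr\<^sup>2 < (\<Sum>i<n. \<sigma> (r * n + i) * c i)\<^sup>2} \<le>
      measure_pmf.prob ?p {\<sigma> \<in> space (measure_pmf ?p). thr \<le> \<bar>(\<Sum>x\<in>?I. \<sigma> x * ?c x) - 0\<bar>}"
  proof (rule measure_pmf.finite_measure_mono)
    show "{\<sigma>. thr\<^sup>2 < (\<Sum>i<n. \<sigma> (r * n + i) * c i)\<^sup>2} \<subseteq> {\<sigma> \<in> space (measure_pmf ?p). thr \<le> \<bar>(\<Sum>x\<in>?I. \<sigma> x * ?c x) - 0\<bar>}"
    proof
      fix \<sigma> assume "\<sigma> \<in> {\<sigma>. thr\<^sup>2 < (\<Sum>i<n. \<sigma> (r * n + i) * c i)\<^sup>2}"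
      then have "\<not> \<bar>\<Sum>i<n. \<sigma> (r * n + i) * c i\<bar> \<le> \<bar>thr\<bar>" by (simp add: abs_le_square_iff)
      then have "thr \<le> \<bar>\<Sum>i<n. \<sigma> (r * n + i) * c i\<bar>" using thr by linarith
      then show "\<sigma> \<in> {\<sigma> \<in> space (measure_pmf ?p). thr \<le> \<bar>(\<Sum>x\<in>?I. \<sigma> x * ?c x) - 0\<bar>}"
        by (simp add: sum.reindex[OF inj])
    qed
  qed simp
  also have "\<dots> \<le> 2 * exp (- 2 * thr\<^sup>2 / (\<Sum>x\<in>?I. (\<bar>?c x\<bar> - - \<bar>?c x\<bar>)\<^sup>2))"
    by (rule H.Hoeffding_ineq_abs_ge) (use thr S sq in simp_all)
  also have "\<dots> \<le> 2 * exp (- \<Lambda> / 2)"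
  proof -
    have "\<Lambda> \<le> thr\<^sup>2 / ?S" using c S by (simp add: le_divide_eq)
    then have "- 2 * thr\<^sup>2 / (4 * ?S) \<le> - \<Lambda> / 2" by (simp add: field_simps)
    then show ?thesis unfolding sq by simp
  qed
  finally show ?thesis .
qed

section \<open>Coupling the machine with an abstract process\<close>

definition tree_structure :: "nat \<Rightarrow> data_structure" where
  "tree_structure \<kappa> = \<lparr>init_prog = (init_words \<kappa> ;; init_data) 0, scale_prog = scale_cmd 0,
     query_prog = query_cmd 0, exact_prog = exact_cmd 0\<rparr>"

definition vec_input :: "real vec \<Rightarrow> real vec \<Rightarrow> nat \<Rightarrow> real" where
  "vec_input y \<delta> = nth_default 0 (list_of_vec y @ list_of_vec \<delta>)"

lemma vec_input_nth:
  assumes "y \<in> carrier_vec d" "\<delta> \<in> carrier_vec n"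
  shows "j < d \<Longrightarrow> vec_input y \<delta> j = y $ j" "i < n \<Longrightarrow> vec_input y \<delta> (d + i) = \<delta> $ i"
  using assms by (auto simp: vec_input_def nth_default_def nth_append list_of_vec_index)

lemma concat_pairs:
  "length (concat (map (\<lambda>(i, j). [i, j]) xs)) = 2 * length xs"
  "e < length xs \<Longrightarrow> concat (map (\<lambda>(i, j). [i, j]) xs) ! (2 * e) = fst (xs ! e)"
  "e < length xs \<Longrightarrow> concat (map (\<lambda>(i, j). [i, j]) xs) ! (2 * e + 1) = snd (xs ! e)"
proof -
  show "length (concat (map (\<lambda>(i, j). [i, j]) xs)) = 2 * length xs"
    by (induction xs) auto
  show "e < length xs \<Longrightarrow> concat (map (\<lambda>(i, j). [i, j]) xs) ! (2 * e) = fst (xs ! e)"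
    "e < length xs \<Longrightarrow> concat (map (\<lambda>(i, j). [i, j]) xs) ! (2 * e + 1) = snd (xs ! e)"
  proof (induction xs arbitrary: e)
    case (Cons x xs)
    { case 1 then show ?case using Cons.IH(1)[of "e - 1"] by (cases e) (auto split: prod.splits) }
    { case 2 then show ?case using Cons.IH(2)[of "e - 1"] by (cases e) (auto split: prod.splits) }
  qed auto
qed

lemma nonzeros_facts:
  assumes "M \<in> carrier_mat n d"
  shows "distinct (nonzeros M)" "length (nonzeros M) = nnz M"
    "(i, j) \<in> set (nonzeros M) \<longleftrightarrow> i < n \<and> j < d \<and> M $$ (i, j) \<noteq> 0" "nnz M \<le> n * d"
proof -
  show D: "distinct (nonzeros M)" by (auto simp: nonzeros_def distinct_product)
  show S: "(i, j) \<in> set (nonzeros M) \<longleftrightarrow> i < n \<and> j < d \<and> M $$ (i, j) \<noteq> 0" for i j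
    using assms by (auto simp: nonzeros_def)
  have "set (nonzeros M) = {(i, j). i < dim_row M \<and> j < dim_col M \<and> M $$ (i, j) \<noteq> 0}"
    by (auto simp: nonzeros_def)
  then show l: "length (nonzeros M) = nnz M" using distinct_card[OF D] by (simp add: nnz_def)
  have "set (nonzeros M) \<subseteq> {..<n} \<times> {..<d}" using S by auto
  then have "card (set (nonzeros M)) \<le> n * d"
    using card_mono[of "{..<n} \<times> {..<d}"] by (simp add: card_cartesian_product)
  then show "nnz M \<le> n * d" using distinct_card[OF D] l by simp
qed

lemma spmf_rel_return: "rel_spmf P p (return_spmf x) \<Longrightarrow> (\<And>a. P a x \<Longrightarrow> Q a y) \<Longrightarrow> rel_spmf Q p (return_spmf y)"
  by (simp add: rel_spmf_return_spmf2)

context sizes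
begin

text \<open>The last component is an upper bound for the running time, computed from the abstract
  state. Randomness enters only with the signs drawn at the end of an epoch.\<close>

fun aserve :: "real \<Rightarrow> (nat \<Rightarrow> nat \<Rightarrow> real) \<Rightarrow> request \<Rightarrow> ast \<Rightarrow> (ast \<times> real vec \<times> nat) pmf" where
  "aserve thr A (Scale i u) s = return_pmf (s\<lparr>aG := (aG s)(i := u)\<rparr>, vec 0 (\<lambda>_. 0), 700 * X)"
| "aserve thr A (ComputeExact i) s = return_pmf (s, vec 1 (\<lambda>_. aX s i), 100 * d)"
| "aserve thr A (Query y \<delta>) s =
     (let s1 = absorbA A (vec_input y \<delta>) (\<lambda>i. vec_input y \<delta> (d + i)) s in
      if Suc (aT s) < R then
        let s2 = (levelsA thr (Suc (aT s)) s1 L)\<lparr>aT := Suc (aT s)\<rparr>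
        in return_pmf (s2, vec n (aB s2), 300 * (n * L) + levels_costA thr (Suc (aT s)) s1)
      else map_pmf (\<lambda>f. let s2 = rebuildA f s1 in (s2, vec n (aB s2), 300 * (n * L) + 2000 * (n * X)))
        (signs_pmf (K * n)))"

definition sim :: "real \<Rightarrow> (nat \<Rightarrow> nat \<Rightarrow> real) \<Rightarrow> mstate \<Rightarrow> ast \<Rightarrow> bool" where
  "sim thr A s a \<longleftrightarrow> (\<exists>W h ot. view s = (W, h, ot) \<and> params W \<and> W 5 = aT a \<and> aT a < R \<and> repr thr A h a)"

lemma R_pos: "0 < R"
  by (simp add: R_L)

lemma view_call: "view s = (W, h, ot) \<Longrightarrow> view (s\<lparr>outp := \<lambda>_. 0, clock := 0\<rparr>) = (W, h, \<lambda>_. 0)"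
  by (auto simp: view_def intro!: ext)

lemma call_runs:
  assumes "view s = (W, h, ot)" "runs w inp c (W, h, \<lambda>_. 0) D T"
  shows "rel_spmf (\<lambda>s' st'. view s' = st' \<and> clock s' \<le> T) (call w inp (c 0) s) D"
  unfolding call_def
  by (rule rel_spmf_mono[OF runsD[OF assms(2) view_call[OF assms(1)]]]) simp

lemma outp_view: "view s = (W, h, ot) \<Longrightarrow> outp s = ot"
  by (simp add: view_def)

lemma repr_aT [simp]: "repr thr A h (s\<lparr>aT := t\<rparr>) = repr thr A h s"
proof -
  have "wgt (s\<lparr>aT := t\<rparr>) = wgt s" by (auto simp: wgt_def)
  then show ?thesis by (simp add: repr_def)
qed

lemma serve_sim:
  assumes S: "sim thr A s a" and q: "well_formed n d q"
  shows "rel_spmf (\<lambda>s' (a', y, c). sim thr A s' a' \<and> answer n q s' = y \<and> clock s' \<le> c)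
    (serve (tree_structure \<kappa>) w q s) (spmf_of_pmf (aserve thr A q a))"
proof -
  from S obtain W h ot where v: "view s = (W, h, ot)" and W: "params W" "W 5 = aT a" and t: "aT a < R"
    and rp: "repr thr A h a" by (auto simp: sim_def)
  show ?thesis
  proof (cases q)
    case (Scale i u)
    let ?inp = "to_input [i] [u]"
    have i: "fst ?inp 0 < n" using q Scale by (simp add: to_input_def)
    have in0: "fst ?inp 0 = i" "snd ?inp 0 = u" by (simp_all add: to_input_def)
    have "rel_spmf (\<lambda>s' st'. view s' = st' \<and> clock s' \<le> 700 * X) (call w ?inp (scale_cmd 0) s)
       (return_spmf (W, scaleH i u h, \<lambda>_. 0))"
      using call_runs[OF v runs_scale[OF W(1) i]] unfolding in0 .
    then show ?thesis unfolding Scale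
      by (simp add: tree_structure_def, elim spmf_rel_return)
        (use scaleH_repr[OF rp, of i u] i in0 W t in \<open>auto simp: sim_def\<close>)
  next
    case (ComputeExact i)
    let ?inp = "to_input [i] []"
    have i: "fst ?inp 0 < n" using q ComputeExact by (simp add: to_input_def)
    have in0: "fst ?inp 0 = i" by (simp_all add: to_input_def)
    have x: "h 3 i + h 2 i * (\<Sum>j<d. h 1 (i * d + j) * h 6 j) = aX a i"
      using rp i in0 by (simp add: repr_def)
    have "rel_spmf (\<lambda>s' st'. view s' = st' \<and> clock s' \<le> 100 * d) (call w ?inp (exact_cmd 0) s)
       (return_spmf (W, h, (\<lambda>_. 0)(0 := aX a i)))"
      using call_runs[OF v runs_exact[OF W(1) i]] unfolding in0 x .
    then show ?thesis unfolding ComputeExact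
      by (simp add: tree_structure_def, elim spmf_rel_return)
        (use rp W t in \<open>auto simp: sim_def outp_view\<close>)
  next
    case (Query y \<delta>)
    let ?inp = "to_input [] (list_of_vec y @ list_of_vec \<delta>)"
    have in0: "snd ?inp = vec_input y \<delta>" by (simp add: to_input_def vec_input_def)
    let ?s1 = "absorbA A (vec_input y \<delta>) (\<lambda>i. vec_input y \<delta> (d + i)) a" and ?h1 = "absorbH (vec_input y \<delta>) h"
    have r1: "repr thr A ?h1 ?s1" by (rule absorbH_repr[OF rp])
    have t5: "W 5 < R" using W t by simp
    have rep: "vec n (reportH h' (\<lambda>_. 0)) = vec n (aB s')" if "repr thr A h' s'" for h' s'
      using that by (auto simp: repr_def reportH_def)
    show ?thesis
    proof (cases "Suc (aT a) < R")
      case True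
      let ?h2 = "levelsH (Suc (aT a)) ?h1 L" and ?s2 = "(levelsA thr (Suc (aT a)) ?s1 L)\<lparr>aT := Suc (aT a)\<rparr>"
      have r2: "repr thr A ?h2 ?s2" using levelsH_repr[OF r1 order_refl] by simp
      have p: "params (W(5 := Suc (aT a)))" using W True less_trans[OF True Rw] unfolding params_def by (simp del: paramsD)
      have "rel_spmf (\<lambda>s' st'. view s' = st' \<and> clock s' \<le> 300 * (n * L) + levels_costA thr (Suc (aT a)) ?s1)
        (call w ?inp (query_cmd 0) s) (return_spmf (W(5 := Suc (aT a)), ?h2, reportH ?h2 (\<lambda>_. 0)))"
        using call_runs[OF v runs_query(1)[OF W(1) t5], of ?inp] True unfolding in0 W(2) levels_cost_eq[OF r1] by simp
      then show ?thesis unfolding Query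
        by (simp add: tree_structure_def True Let_def, elim spmf_rel_return)
          (use r2 p True rep[OF r2] in \<open>auto simp: sim_def outp_view\<close>)
    next
      case False
      let ?h2 = "\<lambda>f. reweight_allH (with_signs (clearH ?h1) (K * n) f)"
      have r2: "repr thr A (?h2 f) (rebuildA f ?s1)" for f by (rule rebuild_repr[OF r1])
      have p: "params (W(5 := 0))" using W unfolding params_def by (simp del: paramsD)
      have "rel_spmf (\<lambda>s' st'. view s' = st' \<and> clock s' \<le> 300 * (n * L) + 2000 * (n * X))
        (call w ?inp (query_cmd 0) s) (map_spmf (\<lambda>f. (W(5 := 0), ?h2 f, reportH (?h2 f) (\<lambda>_. 0))) (signs (K * n)))"
        using call_runs[OF v runs_query(2)[OF W(1) t5], of ?inp] False unfolding in0 W(2) Let_def by simp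
      then have "rel_spmf (\<lambda>s' f. view s' = (W(5 := 0), ?h2 f, reportH (?h2 f) (\<lambda>_. 0)) \<and>
          clock s' \<le> 300 * (n * L) + 2000 * (n * X)) (call w ?inp (query_cmd 0) s) (signs (K * n))"
        by (simp add: spmf_rel_map)
      then have "rel_spmf (\<lambda>s' (a', y, c). sim thr A s' a' \<and> answer n q s' = y \<and> clock s' \<le> c)
        (call w ?inp (query_cmd 0) s) (map_spmf (\<lambda>f. (rebuildA f ?s1, vec n (aB (rebuildA f ?s1)), 300 * (n * L) + 2000 * (n * X))) (signs (K * n)))"
        unfolding spmf_rel_map
        by (rule rel_spmf_mono) (use r2 p rep[OF r2] R_pos in \<open>auto simp: sim_def outp_view rebuildA_def Query\<close>)
      then show ?thesis unfolding Query
        by (simp add: tree_structure_def False Let_def signs_def)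
    qed
  qed
qed

lemma repr_startA_cong:
  assumes R: "repr thr A h (startA g x f)" and e: "\<And>i. i < n \<Longrightarrow> g' i = g i" "\<And>i. i < n \<Longrightarrow> x' i = x i"
  shows "repr thr A h (startA g' x' f)"
proof -
  have "sketched f (wgt (startA g' x' f)) (\<lambda>_ _. 0) h"
    by (rule sketched_cong[where h = h and wt = "wgt (startA g x f)" and U = "\<lambda>_ _. 0" and \<sigma> = f])
      (use R e in \<open>auto simp: repr_def startA_def entry_def wgt_def\<close>)
  then show ?thesis using R e by (simp add: repr_def startA_def wgt_def)
qed

lemma initialize_sim:
  assumes lg: "\<And>x. 2 ^ x < n \<longleftrightarrow> x < lg" and K: "K = \<kappa> * lg" "L = lg + lg" "DEP = lg + 2"
    and B: "B \<in> carrier_mat n d" and g: "g \<in> carrier_vec n" and x0: "x0 \<in> carrier_vec n"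
    and nz: "n \<le> nnz B" and thr: "\<epsilon> / (8 * real L) = thr"
  shows "rel_spmf (\<lambda>s' a'. sim thr (\<lambda>i j. if i < n \<and> j < d then B $$ (i, j) else 0) s' a' \<and> clock s' \<le> 1000 * (nnz B * (DEP * K)))
    (initialize (tree_structure \<kappa>) w B g x0 \<epsilon>)
    (map_spmf (\<lambda>f. startA (\<lambda>i. if i < n then g $ i else 0) (\<lambda>i. if i < n then x0 $ i else 0) f) (signs (K * n)))"
proof -
  let ?es = "nonzeros B"
  define ks where "ks = n # d # length ?es # concat (map (\<lambda>(i, j). [i, j]) ?es)"
  define rs where "rs = \<epsilon> # list_of_vec g @ list_of_vec x0 @ map (\<lambda>ij. B $$ ij) ?es"
  define inp where "inp = to_input ks rs"
  note nf = nonzeros_facts[OF B]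
  let ?len = "nnz B"
  have dims: "dim_row B = n" "dim_col B = d" "length (list_of_vec g) = n" "length (list_of_vec x0) = n"
    using B g x0 by auto
  have w: "fst inp 0 = n" "fst inp 1 = d" "fst inp 2 = ?len"
    using nf(2) by (simp_all add: inp_def to_input_def ks_def nth_default_def)
  have e3: "fst inp (2 * e + 3) = fst (?es ! e)" and e4: "fst inp (2 * e + 4) = snd (?es ! e)"
    and ex: "snd inp (2 * n + 1 + e) = B $$ (?es ! e)" if e: "e < ?len" for e
  proof -
    have "2 * e + 3 = Suc (Suc (Suc (2 * e)))" "2 * e + 4 = Suc (Suc (Suc (2 * e + 1)))" by simp_all
    then show "fst inp (2 * e + 3) = fst (?es ! e)" "fst inp (2 * e + 4) = snd (?es ! e)"
      using concat_pairs(1)[of ?es] concat_pairs(2,3)[of e ?es] e nf(2)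
      by (simp_all only: inp_def to_input_def ks_def nth_default_Cons_Suc fst_conv)
         (auto simp: nth_default_def)
    have "2 * n + 1 + e = Suc (2 * n + e)" by simp
    then show "snd inp (2 * n + 1 + e) = B $$ (?es ! e)"
      using e nf(2) dims by (simp add: inp_def to_input_def rs_def nth_default_def nth_append)
  qed
  have rg: "snd inp (1 + i) = g $ i" "snd inp (1 + n + i) = x0 $ i" if "i < n" for i
    using that g x0 dims by (simp_all add: inp_def to_input_def rs_def nth_default_def nth_append list_of_vec_index)
  have r0: "snd inp 0 = \<epsilon>" by (simp add: inp_def to_input_def rs_def nth_default_def)
  have nzin: "?es ! e \<in> set ?es" if "e < ?len" for e using that nf(2) by simp
  have ent: "fst inp (2 * e + 3) < n \<and> fst inp (2 * e + 4) < d" if "e < ?len" for e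
    using nzin[OF that] nf(3)[of "fst (?es ! e)" "snd (?es ! e)"] that by (simp add: e3 e4)
  let ?A = "\<lambda>i j. if i < n \<and> j < d then B $$ (i, j) else 0"
  let ?h = "\<lambda>f. fold (init_entryH inp) [0..<?len] (with_signs (init_rowsH (snd inp) (\<lambda>_ _. 0)) (K * n) f)"
  let ?a = "\<lambda>f. startA (\<lambda>i. if i < n then g $ i else 0) (\<lambda>i. if i < n then x0 $ i else 0) f"
  have rp: "repr thr ?A (?h f) (startA (\<lambda>i. snd inp (1 + i)) (\<lambda>i. snd inp (1 + n + i)) f)" for f
  proof (rule init_repr[OF ent])
    show "?A (fst inp (2 * e + 3)) (fst inp (2 * e + 4)) = snd inp (2 * n + 1 + e)" if "e < ?len" for e
      using ent[OF that] ex[OF that] by (simp add: e3[OF that] e4[OF that])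
    show "inj_on (\<lambda>e. (fst inp (2 * e + 3), fst inp (2 * e + 4))) {..<?len}"
    proof (rule inj_onI)
      fix e e' assume "e \<in> {..<?len}" "e' \<in> {..<?len}"
        "(fst inp (2 * e + 3), fst inp (2 * e + 4)) = (fst inp (2 * e' + 3), fst inp (2 * e' + 4))"
      then have "?es ! e = ?es ! e'" "e < length ?es" "e' < length ?es"
        using nf(2) by (auto simp: e3 e4 prod_eq_iff)
      then show "e = e'" using nf(1) by (simp add: nth_eq_iff_index_eq)
    qed
    fix i j assume "i < n" "j < d" "?A i j \<noteq> 0"
    then have "(i, j) \<in> set ?es" by (simp add: nf(3))
    then obtain e where "e < length ?es" "?es ! e = (i, j)" by (auto simp: in_set_conv_nth)
    then show "\<exists>e<?len. fst inp (2 * e + 3) = i \<and> fst inp (2 * e + 4) = j"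
      using nf(2) by (intro exI[of _ e]) (simp add: e3 e4)
  qed (use r0 thr in simp_all)
  have rp': "repr thr ?A (?h f) (?a f)" for f
    by (rule repr_startA_cong[OF rp]) (use rg in simp_all)
  obtain W where W: "params W" "W 5 = 0"
    "runs w inp (init_words \<kappa>) (\<lambda>_. 0, \<lambda>_ _. 0, \<lambda>_. 0) (return_spmf (W, \<lambda>_ _. 0, \<lambda>_. 0)) (63 + 20 * n + 9 * L)"
    using runs_init_words[OF lg K w(1,2), of "\<lambda>_ _. 0" "\<lambda>_. 0"] by blast
  have "?len \<le> n * d" by (rule nf(4))
  note run = runs_seq_det[OF W(3) runs_init_data[OF W(1) w(3) this ent]]
  have v: "view blank = (\<lambda>_. 0, \<lambda>_ _. 0, \<lambda>_. 0)" by (auto simp: view_def blank_def fun_eq_iff)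
  have "1 * 1 \<le> DEP * K" using pos by (intro mult_le_mono) auto
  then have DK: "1 \<le> DEP * K" by simp
  have D: "DEP \<le> DEP * K" "K \<le> DEP * K" by simp_all
  \<comment> \<open>By \<open>nz\<close> the loops over the rows and over the signs are charged to
    the nonzero entries.\<close>
  have b: "n \<le> ?len * (DEP * K)" "?len \<le> ?len * (DEP * K)" "1 \<le> ?len * (DEP * K)"
      "DEP \<le> ?len * (DEP * K)" "K * n \<le> ?len * (DEP * K)"
  proof -
    show l: "?len \<le> ?len * (DEP * K)" using mult_le_mono2[OF DK, of ?len] by simp
    then show "n \<le> ?len * (DEP * K)" using nz by linarith
    then show "1 \<le> ?len * (DEP * K)" using n_pos by linarith
    have "1 * DEP \<le> ?len * (DEP * K)" using nz n_pos by (intro mult_le_mono D) linarith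
    then show "DEP \<le> ?len * (DEP * K)" by simp
    show "K * n \<le> ?len * (DEP * K)" using mult_le_mono[OF nz D(2)] by (simp add: mult.commute)
  qed
  have "?len * (75 + 100 * DEP * K) = 75 * ?len + 100 * (?len * (DEP * K))" by (simp add: algebra_simps)
  then have cost: "63 + 20 * n + 9 * L + (60 + 66 * n + 34 * (K * n) + ?len * (75 + 100 * DEP * K)) \<le> 1000 * (?len * (DEP * K))"
    using b L_DEP by linarith
  have "rel_spmf (\<lambda>s' st'. view s' = st' \<and> clock s' \<le> 1000 * (?len * (DEP * K)))
     (call w inp ((init_words \<kappa> ;; init_data) 0) blank) (map_spmf (\<lambda>f. (W, ?h f, \<lambda>_. 0)) (signs (K * n)))"
    by (rule rel_spmf_mono[OF call_runs[OF v run]]) (use cost in auto)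
  then have "rel_spmf (\<lambda>s' f. sim thr ?A s' (?a f) \<and> clock s' \<le> 1000 * (?len * (DEP * K)))
     (call w inp ((init_words \<kappa> ;; init_data) 0) blank) (signs (K * n))"
    unfolding spmf_rel_map
    by (rule rel_spmf_mono) (use W rp' R_pos in \<open>auto simp: sim_def startA_def\<close>)
  moreover have "initialize (tree_structure \<kappa>) w B g x0 \<epsilon> = call w inp ((init_words \<kappa> ;; init_data) 0) blank"
    by (simp add: initialize_def tree_structure_def inp_def ks_def rs_def dims)
  ultimately show ?thesis by (simp add: spmf_rel_map)
qed

end

lemma prob_UN_le:
  fixes p :: "'a pmf"
  assumes "finite I" "\<And>i. i \<in> I \<Longrightarrow> measure_pmf.prob p (E i) \<le> q"
  shows "measure_pmf.prob p (\<Union>i\<in>I. E i) \<le> real (card I) * q"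
proof -
  have "measure_pmf.prob p (\<Union>i\<in>I. E i) \<le> (\<Sum>i\<in>I. measure_pmf.prob p (E i))"
    by (rule measure_UNION_le) (use assms in auto)
  also have "\<dots> \<le> (\<Sum>i\<in>I. q)" by (intro sum_mono assms)
  finally show ?thesis by simp
qed

lemma all_upI:
  assumes "\<And>k. v div 2 ^ k \<noteq> 0 \<Longrightarrow> P (v div 2 ^ k)"
  shows "all_up P v"
  using assms
proof (induction v rule: less_induct)
  case (less v)
  show ?case
  proof (cases "v = 0")
    case False
    have "all_up P (v div 2)"
    proof (rule less.IH)
      show "v div 2 < v" using False by simp
      fix k assume "v div 2 div 2 ^ k \<noteq> 0"
      then show "P (v div 2 div 2 ^ k)" using less.prems[of "Suc k"] by (simp add: div_mult2_eq)
    qed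
    moreover have "P v" using less.prems[of 0] False by simp
    ultimately show ?thesis using False by (subst all_up.simps) simp
  qed (subst all_up.simps, simp)
qed

lemma all_upD: "all_up P v \<Longrightarrow> v \<noteq> 0 \<Longrightarrow> P v"
  by (subst (asm) all_up.simps) simp

section \<open>Dyadic windows and the drift of a row\<close>

text \<open>\<open>P\<close> is a running sum and \<open>r\<close> the last synchronisation. Every
  window that ends after \<open>r\<close> is included, wherever it starts: it was tested when it
  ended, and the row was not synchronised then.\<close>

definition windows_small :: "real \<Rightarrow> nat \<Rightarrow> (nat \<Rightarrow> real) \<Rightarrow> nat \<Rightarrow> nat \<Rightarrow> bool" where
  "windows_small thr b P r t \<longleftrightarrow>
     (\<forall>l<b. \<forall>j. (j + 1) * 2 ^ l \<le> t \<longrightarrow> r < (j + 1) * 2 ^ l \<longrightarrow> \<bar>P ((j + 1) * 2 ^ l) - P (j * 2 ^ l)\<bar> \<le> thr)"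

text \<open>Binary expansion of the distance from \<open>j * 2 ^ l\<close> to \<open>t\<close>: at
  most one window for each level below \<open>l\<close>.\<close>

lemma dyadic_prefix:
  assumes W: "windows_small thr b P r t" and thr: "0 \<le> thr"
    and "l \<le> b" "r \<le> j * 2 ^ l" "j * 2 ^ l \<le> t" "t < (j + 1) * 2 ^ l"
  shows "\<bar>P t - P (j * 2 ^ l)\<bar> \<le> real l * thr"
  using assms(3-)
proof (induction l arbitrary: j)
  case (Suc l)
  have l: "l < b" using Suc.prems by simp
  show ?case
  proof (cases "t < (2 * j + 1) * 2 ^ l")
    case True
    then have "\<bar>P t - P (2 * j * 2 ^ l)\<bar> \<le> real l * thr"
      using Suc.prems by (intro Suc.IH) (auto simp: algebra_simps)
    then show ?thesis using thr by (simp add: algebra_simps)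
  next
    case False
    have "\<bar>P t - P ((2 * j + 1) * 2 ^ l)\<bar> \<le> real l * thr"
      using Suc.prems False by (intro Suc.IH) (auto simp: algebra_simps)
    moreover have "r < (2 * j + 1) * 2 ^ l" "(2 * j + 1) * 2 ^ l \<le> t"
      using Suc.prems(2) False by (auto simp: algebra_simps intro: le_less_trans)
    then have "\<bar>P ((2 * j + 1) * 2 ^ l) - P (2 * j * 2 ^ l)\<bar> \<le> thr"
      using W l unfolding windows_small_def by blast
    ultimately show ?thesis by (simp add: algebra_simps)
  qed
next
  case 0
  then have "t = j" by simp
  then show ?case by simp
qed

text \<open>The mirror image: from \<open>r\<close> to the end of the window of level
  \<open>l\<close> around it there are at most \<open>l + 1\<close> windows, found by
  halving.\<close>

lemma dyadic_suffix:
  assumes W: "windows_small thr b P r t" and thr: "0 \<le> thr"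
    and "l < b" "j * 2 ^ l \<le> r" "r < (j + 1) * 2 ^ l" "(j + 1) * 2 ^ l \<le> t"
  shows "\<bar>P ((j + 1) * 2 ^ l) - P r\<bar> \<le> real (l + 1) * thr"
  using assms(3-)
proof (induction l arbitrary: j)
  case 0
  have "\<bar>P ((j + 1) * 2 ^ 0) - P (j * 2 ^ 0)\<bar> \<le> thr"
    using W 0 unfolding windows_small_def by blast
  moreover have "r = j" using 0 by simp
  ultimately show ?case by simp
next
  case (Suc l)
  have l: "l < b" using Suc.prems by simp
  have e: "(j + 1) * 2 ^ Suc l = (2 * j + 1 + 1) * 2 ^ l" by (simp add: algebra_simps)
  show ?case
  proof (cases "r < (2 * j + 1) * 2 ^ l")
    case True
    then have "\<bar>P ((2 * j + 1) * 2 ^ l) - P r\<bar> \<le> real (l + 1) * thr"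
      using Suc.prems by (intro Suc.IH) (auto simp: algebra_simps)
    moreover have "\<bar>P ((2 * j + 1 + 1) * 2 ^ l) - P ((2 * j + 1) * 2 ^ l)\<bar> \<le> thr"
      using W l Suc.prems unfolding windows_small_def e by blast
    ultimately show ?thesis unfolding e by (simp add: algebra_simps)
  next
    case False
    have "\<bar>P ((2 * j + 1 + 1) * 2 ^ l) - P r\<bar> \<le> real (l + 1) * thr"
      using Suc.prems False by (intro Suc.IH) (auto simp: algebra_simps)
    then show ?thesis using thr unfolding e by (simp add: algebra_simps)
  qed
qed

text \<open>In the smallest dyadic interval that contains both times, the midpoint separates them; a
  suffix before it and a prefix after it take at most two windows per level.\<close>

lemma dyadic_drift:
  assumes W: "windows_small thr b P r t" and thr: "0 \<le> thr" and "r \<le> t" "t < 2 ^ b"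
  shows "\<bar>P t - P r\<bar> \<le> 2 * real b * thr"
proof -
  have "l \<le> b \<Longrightarrow> j * 2 ^ l \<le> r \<Longrightarrow> t < (j + 1) * 2 ^ l \<Longrightarrow> \<bar>P t - P r\<bar> \<le> 2 * real l * thr" for l j
  proof (induction l arbitrary: j)
    case 0
    then have "r = t" using assms(3) by simp
    then show ?case by simp
  next
    case (Suc l)
    let ?m = "(2 * j + 1) * 2 ^ l"
    consider "t < ?m" | "?m \<le> r" | "r < ?m" "?m \<le> t" by linarith
    then show ?case
    proof cases
      case 1
      then have "\<bar>P t - P r\<bar> \<le> 2 * real l * thr" using Suc.prems by (intro Suc.IH[of "2 * j"]) auto
      then show ?thesis using thr by (simp add: algebra_simps)
    next
      case 2
      then have "\<bar>P t - P r\<bar> \<le> 2 * real l * thr"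
        using Suc.prems by (intro Suc.IH[of "2 * j + 1"]) (auto simp: algebra_simps)
      then show ?thesis using thr by (simp add: algebra_simps)
    next
      case 3
      have "\<bar>P ?m - P r\<bar> \<le> real (l + 1) * thr"
        using dyadic_suffix[OF W thr, of l "2 * j"] 3 Suc.prems by simp
      moreover have "\<bar>P t - P ?m\<bar> \<le> real l * thr"
        using 3 Suc.prems by (intro dyadic_prefix[OF W thr]) (auto simp: algebra_simps)
      moreover have "2 * real (Suc l) * thr = real (l + 1) * thr + real l * thr + thr" by (simp add: algebra_simps)
      ultimately show ?thesis using thr by linarith
    qed
  qed
  from this[of b 0] show ?thesis using assms by simp
qed

definition tracks :: "real \<Rightarrow> nat \<Rightarrow> (nat \<Rightarrow> real) \<Rightarrow> nat \<Rightarrow> nat \<Rightarrow> (nat \<Rightarrow> real) \<Rightarrow> bool" where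
  "tracks thr b P r t u \<longleftrightarrow> windows_small thr b P r t \<and> (\<forall>l<b. u l = P t - P (t - t mod 2 ^ l))"

text \<open>The windows ending at \<open>Suc t\<close> are those of the levels with
  \<open>2 ^ l dvd Suc t\<close>, and their sums are the values \<open>u l + a\<close> that are
  about to be reset. Smallness is demanded only if the row is not synchronised now, that is, if
  \<open>r' \<le> t\<close>.\<close>

lemma tracks_step:
  assumes T: "tracks thr b P r t u"
    and small: "\<And>l. l < b \<Longrightarrow> 2 ^ l dvd Suc t \<Longrightarrow> r' \<le> t \<Longrightarrow> \<bar>u l + a\<bar> \<le> thr" and r: "r \<le> r'"
  shows "tracks thr b (P(Suc t := P t + a)) r' (Suc t) (\<lambda>l. if 2 ^ l dvd Suc t then 0 else u l + a)"
  unfolding tracks_def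
proof (intro conjI allI impI)
  let ?P = "P(Suc t := P t + a)"
  have u: "u l = P t - P (t - t mod 2 ^ l)" if "l < b" for l using T that by (simp add: tracks_def)
  show "windows_small thr b ?P r' (Suc t)"
    unfolding windows_small_def
  proof (intro allI impI)
    fix l j assume l: "l < b" "(j + 1) * 2 ^ l \<le> Suc t" "r' < (j + 1) * 2 ^ l"
    have p: "0 < (2::nat) ^ l" by simp
    have j: "j * 2 ^ l \<le> t"
    proof -
      have "j * 2 ^ l < (j + 1) * 2 ^ l" by simp
      then show ?thesis using l(2) by linarith
    qed
    show "\<bar>?P ((j + 1) * 2 ^ l) - ?P (j * 2 ^ l)\<bar> \<le> thr"
    proof (cases "(j + 1) * 2 ^ l = Suc t")
      case True
      have "t = j * 2 ^ l + (2 ^ l - 1)" using True p by (simp add: algebra_simps)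
      then have "t mod 2 ^ l = (2 ^ l - 1 + j * 2 ^ l) mod 2 ^ l" by (simp only: add.commute)
      also have "\<dots> = 2 ^ l - 1" unfolding mod_mult_self1 by (rule mod_less) (use p in simp)
      finally have "t mod 2 ^ l = 2 ^ l - 1" .
      then have "t - t mod 2 ^ l = j * 2 ^ l" using True p by (simp add: algebra_simps)
      moreover have "\<bar>u l + a\<bar> \<le> thr" using small[OF l(1)] l(3) True by (metis dvd_triv_right less_Suc_eq_le)
      ultimately show ?thesis using u[OF l(1)] j unfolding True by simp
    next
      case False
      then have "(j + 1) * 2 ^ l \<le> t" using l(2) by simp
      moreover have "r < (j + 1) * 2 ^ l" using l(3) r by simp
      ultimately have "\<bar>P ((j + 1) * 2 ^ l) - P (j * 2 ^ l)\<bar> \<le> thr"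
        using T l(1) unfolding tracks_def windows_small_def by blast
      then show ?thesis using False j by auto
    qed
  qed
  fix l assume l: "l < b"
  show "(if 2 ^ l dvd Suc t then 0 else u l + a) = ?P (Suc t) - ?P (Suc t - Suc t mod 2 ^ l)"
  proof (cases "2 ^ l dvd Suc t")
    case False
    then have "Suc t mod 2 ^ l = Suc (t mod 2 ^ l)" by (metis dvd_eq_mod_eq_0 mod_Suc)
    then show ?thesis using False u[OF l] by auto
  qed (simp add: dvd_eq_mod_eq_0)
qed

section \<open>Errors of the tests in one tree\<close>

context sizes
begin

lemma node_bound: "i < n \<Longrightarrow> node i k < 2 * n"
  using div_le_dividend[of "n + i" "2 ^ k"] unfolding node_def by linarith

lemma mult_sum: "mult v i = (\<Sum>k<DEP. of_bool (node i k = v))"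
proof -
  have "{k. k < DEP \<and> node i k = v} = {k\<in>{..<DEP}. node i k = v}" by auto
  then show ?thesis unfolding mult_def by (simp add: of_bool_def sum.If_cases Int_def)
qed

text \<open>Going up strictly decreases the number of a node until it is 0, so a positive number is
  met at most once.\<close>

lemma mult_le_1: "1 \<le> v \<Longrightarrow> mult v i \<le> 1"
proof -
  assume v: "1 \<le> v"
  have no: "k' \<le> k" if "node i k = v" "node i k' = v" for k k'
  proof (rule ccontr)
    assume "\<not> k' \<le> k"
    then obtain m where "k' = k + Suc m" using less_imp_Suc_add[of k k'] by auto
    then have "v = (n + i) div 2 ^ (k + Suc m)" using that by (simp only: node_def)
    also have "\<dots> = (n + i) div 2 ^ k div 2 ^ Suc m" by (simp only: power_add div_mult2_eq)
    also have "\<dots> = v div 2 ^ Suc m" using that by (simp only: node_def)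
    also have "\<dots> \<le> v div 2" by (simp add: div_mult2_eq)
    finally show False using v by simp
  qed
  have "card {k. k < DEP \<and> node i k = v} \<le> 1"
    unfolding One_nat_def by (rule card_le_Suc0_iff_eq[THEN iffD2]) (auto intro: no le_antisym)
  then show ?thesis by (simp add: mult_def)
qed

lemma mult_nonneg: "0 \<le> mult v i"
  by (simp add: mult_def)

lemma mult_0: "i < n \<Longrightarrow> 2 * n \<le> v \<Longrightarrow> mult v i = 0"
  using node_bound[of i] unfolding mult_sum by (intro sum.neutral) (auto simp: not_le[symmetric])

text \<open>The sketch of a leaf contains a single row, so the test of a leaf is exact. This is what
  makes the set of synchronised rows independent of the signs.\<close>

lemma mult_leaf: "i < n \<Longrightarrow> i' < n \<Longrightarrow> mult (n + i) i' = of_bool (i' = i)"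
proof -
  assume i: "i < n" "i' < n"
  have "node i' k \<noteq> n + i" if "0 < k" for k
  proof -
    have "node i' k \<le> (n + i') div 2"
      unfolding node_def using that by (cases k) (simp_all add: div_mult2_eq)
    then show ?thesis using i by linarith
  qed
  then have e: "node i' k = n + i \<longleftrightarrow> k = 0 \<and> i' = i" for k
    by (cases "k = 0") (auto simp: node_def)
  have "{k. k < DEP \<and> node i' k = n + i} = (if i' = i then {0} else {})"
    unfolding e using pos(5) by (cases "i' = i") auto
  then show ?thesis by (simp add: mult_def)
qed

lemma mult_node:
  assumes "k < DEP" "1 \<le> node i k" shows "mult (node i k) i = 1"
proof -
  have "0 < card {k'. k' < DEP \<and> node i k' = node i k}" using assms by (intro card_gt_0_iff[THEN iffD2]) auto
  then show ?thesis using mult_le_1[OF assms(2), of i] by (simp add: mult_def)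
qed

lemma sum_mult: "(\<Sum>v\<in>{1..<2*n}. mult v i) \<le> real DEP"
proof -
  have "(\<Sum>v\<in>{1..<2*n}. mult v i) = (\<Sum>k<DEP. \<Sum>v\<in>{1..<2*n}. of_bool (node i k = v))"
    unfolding mult_sum by (rule sum.swap)
  also have "\<dots> \<le> (\<Sum>k<DEP. 1)"
    by (intro sum_mono) (simp add: of_bool_def)
  finally show ?thesis by simp
qed

definition positive_test :: "real \<Rightarrow> (nat \<Rightarrow> real) \<Rightarrow> (nat \<Rightarrow> real) \<Rightarrow> nat \<Rightarrow> bool" where
  "positive_test thr \<sigma> u v \<longleftrightarrow> (\<exists>r<K. thr\<^sup>2 < (\<Sum>i<n. mult v i * \<sigma> (r * n + i) * u i)\<^sup>2)"

lemma test_positive_test: "test thr s l = positive_test thr (aS s) (aU s l)"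
  by (simp add: test_def positive_test_def fun_eq_iff)

definition missed :: "real \<Rightarrow> (nat \<Rightarrow> real) \<Rightarrow> (nat \<Rightarrow> real) \<Rightarrow> bool" where
  "missed thr \<sigma> u \<longleftrightarrow> (\<exists>i<n. thr\<^sup>2 < (u i)\<^sup>2 \<and> \<not> all_up (positive_test thr \<sigma> u) (n + i))"

text \<open>The factor \<open>2 * K\<close> is what Hoeffding's inequality needs for a failure
  probability \<open>2 * exp (- K)\<close>. A spurious node costs time only; the outputs depend on
  \<open>missed\<close> alone.\<close>

definition spurious :: "real \<Rightarrow> (nat \<Rightarrow> real) \<Rightarrow> (nat \<Rightarrow> real) \<Rightarrow> bool" where
  "spurious thr \<sigma> u \<longleftrightarrow> (\<exists>v\<in>{1..<2*n}. positive_test thr \<sigma> u v \<and> 2 * real K * (\<Sum>i<n. (mult v i * u i)\<^sup>2) \<le> thr\<^sup>2)"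

text \<open>There are \<open>n * DEP\<close> pairs of a row and a node on its path, each failing
  with probability \<open>(1/2) ^ K\<close>, and at most \<open>2 * n * K\<close> pairs of a node
  and a sketch, each failing with twice that.\<close>

definition "flaw_prob = real n * (real DEP + 4 * real K) * (1/2) ^ K"

text \<open>\<open>u\<close> is fixed independently of the signs; this is the independence that the
  adversary must not be able to break.\<close>

lemma prob_flaw:
  assumes thr: "0 < thr" and dep: "2 * n \<le> 2 ^ DEP"
  shows "measure_pmf.prob (signs_pmf (K * n)) {\<sigma>. missed thr \<sigma> u \<or> spurious thr \<sigma> u} \<le> flaw_prob"
proof -
  let ?p = "signs_pmf (K * n)"
  let ?E = "\<lambda>(i, k). {\<sigma>. (1 \<le> node i k \<and> thr\<^sup>2 < (u i)\<^sup>2) \<and> (\<forall>r<K. (\<Sum>i'<n. \<sigma> (r * n + i') * (mult (node i k) i' * u i'))\<^sup>2 \<le> thr\<^sup>2)}"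
  let ?G = "\<lambda>(v, r). {\<sigma>. 2 * real K * (\<Sum>i<n. (mult v i * u i)\<^sup>2) \<le> thr\<^sup>2 \<and> thr\<^sup>2 < (\<Sum>i<n. \<sigma> (r * n + i) * (mult v i * u i))\<^sup>2}"
  have "{\<sigma>. missed thr \<sigma> u} \<subseteq> (\<Union>x\<in>{..<n} \<times> {..<DEP}. ?E x)"
  proof
    fix \<sigma> assume "\<sigma> \<in> {\<sigma>. missed thr \<sigma> u}"
    then obtain i where i: "i < n" "thr\<^sup>2 < (u i)\<^sup>2" "\<not> all_up (positive_test thr \<sigma> u) (n + i)"
      by (auto simp: missed_def)
    then obtain k where k: "(n + i) div 2 ^ k \<noteq> 0" "\<not> positive_test thr \<sigma> u ((n + i) div 2 ^ k)"
      using all_upI by blast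
    \<comment> \<open>The number of a leaf is below \<open>2 * n \<le> 2 ^ DEP\<close>, so after
      \<open>DEP\<close> halvings nothing is left of it.\<close>
    have "k < DEP"
    proof (rule ccontr)
      assume "\<not> k < DEP"
      then have "(2::nat) ^ DEP \<le> 2 ^ k" by simp
      then have "n + i < 2 ^ k" using dep i(1) by linarith
      then show False using k(1) by simp
    qed
    then show "\<sigma> \<in> (\<Union>x\<in>{..<n} \<times> {..<DEP}. ?E x)" using i k
      by (intro UN_I[of "(i, k)"]) (auto simp: positive_test_def node_def not_less mult.assoc mult.left_commute, meson not_le)
  qed
  moreover have "{\<sigma>. spurious thr \<sigma> u} \<subseteq> (\<Union>x\<in>{1..<2*n} \<times> {..<K}. ?G x)"
  proof
    fix \<sigma> assume "\<sigma> \<in> {\<sigma>. spurious thr \<sigma> u}"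
    then obtain v r where "v \<in> {1..<2*n}" "r < K" "thr\<^sup>2 < (\<Sum>i<n. mult v i * \<sigma> (r * n + i) * u i)\<^sup>2"
      "2 * real K * (\<Sum>i<n. (mult v i * u i)\<^sup>2) \<le> thr\<^sup>2" by (auto simp: spurious_def positive_test_def)
    then show "\<sigma> \<in> (\<Union>x\<in>{1..<2*n} \<times> {..<K}. ?G x)"
      by (intro UN_I[of "(v, r)"]) (auto simp: mult.assoc mult.left_commute)
  qed
  ultimately have "{\<sigma>. missed thr \<sigma> u \<or> spurious thr \<sigma> u} \<subseteq> (\<Union>x\<in>{..<n} \<times> {..<DEP}. ?E x) \<union> (\<Union>x\<in>{1..<2*n} \<times> {..<K}. ?G x)"
    by blast
  then have "measure_pmf.prob ?p {\<sigma>. missed thr \<sigma> u \<or> spurious thr \<sigma> u} \<le>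
      measure_pmf.prob ?p ((\<Union>x\<in>{..<n} \<times> {..<DEP}. ?E x) \<union> (\<Union>x\<in>{1..<2*n} \<times> {..<K}. ?G x))"
    by (rule measure_pmf.finite_measure_mono) simp
  also have "\<dots> \<le> measure_pmf.prob ?p (\<Union>x\<in>{..<n} \<times> {..<DEP}. ?E x) + measure_pmf.prob ?p (\<Union>x\<in>{1..<2*n} \<times> {..<K}. ?G x)"
    by (rule measure_Un_le) auto
  also have "\<dots> \<le> real (card ({..<n} \<times> {..<DEP})) * (1/2) ^ K + real (card ({1..<2*n} \<times> {..<K})) * (2 * (1/2) ^ K)"
  proof (intro add_mono prob_UN_le)
    fix x assume "x \<in> {..<n} \<times> {..<DEP}"
    then obtain i k where x: "x = (i, k)" "i < n" "k < DEP" by auto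
    show "measure_pmf.prob ?p (?E x) \<le> (1/2) ^ K"
    proof (cases "1 \<le> node i k \<and> thr\<^sup>2 < (u i)\<^sup>2")
      case True
      then show ?thesis
        using prob_all_sketches_small[of i n thr "\<lambda>i'. mult (node i k) i' * u i'" K] mult_node[OF x(3), of i] thr x
        by simp
    next
      case False
      then have "?E x = {}" by (auto simp: x)
      then show ?thesis by simp
    qed
  next
    fix x assume "x \<in> {1..<2*n} \<times> {..<K}"
    then obtain v r where x: "x = (v, r)" "r < K" by auto
    show "measure_pmf.prob ?p (?G x) \<le> 2 * (1/2) ^ K"
    proof (cases "2 * real K * (\<Sum>i<n. (mult v i * u i)\<^sup>2) \<le> thr\<^sup>2")
      case True
      have "exp (- 1 :: real) \<le> 1/2"
        using exp_ge_add_one_self[of 1] by (simp add: exp_minus field_simps)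
      then have "exp (- 1 :: real) ^ K \<le> (1/2) ^ K" by (intro power_mono) auto
      then have e: "2 * exp (- (2 * real K) / 2) \<le> 2 * (1/2) ^ K" by (simp add: exp_of_nat_mult[symmetric])
      show ?thesis using order_trans[OF prob_sketch_large[OF x(2) thr True] e] True by (simp add: x)
    next
      case False
      then have "?G x = {}" by (auto simp: x)
      then show ?thesis by simp
    qed
  qed auto
  also have "\<dots> = real n * real DEP * (1/2) ^ K + (2 * real n - 1) * real K * 2 * (1/2) ^ K"
    using n_pos by (simp add: card_cartesian_product of_nat_diff)
  also have "\<dots> \<le> real n * real DEP * (1/2) ^ K + (2 * real n) * real K * 2 * (1/2) ^ K"
    by (intro add_left_mono mult_right_mono) auto
  also have "\<dots> = flaw_prob" by (simp add: flaw_prob_def algebra_simps)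
  finally show ?thesis .
qed

end

section \<open>Energy pays for the work\<close>

text \<open>The energy is relative to the new value \<open>z = x + a + c\<close>, the windows to the
  reported \<open>b\<close>. If \<open>z \<le> 4 * b\<close>, changes relative to \<open>b\<close>
  are at most 4 times those relative to \<open>z\<close>. Otherwise
  \<open>x \<le> 3/2 * b < 3/8 * z\<close>, so \<open>a + c \<ge> 5/8 * z\<close>, and
  \<open>e\<close> is at least \<open>25/128\<close>.\<close>

lemma energy_row:
  fixes a b c x :: real
  assumes b: "0 < b" and x: "\<bar>x - b\<bar> \<le> b / 2" and x': "0 < x + a + c"
  defines "e \<equiv> (a / (x + a + c))\<^sup>2 + (c / (x + a + c))\<^sup>2"
  shows "1/16 \<le> e \<or> (a / b)\<^sup>2 \<le> 16 * e \<and> (c / b)\<^sup>2 \<le> 16 * e"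
proof -
  define z where "z = x + a + c"
  have z: "0 < z" using x' by (simp add: z_def)
  have e: "e = (a\<^sup>2 + c\<^sup>2) / z\<^sup>2" by (simp add: e_def z_def power_divide add_divide_distrib)
  show ?thesis
  proof (cases "z \<le> 4 * b")
    case True
    then have z16: "z\<^sup>2 \<le> 16 * b\<^sup>2" using power_mono[of z "4 * b" 2] z by (simp add: power_mult_distrib)
    have "(q / b)\<^sup>2 \<le> 16 * e" if "q\<^sup>2 \<le> a\<^sup>2 + c\<^sup>2" for q
    proof -
      have "q\<^sup>2 * z\<^sup>2 \<le> (a\<^sup>2 + c\<^sup>2) * (16 * b\<^sup>2)" by (intro mult_mono that z16) auto
      then have "q\<^sup>2 / b\<^sup>2 \<le> 16 * ((a\<^sup>2 + c\<^sup>2) / z\<^sup>2)" using b z by (simp add: field_simps)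
      then show ?thesis by (simp add: e power_divide)
    qed
    then show ?thesis by simp
  next
    case False
    have "2 * x \<le> 3 * b" using x by linarith
    moreover have "4 * b < x + (a + c)" using False by (simp add: z_def)
    moreover have "5 * z = 5 * x + 5 * (a + c)" by (simp add: z_def)
    ultimately have "5 * z \<le> 8 * (a + c)" by argo
    then have "5 / 8 * z \<le> a + c" by simp
    then have "(5 / 8 * z)\<^sup>2 \<le> (a + c)\<^sup>2" using z by (intro power_mono) auto
    also have "\<dots> \<le> 2 * (a\<^sup>2 + c\<^sup>2)" using sum_squares_bound[of a c] by (simp add: power2_sum)
    finally have "25 * z\<^sup>2 \<le> 128 * (a\<^sup>2 + c\<^sup>2)" by (simp add: power_mult_distrib power_divide)
    then have "1/16 * z\<^sup>2 \<le> a\<^sup>2 + c\<^sup>2" using zero_le_power2[of z] by argo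
    then show ?thesis using z by (simp add: e field_simps)
  qed
qed

text \<open>One step of the Cauchy-Schwarz inequality, which is thus built up query by query;
  \<open>m\<close> counts the queries so far.\<close>

lemma square_add_le:
  fixes u v :: real
  assumes "u\<^sup>2 \<le> 16 * m * p" "v\<^sup>2 \<le> 16 * q" "0 \<le> p" "0 \<le> q" "0 \<le> m"
  shows "(u + v)\<^sup>2 \<le> 16 * (m + 1) * (p + q)"
proof -
  have "(u * v)\<^sup>2 \<le> (16 * m * p) * (16 * q)"
    unfolding power_mult_distrib by (intro mult_mono assms) (use assms in auto)
  \<comment> \<open>Prepared for the inequality of the arithmetic and the geometric mean, which
    bounds the mixed term \<open>u * v\<close>.\<close>
  also have "\<dots> = 4 * (8 * (m * q)) * (8 * p)" by simp
  also have "\<dots> \<le> (8 * (m * q) + 8 * p)\<^sup>2"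
  proof -
    have "0 \<le> (8 * (m * q) - 8 * p)\<^sup>2" by simp
    then show ?thesis by (simp add: power2_eq_square algebra_simps)
  qed
  finally have sq: "(u * v)\<^sup>2 \<le> (8 * (m * q) + 8 * p)\<^sup>2" .
  have "0 \<le> 8 * (m * q) + 8 * p" using assms(3-5) by simp
  with sq have "u * v \<le> 8 * (m * q) + 8 * p" by (rule power2_le_imp_le)
  moreover have "(u + v)\<^sup>2 = u\<^sup>2 + v\<^sup>2 + 2 * (u * v)" by (simp add: power2_sum)
  moreover have "16 * (m + 1) * (p + q) = 16 * m * p + 16 * q + 2 * (8 * (m * q) + 8 * p)" by (simp add: algebra_simps)
  ultimately show ?thesis using assms(1,2) by (smt (verit))
qed

definition window :: "(nat \<Rightarrow> nat \<Rightarrow> real) \<Rightarrow> nat \<Rightarrow> nat \<Rightarrow> nat \<Rightarrow> real" where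
  "window en a b i = (\<Sum>j\<in>{a<..b}. en j i)"

lemma window_nonneg: "(\<And>j. 0 \<le> en j i) \<Longrightarrow> 0 \<le> window en a b i"
  by (simp add: window_def sum_nonneg)

lemma window_Suc: "a \<le> b \<Longrightarrow> window en a (Suc b) i = window en a b i + en (Suc b) i"
proof -
  assume "a \<le> b"
  then have "{a<..Suc b} = insert (Suc b) {a<..b}" by auto
  then show ?thesis by (simp add: window_def)
qed

context sizes
begin

text \<open>\<open>P\<close> and \<open>Q\<close> are running sums of the relative changes due to
  \<open>h\<close> and to \<open>\<delta>\<close>, and \<open>r\<close> is the last synchronisation.
  Since \<open>r\<close> the denominator \<open>aB s i\<close> was constant, so the sums add up to
  the relative distance of \<open>aX\<close> from \<open>aB\<close>; earlier terms have other
  denominators and matter only inside windows around \<open>r\<close>.\<close>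

definition close :: "real \<Rightarrow> ast \<Rightarrow> bool" where
  "close thr s \<longleftrightarrow> (\<forall>i<n. 0 < aB s i \<and> (\<exists>P Q r. r \<le> aT s \<and>
     aX s i - aB s i = aB s i * ((P (aT s) - P r) + (Q (aT s) - Q r)) \<and>
     tracks thr L P r (aT s) (\<lambda>l. aU s l i) \<and> tracks thr L Q r (aT s) (\<lambda>l. aV s l i)))"

text \<open>\<open>P\<close> and \<open>Q\<close> each drift by at most \<open>2 * L * thr\<close>;
  with \<open>thr = \<epsilon> / (8 * L)\<close> the total is \<open>\<epsilon> / 2\<close>.\<close>

lemma close_drift:
  assumes C: "close thr s" and thr: "0 \<le> thr" and t: "aT s < R" and i: "i < n"
  shows "\<bar>aX s i - aB s i\<bar> \<le> 4 * real L * thr * aB s i"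
proof -
  obtain P Q r where b: "0 < aB s i" and r: "r \<le> aT s"
    and eq: "aX s i - aB s i = aB s i * ((P (aT s) - P r) + (Q (aT s) - Q r))"
    and W: "windows_small thr L P r (aT s)" "windows_small thr L Q r (aT s)"
    using C i unfolding close_def tracks_def by blast
  have t2: "aT s < 2 ^ L" using t by (simp add: R_L)
  have "\<bar>(P (aT s) - P r) + (Q (aT s) - Q r)\<bar> \<le> 4 * real L * thr"
    using dyadic_drift[OF W(1) thr r t2] dyadic_drift[OF W(2) thr r t2] by linarith
  then have "\<bar>aX s i - aB s i\<bar> \<le> aB s i * (4 * real L * thr)"
    unfolding eq abs_mult using b by (intro mult_mono) auto
  then show ?thesis by (simp add: mult_ac)
qed

lemma close_fresh:
  assumes "aB s = aX s" "\<And>i. i < n \<Longrightarrow> 0 < aX s i" "aU s = (\<lambda>_ _. 0)" "aV s = (\<lambda>_ _. 0)" "aT s = 0"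
  shows "close thr s"
  unfolding close_def
proof (intro allI impI conjI)
  fix i assume "i < n"
  then show "0 < aB s i" using assms by simp
  show "\<exists>P Q r. r \<le> aT s \<and>
     aX s i - aB s i = aB s i * ((P (aT s) - P r) + (Q (aT s) - Q r)) \<and>
     tracks thr L P r (aT s) (\<lambda>l. aU s l i) \<and> tracks thr L Q r (aT s) (\<lambda>l. aV s l i)"
    by (intro exI[of _ "\<lambda>_. 0"] exI[of _ 0]) (simp add: assms tracks_def windows_small_def)
qed

definition unflawed :: "real \<Rightarrow> nat \<Rightarrow> ast \<Rightarrow> bool" where
  "unflawed thr t s \<longleftrightarrow> (\<forall>l<L. 2 ^ l dvd t \<longrightarrow> \<not> missed thr (aS s) (aU s l) \<and> \<not> spurious thr (aS s) (aU s l))"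

definition advance :: "real \<Rightarrow> ast \<Rightarrow> ast" where
  "advance thr s1 = (levelsA thr (Suc (aT s1)) s1 L)\<lparr>aT := Suc (aT s1)\<rparr>"

lemma close_advance:
  assumes C: "close thr s" and thr: "0 \<le> thr" and F: "unflawed thr (Suc (aT s)) (absorbA A y \<delta> s)"
    and X: "\<And>i. i < n \<Longrightarrow> 0 < aX (absorbA A y \<delta> s) i"
  shows "close thr (advance thr (absorbA A y \<delta> s))"
  unfolding close_def
proof (intro allI impI)
  let ?s1 = "absorbA A y \<delta> s" let ?s2 = "advance thr ?s1" let ?t = "aT s"
  fix i assume i: "i < n"
  obtain P Q r where b: "0 < aB s i" and r: "r \<le> ?t"
    and eq: "aX s i - aB s i = aB s i * ((P ?t - P r) + (Q ?t - Q r))"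
    and T: "tracks thr L P r ?t (\<lambda>l. aU s l i)" "tracks thr L Q r ?t (\<lambda>l. aV s l i)"
    using C i unfolding close_def by blast
  define a where "a = aG s i / aB s i * (\<Sum>j<d. A i j * y j)"
  define c where "c = \<delta> i / aB s i"
  define h where "h \<longleftrightarrow> (\<exists>l<L. 2 ^ l dvd Suc ?t \<and> hit thr ?s1 l i)"
  \<comment> \<open>A synchronisation at any level starts the row afresh, so \<open>r\<close> moves
    to the present.\<close>
  define r' where "r' = (if h then Suc ?t else r)"
  have t1: "aT ?s1 = ?t" by (simp add: absorbA_def)
  have U1: "aU ?s1 l i = aU s l i + a" "aV ?s1 l i = aV s l i + c" for l
    by (simp_all add: absorbA_def a_def c_def)
  have X1: "aX ?s1 i = aX s i + aB s i * (a + c)" using b by (simp add: absorbA_def a_def c_def field_simps)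
  have s2: "aX ?s2 i = aX ?s1 i" "aB ?s2 i = (if h then aX ?s1 i else aB s i)" "aT ?s2 = Suc ?t"
    "l < L \<Longrightarrow> aU ?s2 l i = (if 2 ^ l dvd Suc ?t then 0 else aU s l i + a)"
    "l < L \<Longrightarrow> aV ?s2 l i = (if 2 ^ l dvd Suc ?t then 0 else aV s l i + c)" for l
    by (simp_all add: advance_def levelsA_def t1 h_def[symmetric] U1) (simp_all add: absorbA_def)
  \<comment> \<open>Without a hit, \<open>aV\<close> was seen to be small directly; for
    \<open>aU\<close> this needs the absence of a missed row.\<close>
  have small: "\<bar>aU s l i + a\<bar> \<le> thr \<and> \<bar>aV s l i + c\<bar> \<le> thr" if l: "l < L" "2 ^ l dvd Suc ?t" "r' \<le> ?t" for l
  proof -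
    have nh: "\<not> hit thr ?s1 l i" using l by (auto simp: r'_def h_def split: if_splits)
    have "\<not> missed thr (aS ?s1) (aU ?s1 l)" using F l by (auto simp: unflawed_def)
    then have "\<not> thr\<^sup>2 < (aU ?s1 l i)\<^sup>2" "\<not> thr\<^sup>2 < (aV ?s1 l i)\<^sup>2"
      using nh i unfolding missed_def hit_def test_positive_test by blast+
    then have "(aU s l i + a)\<^sup>2 \<le> thr\<^sup>2" "(aV s l i + c)\<^sup>2 \<le> thr\<^sup>2"
      by (simp_all add: U1 not_less)
    then show ?thesis using thr by (simp add: abs_le_square_iff[symmetric])
  qed
  have rr: "r \<le> r'" "r' \<le> Suc ?t" using r by (auto simp: r'_def)
  have T1: "tracks thr L (P(Suc ?t := P ?t + a)) r' (Suc ?t) (\<lambda>l. if 2 ^ l dvd Suc ?t then 0 else aU s l i + a)"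
    by (rule tracks_step[OF T(1) _ rr(1)]) (use small in blast)
  have T2: "tracks thr L (Q(Suc ?t := Q ?t + c)) r' (Suc ?t) (\<lambda>l. if 2 ^ l dvd Suc ?t then 0 else aV s l i + c)"
    by (rule tracks_step[OF T(2) _ rr(1)]) (use small in blast)
  have cong: "tracks thr L p r' (Suc ?t) u'" if "tracks thr L p r' (Suc ?t) u" "\<And>l. l < L \<Longrightarrow> u' l = u l" for p u u'
    using that by (simp add: tracks_def)
  have TT: "tracks thr L (P(Suc ?t := P ?t + a)) r' (Suc ?t) (\<lambda>l. aU ?s2 l i)"
    "tracks thr L (Q(Suc ?t := Q ?t + c)) r' (Suc ?t) (\<lambda>l. aV ?s2 l i)"
    by (rule cong[OF T1]; rule s2(4); assumption) (rule cong[OF T2]; rule s2(5); assumption)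
  have "aX ?s2 i - aB ?s2 i = aB ?s2 i * (((P(Suc ?t := P ?t + a)) (Suc ?t) - (P(Suc ?t := P ?t + a)) r') +
      ((Q(Suc ?t := Q ?t + c)) (Suc ?t) - (Q(Suc ?t := Q ?t + c)) r'))"
  proof (cases h)
    case False
    then have "aX ?s2 i - aB ?s2 i = (aX s i - aB s i) + aB s i * (a + c)" by (simp add: s2 X1)
    also have "\<dots> = aB s i * ((P ?t + a - P r) + (Q ?t + c - Q r))" unfolding eq by (simp add: algebra_simps)
    finally show ?thesis using False r by (simp add: r'_def s2)
  qed (simp add: s2 r'_def)
  moreover have "0 < aB ?s2 i" using X[OF i] b by (simp add: s2)
  ultimately show "0 < aB ?s2 i \<and> (\<exists>P Q r. r \<le> aT ?s2 \<and>
     aX ?s2 i - aB ?s2 i = aB ?s2 i * ((P (aT ?s2) - P r) + (Q (aT ?s2) - Q r)) \<and>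
     tracks thr L P r (aT ?s2) (\<lambda>l. aU ?s2 l i) \<and> tracks thr L Q r (aT ?s2) (\<lambda>l. aV ?s2 l i))"
    unfolding s2(3) using TT rr(2) by blast
qed

text \<open>Either the row has received energy \<open>1/16\<close> in the window, which pays for
  anything done to it, or its accumulated changes obey the Cauchy-Schwarz bound with the number
  \<open>T mod 2 ^ l\<close> of queries in the window. \<open>absorbed\<close> is the same between
  the absorption of a query and its checks.\<close>

definition backed :: "(nat \<Rightarrow> nat \<Rightarrow> real) \<Rightarrow> nat \<Rightarrow> ast \<Rightarrow> bool" where
  "backed en T s \<longleftrightarrow> (\<forall>i<n. \<forall>l<L. let E = window en (T - T mod 2 ^ l) T i in
     1/16 \<le> E \<or> (aU s l i)\<^sup>2 \<le> 16 * real (T mod 2 ^ l) * E \<and> (aV s l i)\<^sup>2 \<le> 16 * real (T mod 2 ^ l) * E)"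

definition absorbed :: "(nat \<Rightarrow> nat \<Rightarrow> real) \<Rightarrow> nat \<Rightarrow> ast \<Rightarrow> bool" where
  "absorbed en T s \<longleftrightarrow> (\<forall>i<n. \<forall>l<L. let E = window en (T - T mod 2 ^ l) (Suc T) i in
     1/16 \<le> E \<or> (aU s l i)\<^sup>2 \<le> 16 * (real (T mod 2 ^ l) + 1) * E \<and> (aV s l i)\<^sup>2 \<le> 16 * (real (T mod 2 ^ l) + 1) * E)"

lemma backed_fresh:
  assumes "aU s = (\<lambda>_ _. 0)" "aV s = (\<lambda>_ _. 0)" "R dvd T"
  shows "backed en T s"
proof -
  have "2 ^ l dvd T" if "l < L" for l using that assms(3) by (metis R_L dvd_trans le_imp_power_dvd less_imp_le)
  then show ?thesis by (simp add: backed_def assms(1,2) dvd_eq_mod_eq_0 Let_def)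
qed

lemma absorbed_absorb:
  assumes B: "backed en T s" and C: "close thr s" and thr: "0 \<le> thr" "8 * real L * thr \<le> 1" and t: "aT s < R"
    and X: "\<And>i. i < n \<Longrightarrow> 0 < aX (absorbA A y \<delta> s) i"
    and e: "\<And>i. i < n \<Longrightarrow> en (Suc T) i = (aG s i * (\<Sum>j<d. A i j * y j) / aX (absorbA A y \<delta> s) i)\<^sup>2 + (\<delta> i / aX (absorbA A y \<delta> s) i)\<^sup>2"
    and en: "\<And>j i. 0 \<le> en j i"
  shows "absorbed en T (absorbA A y \<delta> s)"
  unfolding absorbed_def Let_def
proof (intro allI impI)
  fix i l assume i: "i < n" and l: "l < L"
  let ?E = "window en (T - T mod 2 ^ l) T i" and ?a = "aG s i * (\<Sum>j<d. A i j * y j)" and ?s1 = "absorbA A y \<delta> s"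
  have b: "0 < aB s i" using C i by (auto simp: close_def)
  have E0: "0 \<le> ?E" using en by (rule window_nonneg)
  have W: "window en (T - T mod 2 ^ l) (Suc T) i = ?E + en (Suc T) i" by (rule window_Suc) simp
  \<comment> \<open>The threshold keeps \<open>x\<close> within half of \<open>aB\<close>, as
    \<open>energy_row\<close> requires.\<close>
  have "\<bar>aX s i - aB s i\<bar> \<le> aB s i / 2"
  proof -
    have "4 * real L * thr * aB s i \<le> 1/2 * aB s i" using thr b by (intro mult_right_mono) auto
    then show ?thesis using close_drift[OF C thr(1) t i] by simp
  qed
  moreover have x1: "aX ?s1 i = aX s i + ?a + \<delta> i" by (simp add: absorbA_def)
  ultimately have "1/16 \<le> en (Suc T) i \<or> (?a / aB s i)\<^sup>2 \<le> 16 * en (Suc T) i \<and> (\<delta> i / aB s i)\<^sup>2 \<le> 16 * en (Suc T) i"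
    using energy_row[OF b, of "aX s i" ?a "\<delta> i"] X[OF i] e[OF i] by simp
  moreover have "1/16 \<le> ?E \<or> (aU s l i)\<^sup>2 \<le> 16 * real (T mod 2 ^ l) * ?E \<and> (aV s l i)\<^sup>2 \<le> 16 * real (T mod 2 ^ l) * ?E"
    using B i l by (simp add: backed_def Let_def)
  moreover have U: "aU ?s1 l i = aU s l i + ?a / aB s i" "aV ?s1 l i = aV s l i + \<delta> i / aB s i"
    by (simp_all add: absorbA_def)
  ultimately show "1/16 \<le> window en (T - T mod 2 ^ l) (Suc T) i \<or>
     (aU ?s1 l i)\<^sup>2 \<le> 16 * (real (T mod 2 ^ l) + 1) * window en (T - T mod 2 ^ l) (Suc T) i \<and>
     (aV ?s1 l i)\<^sup>2 \<le> 16 * (real (T mod 2 ^ l) + 1) * window en (T - T mod 2 ^ l) (Suc T) i"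
    unfolding W U using E0 en[of "Suc T" i] by (smt (verit) square_add_le of_nat_0_le_iff)
qed

lemma dvd_Suc_aT:
  assumes "aT s = T mod R" "l < L" shows "2 ^ l dvd Suc (aT s) \<longleftrightarrow> 2 ^ l dvd Suc T"
proof -
  have "2 ^ l dvd R" using assms(2) by (simp add: R_L le_imp_power_dvd)
  then have "aT s mod 2 ^ l = T mod 2 ^ l" by (simp add: assms(1) mod_mod_cancel)
  then have "Suc (aT s) mod 2 ^ l = Suc T mod 2 ^ l" by (metis mod_Suc_eq)
  then show ?thesis by (simp add: dvd_eq_mod_eq_0)
qed

lemma backed_advance:
  assumes A: "absorbed en T s1" and t: "aT s1 = T mod R"
  shows "backed en (Suc T) (advance thr s1)"
  unfolding backed_def Let_def
proof (intro allI impI)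
  fix i l assume i: "i < n" and l: "l < L"
  let ?s2 = "advance thr s1" and ?E = "window en (Suc T - Suc T mod 2 ^ l) (Suc T) i"
  show "1/16 \<le> ?E \<or> (aU ?s2 l i)\<^sup>2 \<le> 16 * real (Suc T mod 2 ^ l) * ?E \<and> (aV ?s2 l i)\<^sup>2 \<le> 16 * real (Suc T mod 2 ^ l) * ?E"
  proof (cases "2 ^ l dvd Suc T")
    case True
    then have "aU ?s2 l i = 0" "aV ?s2 l i = 0"
      using l by (simp_all add: advance_def levelsA_def dvd_Suc_aT[OF t])
    then show ?thesis using True by (simp add: dvd_eq_mod_eq_0)
  next
    case False
    then have U: "aU ?s2 l = aU s1 l" "aV ?s2 l = aV s1 l"
      using l by (simp_all add: advance_def levelsA_def dvd_Suc_aT[OF t])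
    have m: "Suc T mod 2 ^ l = Suc (T mod 2 ^ l)" using False by (metis dvd_eq_mod_eq_0 mod_Suc)
    then have "Suc T - Suc T mod 2 ^ l = T - T mod 2 ^ l" by simp
    then show ?thesis using A i l unfolding U m absorbed_def Let_def by (simp add: add.commute)
  qed
qed

text \<open>The sketch of the leaf is \<open>aU\<close> up to its sign, and squaring removes the
  sign: a false alarm higher up in the tree never causes a synchronisation.\<close>

lemma hit_large:
  assumes S: "\<And>x. x < K * n \<Longrightarrow> \<bar>aS s x\<bar> = 1" and i: "i < n" and h: "hit thr s l i"
  shows "thr\<^sup>2 < (aU s l i)\<^sup>2 \<or> thr\<^sup>2 < (aV s l i)\<^sup>2"
proof (cases "thr\<^sup>2 < (aV s l i)\<^sup>2")
  case False
  then have "all_up (test thr s l) (n + i)" using h by (simp add: hit_def)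
  then have "test thr s l (n + i)" using n_pos by (auto dest: all_upD)
  then obtain r where r: "r < K" "thr\<^sup>2 < (\<Sum>i'<n. mult (n + i) i' * aS s (r * n + i') * aU s l i')\<^sup>2"
    by (auto simp: test_def)
  have "(\<Sum>i'<n. mult (n + i) i' * aS s (r * n + i') * aU s l i') = (\<Sum>i'<n. if i' = i then aS s (r * n + i) * aU s l i else 0)"
    by (intro sum.cong) (auto simp: mult_leaf[OF i])
  also have "\<dots> = aS s (r * n + i) * aU s l i" using i by simp
  finally have "thr\<^sup>2 < (aS s (r * n + i))\<^sup>2 * (aU s l i)\<^sup>2" using r by (simp add: power_mult_distrib)
  moreover have "(aS s (r * n + i))\<^sup>2 = 1"
    using S[OF ix2_less[OF r(1) i]] by (metis power2_abs power_one)
  ultimately show ?thesis by simp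
qed simp

text \<open>Except for the root, a tested node is \<open>2 * v\<close> or \<open>2 * v + 1\<close>
  for a positive \<open>v\<close>; the set lists node numbers minus 1.\<close>

lemma tested_count_le:
  "tested_count thr s l \<le> 1 + 2 * card {v\<in>{1..<2*n}. test thr s l v}" "tested_count thr s l \<le> 2 * n"
proof -
  let ?T = "{u. u < 2 * n - 1 \<and> all_up (test thr s l) (Suc u div 2)}" and ?P = "{v\<in>{1..<2*n}. test thr s l v}"
  have "?T \<subseteq> {0} \<union> ((\<lambda>v. 2 * v - 1) ` ?P \<union> (\<lambda>v. 2 * v) ` ?P)"
  proof
    fix u assume u: "u \<in> ?T"
    show "u \<in> {0} \<union> ((\<lambda>v. 2 * v - 1) ` ?P \<union> (\<lambda>v. 2 * v) ` ?P)"
    proof (cases "u = 0")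
      case False
      let ?v = "Suc u div 2"
      have "?v \<noteq> 0" using False by simp
      then have "?v \<in> ?P" using u all_upD[of "test thr s l" ?v] by auto
      moreover have "u = 2 * ?v - 1 \<or> u = 2 * ?v" by presburger
      ultimately show ?thesis by blast
    qed simp
  qed
  then have "card ?T \<le> card ({0} \<union> ((\<lambda>v. 2 * v - 1) ` ?P \<union> (\<lambda>v. 2 * v) ` ?P))"
    by (rule card_mono[rotated]) simp
  also have "\<dots> \<le> card {0::nat} + (card ((\<lambda>v. 2 * v - 1) ` ?P) + card ((\<lambda>v. 2 * v) ` ?P))"
    by (intro order_trans[OF card_Un_le] add_mono card_Un_le order_refl)
  also have "\<dots> \<le> 1 + (card ?P + card ?P)"
    by (intro add_mono card_image_le) auto
  finally show "tested_count thr s l \<le> 1 + 2 * card ?P" by (simp add: tested_count_def)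
  have "card ?T \<le> card {..<2 * n}" by (intro card_mono) auto
  then show "tested_count thr s l \<le> 2 * n" by (simp add: tested_count_def)
qed

lemma hit_count_le: "hit_count thr s l \<le> n"
proof -
  have "card {i. i < n \<and> hit thr s l i} \<le> card {..<n}" by (intro card_mono) auto
  then show ?thesis by (simp add: hit_count_def)
qed

context
  fixes thr :: real and s :: ast and l :: nat and E :: "nat \<Rightarrow> real" and m :: real
  assumes thr: "0 < thr" "thr \<le> 1" and S: "\<And>x. x < K * n \<Longrightarrow> \<bar>aS s x\<bar> = 1"
    and m: "1 \<le> m" and E0: "\<And>i. 0 \<le> E i"
    and E: "\<And>i. i < n \<Longrightarrow> 1/16 \<le> E i \<or> (aU s l i)\<^sup>2 \<le> 16 * m * E i \<and> (aV s l i)\<^sup>2 \<le> 16 * m * E i"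
begin

lemma thr_sq: "thr\<^sup>2 \<le> 1"
  using thr by (simp add: power_le_one)

text \<open>A hit takes energy at least \<open>thr\<^sup>2 / (16 * m)\<close>: in the second
  alternative of \<open>E\<close> by \<open>hit_large\<close>, in the first because
  \<open>thr \<le> 1 \<le> m\<close>.\<close>

lemma hit_count_energy: "real (hit_count thr s l) * thr\<^sup>2 \<le> 16 * m * (\<Sum>i<n. E i)"
proof -
  let ?H = "{i. i < n \<and> hit thr s l i}"
  have "real (hit_count thr s l) * thr\<^sup>2 = (\<Sum>i\<in>?H. thr\<^sup>2)" by (simp add: hit_count_def)
  also have "\<dots> \<le> (\<Sum>i\<in>?H. 16 * m * E i)"
  proof (intro sum_mono)
    fix i assume "i \<in> ?H"
    then have i: "i < n" "thr\<^sup>2 < (aU s l i)\<^sup>2 \<or> thr\<^sup>2 < (aV s l i)\<^sup>2" using hit_large[OF S] by auto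
    show "thr\<^sup>2 \<le> 16 * m * E i"
    proof (cases "1/16 \<le> E i")
      case True
      then have "1 * (1/16) \<le> m * E i" using m by (intro mult_mono) auto
      then show ?thesis using thr_sq by simp
    qed (use E i in fastforce)
  qed
  also have "\<dots> \<le> (\<Sum>i<n. 16 * m * E i)"
    by (intro sum_mono2) (use E0 m in auto)
  finally show ?thesis by (simp add: sum_distrib_left)
qed

text \<open>A positive node that is not spurious carries squared changes above
  \<open>thr\<^sup>2 / (2 * K)\<close>, hence energy, and each row is counted in at most
  \<open>DEP\<close> nodes.\<close>

lemma positive_count_energy:
  assumes "\<not> spurious thr (aS s) (aU s l)"
  shows "real (card {v\<in>{1..<2*n}. test thr s l v}) * thr\<^sup>2 \<le> 32 * real K * m * real DEP * (\<Sum>i<n. E i)"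
proof -
  let ?P = "{v\<in>{1..<2*n}. test thr s l v}"
  have K1: "1 \<le> real K" using pos by simp
  have "real (card ?P) * thr\<^sup>2 = (\<Sum>v\<in>?P. thr\<^sup>2)" by simp
  also have "\<dots> \<le> (\<Sum>v\<in>?P. 32 * real K * m * (\<Sum>i<n. mult v i * E i))"
  proof (intro sum_mono)
    fix v assume v: "v \<in> ?P"
    have v1: "1 \<le> v" using v by auto
    have m1: "mult v i = 0 \<or> mult v i = 1" for i
    proof -
      have "card {k. k < DEP \<and> node i k = v} \<le> 1" using mult_le_1[OF v1, of i] by (simp add: mult_def)
      then have "card {k. k < DEP \<and> node i k = v} = 0 \<or> card {k. k < DEP \<and> node i k = v} = 1" by linarith
      then show ?thesis unfolding mult_def by (metis of_nat_0 of_nat_1)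
    qed
    have "thr\<^sup>2 < 2 * real K * (\<Sum>i<n. (mult v i * aU s l i)\<^sup>2)"
      using assms v by (auto simp: spurious_def test_positive_test not_le)
    show "thr\<^sup>2 \<le> 32 * real K * m * (\<Sum>i<n. mult v i * E i)"
    proof (cases "\<exists>i<n. mult v i = 1 \<and> 1/16 \<le> E i")
      case True
      then obtain i where i: "i < n" "mult v i = 1" "1/16 \<le> E i" by blast
      have "mult v i * E i \<le> (\<Sum>i<n. mult v i * E i)"
        by (rule member_le_sum) (use i E0 mult_nonneg in auto)
      then have "1 * 1 * (1/16) \<le> real K * m * (\<Sum>i<n. mult v i * E i)"
        using i K1 m by (intro mult_mono) auto
      then show ?thesis using thr_sq by simp
    next
      case False
      have "(\<Sum>i<n. (mult v i * aU s l i)\<^sup>2) \<le> (\<Sum>i<n. 16 * m * (mult v i * E i))"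
      proof (intro sum_mono)
        fix i assume "i \<in> {..<n}"
        then have i: "i < n" by simp
        show "(mult v i * aU s l i)\<^sup>2 \<le> 16 * m * (mult v i * E i)"
        proof (cases "mult v i = 0")
          case nz: False
          then have "mult v i = 1" using m1 by blast
          then show ?thesis using E[OF i] False i by auto
        qed simp
      qed
      then have "2 * real K * (\<Sum>i<n. (mult v i * aU s l i)\<^sup>2) \<le> 2 * real K * (\<Sum>i<n. 16 * m * (mult v i * E i))"
        by (intro mult_left_mono) auto
      also have "\<dots> = 32 * real K * m * (\<Sum>i<n. mult v i * E i)"
        by (simp add: sum_distrib_left mult_ac)
      finally show ?thesis using \<open>thr\<^sup>2 < _\<close> by linarith
    qed
  qed
  also have "\<dots> = 32 * real K * m * (\<Sum>i<n. (\<Sum>v\<in>?P. mult v i) * E i)"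
    unfolding sum_distrib_left[symmetric] sum_distrib_right by (subst sum.swap) (rule refl)
  also have "\<dots> \<le> 32 * real K * m * (\<Sum>i<n. real DEP * E i)"
  proof (intro mult_left_mono sum_mono mult_right_mono)
    fix i
    have "(\<Sum>v\<in>?P. mult v i) \<le> (\<Sum>v\<in>{1..<2*n}. mult v i)"
      by (intro sum_mono2) (use mult_nonneg in auto)
    then show "(\<Sum>v\<in>?P. mult v i) \<le> real DEP" using sum_mult[of i] by linarith
  qed (use m E0 in auto)
  finally show ?thesis by (simp add: sum_distrib_left mult.assoc)
qed

lemma level_cost_energy:
  assumes "\<not> spurious thr (aS s) (aU s l)"
  shows "real (500 * (n * K) + 130 * K * d * tested_count thr s l + 600 * X * hit_count thr s l)
    \<le> 630 * real (n * K) + 28000 * real K * real X / thr\<^sup>2 * (m * (\<Sum>i<n. E i))"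
proof -
  let ?p = "real (card {v\<in>{1..<2*n}. test thr s l v})" and ?h = "real (hit_count thr s l)" and ?W = "m * (\<Sum>i<n. E i)"
  have W0: "0 \<le> ?W" using m E0 by (simp add: sum_nonneg)
  have K1: "1 \<le> real K" using pos by simp
  have "real (tested_count thr s l) \<le> 1 + 2 * ?p" using tested_count_le(1)[of thr s l] by linarith
  then have p1: "real (K * d) * real (tested_count thr s l) \<le> real (K * d) * (1 + 2 * ?p)" by (intro mult_left_mono) auto
  have p2: "real (K * d) * (1 + 2 * ?p) = real (K * d) + 2 * (real (K * d) * ?p)" by (simp add: algebra_simps)
  have p3: "real (K * d) \<le> real (n * K)" using pos(2) by (simp add: mult.commute)
  have p4: "real (K * d) * ?p * thr\<^sup>2 \<le> real (K * d) * (32 * real K * real DEP * ?W)"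
    using positive_count_energy[OF assms] by (simp add: mult_ac mult_left_mono)
  have p5: "real (K * d) * (32 * real K * real DEP * ?W) \<le> 32 * (real K * real X * ?W)"
  proof -
    have "K * d * DEP \<le> X" unfolding X_def by (simp add: algebra_simps)
    then have "real (K * d * DEP) \<le> real X" by (simp only: of_nat_le_iff)
    then have "real K * real (K * d * DEP) * ?W \<le> real K * real X * ?W"
      using W0 by (intro mult_right_mono mult_left_mono) auto
    then show ?thesis by (simp add: mult_ac)
  qed
  have p6: "real X * ?h * thr\<^sup>2 \<le> real X * (16 * ?W)"
    using mult_left_mono[OF hit_count_energy, of "real X"] by (simp add: mult_ac)
  have p7: "real X * (16 * ?W) \<le> 16 * (real K * real X * ?W)"
  proof -
    have "0 \<le> real X * ?W" using W0 by simp
    then show ?thesis using mult_right_mono[OF K1, of "real X * ?W"] by (simp add: mult_ac)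
  qed
  have thr2: "0 < thr\<^sup>2" using thr by simp
  have a: "real (K * d) * real (tested_count thr s l) \<le> real (n * K) + 2 * (real (K * d) * ?p)"
    using p1 p3 unfolding p2 by argo
  have a2: "real (K * d) * ?p \<le> 32 * (real K * real X * ?W) / thr\<^sup>2"
    unfolding pos_le_divide_eq[OF thr2] by (rule order_trans[OF p4 p5])
  have a3: "real X * ?h \<le> 16 * (real K * real X * ?W) / thr\<^sup>2"
    unfolding pos_le_divide_eq[OF thr2] by (rule order_trans[OF p6 p7])
  have "0 \<le> real K * real X * ?W / thr\<^sup>2" using W0 by simp
  then have "500 * real (n * K) + 130 * (real (K * d) * real (tested_count thr s l)) + 600 * (real X * ?h)
      \<le> 630 * real (n * K) + 28000 * (real K * real X * ?W / thr\<^sup>2)"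
    using a a2 a3 by argo
  then show ?thesis by (simp add: mult_ac)
qed

end

text \<open>The factor \<open>2 ^ l\<close> is the length of the window, lost in the Cauchy-Schwarz
  bound.\<close>

definition "level_weight en T = (\<Sum>l<L. of_bool (2 ^ l dvd T) * (2 ^ l * (\<Sum>i<n. window en (T - 2 ^ l) T i)))"

lemma levels_cost_energy:
  assumes thr: "0 < thr" "thr \<le> 1" and S: "\<And>x. x < K * n \<Longrightarrow> \<bar>aS s x\<bar> = 1"
    and A: "absorbed en T s" and t: "aT s = T mod R" and F: "unflawed thr (Suc (aT s)) s" and en: "\<And>j i. 0 \<le> en j i"
  shows "real (levels_costA thr (Suc (aT s)) s) \<le> 630 * real (n * K) * (\<Sum>l<L. of_bool (2 ^ l dvd Suc T))
    + 28000 * real K * real X / thr\<^sup>2 * level_weight en (Suc T)"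
proof -
  have "real (levels_costA thr (Suc (aT s)) s) \<le> (\<Sum>l<L. of_bool (2 ^ l dvd Suc T) * (630 * real (n * K)
      + 28000 * real K * real X / thr\<^sup>2 * (2 ^ l * (\<Sum>i<n. window en (Suc T - 2 ^ l) (Suc T) i))))"
    unfolding levels_costA_def of_nat_sum
  proof (intro sum_mono)
    fix l assume "l \<in> {..<L}"
    then have l: "l < L" by simp
    show "real (of_bool (2 ^ l dvd Suc (aT s)) * (500 * (n * K) + 130 * K * d * tested_count thr s l + 600 * X * hit_count thr s l))
      \<le> of_bool (2 ^ l dvd Suc T) * (630 * real (n * K)
      + 28000 * real K * real X / thr\<^sup>2 * (2 ^ l * (\<Sum>i<n. window en (Suc T - 2 ^ l) (Suc T) i)))"
    proof (cases "2 ^ l dvd Suc T")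
      case True
      then have t2: "2 ^ l dvd Suc (aT s)" using dvd_Suc_aT[OF t l] by simp
      have "T mod 2 ^ l = 2 ^ l - 1"
      proof -
        have "Suc (T mod 2 ^ l) = 2 ^ l" using True by (metis dvd_eq_mod_eq_0 mod_Suc nat.distinct(1))
        then show ?thesis by linarith
      qed
      then have w: "T - T mod 2 ^ l = Suc T - 2 ^ l" "real (T mod 2 ^ l) + 1 = 2 ^ l"
        by (auto simp: of_nat_diff)
      have "real (500 * (n * K) + 130 * K * d * tested_count thr s l + 600 * X * hit_count thr s l)
        \<le> 630 * real (n * K) + 28000 * real K * real X / thr\<^sup>2 * (2 ^ l * (\<Sum>i<n. window en (Suc T - 2 ^ l) (Suc T) i))"
      proof (rule level_cost_energy[OF thr S])
        show "0 \<le> window en (Suc T - 2 ^ l) (Suc T) i" for i using en by (rule window_nonneg)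
        show "\<not> spurious thr (aS s) (aU s l)" using F l t2 by (simp add: unflawed_def)
        show "1/16 \<le> window en (Suc T - 2 ^ l) (Suc T) i \<or>
          (aU s l i)\<^sup>2 \<le> 16 * 2 ^ l * window en (Suc T - 2 ^ l) (Suc T) i \<and>
          (aV s l i)\<^sup>2 \<le> 16 * 2 ^ l * window en (Suc T - 2 ^ l) (Suc T) i" if "i < n" for i
          using A l that w unfolding absorbed_def Let_def by metis
      qed simp_all
      then show ?thesis using True t2 by simp
    qed (use dvd_Suc_aT[OF t l] in simp)
  qed
  also have "\<dots> = 630 * real (n * K) * (\<Sum>l<L. of_bool (2 ^ l dvd Suc T))
    + 28000 * real K * real X / thr\<^sup>2 * level_weight en (Suc T)"
    unfolding level_weight_def sum_distrib_left sum.distrib[symmetric]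
    by (intro sum.cong) (auto simp: algebra_simps)
  finally show ?thesis .
qed

lemma levels_cost_le: "levels_costA thr t s \<le> L * (500 * (n * K) + 260 * K * d * n + 600 * X * n)"
proof -
  have "levels_costA thr t s \<le> (\<Sum>l<L. 500 * (n * K) + 260 * K * d * n + 600 * X * n)"
    unfolding levels_costA_def
  proof (intro sum_mono)
    fix l
    have "130 * K * d * tested_count thr s l \<le> 130 * K * d * (2 * n)" by (intro mult_left_mono tested_count_le) simp
    moreover have "600 * X * hit_count thr s l \<le> 600 * X * n" by (intro mult_left_mono hit_count_le) simp
    ultimately have "500 * (n * K) + 130 * K * d * tested_count thr s l + 600 * X * hit_count thr s l
      \<le> 500 * (n * K) + 260 * K * d * n + 600 * X * n" by linarith
    then show "of_bool (2 ^ l dvd t) * (500 * (n * K) + 130 * K * d * tested_count thr s l + 600 * X * hit_count thr s l)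
      \<le> 500 * (n * K) + 260 * K * d * n + 600 * X * n" by (cases "2 ^ l dvd t") simp_all
  qed
  then show ?thesis by simp
qed

text \<open>A sketch adds at most \<open>n\<close> terms, so with all entries of \<open>u\<close>
  within \<open>thr / n\<close> no test can be positive, for any signs. This is how late epochs do
  without probability.\<close>

lemma tiny_unflawed:
  assumes thr: "0 < thr" and \<sigma>: "\<And>x. x < K * n \<Longrightarrow> \<bar>\<sigma> x\<bar> = 1" and u: "\<And>i. i < n \<Longrightarrow> (u i)\<^sup>2 \<le> (thr / real n)\<^sup>2"
  shows "\<not> missed thr \<sigma> u" "\<not> spurious thr \<sigma> u"
proof -
  have n1: "1 \<le> real n" using n_pos by simp
  have ua: "\<bar>u i\<bar> \<le> thr / real n" if "i < n" for i
    using u[OF that] thr n1 by (simp add: abs_le_square_iff[symmetric])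
  have "\<bar>u i\<bar> \<le> thr" if "i < n" for i
  proof -
    have "thr / real n \<le> thr" using thr n1 by (simp add: divide_le_eq)
    then show ?thesis using ua[OF that] by linarith
  qed
  then have "(u i)\<^sup>2 \<le> thr\<^sup>2" if "i < n" for i
    using that thr by (simp add: abs_le_square_iff[symmetric])
  then show "\<not> missed thr \<sigma> u" unfolding missed_def by (meson not_le)
  have "\<not> positive_test thr \<sigma> u v" if v: "1 \<le> v" for v
  proof -
    have "(\<Sum>i<n. mult v i * \<sigma> (r * n + i) * u i)\<^sup>2 \<le> thr\<^sup>2" if r: "r < K" for r
    proof -
      have "\<bar>\<Sum>i<n. mult v i * \<sigma> (r * n + i) * u i\<bar> \<le> (\<Sum>i<n. \<bar>mult v i * \<sigma> (r * n + i) * u i\<bar>)" by (rule sum_abs)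
      also have "\<dots> \<le> (\<Sum>i<n. 1 * 1 * (thr / real n))"
        unfolding abs_mult
        by (intro sum_mono mult_mono) (use mult_le_1[OF v] mult_nonneg \<sigma> ix2_less[OF r] ua in auto)
      also have "\<dots> = thr" using n1 by simp
      finally show ?thesis using thr by (simp add: abs_le_square_iff[symmetric])
    qed
    then show ?thesis unfolding positive_test_def by (meson not_le)
  qed
  then show "\<not> spurious thr \<sigma> u" by (auto simp: spurious_def)
qed

end

section \<open>Requests and energy row by row\<close>

fun scaling :: "real vec \<Rightarrow> request list \<Rightarrow> real vec" where
  "scaling g [] = g"
| "scaling g (Scale i u # qs) = scaling (g |\<^sub>v i \<mapsto> u) qs"
| "scaling g (Query h \<delta> # qs) = scaling g qs"
| "scaling g (ComputeExact i # qs) = scaling g qs"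

lemma queries_snoc:
  "queries g (qs @ [q]) = queries g qs @ (case q of Query h \<delta> \<Rightarrow> [(scaling g qs, h, \<delta>)] | _ \<Rightarrow> [])"
  by (induction g qs rule: queries.induct) (auto split: request.splits)

lemma scaling_snoc: "scaling g (qs @ [q]) = (case q of Scale i u \<Rightarrow> scaling g qs |\<^sub>v i \<mapsto> u | _ \<Rightarrow> scaling g qs)"
  by (induction g qs rule: queries.induct) (auto split: request.splits)

lemma dim_scaling [simp]: "dim_vec (scaling g qs) = dim_vec g"
  by (induction g qs rule: queries.induct) auto

lemma length_queries: "length (queries g qs) = length (filter is_Query qs)"
  by (induction g qs rule: queries.induct) auto

lemma queries_dims:
  assumes "\<forall>q\<in>set qs. well_formed n d q" "(g', h, \<delta>) \<in> set (queries g qs)"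
  shows "dim_vec g' = dim_vec g \<and> h \<in> carrier_vec d \<and> \<delta> \<in> carrier_vec n"
  using assms by (induction g qs rule: queries.induct) auto

lemma Diag_mult:
  assumes "dim_vec g = n" "v \<in> carrier_vec n" "i < n" shows "(Diag g *\<^sub>v v) $ i = g $ i * v $ i"
proof -
  have "(Diag g *\<^sub>v v) $ i = (\<Sum>j\<in>{0..<n}. (if i = j then g $ j else 0) * v $ j)"
    using assms by (auto simp: Diag_def mat_diag_def scalar_prod_def intro!: sum.cong)
  also have "\<dots> = (\<Sum>j\<in>{0..<n}. if j = i then g $ i * v $ i else 0)" by (intro sum.cong) auto
  finally show ?thesis using assms(3) by simp
qed

lemma Diag_inv_mult:
  assumes "dim_vec g = n" "v \<in> carrier_vec n" "i < n" shows "(Diag_inv g *\<^sub>v v) $ i = v $ i / g $ i"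
proof -
  have "(Diag_inv g *\<^sub>v v) $ i = (\<Sum>j\<in>{0..<n}. (if i = j then inverse (g $ j) else 0) * v $ j)"
    using assms by (auto simp: Diag_inv_def mat_diag_def scalar_prod_def intro!: sum.cong)
  also have "\<dots> = (\<Sum>j\<in>{0..<n}. if j = i then inverse (g $ i) * v $ i else 0)" by (intro sum.cong) auto
  finally show ?thesis using assms(3) by (simp add: field_simps)
qed

definition row_energy ::
    "real mat \<Rightarrow> real vec \<Rightarrow> (real vec \<times> real vec \<times> real vec) list \<Rightarrow> nat \<Rightarrow> nat \<Rightarrow> real" where
  "row_energy A x0 qs k i = (case qs ! (k - 1) of (g, h, \<delta>) \<Rightarrow>
     ((Diag g *\<^sub>v (A *\<^sub>v h)) $ i / xvec A x0 qs k $ i)\<^sup>2 + (\<delta> $ i / xvec A x0 qs k $ i)\<^sup>2)"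

lemma row_energy_nonneg: "0 \<le> row_energy A x0 qs k i"
  by (simp add: row_energy_def split: prod.splits)

lemma xvec_append: "t \<le> length qs \<Longrightarrow> xvec A x0 (qs @ qs') t = xvec A x0 qs t"
  unfolding xvec_def by (intro eq_vecI) (auto intro!: arg_cong2[where f = "(+)"] sum.cong simp: nth_append)

lemma row_energy_append:
  "1 \<le> k \<Longrightarrow> k \<le> length qs \<Longrightarrow> row_energy A x0 (qs @ qs') k i = row_energy A x0 qs k i"
proof -
  assume k: "1 \<le> k" "k \<le> length qs"
  then have "k - 1 < length qs" by linarith
  then show ?thesis by (simp only: row_energy_def xvec_append[OF k(2)] nth_append if_True)
qed

lemma xvec_snoc:
  assumes "i < dim_row A"
  shows "xvec A x0 (qs @ [(g, h, \<delta>)]) (Suc (length qs)) $ i =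
    xvec A x0 qs (length qs) $ i + (Diag g *\<^sub>v (A *\<^sub>v h)) $ i + \<delta> $ i"
proof -
  have "{1..Suc (length qs)} = insert (Suc (length qs)) {1..length qs}" by auto
  then have "xvec A x0 (qs @ [(g, h, \<delta>)]) (Suc (length qs)) $ i =
    xvec A x0 (qs @ [(g, h, \<delta>)]) (length qs) $ i + (Diag g *\<^sub>v (A *\<^sub>v h)) $ i + \<delta> $ i"
    using assms by (simp add: xvec_def nth_append del: atLeastAtMost_insertL)
  then show ?thesis by (simp add: xvec_append)
qed

lemma energy_rows:
  assumes A: "A \<in> carrier_mat n d"
    and D: "\<And>g h \<delta>. (g, h, \<delta>) \<in> set qs \<Longrightarrow> dim_vec g = n \<and> h \<in> carrier_vec d \<and> \<delta> \<in> carrier_vec n"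
  shows "energy A x0 qs = (\<Sum>k\<in>{1..length qs}. \<Sum>i<n. row_energy A x0 qs k i)"
  unfolding energy_def
proof (intro sum.cong refl)
  fix k assume k: "k \<in> {1..length qs}"
  obtain g h \<delta> where q: "qs ! (k - 1) = (g, h, \<delta>)" by (metis prod_cases3)
  moreover have "qs ! (k - 1) \<in> set qs" using k by (intro nth_mem) auto
  ultimately have D': "dim_vec g = n" "h \<in> carrier_vec d" "\<delta> \<in> carrier_vec n" using D by auto
  have x: "dim_vec (xvec A x0 qs k) = n" using A by (simp add: xvec_def)
  have a: "Diag g *\<^sub>v (A *\<^sub>v h) \<in> carrier_vec n" by (rule carrier_vecI) (simp add: Diag_def mat_diag_def D'(1))
  have dI: "dim_vec (Diag_inv (xvec A x0 qs k) *\<^sub>v v) = n" for v using x by (simp add: Diag_inv_def mat_diag_def)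
  show "(case qs ! (k - 1) of (g, h, \<delta>) \<Rightarrow>
        sqnorm2 (Diag_inv (xvec A x0 qs k) *\<^sub>v (Diag g *\<^sub>v (A *\<^sub>v h)))
        + sqnorm2 (Diag_inv (xvec A x0 qs k) *\<^sub>v \<delta>)) = (\<Sum>i<n. row_energy A x0 qs k i)"
    unfolding q row_energy_def sqnorm2_def dI sum.distrib[symmetric] prod.case
    by (intro sum.cong refl) (simp add: Diag_inv_mult[OF x a] Diag_inv_mult[OF x D'(3)])
qed

definition query_costs :: "log \<Rightarrow> nat list" where
  "query_costs tr = map (\<lambda>(q, y, c). c) (filter (\<lambda>(q, y, c). is_Query q) tr)"

lemma length_query_costs: "length (query_costs tr) = length (queries g (requests tr))"
  by (induction tr) (auto simp: query_costs_def length_queries split: prod.splits)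

lemma length_query_outputs: "length (query_outputs tr) = length (queries g (requests tr))"
  by (induction tr) (auto simp: query_outputs_def length_queries split: prod.splits)

lemma window_cong: "(\<And>j. a < j \<Longrightarrow> j \<le> b \<Longrightarrow> en j i = en' j i) \<Longrightarrow> window en a b i = window en' a b i"
  by (simp add: window_def)

lemma approx_entry:
  fixes x y \<epsilon> :: real
  assumes "\<bar>x - y\<bar> \<le> \<epsilon> / 2 * y" "0 < y" "0 < \<epsilon>" "\<epsilon> < 1"
  shows "exp (- \<epsilon>) * x \<le> y \<and> y \<le> exp \<epsilon> * x"
proof
  have x: "x \<le> (1 + \<epsilon> / 2) * y" "(1 - \<epsilon> / 2) * y \<le> x" using abs_le_D1[OF assms(1)] abs_le_D2[OF assms(1)] by (simp_all add: algebra_simps)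
  have e: "1 + \<epsilon> \<le> exp \<epsilon>" by (rule exp_ge_add_one_self)
  have e2: "1 + \<epsilon> / 2 \<le> exp \<epsilon>" using e assms(3) by argo
  have "x \<le> (1 + \<epsilon> / 2) * y" by (rule x)
  also have "\<dots> \<le> exp \<epsilon> * y" using e2 by (rule mult_right_mono) (use assms in simp)
  finally show "exp (- \<epsilon>) * x \<le> y" by (simp add: exp_minus field_simps)
  have "\<epsilon> * \<epsilon> \<le> \<epsilon>" using assms mult_left_le[of \<epsilon> \<epsilon>] by simp
  then have "1 \<le> (1 + \<epsilon>) * (1 - \<epsilon> / 2)" by (simp add: algebra_simps)
  then have "1 * y \<le> ((1 + \<epsilon>) * (1 - \<epsilon> / 2)) * y" using assms by (intro mult_right_mono) auto
  also have "\<dots> = (1 + \<epsilon>) * ((1 - \<epsilon> / 2) * y)" by simp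
  also have "\<dots> \<le> exp \<epsilon> * x" by (rule mult_mono[OF e x(2)]) (use assms in simp_all)
  finally show "y \<le> exp \<epsilon> * x" by simp
qed

section \<open>Failure probability along a Markov chain\<close>

text \<open>The recursion peels off the first step, so that an invariant may depend on the number of
  steps still to come, as \<open>doomed\<close> does; \<open>chain_Suc\<close> gives the other form,
  that of \<open>play\<close>.\<close>

primrec chain :: "('a \<Rightarrow> 'a pmf) \<Rightarrow> nat \<Rightarrow> 'a \<Rightarrow> 'a pmf" where
  "chain f 0 c = return_pmf c"
| "chain f (Suc m) c = bind_pmf (f c) (chain f m)"

lemma chain_Suc: "chain f (Suc m) c = bind_pmf (chain f m c) f"
proof (induction m arbitrary: c)
  case 0
  have "chain f 0 = return_pmf" by (rule ext) simp
  then show ?case by (simp add: bind_return_pmf bind_return_pmf')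
next
  case (Suc m)
  have "chain f (Suc m) = (\<lambda>c. bind_pmf (chain f m c) f)" by (rule ext) (rule Suc.IH)
  then have "bind_pmf (f c) (chain f (Suc m)) = bind_pmf (bind_pmf (f c) (chain f m)) f" by (simp only: bind_assoc_pmf)
  then show ?case by (simp only: chain.simps)
qed

lemma prob_bind_le:
  assumes "\<And>x. x \<in> set_pmf p \<Longrightarrow> x \<notin> E \<Longrightarrow> measure_pmf.prob (f x) A \<le> b" "0 \<le> b"
  shows "measure_pmf.prob (bind_pmf p f) A \<le> measure_pmf.prob p E + b"
proof -
  have "ennreal (measure_pmf.prob (bind_pmf p f) A) = (\<integral>\<^sup>+x. emeasure (f x) A \<partial>p)"
    unfolding measure_pmf.emeasure_eq_measure[symmetric] by (simp add: emeasure_bind_pmf)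
  also have "\<dots> \<le> (\<integral>\<^sup>+x. indicator E x + ennreal b \<partial>p)"
  proof (intro nn_integral_mono_AE AE_pmfI)
    fix x assume x: "x \<in> set_pmf p"
    show "emeasure (f x) A \<le> indicator E x + ennreal b"
    proof (cases "x \<in> E")
      case True
      have "emeasure (f x) A \<le> 1" by (rule measure_pmf.emeasure_le_1)
      then show ?thesis using True by (simp add: add_increasing2)
    next
      case False
      then show ?thesis using assms(1)[OF x] by (simp add: measure_pmf.emeasure_eq_measure ennreal_leI)
    qed
  qed
  also have "\<dots> = emeasure p E + ennreal b" by (simp add: nn_integral_add measure_pmf.emeasure_space_1)
  also have "\<dots> = ennreal (measure_pmf.prob p E + b)"
    using assms(2) by (simp add: measure_pmf.emeasure_eq_measure)
  finally have "ennreal (measure_pmf.prob (bind_pmf p f) A) \<le> ennreal (measure_pmf.prob p E + b)" .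
  then show ?thesis by (subst (asm) ennreal_le_iff) (use assms(2) in simp_all)
qed

text \<open>\<open>\<beta>\<close> bounds the probability that a later step leaves the good configurations.\<close>

lemma chain_bound:
  assumes step: "\<And>m c. good (Suc m) c \<Longrightarrow> \<exists>b\<ge>0. (\<forall>c'\<in>set_pmf (f c). good m c' \<longrightarrow> \<beta> c' \<le> b) \<and>
      measure_pmf.prob (f c) {c'. \<not> good m c'} + b \<le> \<beta> c"
    and fin: "\<And>c. good 0 c \<Longrightarrow> c \<notin> A" and nonneg: "\<And>c. 0 \<le> \<beta> c"
  shows "good m c \<Longrightarrow> measure_pmf.prob (chain f m c) A \<le> \<beta> c"
proof (induction m arbitrary: c)
  case 0
  then show ?case using fin nonneg by (simp add: measure_return_pmf)
next
  case (Suc m)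
  then obtain b where b: "0 \<le> b" "\<And>c'. c' \<in> set_pmf (f c) \<Longrightarrow> good m c' \<Longrightarrow> \<beta> c' \<le> b"
    "measure_pmf.prob (f c) {c'. \<not> good m c'} + b \<le> \<beta> c" using step by blast
  have "measure_pmf.prob (chain f (Suc m) c) A \<le> measure_pmf.prob (f c) {c'. \<not> good m c'} + b"
    unfolding chain.simps by (rule prob_bind_le) (use Suc.IH b in \<open>auto intro: order_trans\<close>)
  then show ?case using b(3) by linarith
qed

context sizes
begin

text \<open>What \<open>hit\<close> would be with perfect tests; no sign occurs in it.\<close>

definition ideal_hit :: "real \<Rightarrow> ast \<Rightarrow> nat \<Rightarrow> nat \<Rightarrow> bool" where
  "ideal_hit thr s l i \<longleftrightarrow> (i < n \<and> thr\<^sup>2 < (aU s l i)\<^sup>2) \<or> thr\<^sup>2 < (aV s l i)\<^sup>2"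

definition ideal_advance :: "real \<Rightarrow> ast \<Rightarrow> ast" where
  "ideal_advance thr s = s\<lparr>aB := \<lambda>i. if \<exists>l<L. 2 ^ l dvd Suc (aT s) \<and> ideal_hit thr s l i then aX s i else aB s i,
     aU := \<lambda>l. if l < L \<and> 2 ^ l dvd Suc (aT s) then \<lambda>_. 0 else aU s l,
     aV := \<lambda>l. if l < L \<and> 2 ^ l dvd Suc (aT s) then \<lambda>_. 0 else aV s l,
     aT := Suc (aT s)\<rparr>"

lemma ideal_advance_signs: "ideal_advance thr (s\<lparr>aS := f\<rparr>) = (ideal_advance thr s)\<lparr>aS := f\<rparr>"
proof -
  have "ideal_hit thr (s\<lparr>aS := f\<rparr>) = ideal_hit thr s" by (intro ext) (simp add: ideal_hit_def)
  moreover have "aX (s\<lparr>aS := f\<rparr>) = aX s" "aB (s\<lparr>aS := f\<rparr>) = aB s" "aU (s\<lparr>aS := f\<rparr>) = aU s"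
    "aV (s\<lparr>aS := f\<rparr>) = aV s" "aT (s\<lparr>aS := f\<rparr>) = aT s" by simp_all
  ultimately show ?thesis unfolding ideal_advance_def by (simp only:) (rule ast.equality; simp)
qed

lemma absorb_signs: "absorbA A y \<delta> (s\<lparr>aS := f\<rparr>) = (absorbA A y \<delta> s)\<lparr>aS := f\<rparr>"
  by (simp add: absorbA_def)

text \<open>One direction is the absence of missed rows, the other the exactness of the leaf test;
  spurious nodes do not enter.\<close>

lemma hit_ideal:
  assumes S: "\<And>x. x < K * n \<Longrightarrow> \<bar>aS s x\<bar> = 1" and F: "\<not> missed thr (aS s) (aU s l)"
  shows "hit thr s l i \<longleftrightarrow> ideal_hit thr s l i"
proof (cases "i < n")
  case True
  then have "thr\<^sup>2 < (aU s l i)\<^sup>2 \<Longrightarrow> hit thr s l i"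
    using F unfolding missed_def hit_def test_positive_test by blast
  then show ?thesis using True hit_large[OF S True] by (auto simp: ideal_hit_def) (auto simp: hit_def)
next
  case False
  have "mult (n + i) i' = 0" if "i' < n" for i' using mult_0[OF that] False by simp
  then have "\<not> test thr s l (n + i)" by (simp add: test_def not_less)
  then have "\<not> all_up (test thr s l) (n + i)" using n_pos by (auto dest: all_upD)
  then show ?thesis using False by (simp add: ideal_hit_def hit_def)
qed

lemma advance_ideal:
  assumes S: "\<And>x. x < K * n \<Longrightarrow> \<bar>aS s x\<bar> = 1" and F: "unflawed thr (Suc (aT s)) s"
  shows "advance thr s = ideal_advance thr s"
proof -
  have "hit thr s l i \<longleftrightarrow> ideal_hit thr s l i" if "l < L" "2 ^ l dvd Suc (aT s)" for l i
    using hit_ideal[OF S] F that by (auto simp: unflawed_def)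
  then have "(\<exists>l<L. 2 ^ l dvd Suc (aT s) \<and> hit thr s l i) \<longleftrightarrow> (\<exists>l<L. 2 ^ l dvd Suc (aT s) \<and> ideal_hit thr s l i)" for i
    by blast
  then show ?thesis by (simp add: advance_def levelsA_def ideal_advance_def)
qed

end

section \<open>The game against the adversary\<close>

locale game = sizes +
  fixes Am :: "real mat" and g0 x0 :: "real vec" and adv :: adversary and thr \<epsilon> :: real
  assumes Am: "Am \<in> carrier_mat n d" and g0: "g0 \<in> carrier_vec n" and x0: "x0 \<in> carrier_vec n"
    and adm: "admissible_adversary Am g0 x0 adv"
    and eps: "0 < \<epsilon>" "\<epsilon> < 1/10" and thr_eq: "thr = \<epsilon> / (8 * real L)" and dep: "2 * n \<le> 2 ^ DEP"
begin

lemma L1: "1 \<le> real L"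
  using pos by simp

lemma thr: "0 < thr" "thr \<le> 1" "8 * real L * thr \<le> 1" "4 * real L * thr = \<epsilon> / 2"
proof -
  have le: "\<epsilon> \<le> 8 * real L" using eps L1 by argo
  have L8: "0 < 8 * real L" using L1 by simp
  show "0 < thr" using eps L8 by (simp add: thr_eq)
  show "thr \<le> 1" unfolding thr_eq by (rule divide_le_eq_1_pos[THEN iffD2, OF L8 le])
  show "8 * real L * thr \<le> 1" "4 * real L * thr = \<epsilon> / 2" using eps L8 by (simp_all add: thr_eq)
qed

definition Af :: "nat \<Rightarrow> nat \<Rightarrow> real" where
  "Af i j = (if i < n \<and> j < d then Am $$ (i, j) else 0)"

abbreviation absorb_query :: "real vec \<Rightarrow> real vec \<Rightarrow> ast \<Rightarrow> ast" where
  "absorb_query y \<delta> \<equiv> absorbA Af (vec_input y \<delta>) (\<lambda>i. vec_input y \<delta> (d + i))"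

text \<open>The configurations reached while no test is flawed do not depend on the current signs.\<close>

primrec doomed :: "nat \<Rightarrow> ast \<Rightarrow> real vec list \<Rightarrow> bool" where
  "doomed 0 s ys = False"
| "doomed (Suc m) s ys = (case adv ys of
     Scale i u \<Rightarrow> doomed m (s\<lparr>aG := (aG s)(i := u)\<rparr>) (ys @ [vec 0 (\<lambda>_. 0)])
   | ComputeExact i \<Rightarrow> doomed m s (ys @ [vec 1 (\<lambda>_. aX s i)])
   | Query y \<delta> \<Rightarrow> let s1 = absorb_query y \<delta> s in Suc (aT s) < R \<and>
      (\<not> unflawed thr (Suc (aT s)) s1 \<or>
       doomed m (ideal_advance thr s1) (ys @ [vec n (aB (ideal_advance thr s1))])))"

definition "epoch_flaw = real R * (real L * flaw_prob)"

lemma flaw_prob_nonneg: "0 \<le> flaw_prob"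
  by (simp add: flaw_prob_def)

lemma epoch_flaw_nonneg: "0 \<le> epoch_flaw"
  using flaw_prob_nonneg by (simp add: epoch_flaw_def)

text \<open>Along the recursion of \<open>doomed\<close> the states for different \<open>f\<close>
  differ in \<open>aS\<close> only, so every tested \<open>u\<close> is fixed and
  \<open>prob_flaw\<close> applies: \<open>L\<close> levels for each query left in the
  epoch.\<close>

lemma prob_doomed_upto:
  "measure_pmf.prob (signs_pmf (K * n)) {f. doomed m (s\<lparr>aS := f\<rparr>) ys} \<le> real (R - aT s) * (real L * flaw_prob)"
proof (induction m arbitrary: s ys)
  case 0
  then show ?case using flaw_prob_nonneg by simp
next
  case (Suc m)
  have LF: "0 \<le> real L * flaw_prob" using flaw_prob_nonneg by simp
  show ?case
  proof (cases "adv ys")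
    case (Scale i u)
    have e: "s\<lparr>aS := f, aG := (aG (s\<lparr>aS := f\<rparr>))(i := u)\<rparr> = s\<lparr>aG := (aG s)(i := u), aS := f\<rparr>" for f
      by (rule ast.equality) simp_all
    show ?thesis unfolding doomed.simps Scale request.case e
      using Suc.IH[of "s\<lparr>aG := (aG s)(i := u)\<rparr>"] by simp
  next
    case (ComputeExact i)
    then show ?thesis using Suc.IH[of s] by simp
  next
    case (Query y \<delta>)
    let ?p = "signs_pmf (K * n)" and ?s1 = "absorb_query y \<delta> s"
    let ?s2 = "ideal_advance thr ?s1"
    let ?E = "\<lambda>l. {f. missed thr f (aU ?s1 l) \<or> spurious thr f (aU ?s1 l)}"
    note c = ideal_advance_signs absorb_signs
    show ?thesis
    proof (cases "Suc (aT s) < R")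
      case True
      have "{f. doomed (Suc m) (s\<lparr>aS := f\<rparr>) ys} \<subseteq> (\<Union>l\<in>{..<L}. ?E l) \<union> {f. doomed m (?s2\<lparr>aS := f\<rparr>) (ys @ [vec n (aB ?s2)])}"
        by (auto simp: Query c Let_def unflawed_def)
      then have "measure_pmf.prob ?p {f. doomed (Suc m) (s\<lparr>aS := f\<rparr>) ys} \<le>
        measure_pmf.prob ?p ((\<Union>l\<in>{..<L}. ?E l) \<union> {f. doomed m (?s2\<lparr>aS := f\<rparr>) (ys @ [vec n (aB ?s2)])})"
        by (rule measure_pmf.finite_measure_mono) simp
      also have "\<dots> \<le> measure_pmf.prob ?p (\<Union>l\<in>{..<L}. ?E l) + measure_pmf.prob ?p {f. doomed m (?s2\<lparr>aS := f\<rparr>) (ys @ [vec n (aB ?s2)])}"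
        by (rule measure_Un_le) auto
      also have "\<dots> \<le> real (card {..<L}) * flaw_prob + real (R - aT ?s2) * (real L * flaw_prob)"
        by (intro add_mono Suc.IH prob_UN_le prob_flaw thr dep) simp
      also have "\<dots> = (1 + real (R - Suc (aT s))) * (real L * flaw_prob)"
        by (simp add: ideal_advance_def absorbA_def algebra_simps)
      also have "1 + real (R - Suc (aT s)) = real (R - aT s)" using True by simp
      finally show ?thesis .
    qed (use LF in \<open>simp add: Query Let_def\<close>)
  qed
qed

lemma prob_doomed: "measure_pmf.prob (signs_pmf (K * n)) {f. doomed m (s\<lparr>aS := f\<rparr>) ys} \<le> epoch_flaw"
proof -
  have "real (R - aT s) * (real L * flaw_prob) \<le> epoch_flaw"
    unfolding epoch_flaw_def using flaw_prob_nonneg by (intro mult_right_mono) auto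
  then show ?thesis using prob_doomed_upto order_trans by blast
qed

end

text \<open>With \<open>random_step\<close>, one of the two ways to meet the hypothesis of
  \<open>chain_bound\<close>: a deterministic step never fails, a rebuild fails only if the new
  signs fall into a bad set \<open>E\<close>.\<close>

lemma det_step:
  assumes "f c = return_pmf c'" "good m c'" "\<beta> c' \<le> \<beta> c" "0 \<le> (\<beta> c :: real)"
  shows "\<exists>b\<ge>0. (\<forall>c'\<in>set_pmf (f c). good m c' \<longrightarrow> \<beta> c' \<le> b) \<and> measure_pmf.prob (f c) {c'. \<not> good m c'} + b \<le> \<beta> c"
  by (rule exI[of _ "\<beta> c"]) (use assms in \<open>simp add: measure_return_pmf\<close>)

lemma random_step:
  assumes f: "f c = map_pmf h p" and E: "\<And>x. x \<in> set_pmf p \<Longrightarrow> x \<notin> E \<Longrightarrow> good m (h x)"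
    and q: "measure_pmf.prob p E \<le> q" and b: "\<And>x. \<beta> (h x) \<le> b" "0 \<le> (b :: real)" "q + b \<le> \<beta> c"
  shows "\<exists>b\<ge>0. (\<forall>c'\<in>set_pmf (f c). good m c' \<longrightarrow> \<beta> c' \<le> b) \<and> measure_pmf.prob (f c) {c'. \<not> good m c'} + b \<le> \<beta> c"
proof (intro exI[of _ b] conjI)
  have "measure_pmf.prob (f c) {c'. \<not> good m c'} = measure_pmf.prob p (h -` {c'. \<not> good m c'})"
    by (simp add: f)
  also have "\<dots> \<le> measure_pmf.prob p E"
    by (rule measure_pmf.finite_measure_mono_AE) (use E in \<open>auto simp: AE_measure_pmf_iff\<close>)
  finally show "measure_pmf.prob (f c) {c'. \<not> good m c'} + b \<le> \<beta> c" using q b(3) by linarith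
qed (use b in \<open>auto simp: f\<close>)

lemma query_lists_snoc:
  "query_costs (tr @ [(q, y, t)]) = query_costs tr @ (if is_Query q then [t] else [])"
  "query_outputs (tr @ [(q, y, t)]) = query_outputs tr @ (if is_Query q then [y] else [])"
  by (auto simp: query_costs_def query_outputs_def)

context sizes
begin

lemma close_signs: "close thr (s\<lparr>aG := g\<rparr>) = close thr s"
  by (simp add: close_def)

lemma backed_signs: "backed e t (s\<lparr>aG := g\<rparr>) = backed e t s"
  by (simp add: backed_def)

text \<open>Query \<open>k\<close> belongs to the epoch that starts after query
  \<open>k - 1 - (k - 1) mod R\<close>. At the end of an epoch \<open>epoch_energy\<close> covers
  all of it, whereas \<open>recent_energy\<close> is already empty.\<close>

definition "epoch_energy e k = (\<Sum>i<n. window e (k - 1 - (k - 1) mod R) k i)"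
definition "recent_energy e k = (\<Sum>i<n. window e (k - k mod R) k i)"
text \<open>Chosen so that \<open>16 * R * tiny thr = (thr / n)\<^sup>2\<close>: by Cauchy-Schwarz
  over at most \<open>R\<close> queries the changes then stay within \<open>thr / n\<close>.\<close>

definition "tiny thr = thr\<^sup>2 / (16 * real R * (real n)\<^sup>2)"
definition "worst = real (300 * (n * L) + L * (500 * (n * K) + 260 * K * d * n + 600 * X * n))"
text \<open>In this order: absorption and output, the fixed part of the checks, the rebuild, the
  part paid by energy, and for queries after \<open>B\<close> epochs the worst case, charged to an
  epoch energy of at least \<open>tiny thr\<close>.\<close>

definition "cost_bound thr B e k = 300 * real (n * L) + 630 * real (n * K) * (\<Sum>l<L. of_bool (2 ^ l dvd k))
  + (if R dvd k then 2000 * real (n * X) else 0) + 28000 * real K * real X / thr\<^sup>2 * level_weight e k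
  + (if R * B \<le> k then worst / tiny thr * epoch_energy e k else 0)"

lemma cost_bound_cong:
  assumes "\<And>j i. 1 \<le> j \<Longrightarrow> j \<le> k \<Longrightarrow> e j i = e' j i"
  shows "cost_bound thr B e k = cost_bound thr B e' k"
proof -
  have "window e a k i = window e' a k i" for a i by (rule window_cong) (use assms in simp)
  then show ?thesis by (simp add: cost_bound_def level_weight_def epoch_energy_def)
qed

lemma tiny_pos: "0 < thr \<Longrightarrow> 0 < tiny thr"
  using R_pos n_pos by (simp add: tiny_def)

lemma worst_nonneg: "0 \<le> worst"
  by (simp add: worst_def)

text \<open>As \<open>tiny thr \<le> 1/16\<close>, the first alternative of \<open>absorbed\<close>
  is impossible; the second puts \<open>aU\<close> within \<open>thr / n\<close>.\<close>

lemma tiny_absorbed: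
  assumes thr: "0 < thr" "thr \<le> 1" and S: "\<And>x. x < K * n \<Longrightarrow> \<bar>aS s x\<bar> = 1" and A: "absorbed e k s"
    and e: "\<And>j i. 0 \<le> e j i" and small: "(\<Sum>i<n. window e (k - k mod R) (Suc k) i) < tiny thr"
  shows "unflawed thr t s"
  unfolding unflawed_def
proof (intro allI impI)
  fix l assume l: "l < L" "2 ^ l dvd t"
  have n1: "1 \<le> real n" using n_pos by simp
  have R1: "1 \<le> real R" using R_pos by simp
  have t2: "thr\<^sup>2 \<le> 1" using thr by (simp add: power_le_one)
  have "(aU s l i)\<^sup>2 \<le> (thr / real n)\<^sup>2" if i: "i < n" for i
  proof -
    let ?E = "window e (k - k mod 2 ^ l) (Suc k) i"
    have dv: "(2::nat) ^ l dvd R" using l by (simp add: R_L le_imp_power_dvd)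
    then have "k mod 2 ^ l = k mod R mod 2 ^ l" by (simp add: mod_mod_cancel)
    then have le: "k mod 2 ^ l \<le> k mod R" by simp
    have lt: "k mod 2 ^ l < R" using le mod_less_divisor[OF R_pos, of k] by linarith
    have "?E \<le> window e (k - k mod R) (Suc k) i"
      unfolding window_def by (intro sum_mono2) (use le e in auto)
    also have "\<dots> \<le> (\<Sum>i<n. window e (k - k mod R) (Suc k) i)"
      by (rule member_le_sum) (use i e window_nonneg[of e] in auto)
    finally have E: "?E \<le> tiny thr" using small by linarith
    have E0: "0 \<le> ?E" using e by (rule window_nonneg)
    have "1 * 1 \<le> real R * (real n)\<^sup>2" using R1 n1 by (intro mult_mono) auto
    then have "tiny thr < 1/16 \<or> tiny thr = 1/16" using t2 thr n1 R1
      unfolding tiny_def by (simp add: divide_le_eq less_divide_eq) argo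
    then have "?E < 1/16 \<or> ?E = 1/16 \<and> tiny thr = 1/16" using E by argo
    have sm: "?E < tiny thr"
      using \<open>?E \<le> window e (k - k mod R) (Suc k) i\<close>
        \<open>window e (k - k mod R) (Suc k) i \<le> (\<Sum>i<n. window e (k - k mod R) (Suc k) i)\<close> small by linarith
    have "\<not> 1/16 \<le> ?E" using sm \<open>tiny thr < 1/16 \<or> tiny thr = 1/16\<close> by argo
    then have "(aU s l i)\<^sup>2 \<le> 16 * (real (k mod 2 ^ l) + 1) * ?E"
      using A i l unfolding absorbed_def Let_def by blast
    also have "\<dots> \<le> 16 * real R * tiny thr"
      by (rule mult_mono) (use lt E E0 in auto)
    also have "\<dots> = (thr / real n)\<^sup>2" using R1 n1 by (simp add: tiny_def power_divide)
    finally show ?thesis .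
  qed
  then show "\<not> missed thr (aS s) (aU s l) \<and> \<not> spurious thr (aS s) (aU s l)"
    using tiny_unflawed[of thr "aS s" "aU s l"] thr(1) S by blast
qed

end

context game
begin

abbreviation past :: "log \<Rightarrow> (real vec \<times> real vec \<times> real vec) list" where
  "past tr \<equiv> queries g0 (requests tr)"

abbreviation energies :: "log \<Rightarrow> nat \<Rightarrow> nat \<Rightarrow> real" where
  "energies tr \<equiv> row_energy Am x0 (past tr)"

definition astep :: "ast \<times> log \<Rightarrow> (ast \<times> log) pmf" where
  "astep c = (case c of (s, tr) \<Rightarrow>
     map_pmf (\<lambda>(s', y, t). (s', tr @ [(adv (outputs tr), y, t)])) (aserve thr Af (adv (outputs tr)) s))"

definition start :: "(nat \<Rightarrow> real) \<Rightarrow> ast \<times> log" where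
  "start f = (startA (\<lambda>i. if i < n then g0 $ i else 0) (\<lambda>i. if i < n then x0 $ i else 0) f, [])"

definition achain :: "nat \<Rightarrow> (ast \<times> log) pmf" where
  "achain m = bind_pmf (signs_pmf (K * n)) (\<lambda>f. chain astep m (start f))"

definition entry_ok :: "log \<Rightarrow> request \<times> real vec \<times> nat \<Rightarrow> bool" where
  "entry_ok tr = (\<lambda>(q, y, t). case q of Scale i u \<Rightarrow> t = 700 * X | Query h \<delta> \<Rightarrow> True
     | ComputeExact i \<Rightarrow> t = 100 * d \<and> y $ 0 = xvec Am x0 (past tr) (length (past tr)) $ i)"

text \<open>The first conjunct says that the log is a play against \<open>adv\<close>, which makes
  the promise of \<open>admissible_adversary\<close> applicable to it.\<close>

definition sound :: "ast \<Rightarrow> log \<Rightarrow> bool" where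
  "sound s tr \<longleftrightarrow> requests tr = map (\<lambda>m. adv (take m (outputs tr))) [0..<length tr] \<and>
     (\<forall>i<n. aX s i = xvec Am x0 (past tr) (length (past tr)) $ i \<and> aG s i = scaling g0 (requests tr) $ i) \<and>
     aT s = length (past tr) mod R \<and> (\<forall>x<K*n. \<bar>aS s x\<bar> = 1) \<and> (\<forall>j<length tr. entry_ok (take j tr) (tr ! j))"

lemma soundD:
  assumes "sound s tr"
  shows "i < n \<Longrightarrow> aX s i = xvec Am x0 (past tr) (length (past tr)) $ i" "i < n \<Longrightarrow> aG s i = scaling g0 (requests tr) $ i"
    "aT s = length (past tr) mod R" "aT s < R" "x < K * n \<Longrightarrow> \<bar>aS s x\<bar> = 1"
  using assms R_pos by (auto simp: sound_def)

lemma request_facts: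
  assumes S: "sound s tr"
  shows "q \<in> set (requests tr @ [adv (outputs tr)]) \<Longrightarrow> well_formed n d q"
    "k \<le> length (queries g0 (requests tr @ [adv (outputs tr)])) \<Longrightarrow> i < n \<Longrightarrow>
      0 < xvec Am x0 (queries g0 (requests tr @ [adv (outputs tr)])) k $ i"
proof -
  have "requests tr @ [adv (outputs tr)] = map (\<lambda>m. adv (take m (outputs tr))) [0..<Suc (length (outputs tr))]"
    using S by (simp add: sound_def)
  then have "admissible Am g0 x0 (requests tr @ [adv (outputs tr)])"
    using adm unfolding admissible_adversary_def by metis
  then show "q \<in> set (requests tr @ [adv (outputs tr)]) \<Longrightarrow> well_formed n d q"
    "k \<le> length (queries g0 (requests tr @ [adv (outputs tr)])) \<Longrightarrow> i < n \<Longrightarrow>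
      0 < xvec Am x0 (queries g0 (requests tr @ [adv (outputs tr)])) k $ i"
    using Am unfolding admissible_def by auto
qed

lemma sound_snoc:
  assumes S: "sound s tr" and tr': "tr' = tr @ [(adv (outputs tr), y, t)]"
    and X: "\<And>i. i < n \<Longrightarrow> aX s' i = xvec Am x0 (past tr') (length (past tr')) $ i"
      "\<And>i. i < n \<Longrightarrow> aG s' i = scaling g0 (requests tr') $ i"
    and T: "aT s' = length (past tr') mod R" and "\<And>x. x < K * n \<Longrightarrow> \<bar>aS s' x\<bar> = 1"
    and e: "entry_ok tr (adv (outputs tr), y, t)"
  shows "sound s' tr'"
proof -
  have "map (\<lambda>m. adv (take m (outputs tr @ [y]))) [0..<length tr] = map (\<lambda>m. adv (take m (outputs tr))) [0..<length tr]"
    by (intro map_cong) auto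
  then have "requests tr' = map (\<lambda>m. adv (take m (outputs tr'))) [0..<length tr']"
    using S by (simp add: tr' sound_def)
  moreover have "entry_ok (take j tr') (tr' ! j)" if "j < length tr'" for j
  proof (cases "j = length tr")
    case False
    then have "j < length tr" using that tr' by simp
    then show ?thesis using S by (simp add: tr' sound_def nth_append)
  qed (use e in \<open>simp add: tr'\<close>)
  ultimately show ?thesis using assms unfolding sound_def by blast
qed

lemma nonquery_step:
  assumes S: "sound s tr" and q: "\<not> is_Query (adv (outputs tr))"
  obtains s' y t where "astep (s, tr) = return_pmf (s', tr @ [(adv (outputs tr), y, t)])"
    "sound s' (tr @ [(adv (outputs tr), y, t)])" "close thr s' = close thr s"
    "\<And>e k. backed e k s' = backed e k s" "\<And>m. doomed m s' (outputs tr @ [y]) = doomed (Suc m) s (outputs tr)"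
    "past (tr @ [(adv (outputs tr), y, t)]) = past tr"
proof (cases "adv (outputs tr)")
  case (Scale i u)
  let ?s = "s\<lparr>aG := (aG s)(i := u)\<rparr>" and ?tr = "tr @ [(adv (outputs tr), vec 0 (\<lambda>_. 0), 700 * X)]"
  have i: "i < n" using request_facts(1)[OF S, of "Scale i u"] Scale by simp
  have p: "past ?tr = past tr" by (simp add: queries_snoc Scale)
  have "sound ?s ?tr"
    by (rule sound_snoc[OF S refl])
      (use soundD[OF S] i g0 in \<open>auto simp: queries_snoc Scale scaling_snoc entry_ok_def\<close>)
  then show thesis
    by (intro that[of ?s "vec 0 (\<lambda>_. 0)" "700 * X"] p) (simp_all add: astep_def Scale close_signs backed_signs)
next
  case (ComputeExact i)
  let ?y = "vec 1 (\<lambda>_. aX s i)"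
  let ?tr = "tr @ [(adv (outputs tr), ?y, 100 * d)]"
  have i: "i < n" using request_facts(1)[OF S, of "ComputeExact i"] ComputeExact by simp
  have p: "past ?tr = past tr" by (simp add: queries_snoc ComputeExact)
  have "sound s ?tr"
    by (rule sound_snoc[OF S refl])
      (use soundD[OF S] i in \<open>auto simp: queries_snoc ComputeExact scaling_snoc entry_ok_def\<close>)
  then show thesis
    by (intro that[of s ?y "100 * d"] p) (simp_all add: astep_def ComputeExact)
qed (use q in simp)

context
  fixes s :: ast and tr :: log and y \<delta> :: "real vec"
  assumes S: "sound s tr" and q: "adv (outputs tr) = Query y \<delta>"
begin

abbreviation "s1 \<equiv> absorb_query y \<delta> s"
abbreviation "tm \<equiv> length (past tr)"

definition "past' = past tr @ [(scaling g0 (requests tr), y, \<delta>)]"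
abbreviation "en' \<equiv> row_energy Am x0 past'"

lemma past_snoc: "past (tr @ [(Query y \<delta>, v, t)]) = past'" and len': "length past' = Suc tm"
  and past_adv: "queries g0 (requests tr @ [adv (outputs tr)]) = past'"
  by (simp_all add: queries_snoc past'_def q)

lemma vecs: "y \<in> carrier_vec d" "\<delta> \<in> carrier_vec n"
  using request_facts(1)[OF S, of "Query y \<delta>"] q by simp_all

lemma move_eq:
  assumes i: "i < n"
  shows "aG s i * (\<Sum>j<d. Af i j * vec_input y \<delta> j) = (Diag (scaling g0 (requests tr)) *\<^sub>v (Am *\<^sub>v y)) $ i"
proof -
  have "(\<Sum>j<d. Af i j * vec_input y \<delta> j) = (\<Sum>j\<in>{0..<d}. Am $$ (i, j) * y $ j)"
    by (intro sum.cong) (use i vec_input_nth(1)[OF vecs] in \<open>auto simp: Af_def\<close>)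
  also have "\<dots> = (Am *\<^sub>v y) $ i"
    using i Am vecs by (simp add: scalar_prod_def)
  finally have a: "(\<Sum>j<d. Af i j * vec_input y \<delta> j) = (Am *\<^sub>v y) $ i" .
  have "Am *\<^sub>v y \<in> carrier_vec n" using Am vecs by simp
  then show ?thesis unfolding a using Diag_mult[of "scaling g0 (requests tr)" n "Am *\<^sub>v y" i] g0 i soundD(2)[OF S i] by simp
qed

lemma absorb_X: "i < n \<Longrightarrow> aX s1 i = xvec Am x0 past' (Suc tm) $ i"
  and absorb_pos: "i < n \<Longrightarrow> 0 < aX s1 i"
proof -
  assume i: "i < n"
  show e: "aX s1 i = xvec Am x0 past' (Suc tm) $ i"
    using xvec_snoc[of i Am x0 "past tr"] Am i soundD(1)[OF S i] move_eq[OF i] vec_input_nth(2)[OF vecs i]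
    by (simp add: absorbA_def past'_def)
  show "0 < aX s1 i" unfolding e using request_facts(2)[OF S, of "Suc tm" i] i unfolding past_adv len' by simp
qed

lemma absorb_energy:
  assumes "i < n"
  shows "en' (Suc tm) i = (aG s i * (\<Sum>j<d. Af i j * vec_input y \<delta> j) / aX s1 i)\<^sup>2 + (vec_input y \<delta> (d + i) / aX s1 i)\<^sup>2"
  unfolding row_energy_def absorb_X[OF assms] move_eq[OF assms] vec_input_nth(2)[OF vecs assms]
  by (simp add: past'_def nth_append)

lemma en'_old: "1 \<le> j \<Longrightarrow> j \<le> tm \<Longrightarrow> en' j i = energies tr j i"
  unfolding past'_def by (rule row_energy_append)

lemma backed_en': "backed en' tm s = backed (energies tr) tm s"
proof -
  have "window en' a tm i = window (energies tr) a tm i" for a i by (rule window_cong) (simp add: en'_old)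
  then show ?thesis by (simp add: backed_def)
qed

lemma absorbed_query: "close thr s \<Longrightarrow> backed (energies tr) tm s \<Longrightarrow> absorbed en' tm s1"
  using thr absorb_pos absorb_energy soundD(4)[OF S] row_energy_nonneg
  by (intro absorbed_absorb) (auto simp: backed_en')

lemma s1_simps: "aT s1 = tm mod R" "aS s1 = aS s"
  using soundD(3)[OF S] by (simp_all add: absorbA_def)

lemma mid_step:
  assumes "Suc (aT s) < R"
  defines "s2 \<equiv> advance thr s1"
  defines "t \<equiv> 300 * (n * L) + levels_costA thr (Suc (aT s1)) s1"
  defines "tr' \<equiv> tr @ [(Query y \<delta>, vec n (aB s2), t)]"
  shows "astep (s, tr) = return_pmf (s2, tr')" "sound s2 tr'" "Suc tm mod R = Suc (tm mod R)" "aX s2 = aX s1" "real t \<le> worst"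
proof -
  have aT1: "aT s1 = aT s" by (simp add: absorbA_def)
  show "astep (s, tr) = return_pmf (s2, tr')"
    using assms(1) by (simp add: astep_def q Let_def s2_def t_def tr'_def advance_def aT1)
  show m: "Suc tm mod R = Suc (tm mod R)" using assms(1) soundD(3)[OF S] by (simp add: mod_Suc)
  have X2: "aX s2 = aX s1" "aG s2 = aG s" "aS s2 = aS s" "aT s2 = Suc (aT s)"
    by (simp_all add: s2_def advance_def levelsA_def absorbA_def)
  show "aX s2 = aX s1" by (rule X2)
  have tr': "tr' = tr @ [(adv (outputs tr), vec n (aB s2), t)]" by (simp add: tr'_def q)
  show "sound s2 tr'"
    by (rule sound_snoc[OF S tr'])
      (use m soundD[OF S] absorb_X in \<open>simp_all add: X2 past'_def queries_snoc tr' scaling_snoc q entry_ok_def\<close>)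
  have "t \<le> 300 * (n * L) + L * (500 * (n * K) + 260 * K * d * n + 600 * X * n)"
    unfolding t_def by (intro add_left_mono levels_cost_le)
  then show "real t \<le> worst" unfolding worst_def by (simp only: of_nat_le_iff)
qed

lemma mid_doomed:
  assumes "Suc (aT s) < R"
  defines "s2 \<equiv> advance thr s1"
  shows "\<not> doomed (Suc m) s (outputs tr) \<Longrightarrow> unflawed thr (Suc (aT s1)) s1 \<and> \<not> doomed m s2 (outputs tr @ [vec n (aB s2)])"
proof -
  assume D: "\<not> doomed (Suc m) s (outputs tr)"
  have aT1: "aT s1 = aT s" by (simp add: absorbA_def)
  have F: "unflawed thr (Suc (aT s1)) s1" and D2: "\<not> doomed m (ideal_advance thr s1) (outputs tr @ [vec n (aB (ideal_advance thr s1))])"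
    using D assms(1) by (auto simp: q Let_def aT1)
  have "s2 = ideal_advance thr s1" unfolding s2_def
    by (rule advance_ideal[OF _ F]) (use soundD(5)[OF S] s1_simps in simp)
  then show ?thesis using F D2 by simp
qed

lemma mid_close: "close thr s \<Longrightarrow> unflawed thr (Suc (aT s1)) s1 \<Longrightarrow> close thr (advance thr s1)"
  using thr(1) absorb_pos soundD(3)[OF S] by (intro close_advance) (simp_all add: s1_simps)

lemma mid_cost:
  assumes "absorbed en' tm s1" "unflawed thr (Suc (aT s1)) s1"
  shows "real (300 * (n * L) + levels_costA thr (Suc (aT s1)) s1) \<le> 300 * real (n * L)
    + 630 * real (n * K) * (\<Sum>l<L. of_bool (2 ^ l dvd Suc tm)) + 28000 * real K * real X / thr\<^sup>2 * level_weight en' (Suc tm)"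
  using levels_cost_energy[OF thr(1,2) _ assms(1) s1_simps(1) assms(2) row_energy_nonneg] soundD(5)[OF S] s1_simps(2)
  by simp

lemma end_step:
  assumes "\<not> Suc (aT s) < R"
  defines "tr' \<equiv> tr @ [(Query y \<delta>, vec n (aX s1), 300 * (n * L) + 2000 * (n * X))]"
  shows "astep (s, tr) = map_pmf (\<lambda>f. (rebuildA f s1, tr')) (signs_pmf (K * n))" "R dvd Suc tm"
    "f \<in> set_pmf (signs_pmf (K * n)) \<Longrightarrow> sound (rebuildA f s1) tr'"
    "close thr (rebuildA f s1)" "backed e (Suc tm) (rebuildA f s1)"
proof -
  show "astep (s, tr) = map_pmf (\<lambda>f. (rebuildA f s1, tr')) (signs_pmf (K * n))"
    using assms(1) by (simp add: astep_def q Let_def tr'_def rebuildA_def pmf.map_comp o_def)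
  have "Suc (tm mod R) = R" using assms(1) soundD(3,4)[OF S] by simp
  then have m: "Suc tm mod R = 0" by (simp add: mod_Suc)
  then show dv: "R dvd Suc tm" by (simp add: dvd_eq_mod_eq_0)
  have tr': "tr' = tr @ [(adv (outputs tr), vec n (aX s1), 300 * (n * L) + 2000 * (n * X))]" by (simp add: tr'_def q)
  have G: "aG s1 = aG s" by (simp add: absorbA_def)
  show "sound (rebuildA f s1) tr'" if "f \<in> set_pmf (signs_pmf (K * n))"
    by (rule sound_snoc[OF S tr'])
      (use m soundD[OF S] absorb_X set_signs_pmf[OF that] G in \<open>simp_all add: rebuildA_def past'_def queries_snoc tr' scaling_snoc q entry_ok_def\<close>)
  show "close thr (rebuildA f s1)" by (rule close_fresh) (use absorb_pos in \<open>simp_all add: rebuildA_def\<close>)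
  show "backed e (Suc tm) (rebuildA f s1)" by (rule backed_fresh) (simp_all add: rebuildA_def dv)
qed

end

end

section \<open>Invariants for the time and for the accuracy\<close>

context game
begin

definition claims :: "nat \<Rightarrow> log \<Rightarrow> bool" where
  "claims B tr \<longleftrightarrow> (\<forall>k<length (past tr). real (query_costs tr ! k) \<le> cost_bound thr B (energies tr) (Suc k))"

text \<open>In the first \<open>B\<close> epochs the signs are known not to be doomed. Later the
  state may go wrong, but not while the recent energy is tiny; and each rebuild restores
  \<open>close\<close> and \<open>backed\<close> unconditionally.\<close>

definition good_time :: "nat \<Rightarrow> nat \<Rightarrow> ast \<times> log \<Rightarrow> bool" where
  "good_time B m = (\<lambda>(s, tr). sound s tr \<and> claims B tr \<and>
     (length (past tr) div R < B \<or> recent_energy (energies tr) (length (past tr)) < tiny thr \<longrightarrow>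
       close thr s \<and> backed (energies tr) (length (past tr)) s) \<and>
     (length (past tr) div R < B \<longrightarrow> \<not> doomed m s (outputs tr)))"

text \<open>Only the epoch that contains query \<open>k\<close> matters: earlier errors are wiped
  out by the rebuild before it, and an output once given stays.\<close>

definition good_approx :: "nat \<Rightarrow> nat \<Rightarrow> ast \<times> log \<Rightarrow> bool" where
  "good_approx k m = (\<lambda>(s, tr). sound s tr \<and>
     (length (past tr) < k \<and> length (past tr) div R = (k - 1) div R \<longrightarrow> close thr s \<and> \<not> doomed m s (outputs tr)) \<and>
     (k \<le> length (past tr) \<longrightarrow> approx \<epsilon> (query_outputs tr ! (k - 1)) (xvec Am x0 (past tr) k)))"

lemma prob_rebuild_doomed:
  "measure_pmf.prob (signs_pmf (K * n)) {f. doomed m (rebuildA f s) ys} \<le> epoch_flaw"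
proof -
  have e: "(rebuildA (\<lambda>_. 0) s)\<lparr>aS := f\<rparr> = rebuildA f s" for f by (simp add: rebuildA_def)
  show ?thesis using prob_doomed[of m "rebuildA (\<lambda>_. 0) s" ys] unfolding e .
qed

lemma claims_snoc:
  assumes S: "sound s tr" and q: "adv (outputs tr) = Query y \<delta>" and C: "claims B tr"
    and t: "real t \<le> cost_bound thr B (row_energy Am x0 (past' tr y \<delta>)) (Suc (length (past tr)))"
  shows "claims B (tr @ [(Query y \<delta>, v, t)])"
  unfolding claims_def past_snoc[OF S q]
proof (intro allI impI)
  fix k assume k: "k < length (past' tr y \<delta>)"
  have l: "length (query_costs tr) = length (past tr)" by (rule length_query_costs)
  show "real (query_costs (tr @ [(Query y \<delta>, v, t)]) ! k) \<le> cost_bound thr B (row_energy Am x0 (past' tr y \<delta>)) (Suc k)"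
  proof (cases "k = length (past tr)")
    case True
    then show ?thesis using t l by (simp add: query_lists_snoc nth_append)
  next
    case False
    then have k': "k < length (past tr)" using k len'[OF S q] by simp
    have "cost_bound thr B (row_energy Am x0 (past' tr y \<delta>)) (Suc k) = cost_bound thr B (energies tr) (Suc k)"
      by (rule cost_bound_cong, rule en'_old[OF S q]) (use k' in auto)
    then show ?thesis using C k' l by (simp add: claims_def query_lists_snoc nth_append)
  qed
qed

text \<open>\<open>\<beta>\<close> reserves one \<open>epoch_flaw\<close> for each of the first
  \<open>B\<close> epochs still to come; the current epoch was charged when its signs were
  drawn.\<close>

lemma good_time_step:
  assumes G: "good_time B (Suc m) (s, tr)"
  defines "\<beta> \<equiv> \<lambda>(s :: ast, tr). real (B - 1 - length (past tr) div R) * epoch_flaw"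
  shows "\<exists>b\<ge>0. (\<forall>c'\<in>set_pmf (astep (s, tr)). good_time B m c' \<longrightarrow> \<beta> c' \<le> b) \<and>
      measure_pmf.prob (astep (s, tr)) {c'. \<not> good_time B m c'} + b \<le> \<beta> (s, tr)"
proof -
  let ?T = "length (past tr)"
  have S: "sound s tr" and C: "claims B tr"
    and I: "?T div R < B \<or> recent_energy (energies tr) ?T < tiny thr \<Longrightarrow> close thr s \<and> backed (energies tr) ?T s"
    and D: "?T div R < B \<Longrightarrow> \<not> doomed (Suc m) s (outputs tr)"
    using G by (auto simp: good_time_def)
  have \<beta>0: "0 \<le> \<beta> c" for c using epoch_flaw_nonneg by (simp add: \<beta>_def split: prod.splits)
  show ?thesis
  proof (cases "is_Query (adv (outputs tr))")
    case True
    then obtain y \<delta> where q: "adv (outputs tr) = Query y \<delta>" by (cases "adv (outputs tr)") auto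
    note c = S q
    let ?s1 = "absorb_query y \<delta> s" and ?e = "row_energy Am x0 (past' tr y \<delta>)"
    have lv: "0 \<le> level_weight ?e (Suc ?T)"
      unfolding level_weight_def by (intro sum_nonneg mult_nonneg_nonneg window_nonneg row_energy_nonneg) auto
    have ep: "0 \<le> epoch_energy ?e (Suc ?T)"
      unfolding epoch_energy_def by (intro sum_nonneg window_nonneg row_energy_nonneg)
    have Z: "0 \<le> 28000 * real K * real X / thr\<^sup>2 * level_weight ?e (Suc ?T)" using lv by simp
    have V: "0 \<le> (\<Sum>l<L. of_bool (2 ^ l dvd Suc ?T) :: real)" by (intro sum_nonneg) auto
    have wt: "0 \<le> worst / tiny thr" using worst_nonneg tiny_pos[OF thr(1)] by simp
    have LE: "0 \<le> (if R * B \<le> Suc ?T then worst / tiny thr * epoch_energy ?e (Suc ?T) else 0)"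
      using mult_nonneg_nonneg[OF wt ep] by (cases "R * B \<le> Suc ?T") simp_all
    show ?thesis
    proof (cases "Suc (aT s) < R")
      case True
      let ?s2 = "advance thr ?s1" and ?t = "300 * (n * L) + levels_costA thr (Suc (aT ?s1)) ?s1"
      let ?tr = "tr @ [(Query y \<delta>, vec n (aB ?s2), ?t)]"
      note M = mid_step[OF c True]
      have div: "Suc ?T div R = ?T div R" using M(3) by (metis div_Suc nat.distinct(1))
      have past: "past ?tr = past' tr y \<delta>" "length (past' tr y \<delta>) = Suc ?T" by (rule past_snoc[OF c], rule len'[OF c])
      have pl: "length (past ?tr) = Suc ?T" unfolding past_snoc[OF c] by (rule len'[OF c])
      have ndv: "\<not> R dvd Suc ?T" using M(3) by (simp add: dvd_eq_mod_eq_0)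
      have start: "Suc ?T - Suc ?T mod R = ?T - ?T mod R" using M(3) by simp
      have rec: "recent_energy ?e (Suc ?T) = epoch_energy ?e (Suc ?T)"
        by (simp add: recent_energy_def epoch_energy_def start del: diff_Suc_Suc)
      have old: "recent_energy (energies tr) ?T \<le> epoch_energy ?e (Suc ?T)"
        unfolding recent_energy_def epoch_energy_def diff_Suc_1
      proof (intro sum_mono)
        fix i
        have "window ?e (?T - ?T mod R) (Suc ?T) i = window ?e (?T - ?T mod R) ?T i + ?e (Suc ?T) i" by (rule window_Suc) simp
        moreover have "window ?e (?T - ?T mod R) ?T i = window (energies tr) (?T - ?T mod R) ?T i"
          by (rule window_cong) (simp add: en'_old[OF c])
        ultimately show "window (energies tr) (?T - ?T mod R) ?T i \<le> window ?e (?T - ?T mod R) (Suc ?T) i"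
          using row_energy_nonneg[of Am x0 "past' tr y \<delta>" "Suc ?T" i] by simp
      qed
      have main: "claims B ?tr \<and> (?T div R < B \<or> recent_energy ?e (Suc ?T) < tiny thr \<longrightarrow> close thr ?s2 \<and> backed ?e (Suc ?T) ?s2)
          \<and> (?T div R < B \<longrightarrow> \<not> doomed m ?s2 (outputs tr @ [vec n (aB ?s2)]))"
      proof (cases "?T div R < B \<or> recent_energy ?e (Suc ?T) < tiny thr")
        case early: True
        \<comment> \<open>Recent energy only grows within an epoch, so if it is tiny now it was tiny
          before, and the invariant was in force.\<close>
        have ok: "close thr s" "backed (energies tr) ?T s" using I early old rec by auto
        note A = absorbed_query[OF c ok]
        have F: "unflawed thr (Suc (aT ?s1)) ?s1"
        proof (cases "?T div R < B")
          case True
          then show ?thesis using mid_doomed[OF c \<open>Suc (aT s) < R\<close> D] by blast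
        next
          case False
          then have "epoch_energy ?e (Suc ?T) < tiny thr" using early rec by simp
          then show ?thesis
            using tiny_absorbed[OF thr(1,2) _ A row_energy_nonneg] soundD(5)[OF S] s1_simps[OF c]
            by (simp add: epoch_energy_def)
        qed
        have "real ?t \<le> cost_bound thr B ?e (Suc ?T)"
          using mid_cost[OF c A F] LE ndv by (simp add: cost_bound_def)
        then have "claims B ?tr" by (rule claims_snoc[OF c C])
        moreover have "close thr ?s2" by (rule mid_close[OF c ok(1) F])
        moreover have "backed ?e (Suc ?T) ?s2" by (rule backed_advance[OF A]) (use s1_simps[OF c] in simp)
        moreover have "?T div R < B \<Longrightarrow> \<not> doomed m ?s2 (outputs tr @ [vec n (aB ?s2)])"
          using mid_doomed[OF c True D] by blast
        ultimately show ?thesis by blast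
      next
        case late: False
        then have big: "tiny thr \<le> epoch_energy ?e (Suc ?T)" and B: "B \<le> ?T div R" using rec by auto
        have "R * B \<le> R * (?T div R)" using B by simp
        also have "\<dots> \<le> Suc ?T" using times_div_less_eq_dividend[of R ?T] by linarith
        finally have RB: "R * B \<le> Suc ?T" .
        \<comment> \<open>No invariant is available here; the worst-case cost is charged to the
          energy of the epoch, which is at least \<open>tiny thr\<close>.\<close>
        have "worst / tiny thr * tiny thr \<le> worst / tiny thr * epoch_energy ?e (Suc ?T)"
          by (rule mult_left_mono[OF big wt])
        then have w: "worst \<le> worst / tiny thr * epoch_energy ?e (Suc ?T)" using tiny_pos[OF thr(1)] by simp
        have "0 \<le> 300 * real (n * L) + 630 * real (n * K) * (\<Sum>l<L. of_bool (2 ^ l dvd Suc ?T))" using V by simp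
        then have "worst \<le> cost_bound thr B ?e (Suc ?T)"
          using w Z RB unfolding cost_bound_def if_not_P[OF ndv] if_P[OF RB] by argo
        then have "real ?t \<le> cost_bound thr B ?e (Suc ?T)" using M(5) by argo
        then have "claims B ?tr" by (rule claims_snoc[OF c C])
        then show ?thesis using late by blast
      qed
      have "outputs ?tr = outputs tr @ [vec n (aB ?s2)]" by simp
      then have "good_time B m (?s2, ?tr)"
        using main M(2) div unfolding good_time_def prod.case past by auto
      then show ?thesis
        by (rule det_step[where f = astep and c = "(s, tr)" and good = "good_time B" and m = m and \<beta> = \<beta>, OF M(1)]; ((simp only: \<beta>_def prod.case pl div order_refl; fail) | (simp only: \<beta>_def prod.case; simp add: epoch_flaw_nonneg)))
    next
      case False
      let ?t = "300 * (n * L) + 2000 * (n * X)"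
      let ?tr = "tr @ [(Query y \<delta>, vec n (aX ?s1), ?t)]" and ?b = "real (B - 1 - Suc ?T div R) * epoch_flaw"
      note E = end_step[OF c False]
      have past: "past ?tr = past' tr y \<delta>" "length (past' tr y \<delta>) = Suc ?T" by (rule past_snoc[OF c], rule len'[OF c])
      have pl: "length (past ?tr) = Suc ?T" unfolding past_snoc[OF c] by (rule len'[OF c])
      have div: "Suc ?T div R = Suc (?T div R)" using E(2) by (simp add: div_Suc dvd_eq_mod_eq_0)
      have "0 \<le> 630 * real (n * K) * (\<Sum>l<L. of_bool (2 ^ l dvd Suc ?T))" using V by simp
      moreover have "real ?t = 300 * real (n * L) + 2000 * real (n * X)" by simp
      ultimately have "real ?t \<le> cost_bound thr B ?e (Suc ?T)"
        using Z LE unfolding cost_bound_def if_P[OF E(2)] by argo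
      then have cl: "claims B ?tr" by (rule claims_snoc[OF c C])
      \<comment> \<open>Doomed signs count as a failure only if the new epoch is among the first
        \<open>B\<close>.\<close>
      let ?bad = "if Suc (?T div R) < B then {f. doomed m (rebuildA f ?s1) (outputs ?tr)} else {}"
      show ?thesis
      proof (rule random_step[where f = astep and c = "(s, tr)" and good = "good_time B" and m = m and \<beta> = \<beta>, OF E(1), where E = ?bad and q = "if Suc (?T div R) < B then epoch_flaw else 0" and b = ?b])
        fix f assume f: "f \<in> set_pmf (signs_pmf (K * n))" "f \<notin> ?bad"
        show "good_time B m (rebuildA f ?s1, ?tr)"
          unfolding good_time_def prod.case past using E(3)[OF f(1)] E(4,5) f(2) cl by (auto simp: div)
      next
        show "measure_pmf.prob (signs_pmf (K * n)) ?bad \<le> (if Suc (?T div R) < B then epoch_flaw else 0)"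
          using prob_rebuild_doomed by simp
        show "\<beta> (rebuildA f ?s1, ?tr) \<le> ?b" for f by (simp only: \<beta>_def prod.case pl order_refl)
        show "0 \<le> ?b" using epoch_flaw_nonneg by simp
        show "(if Suc (?T div R) < B then epoch_flaw else 0) + ?b \<le> \<beta> (s, tr)"
        proof (cases "Suc (?T div R) < B")
          case True
          then have "real (B - 1 - ?T div R) = 1 + real (B - 1 - Suc ?T div R)" unfolding div by simp
          then show ?thesis using True by (simp add: \<beta>_def algebra_simps)
        next
          case False
          have "?b \<le> real (B - 1 - ?T div R) * epoch_flaw"
            unfolding div using epoch_flaw_nonneg by (intro mult_right_mono) auto
          then show ?thesis using False by (simp add: \<beta>_def)
        qed
      qed
    qed
  next
    case nq: False
    from nonquery_step[OF S nq] obtain s' v t where N: "astep (s, tr) = return_pmf (s', tr @ [(adv (outputs tr), v, t)])"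
      "sound s' (tr @ [(adv (outputs tr), v, t)])" "close thr s' = close thr s"
      "\<And>e k. backed e k s' = backed e k s" "\<And>m. doomed m s' (outputs tr @ [v]) = doomed (Suc m) s (outputs tr)"
      "past (tr @ [(adv (outputs tr), v, t)]) = past tr" by blast
    have "query_costs (tr @ [(adv (outputs tr), v, t)]) = query_costs tr" by (simp add: query_lists_snoc nq)
    then have "good_time B m (s', tr @ [(adv (outputs tr), v, t)])"
      using N(2) C I D unfolding good_time_def claims_def prod.case N(3,4,6) by (auto simp: N(5))
    then show ?thesis by (rule det_step[where f = astep and c = "(s, tr)" and good = "good_time B" and m = m and \<beta> = \<beta>, OF N(1)]; ((simp only: \<beta>_def prod.case N(6) order_refl; fail) | (simp only: \<beta>_def prod.case; simp add: epoch_flaw_nonneg)))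
  qed
qed

lemma approx_close:
  assumes S: "sound s tr" and C: "close thr s"
  shows "approx \<epsilon> (vec n (aB s)) (xvec Am x0 (past tr) (length (past tr)))"
proof -
  have "exp (- \<epsilon>) * aX s i \<le> aB s i \<and> aB s i \<le> exp \<epsilon> * aX s i" if i: "i < n" for i
  proof (rule approx_entry)
    have "0 \<le> thr" using thr(1) by simp
    then show "\<bar>aX s i - aB s i\<bar> \<le> \<epsilon> / 2 * aB s i"
      using close_drift[OF C _ soundD(4)[OF S] i] unfolding thr(4) by blast
    show "0 < aB s i" using C i by (auto simp: close_def)
  qed (use eps in auto)
  then show ?thesis using soundD(1)[OF S] Am by (auto simp: approx_def xvec_def)
qed

lemma approx_snoc:
  assumes S: "sound s tr" and q: "adv (outputs tr) = Query y \<delta>" and k: "1 \<le> k" "k \<le> length (past tr)"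
    and a: "approx \<epsilon> (query_outputs tr ! (k - 1)) (xvec Am x0 (past tr) k)"
  shows "approx \<epsilon> (query_outputs (tr @ [(Query y \<delta>, v, t)]) ! (k - 1)) (xvec Am x0 (past (tr @ [(Query y \<delta>, v, t)])) k)"
proof -
  have "k - 1 < length (query_outputs tr)" using k length_query_outputs[of tr g0] by simp
  then show ?thesis unfolding past_snoc[OF S q] past'_def[OF S q]
    using a by (simp add: query_lists_snoc nth_append xvec_append[OF k(2)])
qed

text \<open>\<open>\<beta>\<close> is a single \<open>epoch_flaw\<close>, due when the signs for the
  epoch of query \<open>k\<close> are drawn.\<close>

lemma good_approx_step:
  assumes G: "good_approx k (Suc m) (s, tr)" and k: "1 \<le> k"
  defines "\<beta> \<equiv> \<lambda>(s :: ast, tr). if length (past tr) div R < (k - 1) div R then epoch_flaw else 0"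
  shows "\<exists>b\<ge>0. (\<forall>c'\<in>set_pmf (astep (s, tr)). good_approx k m c' \<longrightarrow> \<beta> c' \<le> b) \<and>
      measure_pmf.prob (astep (s, tr)) {c'. \<not> good_approx k m c'} + b \<le> \<beta> (s, tr)"
proof -
  let ?T = "length (past tr)" and ?e0 = "(k - 1) div R"
  have S: "sound s tr"
    and I: "?T < k \<Longrightarrow> ?T div R = ?e0 \<Longrightarrow> close thr s \<and> \<not> doomed (Suc m) s (outputs tr)"
    and A: "k \<le> ?T \<Longrightarrow> approx \<epsilon> (query_outputs tr ! (k - 1)) (xvec Am x0 (past tr) k)"
    using G by (auto simp: good_approx_def)
  have \<beta>0: "0 \<le> \<beta> c" for c using epoch_flaw_nonneg by (simp add: \<beta>_def split: prod.splits)
  show ?thesis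
  proof (cases "is_Query (adv (outputs tr))")
    case True
    then obtain y \<delta> where q: "adv (outputs tr) = Query y \<delta>" by (cases "adv (outputs tr)") auto
    note c = S q
    let ?s1 = "absorb_query y \<delta> s"
    have ql: "length (query_outputs tr) = ?T" by (rule length_query_outputs)
    show ?thesis
    proof (cases "Suc (aT s) < R")
      case True
      let ?s2 = "advance thr ?s1" and ?t = "300 * (n * L) + levels_costA thr (Suc (aT ?s1)) ?s1"
      let ?tr = "tr @ [(Query y \<delta>, vec n (aB ?s2), ?t)]"
      note M = mid_step[OF c True]
      have div: "Suc ?T div R = ?T div R" using M(3) by (metis div_Suc nat.distinct(1))
      have past: "past ?tr = past' tr y \<delta>" "length (past ?tr) = Suc ?T"
        using past_snoc[OF c] len'[OF c] by simp_all
      have cl: "close thr ?s2 \<and> \<not> doomed m ?s2 (outputs ?tr)" if "?T < k" "?T div R = ?e0"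
        using mid_doomed[OF c True conjunct2[OF I[OF that]]] mid_close[OF c conjunct1[OF I[OF that]]] by simp
      have ap: "approx \<epsilon> (query_outputs ?tr ! (k - 1)) (xvec Am x0 (past ?tr) k)" if "k \<le> Suc ?T"
      proof (cases "k \<le> ?T")
        case True
        then show ?thesis using approx_snoc[OF c k True A] by blast
      next
        case False
        then have e: "k = Suc ?T" using that by simp
        then have "close thr ?s2" using cl by simp
        from approx_close[OF M(2) this] show ?thesis
          unfolding past(2) using e ql by (simp add: query_lists_snoc nth_append)
      qed
      have "good_approx k m (?s2, ?tr)"
        unfolding good_approx_def prod.case past(2) div using M(2) cl ap by auto
      then show ?thesis
        by (rule det_step[where f = astep and c = "(s, tr)" and good = "good_approx k" and m = m and \<beta> = \<beta>, OF M(1)]; ((simp only: \<beta>_def prod.case past(2) div order_refl; fail) | (simp only: \<beta>_def prod.case; simp add: epoch_flaw_nonneg)))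
    next
      case False
      let ?t = "300 * (n * L) + 2000 * (n * X)"
      let ?tr = "tr @ [(Query y \<delta>, vec n (aX ?s1), ?t)]" and ?b = "if Suc (?T div R) < ?e0 then epoch_flaw else 0"
      note E = end_step[OF c False]
      have past: "past ?tr = past' tr y \<delta>" "length (past ?tr) = Suc ?T"
        using past_snoc[OF c] len'[OF c] by simp_all
      have div: "Suc ?T div R = Suc (?T div R)" using E(2) by (simp add: div_Suc dvd_eq_mod_eq_0)
      have ap: "approx \<epsilon> (query_outputs ?tr ! (k - 1)) (xvec Am x0 (past ?tr) k)"
        if "k \<le> Suc ?T" and f: "f \<in> set_pmf (signs_pmf (K * n))" for f
      proof (cases "k \<le> ?T")
        case True
        then show ?thesis using approx_snoc[OF c k True A] by blast
      next
        case False
        then have e: "k = Suc ?T" using that by simp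
        \<comment> \<open>Query \<open>k\<close> may be the one that ends its epoch; the rebuild
          precedes the output, which is then exact.\<close>
        have "aB (rebuildA f ?s1) = aX ?s1" by (simp add: rebuildA_def)
        from approx_close[OF E(3)[OF f] E(4)] this show ?thesis
          unfolding past(2) using e ql by (simp add: query_lists_snoc nth_append)
      qed
      let ?bad = "if Suc (?T div R) = ?e0 then {f. doomed m (rebuildA f ?s1) (outputs ?tr)} else {}"
      show ?thesis
      proof (rule random_step[where f = astep and c = "(s, tr)" and good = "good_approx k" and m = m and \<beta> = \<beta>, OF E(1), where E = ?bad and q = "if Suc (?T div R) = ?e0 then epoch_flaw else 0" and b = ?b])
        fix f assume f: "f \<in> set_pmf (signs_pmf (K * n))" "f \<notin> ?bad"
        show "good_approx k m (rebuildA f ?s1, ?tr)"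
          unfolding good_approx_def prod.case past(2) div using E(3)[OF f(1)] E(4) f(2) ap[OF _ f(1)] by auto
      next
        show "measure_pmf.prob (signs_pmf (K * n)) ?bad \<le> (if Suc (?T div R) = ?e0 then epoch_flaw else 0)"
          using prob_rebuild_doomed by simp
        show "\<beta> (rebuildA f ?s1, ?tr) \<le> ?b" for f by (simp only: \<beta>_def prod.case past(2) div order_refl)
        show "0 \<le> ?b" using epoch_flaw_nonneg by simp
        show "(if Suc (?T div R) = ?e0 then epoch_flaw else 0) + ?b \<le> \<beta> (s, tr)"
          using epoch_flaw_nonneg by (auto simp: \<beta>_def)
      qed
    qed
  next
    case nq: False
    from nonquery_step[OF S nq] obtain s' v t where N: "astep (s, tr) = return_pmf (s', tr @ [(adv (outputs tr), v, t)])"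
      "sound s' (tr @ [(adv (outputs tr), v, t)])" "close thr s' = close thr s"
      "\<And>e k. backed e k s' = backed e k s" "\<And>m. doomed m s' (outputs tr @ [v]) = doomed (Suc m) s (outputs tr)"
      "past (tr @ [(adv (outputs tr), v, t)]) = past tr" by blast
    have qo: "query_outputs (tr @ [(adv (outputs tr), v, t)]) = query_outputs tr" by (simp add: query_lists_snoc nq)
    have "good_approx k m (s', tr @ [(adv (outputs tr), v, t)])"
      using N(2) I A unfolding good_approx_def prod.case N(3,6) qo by (auto simp: N(5))
    then show ?thesis by (rule det_step[where f = astep and c = "(s, tr)" and good = "good_approx k" and m = m and \<beta> = \<beta>, OF N(1)]; ((simp only: \<beta>_def prod.case N(6) order_refl; fail) | (simp only: \<beta>_def prod.case; simp add: epoch_flaw_nonneg)))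
  qed
qed

lemma start_facts:
  assumes "f \<in> set_pmf (signs_pmf (K * n))"
  shows "sound (fst (start f)) []" "close thr (fst (start f))" "backed e 0 (fst (start f))" "snd (start f) = []"
proof -
  have x: "xvec Am x0 qs 0 $ i = x0 $ i" if "i < n" for i qs using that Am by (simp add: xvec_def)
  have A: "admissible Am g0 x0 (map (\<lambda>m. adv (take m [])) [0..<Suc (length ([] :: real vec list))])"
    by (rule adm[unfolded admissible_adversary_def, THEN spec])
  have p: "0 < x0 $ i" if i: "i < n" for i
  proof -
    have "0 < xvec Am x0 (queries g0 (map (\<lambda>m. adv (take m [])) [0..<Suc (length ([] :: real vec list))])) 0 $ i"
      by (rule conjunct2[OF A[unfolded admissible_def], rule_format, OF le0]) (use i Am in simp)
    then show ?thesis unfolding x[OF i] .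
  qed
  show "sound (fst (start f)) []"
    using set_signs_pmf[OF assms] x by (simp add: sound_def start_def startA_def)
  show "close thr (fst (start f))"
    by (rule close_fresh) (use p x in \<open>simp_all add: start_def startA_def\<close>)
  show "backed e 0 (fst (start f))" by (rule backed_fresh) (simp_all add: start_def startA_def)
  show "snd (start f) = []" by (simp add: start_def)
qed

lemma prob_start_doomed: "measure_pmf.prob (signs_pmf (K * n)) {f. doomed m (fst (start f)) ys} \<le> epoch_flaw"
proof -
  have e: "(fst (start (\<lambda>_. 0)))\<lparr>aS := f\<rparr> = fst (start f)" for f by (simp add: start_def startA_def)
  show ?thesis using prob_doomed[of m "fst (start (\<lambda>_. 0))" ys] unfolding e .
qed

text \<open>One \<open>epoch_flaw\<close> for the signs of the initialisation, and one for each of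
  the \<open>B - 1\<close> rebuilds that start a further early epoch.\<close>

theorem prob_claims:
  assumes B: "1 \<le> B"
  shows "measure_pmf.prob (achain m) {(s, tr). \<not> claims B tr} \<le> real B * epoch_flaw"
proof -
  let ?\<beta> = "\<lambda>(s :: ast, tr). real (B - 1 - length (past tr) div R) * epoch_flaw"
  have "measure_pmf.prob (achain m) {(s, tr). \<not> claims B tr} \<le>
      measure_pmf.prob (signs_pmf (K * n)) {f. doomed m (fst (start f)) []} + real (B - 1) * epoch_flaw"
    unfolding achain_def
  proof (rule prob_bind_le)
    fix f assume f: "f \<in> set_pmf (signs_pmf (K * n))" "f \<notin> {f. doomed m (fst (start f)) []}"
    note st = start_facts[OF f(1)]
    have st': "start f = (fst (start f), [])" by (rule prod_eqI) (simp_all add: st(4))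
    have good: "good_time B m (start f)"
      using st f(2) by (subst st') (simp add: good_time_def claims_def)
    have "measure_pmf.prob (chain astep m (start f)) {(s, tr). \<not> claims B tr} \<le> ?\<beta> (start f)"
    proof (rule chain_bound[where good = "good_time B" and \<beta> = ?\<beta>, OF _ _ _ good])
      show "\<exists>b\<ge>0. (\<forall>c'\<in>set_pmf (astep c). good_time B m c' \<longrightarrow> ?\<beta> c' \<le> b) \<and>
        measure_pmf.prob (astep c) {c'. \<not> good_time B m c'} + b \<le> ?\<beta> c" if "good_time B (Suc m) c" for m c
        using that by (cases c) (simp only: good_time_step)
    qed (use epoch_flaw_nonneg in \<open>auto simp: good_time_def\<close>)
    also have "?\<beta> (start f) = real (B - 1) * epoch_flaw" by (subst st') simp
    finally show "measure_pmf.prob (chain astep m (start f)) {(s, tr). \<not> claims B tr} \<le> real (B - 1) * epoch_flaw" .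
  qed (use epoch_flaw_nonneg in simp)
  also have "\<dots> \<le> epoch_flaw + real (B - 1) * epoch_flaw"
    by (intro add_right_mono prob_start_doomed)
  also have "\<dots> = real B * epoch_flaw" using B by (simp add: of_nat_diff algebra_simps)
  finally show ?thesis .
qed

text \<open>The bound does not grow with \<open>k\<close> or \<open>m\<close>, since only one set of
  signs can spoil query \<open>k\<close>; for the first epoch these are the signs drawn by the
  initialisation.\<close>

theorem prob_not_approx:
  assumes k: "1 \<le> k"
  shows "measure_pmf.prob (achain m) {(s, tr). \<not> (k \<le> length (past tr) \<longrightarrow>
    approx \<epsilon> (query_outputs tr ! (k - 1)) (xvec Am x0 (past tr) k))} \<le> epoch_flaw"
    (is "measure_pmf.prob _ ?A \<le> _")
proof -
  let ?\<beta> = "\<lambda>(s :: ast, tr). if length (past tr) div R < (k - 1) div R then epoch_flaw else 0"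
  let ?E = "if (k - 1) div R = 0 then {f. doomed m (fst (start f)) []} else {}"
  let ?b = "if 0 < (k - 1) div R then epoch_flaw else 0"
  have "measure_pmf.prob (achain m) ?A \<le> measure_pmf.prob (signs_pmf (K * n)) ?E + ?b"
    unfolding achain_def
  proof (rule prob_bind_le)
    fix f assume f: "f \<in> set_pmf (signs_pmf (K * n))" "f \<notin> ?E"
    note st = start_facts[OF f(1)]
    have st': "start f = (fst (start f), [])" by (rule prod_eqI) (simp_all add: st(4))
    have good: "good_approx k m (start f)"
      using st f(2) k by (subst st') (auto simp: good_approx_def split: if_splits)
    have "measure_pmf.prob (chain astep m (start f)) ?A \<le> ?\<beta> (start f)"
    proof (rule chain_bound[where good = "good_approx k" and \<beta> = ?\<beta>, OF _ _ _ good])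
      show "\<exists>b\<ge>0. (\<forall>c'\<in>set_pmf (astep c). good_approx k m c' \<longrightarrow> ?\<beta> c' \<le> b) \<and>
        measure_pmf.prob (astep c) {c'. \<not> good_approx k m c'} + b \<le> ?\<beta> c" if "good_approx k (Suc m) c" for m c
        using that by (cases c) (simp only: good_approx_step[OF _ k])
    qed (use epoch_flaw_nonneg in \<open>auto simp: good_approx_def\<close>)
    also have "?\<beta> (start f) = ?b" by (subst st') simp
    finally show "measure_pmf.prob (chain astep m (start f)) ?A \<le> ?b" .
  next
    show "0 \<le> ?b" by (cases "0 < (k - 1) div R") (simp_all only: if_True if_False epoch_flaw_nonneg order_refl)
  qed
  also have "\<dots> \<le> epoch_flaw"
  proof (cases "(k - 1) div R = 0")
    case True
    have "?E = {f. doomed m (fst (start f)) []}" "?b = 0" unfolding True by (simp_all only: if_True if_False simp_thms less_irrefl)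
    then show ?thesis using prob_start_doomed[of m "[]"] by (simp only: add_0_right)
  next
    case False
    have "?E = {}" by (rule if_not_P[OF False])
    moreover have "?b = epoch_flaw" using False by (intro if_P) blast
    ultimately show ?thesis by (simp only: measure_empty add_0_left order_refl)
  qed
  finally show ?thesis .
qed

theorem sound_achain: "(s, tr) \<in> set_pmf (achain m) \<Longrightarrow> sound s tr \<and> length tr = m"
proof -
  have step: "sound s' tr' \<and> length tr' = Suc (length tr)" if S: "sound s tr" "(s', tr') \<in> set_pmf (astep (s, tr))" for s tr s' tr'
  proof (cases "is_Query (adv (outputs tr))")
    case True
    then obtain y \<delta> where q: "adv (outputs tr) = Query y \<delta>" by (cases "adv (outputs tr)") auto
    show ?thesis
    proof (cases "Suc (aT s) < R")
      case True
      obtain s2 e where M: "astep (s, tr) = return_pmf (s2, tr @ [e])" "sound s2 (tr @ [e])"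
        using mid_step(1,2)[OF S(1) q True] by blast
      then have "s' = s2" "tr' = tr @ [e]" using S(2) by simp_all
      then show ?thesis using M(2) by simp
    next
      case False
      note E = end_step(1,3)[OF S(1) q False]
      obtain f where f: "f \<in> set_pmf (signs_pmf (K * n))"
        "(s', tr') = (rebuildA f (s1 s y \<delta>), tr @ [(Query y \<delta>, vec n (aX (s1 s y \<delta>)), 300 * (n * L) + 2000 * (n * X))])"
        using S(2) unfolding E(1) set_map_pmf by (rule imageE)
      have "sound s' tr'" using E(2)[OF f(1)] f(2) by (simp only: prod.inject)
      moreover have "length tr' = Suc (length tr)"
        using f(2) by (simp only: prod.inject length_append list.size add_0_right add_Suc_right)
      ultimately show ?thesis by blast
    qed
  next
    case False
    show ?thesis
    proof (rule nonquery_step[OF S(1) False])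
      fix s2 v t assume N: "astep (s, tr) = return_pmf (s2, tr @ [(adv (outputs tr), v, t)])"
        "sound s2 (tr @ [(adv (outputs tr), v, t)])"
      have e: "(s', tr') = (s2, tr @ [(adv (outputs tr), v, t)])"
        using S(2) unfolding N(1) set_return_pmf by (rule singletonD)
      have "sound s' tr'" using N(2) e by (simp only: prod.inject)
      moreover have "length tr' = Suc (length tr)"
        using e by (simp only: prod.inject length_append list.size add_0_right add_Suc_right)
      ultimately show ?thesis by blast
    qed
  qed
  have ch: "sound s tr \<Longrightarrow> (s', tr') \<in> set_pmf (chain astep m (s, tr)) \<Longrightarrow> sound s' tr' \<and> length tr' = length tr + m" for s tr s' tr' m
  proof (induction m arbitrary: s tr)
    case (Suc m)
    then obtain s2 tr2 where 2: "(s2, tr2) \<in> set_pmf (astep (s, tr))" "(s', tr') \<in> set_pmf (chain astep m (s2, tr2))" by auto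
    note st = step[OF Suc.prems(1) 2(1)]
    show ?case using Suc.IH[OF conjunct1[OF st] 2(2)] conjunct2[OF st] by simp
  qed auto
  assume "(s, tr) \<in> set_pmf (achain m)"
  then obtain f where f: "f \<in> set_pmf (signs_pmf (K * n))" "(s, tr) \<in> set_pmf (chain astep m (start f))"
    by (auto simp: achain_def)
  note st = start_facts[OF f(1)]
  have "start f = (fst (start f), [])" by (rule prod_eqI) (simp_all add: st(4))
  then have "(s, tr) \<in> set_pmf (chain astep m (fst (start f), []))" using f(2) by (rule subst[where P = "\<lambda>c. (s, tr) \<in> set_pmf (chain astep m c)"])
  from ch[OF st(1) this] show ?thesis by simp
qed

end

section \<open>Summing the costs of a run\<close>

lemma sum_of_bool_dvd: "1 \<le> m \<Longrightarrow> (\<Sum>k\<in>{1..t}. of_bool (m dvd k) :: real) = real (t div m)"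
proof (induction t)
  case (Suc t)
  have "{1..Suc t} = insert (Suc t) {1..t}" by auto
  then have "(\<Sum>k\<in>{1..Suc t}. of_bool (m dvd k) :: real) = of_bool (m dvd Suc t) + real (t div m)"
    using Suc by simp
  also have "\<dots> = real (Suc t div m)" by (simp add: div_Suc dvd_eq_mod_eq_0)
  finally show ?case .
qed simp

text \<open>Double counting: \<open>e j i\<close> is charged once for each window containing
  \<open>j\<close>, and \<open>c\<close> bounds their number.\<close>

lemma sum_window_le:
  assumes e: "\<And>j. 0 \<le> e j i" and d: "\<And>k. k \<in> {1..t} \<Longrightarrow> P k \<Longrightarrow> k - a k \<le> (m :: nat)"
    and c: "\<And>j. j \<in> {1..t} \<Longrightarrow> card {k\<in>{1..t}. P k \<and> a k < j \<and> j \<le> k} \<le> c"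
  shows "(\<Sum>k\<in>{1..t}. of_bool (P k) * window e (a k) k i) \<le> real c * (\<Sum>j\<in>{1..t}. e j i)"
proof -
  have "(\<Sum>k\<in>{1..t}. of_bool (P k) * window e (a k) k i) =
    (\<Sum>k\<in>{1..t}. \<Sum>j\<in>{1..t}. of_bool (P k \<and> a k < j \<and> j \<le> k) * e j i)"
  proof (intro sum.cong refl)
    fix k assume k: "k \<in> {1..t}"
    have s: "{a k<..k} = {j\<in>{1..t}. a k < j \<and> j \<le> k}" using k by auto
    show "of_bool (P k) * window e (a k) k i = (\<Sum>j\<in>{1..t}. of_bool (P k \<and> a k < j \<and> j \<le> k) * e j i)"
    proof (cases "P k")
      case True
      have "(\<Sum>j\<in>{j\<in>{1..t}. a k < j \<and> j \<le> k}. e j i) = (\<Sum>j\<in>{1..t}. if a k < j \<and> j \<le> k then e j i else 0)"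
        by (rule sum.inter_filter) simp
      also have "\<dots> = (\<Sum>j\<in>{1..t}. of_bool (P k \<and> a k < j \<and> j \<le> k) * e j i)"
        by (intro sum.cong) (auto simp: True)
      finally show ?thesis unfolding window_def s using True by (simp only: of_bool_eq mult_1_left)
    qed simp
  qed
  also have "\<dots> = (\<Sum>j\<in>{1..t}. real (card {k\<in>{1..t}. P k \<and> a k < j \<and> j \<le> k}) * e j i)"
    by (subst sum.swap) (simp add: sum_distrib_right[symmetric] of_bool_def sum.If_cases Int_def conj_commute conj_left_commute)
  also have "\<dots> \<le> (\<Sum>j\<in>{1..t}. real c * e j i)"
    using c e by (intro sum_mono mult_right_mono) auto
  finally show ?thesis by (simp add: sum_distrib_left)
qed

lemma card_le_1I:
  assumes "\<And>x y. x \<in> A \<Longrightarrow> y \<in> A \<Longrightarrow> x \<le> (y :: nat)" shows "card A \<le> 1"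
proof (cases "finite A")
  case True
  then show ?thesis unfolding One_nat_def using card_le_Suc0_iff_eq assms by (metis le_antisym)
qed simp

lemma sum_geometric_le: "(\<Sum>l<b. if 2 ^ l \<le> t then 2 ^ l else 0 :: real) \<le> 2 * real t"
proof (induction b)
  case (Suc b)
  have "(\<Sum>l<m. (2::real) ^ l) \<le> 2 ^ m" for m by (induction m) auto
  note g = this
  show ?case
  proof (cases "2 ^ b \<le> t")
    case True
    have "(\<Sum>l<Suc b. if 2 ^ l \<le> t then 2 ^ l else 0 :: real) \<le> (\<Sum>l<Suc b. 2 ^ l)" by (intro sum_mono) auto
    also have "\<dots> \<le> 2 ^ Suc b" by (rule g)
    also have "\<dots> = 2 * real (2 ^ b)" by simp
    also have "\<dots> \<le> 2 * real t" using True by (simp only: of_nat_le_iff mult_le_cancel_left_pos zero_less_numeral)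
    finally show ?thesis .
  qed (use Suc in simp)
qed simp

lemma sum_halves_le: "(\<Sum>l<b. real (t div 2 ^ l)) \<le> 2 * real t"
proof -
  have "(\<Sum>l<b. real (t div 2 ^ l)) \<le> (\<Sum>l<b. real t * (1/2) ^ l)"
  proof (intro sum_mono)
    fix l
    have "real (t div 2 ^ l) \<le> real t / real (2 ^ l)" by (rule of_nat_div_le_of_nat)
    also have "\<dots> = real t * (1/2) ^ l"
      by (simp only: power_one_over of_nat_power of_nat_numeral times_divide_eq_right mult_1_right)
    finally show "real (t div 2 ^ l) \<le> real t * (1/2) ^ l" .
  qed
  also have "\<dots> = real t * (\<Sum>l<b. (1/2) ^ l)" by (simp add: sum_distrib_left)
  also have "\<dots> \<le> real t * 2"
  proof (intro mult_left_mono)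
    have "(\<Sum>l<b. (1/2::real) ^ l) \<le> 2 - 2 * (1/2) ^ b" by (induction b) (auto simp: algebra_simps)
    then show "(\<Sum>l<b. (1/2::real) ^ l) \<le> 2" by (smt (verit) zero_le_power zero_le_divide_1_iff)
  qed simp
  finally show ?thesis by simp
qed

context sizes
begin

text \<open>At one level the windows are disjoint, so level \<open>l\<close> contributes at most
  \<open>2 ^ l\<close> times the energy. Levels with \<open>2 ^ l > t\<close> are never checked, and
  the rest is a geometric sum below \<open>2 * t\<close>: the factor \<open>T\<close> in front of
  the energy.\<close>

lemma sum_level_weight:
  assumes e: "\<And>j i. 0 \<le> e j i"
  shows "(\<Sum>k\<in>{1..t}. level_weight e k) \<le> 2 * real t * (\<Sum>j\<in>{1..t}. \<Sum>i<n. e j i)"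
proof -
  let ?E = "\<Sum>j\<in>{1..t}. \<Sum>i<n. e j i"
  have E0: "0 \<le> ?E" using e by (intro sum_nonneg) auto
  have lev: "(\<Sum>k\<in>{1..t}. of_bool (2 ^ l dvd k) * (\<Sum>i<n. window e (k - 2 ^ l) k i)) \<le> ?E" for l
  proof -
    have "(\<Sum>k\<in>{1..t}. of_bool (2 ^ l dvd k) * window e (k - 2 ^ l) k i) \<le> real 1 * (\<Sum>j\<in>{1..t}. e j i)" for i
    proof (rule sum_window_le[where m = "2 ^ l"])
      fix j
      show "card {k\<in>{1..t}. 2 ^ l dvd k \<and> k - 2 ^ l < j \<and> j \<le> k} \<le> 1"
      proof (rule card_le_1I)
        fix x y assume a: "x \<in> {k\<in>{1..t}. 2 ^ l dvd k \<and> k - 2 ^ l < j \<and> j \<le> k}" "y \<in> {k\<in>{1..t}. 2 ^ l dvd k \<and> k - 2 ^ l < j \<and> j \<le> k}"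
        show "x \<le> y"
        proof (rule ccontr)
          assume "\<not> x \<le> y"
          moreover have "2 ^ l dvd x - y" using a by (intro dvd_diff_nat) auto
          ultimately have "2 ^ l \<le> x - y" by (intro dvd_imp_le) auto
          then show False using a by auto
        qed
      qed
    qed (use e in auto)
    then have h: "(\<Sum>k\<in>{1..t}. of_bool (2 ^ l dvd k) * window e (k - 2 ^ l) k i) \<le> (\<Sum>j\<in>{1..t}. e j i)" for i
      by (simp only: of_nat_1 mult_1_left)
    have "(\<Sum>i<n. \<Sum>k\<in>{1..t}. of_bool (2 ^ l dvd k) * window e (k - 2 ^ l) k i) \<le> (\<Sum>i<n. \<Sum>j\<in>{1..t}. e j i)"
      by (rule sum_mono) (rule h)
    then show ?thesis unfolding sum_distrib_left by (simp only: sum.swap[of _ "{..<n}" "{1..t}"])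
  qed
  have "(\<Sum>k\<in>{1..t}. level_weight e k) =
      (\<Sum>l<L. 2 ^ l * (\<Sum>k\<in>{1..t}. of_bool (2 ^ l dvd k) * (\<Sum>i<n. window e (k - 2 ^ l) k i)))"
    unfolding level_weight_def sum_distrib_left by (subst sum.swap) (simp only: mult.left_commute)
  also have "\<dots> \<le> (\<Sum>l<L. (if 2 ^ l \<le> t then 2 ^ l else 0) * ?E)"
  proof (intro sum_mono)
    fix l
    show "2 ^ l * (\<Sum>k\<in>{1..t}. of_bool (2 ^ l dvd k) * (\<Sum>i<n. window e (k - 2 ^ l) k i)) \<le> (if 2 ^ l \<le> t then 2 ^ l else 0) * ?E"
    proof (cases "2 ^ l \<le> t")
      case True
      have "2 ^ l * (\<Sum>k\<in>{1..t}. of_bool (2 ^ l dvd k) * (\<Sum>i<n. window e (k - 2 ^ l) k i)) \<le> 2 ^ l * ?E"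
        by (rule mult_left_mono[OF lev]) simp
      then show ?thesis using True by simp
    next
      case False
      have "\<not> 2 ^ l dvd k" if "k \<in> {1..t}" for k
      proof
        assume "2 ^ l dvd k"
        then have "2 ^ l \<le> k" using that by (intro dvd_imp_le) auto
        then show False using that False by auto
      qed
      then have "(\<Sum>k\<in>{1..t}. of_bool (2 ^ l dvd k) * (\<Sum>i<n. window e (k - 2 ^ l) k i)) = 0"
        by (intro sum.neutral ballI) simp
      then show ?thesis using False by simp
    qed
  qed
  also have "\<dots> = (\<Sum>l<L. if 2 ^ l \<le> t then 2 ^ l else 0) * ?E" by (simp only: sum_distrib_right)
  also have "\<dots> \<le> (2 * real t) * ?E" by (rule mult_right_mono[OF sum_geometric_le E0])
  finally show ?thesis .
qed

text \<open>The epoch energy at query \<open>k\<close> sees query \<open>j\<close> only if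
  \<open>j \<le> k < j + R\<close>.\<close>

lemma sum_epoch_energy:
  assumes e: "\<And>j i. 0 \<le> e j i"
  shows "(\<Sum>k\<in>{1..t}. epoch_energy e k) \<le> real R * (\<Sum>j\<in>{1..t}. \<Sum>i<n. e j i)"
proof -
  have "(\<Sum>k\<in>{1..t}. of_bool True * window e (k - 1 - (k - 1) mod R) k i) \<le> real R * (\<Sum>j\<in>{1..t}. e j i)" for i
  proof (rule sum_window_le[where m = t])
    fix j
    have "{k\<in>{1..t}. True \<and> k - 1 - (k - 1) mod R < j \<and> j \<le> k} \<subseteq> {j..<j + R}"
    proof
      fix k assume a: "k \<in> {k\<in>{1..t}. True \<and> k - 1 - (k - 1) mod R < j \<and> j \<le> k}"
      have "(k - 1) mod R < R" using R_pos by simp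
      then show "k \<in> {j..<j + R}" using a by auto
    qed
    then have "card {k\<in>{1..t}. True \<and> k - 1 - (k - 1) mod R < j \<and> j \<le> k} \<le> card {j..<j + R}"
      by (rule card_mono[rotated]) simp
    then show "card {k\<in>{1..t}. True \<and> k - 1 - (k - 1) mod R < j \<and> j \<le> k} \<le> R" by simp
  qed (use e in auto)
  then have h: "(\<Sum>k\<in>{1..t}. window e (k - 1 - (k - 1) mod R) k i) \<le> real R * (\<Sum>j\<in>{1..t}. e j i)" for i
    by (simp only: of_bool_eq mult_1_left)
  have "(\<Sum>i<n. \<Sum>k\<in>{1..t}. window e (k - 1 - (k - 1) mod R) k i) \<le> (\<Sum>i<n. real R * (\<Sum>j\<in>{1..t}. e j i))"
    by (rule sum_mono) (rule h)
  then show ?thesis unfolding epoch_energy_def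
    by (simp only: sum.swap[of _ "{..<n}" "{1..t}"] sum_distrib_left[symmetric])
qed

text \<open>The constant 56001 is \<open>2 * 28000\<close> from the level weights plus 1 from the
  late epochs; 1260 is twice 630 because level \<open>l\<close> is checked in every
  \<open>2 ^ l\<close>-th query.\<close>

lemma sum_cost_bound:
  assumes e: "\<And>j i. 0 \<le> e j i" and thr: "0 < thr" and B: "1 \<le> B" "worst * (16 * real R * (real n)\<^sup>2) \<le> real B"
  shows "(\<Sum>k\<in>{1..t}. cost_bound thr B e k) \<le> real t * (300 * real (n * L) + 1260 * real (n * K) + 2000 * real (n * X) / real R
    + 56001 * real K * real X / thr\<^sup>2 * (\<Sum>j\<in>{1..t}. \<Sum>i<n. e j i))"
proof -
  let ?E = "\<Sum>j\<in>{1..t}. \<Sum>i<n. e j i"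
  define c1 where "c1 = 300 * real (n * L)"
  define c2 where "c2 = 630 * real (n * K)"
  define c3 where "c3 = 2000 * real (n * X)"
  define c4 where "c4 = 28000 * real K * real X / thr\<^sup>2"
  define c5 where "c5 = worst / tiny thr"
  have nn: "0 \<le> c2" "0 \<le> c3" "0 \<le> c4" "0 \<le> c5"
    using worst_nonneg tiny_pos[OF thr] by (simp_all add: c2_def c3_def c4_def c5_def)
  have E0: "0 \<le> ?E" using e by (intro sum_nonneg) auto
  have ep: "0 \<le> epoch_energy e k" for k unfolding epoch_energy_def using e by (intro sum_nonneg window_nonneg)
  have cb: "cost_bound thr B e k = c1 + c2 * (\<Sum>l<L. of_bool (2 ^ l dvd k)) + c3 * of_bool (R dvd k) + c4 * level_weight e k
     + (if R * B \<le> k then c5 * epoch_energy e k else 0)" for k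
    by (simp add: cost_bound_def c1_def c2_def c3_def c4_def c5_def)
  have s1: "(\<Sum>k\<in>{1..t}. c1) = real t * c1" by simp
  have s2: "(\<Sum>k\<in>{1..t}. c2 * (\<Sum>l<L. of_bool (2 ^ l dvd k))) \<le> c2 * (2 * real t)"
  proof -
    have "(\<Sum>k\<in>{1..t}. (\<Sum>l<L. of_bool (2 ^ l dvd k) :: real)) = (\<Sum>l<L. real (t div 2 ^ l))"
      by (subst sum.swap) (intro sum.cong refl sum_of_bool_dvd, simp)
    then show ?thesis unfolding sum_distrib_left[symmetric]
      using mult_left_mono[OF sum_halves_le[where b = L and t = t] nn(1)] by simp
  qed
  have s3: "(\<Sum>k\<in>{1..t}. c3 * of_bool (R dvd k)) \<le> c3 * (real t / real R)"
  proof -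
    have R1: "1 \<le> R" using R_pos by simp
    have "(\<Sum>k\<in>{1..t}. of_bool (R dvd k) :: real) \<le> real t / real R"
      unfolding sum_of_bool_dvd[OF R1] by (rule of_nat_div_le_of_nat)
    then show ?thesis unfolding sum_distrib_left[symmetric] by (rule mult_left_mono[OF _ nn(2)])
  qed
  have s4: "(\<Sum>k\<in>{1..t}. c4 * level_weight e k) \<le> c4 * (2 * real t * ?E)"
    unfolding sum_distrib_left[symmetric] by (rule mult_left_mono[OF sum_level_weight[of e t, OF e] nn(3)])
  have s5: "(\<Sum>k\<in>{1..t}. if R * B \<le> k then c5 * epoch_energy e k else 0) \<le> real t * (?E / thr\<^sup>2)"
  proof (cases "R * B \<le> t")
    case True
    have "(\<Sum>k\<in>{1..t}. if R * B \<le> k then c5 * epoch_energy e k else 0) \<le> (\<Sum>k\<in>{1..t}. c5 * epoch_energy e k)"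
      using mult_nonneg_nonneg[OF nn(4) ep] by (intro sum_mono) auto
    also have "\<dots> \<le> c5 * (real R * ?E)"
      unfolding sum_distrib_left[symmetric, of c5] by (rule mult_left_mono[OF sum_epoch_energy[of e t, OF e] nn(4)])
    also have "\<dots> = (worst * (16 * real R * (real n)\<^sup>2)) * real R * (?E / thr\<^sup>2)"
      using thr by (simp add: c5_def tiny_def)
    \<comment> \<open>\<open>B\<close> exceeds the polynomial loss of charging the worst case, and
      late queries exist only if \<open>t \<ge> R * B\<close>: the factor \<open>t\<close>
      pays.\<close>
    also have "\<dots> \<le> real B * real R * (?E / thr\<^sup>2)"
      using E0 by (intro mult_right_mono B(2)) auto
    also have "\<dots> = real (R * B) * (?E / thr\<^sup>2)" by (simp add: mult_ac)
    also have "\<dots> \<le> real t * (?E / thr\<^sup>2)" using True E0 by (intro mult_right_mono) (simp_all only: of_nat_le_iff, simp)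
    finally show ?thesis .
  next
    case False
    then have "(\<Sum>k\<in>{1..t}. if R * B \<le> k then c5 * epoch_energy e k else 0) = 0" by (intro sum.neutral) auto
    then show ?thesis using E0 by simp
  qed
  have "1 \<le> D1" by (rule trans_le_add1[OF pos(1)])
  then have "1 * (1 * 1) \<le> D1 * (DEP * K)" by (rule mult_le_mono[OF _ mult_le_mono[OF pos(5) pos(3)]])
  then have "1 * 1 \<le> K * X" using pos(3) unfolding X_def[symmetric] by (intro mult_le_mono) auto
  then have "1 \<le> real K * real X" by (metis mult_1 of_nat_1 of_nat_le_iff of_nat_mult)
  then have "1 / thr\<^sup>2 \<le> real K * real X / thr\<^sup>2" by (intro divide_right_mono) auto
  then have s6: "real t * (?E / thr\<^sup>2) \<le> real t * (real K * real X / thr\<^sup>2 * ?E)"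
    using mult_right_mono[OF _ E0, of "1 / thr\<^sup>2" "real K * real X / thr\<^sup>2"] by (intro mult_left_mono) simp_all
  have "(\<Sum>k\<in>{1..t}. cost_bound thr B e k) = (\<Sum>k\<in>{1..t}. c1) + (\<Sum>k\<in>{1..t}. c2 * (\<Sum>l<L. of_bool (2 ^ l dvd k))) +
     (\<Sum>k\<in>{1..t}. c3 * of_bool (R dvd k)) + (\<Sum>k\<in>{1..t}. c4 * level_weight e k) +
     (\<Sum>k\<in>{1..t}. if R * B \<le> k then c5 * epoch_energy e k else 0)"
    unfolding cb sum.distrib ..
  also have "\<dots> \<le> real t * c1 + c2 * (2 * real t) + c3 * (real t / real R) + c4 * (2 * real t * ?E) + real t * (real K * real X / thr\<^sup>2 * ?E)"
    using s1 s2 s3 s4 s5 s6 by argo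
  also have "\<dots> = real t * (300 * real (n * L) + 1260 * real (n * K) + 2000 * real (n * X) / real R + 56001 * real K * real X / thr\<^sup>2 * ?E)"
    by (simp add: c1_def c2_def c3_def c4_def algebra_simps)
  finally show ?thesis .
qed

end

section \<open>Numerical estimates\<close>

text \<open>With \<open>N = 2 ^ lg\<close> the left side is at most
  \<open>1920000 * \<kappa>\<^sup>2 * N ^ (14 + c)\<close>, while
  \<open>2 ^ K = N ^ \<kappa>\<close>. As \<open>1920000 \<le> 2 ^ 21\<close> and
  \<open>\<kappa> \<le> 2 ^ j\<close>, an exponent \<open>21 + 2 * j + 14 + c = 3 * j\<close>
  suffices, and \<open>\<kappa> = 4 * j\<close> leaves room.\<close>

lemma flaw_arith:
  fixes c n d lg :: nat
  defines "j \<equiv> 35 + c"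
  defines "\<kappa> \<equiv> 4 * j"
  assumes n: "n \<le> 2 ^ lg" and d: "d \<le> n" and lg: "1 \<le> lg" and n1: "1 \<le> n"
  defines "K \<equiv> \<kappa> * lg" and "DEP \<equiv> lg + 2" and "R \<equiv> 2 ^ (lg + lg)"
  defines "X \<equiv> (d + (lg + lg)) * (DEP * K)"
  defines "worst \<equiv> 300 * (n * (lg + lg)) + (lg + lg) * (500 * (n * K) + 260 * K * d * n + 600 * X * n)"
  defines "B \<equiv> 16 * R * n\<^sup>2 * worst"
  shows "B * (R * ((lg + lg) * (n * (DEP + 4 * K)))) * n ^ c \<le> 2 ^ K"
proof -
  define N :: nat where "N = 2 ^ lg"
  have N2: "2 \<le> N" unfolding N_def using lg power_increasing[of 1 lg "2::nat"] by simp
  have lgN: "lg \<le> N" unfolding N_def using less_exp[of lg] by simp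
  have nN: "n \<le> N" "d \<le> N" using n d by (simp_all add: N_def)
  have DN: "DEP \<le> 2 * N"
  proof -
    have "Suc lg \<le> 2 ^ lg" using less_exp[of lg] by (rule Suc_leI)
    moreover have "lg + 2 \<le> 2 * (Suc lg)" by simp
    ultimately show ?thesis unfolding DEP_def N_def by linarith
  qed
  have KN: "K \<le> \<kappa> * N" unfolding K_def using lgN by simp
  have RN: "R = N * N" by (simp add: R_def N_def power_add)
  have k1: "1 \<le> \<kappa>" by (simp add: \<kappa>_def j_def)
  have "X \<le> (3 * N) * (2 * N * (\<kappa> * N))"
    unfolding X_def using nN lgN by (intro mult_le_mono DN KN) linarith
  then have XN: "X \<le> 6 * \<kappa> * N ^ 3" by (simp add: power3_eq_cube mult_ac)
  have "worst \<le> 300 * (N * (N + N)) + (N + N) * (500 * (N * (\<kappa> * N)) + 260 * (\<kappa> * N) * N * N + 600 * (6 * \<kappa> * N ^ 3) * N)"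
    unfolding worst_def by (intro add_mono mult_le_mono nN lgN KN XN order_refl)
  also have "\<dots> = 600 * N ^ 2 + 1000 * \<kappa> * N ^ 3 + 520 * \<kappa> * N ^ 4 + 7200 * \<kappa> * N ^ 5"
    by (simp add: algebra_simps power_numeral_reduce)
  also have "\<dots> \<le> 600 * \<kappa> * N ^ 5 + 1000 * \<kappa> * N ^ 5 + 520 * \<kappa> * N ^ 5 + 7200 * \<kappa> * N ^ 5"
  proof (intro add_mono mult_le_mono order_refl)
    show "600 \<le> 600 * \<kappa>" using k1 by simp
  qed (use N2 in \<open>simp_all add: power_increasing\<close>)
  also have "\<dots> \<le> 10000 * \<kappa> * N ^ 5" by simp
  finally have WN: "worst \<le> 10000 * \<kappa> * N ^ 5" .
  have b1: "B \<le> 16 * (N * N) * N\<^sup>2 * (10000 * \<kappa> * N ^ 5)"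
    unfolding B_def RN by (intro mult_le_mono order_refl WN power_mono nN) simp
  have b2: "R * ((lg + lg) * (n * (DEP + 4 * K))) \<le> (N * N) * ((N + N) * (N * (2 * N + 4 * (\<kappa> * N))))"
    unfolding RN by (intro mult_le_mono add_mono order_refl nN lgN DN KN)
  have b3: "n ^ c \<le> N ^ c" using nN by (intro power_mono) auto
  have "B * (R * ((lg + lg) * (n * (DEP + 4 * K)))) * n ^ c \<le>
    (16 * (N * N) * N\<^sup>2 * (10000 * \<kappa> * N ^ 5)) * ((N * N) * ((N + N) * (N * (2 * N + 4 * (\<kappa> * N))))) * N ^ c"
    by (rule mult_le_mono[OF mult_le_mono[OF b1 b2] b3])
  also have "\<dots> = (640000 * \<kappa> + 1280000 * \<kappa> * \<kappa>) * (N ^ 14 * N ^ c)"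
    by (simp add: algebra_simps power_numeral_reduce)
  also have "\<dots> \<le> (1920000 * (\<kappa> * \<kappa>)) * (N ^ 14 * N ^ c)"
    using k1 by (intro mult_le_mono) auto
  also have "\<dots> \<le> (N ^ 21 * N ^ (2 * j)) * (N ^ 14 * N ^ c)"
  proof (intro mult_le_mono order_refl)
    have "(2::nat) ^ 21 \<le> N ^ 21" using N2 by (rule power_mono) simp
    then show "1920000 \<le> N ^ 21" by simp
    have q: "4 * m \<le> 2 ^ m" if "4 \<le> m" for m :: nat
      using that by (induction m rule: dec_induct) auto
    have "\<kappa> \<le> 2 ^ j" unfolding \<kappa>_def by (rule q) (simp add: j_def)
    also have "\<dots> \<le> N ^ j" using N2 by (rule power_mono) simp
    finally have "\<kappa> * \<kappa> \<le> N ^ j * N ^ j" by (intro mult_le_mono)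
    then show "\<kappa> * \<kappa> \<le> N ^ (2 * j)" by (simp add: mult_2 power_add)
  qed
  also have "\<dots> = N ^ (21 + 2 * j + (14 + c))" by (simp add: power_add)
  also have "\<dots> \<le> N ^ \<kappa>" using N2 by (intro power_increasing) (auto simp: \<kappa>_def j_def)
  also have "\<dots> = 2 ^ K" by (simp add: N_def K_def power_mult[symmetric] mult.commute)
  finally show ?thesis .
qed

text \<open>\<open>n\<close>, \<open>d\<close> and \<open>lg\<close> are at most
  \<open>N = 2 ^ lg\<close>, so the space needed is of order \<open>\<kappa> * N ^ 3\<close>; words
  of \<open>(\<kappa> + 10) * lg\<close> bits address \<open>N ^ (\<kappa> + 10)\<close>
  cells.\<close>

lemma mem_arith:
  fixes \<kappa> n d lg :: nat
  assumes n: "n \<le> 2 ^ lg" and d: "d \<le> n" and lg: "1 \<le> lg" and k: "1 \<le> \<kappa>"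
  defines "w \<equiv> (\<kappa> + 10) * lg"
  shows "16 * (2 * n * (\<kappa> * lg) * (d + (lg + lg))) + 16 \<le> 2 ^ w" "lg + 2 < (2::nat) ^ w" "2 ^ (lg + lg) < (2::nat) ^ w"
proof -
  define N :: nat where "N = 2 ^ lg"
  have N2: "2 \<le> N" unfolding N_def using lg power_increasing[of 1 lg "2::nat"] by simp
  have lgN: "lg \<le> N" unfolding N_def using less_exp[of lg] by simp
  have nN: "n \<le> N" "d \<le> N" using n d by (simp_all add: N_def)
  have wN: "(2::nat) ^ w = N ^ (\<kappa> + 10)" by (simp add: w_def N_def power_mult[symmetric] mult.commute)
  have "16 * (2 * n * (\<kappa> * lg) * (d + (lg + lg))) + 16 \<le> 16 * (2 * N * (\<kappa> * N) * (N + (N + N))) + 16 * (\<kappa> * N ^ 3)"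
    using k N2 by (intro add_mono mult_le_mono nN lgN order_refl) simp
  also have "\<dots> = 112 * (\<kappa> * N ^ 3)" by (simp add: algebra_simps power3_eq_cube)
  also have "\<dots> \<le> N ^ 7 * (N ^ \<kappa> * N ^ 3)"
  proof (intro mult_le_mono order_refl)
    have "(2::nat) ^ 7 \<le> N ^ 7" using N2 by (rule power_mono) simp
    then show "112 \<le> N ^ 7" by simp
    have "\<kappa> \<le> 2 ^ \<kappa>" using less_exp[of \<kappa>] by simp
    also have "\<dots> \<le> N ^ \<kappa>" using N2 by (rule power_mono) simp
    finally show "\<kappa> \<le> N ^ \<kappa>" .
  qed
  also have "\<dots> = 2 ^ w" unfolding wN by (simp add: power_add[symmetric] add.commute)
  finally show "16 * (2 * n * (\<kappa> * lg) * (d + (lg + lg))) + 16 \<le> 2 ^ w" .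
  have "lg + lg < w" using lg unfolding w_def by (simp add: algebra_simps)
  then show R: "2 ^ (lg + lg) < (2::nat) ^ w" by (intro power_strict_increasing) auto
  have "lg + 2 < 2 ^ (lg + 2)" by (rule less_exp)
  also have "\<dots> \<le> 2 ^ w" using lg unfolding w_def by (intro power_increasing) (auto simp: algebra_simps)
  finally show "lg + 2 < (2::nat) ^ w" .
qed

text \<open>The factor 4 is 2 from \<open>ln 2 \<ge> 1/2\<close> plus 2 from the rounding, as
  \<open>1 \<le> 2 * ln n\<close> for \<open>n \<ge> 2\<close>.\<close>

lemma ceil_log:
  assumes n: "2 \<le> (n::nat)"
  defines "lg \<equiv> nat \<lceil>log 2 (real n)\<rceil>"
  shows "2 ^ x < n \<longleftrightarrow> x < lg" "n \<le> 2 ^ lg" "1 \<le> lg" "real lg \<le> 4 * ln (real n)" "1/2 \<le> ln (real n)"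
proof -
  have e: "2 ^ x < n \<longleftrightarrow> x < lg" for x
  proof -
    have "2 ^ x < n \<longleftrightarrow> real (2 ^ x) < real n" by (simp only: of_nat_less_iff)
    also have "\<dots> \<longleftrightarrow> 2 powr (real x) < real n" by (simp add: powr_realpow)
    also have "\<dots> \<longleftrightarrow> real x < log 2 (real n)" by (subst less_log_iff) (use n in simp_all)
    also have "\<dots> \<longleftrightarrow> x < lg" unfolding lg_def by (simp only: zless_nat_eq_int_zless less_ceiling_iff of_int_of_nat_eq)
    finally show ?thesis .
  qed
  show "2 ^ x < n \<longleftrightarrow> x < lg" by (rule e)
  show "n \<le> 2 ^ lg" using e[of lg] by simp
  show l1: "1 \<le> lg" using e[of 0] n by simp
  have l2: "1/2 \<le> ln (2::real)"
  proof -
    have "(exp (1/2 :: real))\<^sup>2 = exp 1" by (simp add: exp_double[symmetric])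
    also have "\<dots> \<le> 2\<^sup>2" using exp_le by simp
    finally have "exp (1/2 :: real) \<le> 2" by (rule power2_le_imp_le) simp
    then show ?thesis by (subst ln_ge_iff) simp_all
  qed
  also have "\<dots> \<le> ln (real n)" using n by simp
  finally show l3: "1/2 \<le> ln (real n)" .
  have "0 \<le> log 2 (real n)" using n by simp
  then have "real lg < log 2 (real n) + 1" unfolding lg_def by linarith
  moreover have "log 2 (real n) \<le> ln (real n) * 2"
  proof -
    have "ln (real n) \<le> ln (real n) * 2 * ln 2" using mult_left_mono[OF l2, of "ln (real n) * 2"] l3 by simp
    then show ?thesis using l2 by (simp add: log_def divide_le_eq)
  qed
  ultimately show "real lg \<le> 4 * ln (real n)" using l3 by argo
qed

text \<open>\<open>14336256 = 56001 * 256\<close>, with 256 from the square of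
  \<open>8 * (2 * l)\<close>, and \<open>36864 = 9 * 4 ^ 6\<close>; their product is below
  \<open>10 ^ 12\<close>. Of the six logarithms three come from \<open>X\<close>, one from the
  number of sketches and two from the threshold.\<close>

lemma query_arith:
  fixes l z \<kappa> d n X R E \<epsilon> :: real
  assumes l: "1 \<le> l" "l \<le> 4 * z" and k: "1 \<le> \<kappa>" and d: "1 \<le> d" and n: "0 \<le> n" and e: "0 < \<epsilon>" and E: "0 \<le> E"
    and X: "X \<le> 9 * \<kappa> * d * l ^ 3" "X \<le> 6 * \<kappa> * l * R" and R: "0 < R"
  shows "300 * (n * (2 * l)) + 1260 * (n * (\<kappa> * l)) + 2000 * (n * X) / R + 56001 * (\<kappa> * l) * X / (\<epsilon> / (8 * (2 * l)))\<^sup>2 * E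
    \<le> 10 ^ 12 * \<kappa>\<^sup>2 * (n * z + E * (1 / \<epsilon>\<^sup>2) * d * z ^ 6)"
proof -
  have kk: "\<kappa> \<le> \<kappa>\<^sup>2" using k by (simp add: power2_eq_square)
  have z0: "0 \<le> z" using l by argo
  have nl: "0 \<le> n * l" using n l by simp
  have nkl: "n * l \<le> n * (\<kappa> * l)" using k l n by (intro mult_left_mono) auto
  have "n * X \<le> n * (6 * \<kappa> * l * R)" by (rule mult_left_mono[OF X(2) n])
  then have x: "2000 * (n * X) / R \<le> 12000 * (n * (\<kappa> * l))" using R by (simp add: divide_le_eq mult_ac)
  have "300 * (n * (2 * l)) + 1260 * (n * (\<kappa> * l)) + 2000 * (n * X) / R \<le> 13860 * (n * (\<kappa> * l))"
    using nkl x by argo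
  also have "\<dots> \<le> 13860 * (n * (\<kappa>\<^sup>2 * (4 * z)))"
    using n k l kk by (intro mult_left_mono mult_mono) auto
  also have "\<dots> \<le> 10 ^ 12 * \<kappa>\<^sup>2 * (n * z)"
  proof -
    have "0 \<le> n * (\<kappa>\<^sup>2 * z)" using n z0 by simp
    then show ?thesis by (simp add: mult_ac)
  qed
  finally have 1: "300 * (n * (2 * l)) + 1260 * (n * (\<kappa> * l)) + 2000 * (n * X) / R \<le> 10 ^ 12 * \<kappa>\<^sup>2 * (n * z)" .
  define F where "F = E / \<epsilon>\<^sup>2"
  have F: "0 \<le> F" using E by (simp add: F_def)
  have eq: "56001 * (\<kappa> * l) * X / (\<epsilon> / (8 * (2 * l)))\<^sup>2 * E = 14336256 * (\<kappa> * l ^ 3 * X) * F"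
    using e l by (simp add: F_def power_divide power_mult_distrib power_numeral_reduce field_simps)
  have "\<kappa> * l ^ 3 * X \<le> \<kappa> * l ^ 3 * (9 * \<kappa> * d * l ^ 3)" using k l by (intro mult_left_mono X) auto
  also have "\<dots> = 9 * (\<kappa>\<^sup>2 * d) * l ^ 6" by (simp add: power_numeral_reduce mult_ac)
  also have "\<dots> \<le> 9 * (\<kappa>\<^sup>2 * d) * (4 * z) ^ 6" using l d by (intro mult_left_mono power_mono) auto
  also have "\<dots> = 36864 * (\<kappa>\<^sup>2 * d * z ^ 6)" by (simp add: power_mult_distrib)
  finally have "14336256 * (\<kappa> * l ^ 3 * X) * F \<le> 14336256 * (36864 * (\<kappa>\<^sup>2 * d * z ^ 6)) * F"
    using F by (intro mult_right_mono mult_left_mono) auto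
  also have "\<dots> \<le> 10 ^ 12 * (\<kappa>\<^sup>2 * d * z ^ 6) * F"
    using F d z0 by (intro mult_right_mono) auto
  also have "\<dots> = 10 ^ 12 * \<kappa>\<^sup>2 * (E * (1 / \<epsilon>\<^sup>2) * d * z ^ 6)" by (simp add: F_def)
  finally show ?thesis using 1 unfolding eq by (simp only: distrib_left)
qed

lemma small_arith:
  fixes l z \<kappa> d X :: real
  assumes l: "1 \<le> l" "l \<le> 4 * z" "1/2 \<le> z" and k: "1 \<le> \<kappa>" and d: "0 \<le> d"
  shows "X \<le> 9 * \<kappa> * d * l ^ 3 \<Longrightarrow> 700 * X \<le> 10 ^ 12 * \<kappa>\<^sup>2 * (d * z ^ 5)"
    "100 * d \<le> 10 ^ 12 * \<kappa>\<^sup>2 * (d * z)" "1000 * (3 * l * (\<kappa> * l)) \<le> 10 ^ 12 * \<kappa>\<^sup>2 * z ^ 5"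
proof -
  have kk: "\<kappa> \<le> \<kappa>\<^sup>2" "1 \<le> \<kappa>\<^sup>2"
    using self_le_power[OF k, of 2] one_le_power[OF k, of 2] by simp_all
  have p: "1 \<le> 2 * z" using l by argo
  have p3: "z ^ 3 \<le> 4 * z ^ 5" and p2: "z ^ 2 \<le> 8 * z ^ 5"
  proof -
    have "1 \<le> (2 * z) ^ 2" "1 \<le> (2 * z) ^ 3" using p by (rule one_le_power)+
    then have "z ^ 3 * 1 \<le> z ^ 3 * (2 * z) ^ 2" "z ^ 2 * 1 \<le> z ^ 2 * (2 * z) ^ 3" using l(3) by (intro mult_left_mono; simp)+
    then show "z ^ 3 \<le> 4 * z ^ 5" "z ^ 2 \<le> 8 * z ^ 5" by (simp_all add: power_mult_distrib power_numeral_reduce mult_ac)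
  qed
  show "700 * X \<le> 10 ^ 12 * \<kappa>\<^sup>2 * (d * z ^ 5)" if X: "X \<le> 9 * \<kappa> * d * l ^ 3"
  proof -
    have "X \<le> 9 * \<kappa> * d * l ^ 3" by (rule X)
    also have "\<dots> \<le> 9 * \<kappa>\<^sup>2 * d * (4 * z) ^ 3" using l k d kk by (intro mult_mono power_mono) auto
    also have "\<dots> = 576 * (\<kappa>\<^sup>2 * d * z ^ 3)" by (simp add: power_mult_distrib)
    also have "\<dots> \<le> 576 * (\<kappa>\<^sup>2 * d * (4 * z ^ 5))" using d p3 by (intro mult_left_mono) auto
    finally have "700 * X \<le> 700 * (576 * (\<kappa>\<^sup>2 * d * (4 * z ^ 5)))" by (rule mult_left_mono) simp
    also have "\<dots> = 1612800 * (\<kappa>\<^sup>2 * d * z ^ 5)" by simp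
    also have "\<dots> \<le> 10 ^ 12 * (\<kappa>\<^sup>2 * d * z ^ 5)" using d l(3) by (intro mult_right_mono) auto
    finally show ?thesis by (simp add: mult_ac)
  qed
  have "d * 1 \<le> d * (2 * z)" by (rule mult_left_mono[OF p d])
  then have d1: "100 * d \<le> 200 * (d * z)" by argo
  have "200 * 1 * (d * z) \<le> 10 ^ 12 * \<kappa>\<^sup>2 * (d * z)" using d l kk by (intro mult_right_mono mult_mono) auto
  then show "100 * d \<le> 10 ^ 12 * \<kappa>\<^sup>2 * (d * z)" using d1 by argo
  have "1000 * (3 * l * (\<kappa> * l)) = 3000 * (\<kappa> * l ^ 2)" by (simp add: power2_eq_square)
  also have "\<dots> \<le> 3000 * (\<kappa>\<^sup>2 * (4 * z) ^ 2)" using l k kk by (intro mult_left_mono mult_mono power_mono) auto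
  also have "\<dots> = 48000 * (\<kappa>\<^sup>2 * z ^ 2)" by (simp add: power_mult_distrib)
  also have "\<dots> \<le> 48000 * (\<kappa>\<^sup>2 * (8 * z ^ 5))" using p2 by (intro mult_left_mono) auto
  also have "\<dots> = 384000 * (\<kappa>\<^sup>2 * z ^ 5)" by simp
  also have "\<dots> \<le> 10 ^ 12 * (\<kappa>\<^sup>2 * z ^ 5)" using l(3) by (intro mult_right_mono) auto
  finally show "1000 * (3 * l * (\<kappa> * l)) \<le> 10 ^ 12 * \<kappa>\<^sup>2 * z ^ 5" by (simp add: mult_ac)
qed

section \<open>Transfer to the machine and final bounds\<close>

text \<open>Costs need only be dominated: the adversary sees outputs but no running times, so both
  sides receive the same requests.\<close>

definition agree :: "log \<Rightarrow> log \<Rightarrow> bool" where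
  "agree = list_all2 (\<lambda>(q, y, c) (q', y', c'). q = q' \<and> y = y' \<and> c \<le> c')"

lemma agreeD:
  assumes "agree tr tr'"
  shows "requests tr = requests tr'" "outputs tr = outputs tr'" "query_outputs tr = query_outputs tr'"
    "time_of P tr \<le> time_of P tr'" "length tr = length tr'"
  using assms unfolding agree_def
  by (induction rule: list_all2_induct) (auto simp: query_outputs_def time_of_def)

lemma agree_snoc: "agree tr tr' \<Longrightarrow> c \<le> c' \<Longrightarrow> agree (tr @ [(q, y, c)]) (tr' @ [(q, y, c')])"
  by (simp add: agree_def list_all2_appendI)

lemma time_of_nonquery:
  assumes "\<forall>(q, y, c)\<in>set tr. (is_Scale q \<longrightarrow> c \<le> a) \<and> (is_Exact q \<longrightarrow> c \<le> b)"
  shows "time_of (\<lambda>q. \<not> is_Query q) tr \<le> a * number_of is_Scale tr + b * number_of is_Exact tr"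
  using assms
proof (induction tr)
  case (Cons e tr)
  obtain q y c where e: "e = (q, y, c)" by (metis prod_cases3)
  show ?case using Cons by (cases q) (auto simp: e time_of_def number_of_def)
qed (simp add: time_of_def)

lemma time_of_split: "time_of (\<lambda>q. True) tr = time_of (\<lambda>q. \<not> is_Query q) tr + sum_list (query_costs tr)"
  by (induction tr) (auto simp: time_of_def query_costs_def)

lemma sum_list_nth1: "sum_list xs = (\<Sum>k\<in>{1..length xs}. xs ! (k - 1))"
  by (subst sum_list_sum_nth) (rule sum.reindex_bij_witness[of _ "\<lambda>k. k - 1" Suc], auto)

lemma spmf_of_pmf_bind_spmf: "spmf_of_pmf (bind_pmf p f) = bind_spmf (spmf_of_pmf p) (\<lambda>x. spmf_of_pmf (f x))"
  by (simp only: bind_spmf_of_pmf spmf_of_pmf_bind)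

context game
begin

lemma wf_request: "well_formed n d (adv ys)"
proof -
  have "admissible Am g0 x0 (map (\<lambda>m. adv (take m ys)) [0..<Suc (length ys)])"
    by (rule adm[unfolded admissible_adversary_def, THEN spec])
  moreover have "adv ys \<in> set (map (\<lambda>m. adv (take m ys)) [0..<Suc (length ys)])" by simp
  ultimately show ?thesis using Am unfolding admissible_def by (metis carrier_matD)
qed

lemma achain_Suc: "achain (Suc m) = bind_pmf (achain m) astep"
proof -
  have "chain astep (Suc m) (start f) = bind_pmf (chain astep m (start f)) astep" for f by (rule chain_Suc)
  then show ?thesis unfolding achain_def bind_assoc_pmf by (simp only:)
qed

lemma play_sim:
  assumes init: "rel_spmf (sim thr Af) (initialize (tree_structure \<kappa>) w Am g0 x0 \<epsilon>)
    (map_spmf (\<lambda>f. fst (start f)) (signs (K * n)))"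
  shows "rel_spmf (\<lambda>(s, tr) (a, tr'). sim thr Af s a \<and> agree tr tr')
    (play (tree_structure \<kappa>) w Am g0 x0 \<epsilon> adv m) (spmf_of_pmf (achain m))"
proof (induction m)
  case 0
  have st: "start f = (fst (start f), [])" for f by (simp add: start_def)
  have "chain astep 0 (start f) = return_pmf (fst (start f), [])" for f by (subst st) simp
  then have e: "spmf_of_pmf (achain 0) = map_spmf (\<lambda>f. (fst (start f), [])) (signs (K * n))"
    unfolding achain_def by (simp only: map_pmf_def[symmetric] signs_def map_spmf_of_pmf)
  show ?case unfolding e play.simps spmf_rel_map
    by (rule rel_spmf_mono[OF init[unfolded spmf_rel_map]]) (simp add: agree_def)
next
  case (Suc m)
  show ?case unfolding achain_Suc play.simps(2) spmf_of_pmf_bind_spmf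
  proof (rule rel_spmf_bindI[OF Suc])
    fix x z assume xz: "(\<lambda>(s, tr) (a, tr'). sim thr Af s a \<and> agree tr tr') x z"
    obtain s tr a tr' where e: "x = (s, tr)" "z = (a, tr')" by (metis prod.collapse)
    have sa: "sim thr Af s a" "agree tr tr'" using xz by (simp_all add: e)
    have o: "outputs tr = outputs tr'" by (rule agreeD(2)[OF sa(2)])
    let ?q = "adv (outputs tr')"
    have dr: "dim_row Am = n" using Am by simp
    have a: "spmf_of_pmf (astep (a, tr')) = map_spmf (\<lambda>(s', y, t). (s', tr' @ [(?q, y, t)])) (spmf_of_pmf (aserve thr Af ?q a))"
      by (simp only: astep_def prod.case map_spmf_of_pmf)
    show "rel_spmf (\<lambda>(s, tr) (a, tr'). sim thr Af s a \<and> agree tr tr')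
      (case x of (s, tr) \<Rightarrow> let q = adv (outputs tr) in
         map_spmf (\<lambda>s'. (s', tr @ [(q, answer (dim_row Am) q s', clock s')])) (serve (tree_structure \<kappa>) w q s))
      (spmf_of_pmf (astep z))"
      unfolding e prod.case Let_def o a spmf_rel_map dr
      by (rule rel_spmf_mono[OF serve_sim[OF sa(1) wf_request]]) (auto intro: agree_snoc[OF sa(2)])
  qed
qed

lemma sound_time:
  assumes S: "sound s tr"
  shows "time_of (\<lambda>q. \<not> is_Query q) tr \<le> 700 * X * number_of is_Scale tr + 100 * d * number_of is_Exact tr"
proof (rule time_of_nonquery, rule ballI)
  fix e assume "e \<in> set tr"
  then obtain j where j: "j < length tr" "tr ! j = e" by (auto simp: in_set_conv_nth)
  have "entry_ok (take j tr) e" using S j by (auto simp: sound_def)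
  then show "case e of (q, y, c) \<Rightarrow> (is_Scale q \<longrightarrow> c \<le> 700 * X) \<and> (is_Exact q \<longrightarrow> c \<le> 100 * d)"
    by (auto simp: entry_ok_def split: prod.splits request.splits)
qed

lemma past_energy:
  assumes S: "sound s tr"
  shows "energy Am x0 (past tr) = (\<Sum>k\<in>{1..length (past tr)}. \<Sum>i<n. energies tr k i)"
proof (rule energy_rows[OF Am])
  have wf: "\<forall>q\<in>set (requests tr). well_formed n d q" using request_facts(1)[OF S] by auto
  fix g h \<delta> assume "(g, h, \<delta>) \<in> set (past tr)"
  from queries_dims[OF wf this] show "dim_vec g = n \<and> h \<in> carrier_vec d \<and> \<delta> \<in> carrier_vec n" using g0 by simp
qed

end

lemma full_rank_le:
  assumes A: "A \<in> carrier_mat n d" and r: "vec_space.rank n (A :: real mat) = d"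
  shows "d \<le> n"
proof -
  interpret vec_space "TYPE(real)" n .
  obtain S where S: "maximal S (\<lambda>T. T \<subseteq> set (cols A) \<and> lin_indpt T)"
    using maximal_exists[of "(\<lambda>T. T \<subseteq> set (cols A) \<and> lin_indpt T)" "card (set (cols A))" "{}"]
    by (meson List.finite_set card_mono empty_iff empty_subsetI finite_lin_indpt2 rev_finite_subset)
  then have "S \<subseteq> carrier_vec n" "lin_indpt S" using A cols_dim[of A] by (auto simp: maximal_def)
  then have "card S \<le> n" using li_le_dim(2)[OF fin_dim, of S] dim_is_n by simp
  then show ?thesis using rank_card_indpt[OF A S] r by simp
qed

text \<open>Choosing a nonzero entry in each row injects the rows into the nonzero entries;
  \<open>n \<le> nnz A\<close> is what makes the loops over rows affordable in the
  initialisation.\<close>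

lemma nondegenerate_sizes:
  assumes A: "A \<in> carrier_mat n d" and nd: "nondegenerate A" and n: "1 \<le> n"
  shows "1 \<le> d" "d \<le> n" "n \<le> nnz A"
proof -
  have dims: "dim_row A = n" "dim_col A = d" using A by simp_all
  have ex: "\<exists>j<d. A $$ (i, j) \<noteq> 0" if i: "i < n" for i
  proof (rule ccontr)
    assume "\<not> ?thesis"
    then have "row A i = 0\<^sub>v d" using i dims by (intro eq_vecI) auto
    then show False using nd i dims by (auto simp: nondegenerate_def)
  qed
  show "1 \<le> d" using ex[of 0] n by (cases d) auto
  show "d \<le> n" using nd full_rank_le[OF A] unfolding nondegenerate_def dims by simp
  define J where "J i = (SOME j. j < d \<and> A $$ (i, j) \<noteq> 0)" for i
  have J: "J i < d \<and> A $$ (i, J i) \<noteq> 0" if "i < n" for i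
    unfolding J_def by (rule someI_ex) (use ex[OF that] in blast)
  let ?Z = "{(i, j). i < dim_row A \<and> j < dim_col A \<and> A $$ (i, j) \<noteq> 0}"
  have "finite ?Z" by (rule finite_subset[of _ "{..<n} \<times> {..<d}"]) (auto simp: dims)
  moreover have "(\<lambda>i. (i, J i)) ` {..<n} \<subseteq> ?Z" using J by (auto simp: dims)
  ultimately have "card ((\<lambda>i. (i, J i)) ` {..<n}) \<le> card ?Z" by (intro card_mono)
  moreover have "card ((\<lambda>i. (i, J i)) ` {..<n}) = n" by (subst card_image) (auto simp: inj_on_def)
  ultimately show "n \<le> nnz A" by (simp add: nnz_def)
qed

lemma rel_spmf_ex: "rel_spmf P p q \<Longrightarrow> x \<in> set_spmf p \<Longrightarrow> \<exists>y\<in>set_spmf q. P x y"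
proof -
  assume r: "rel_spmf P p q" and x: "x \<in> set_spmf p"
  obtain pq where pq: "\<And>x y. (x, y) \<in> set_spmf pq \<Longrightarrow> P x y" "p = map_spmf fst pq" "q = map_spmf snd pq"
    using r by (rule rel_spmfE) blast
  obtain y where y: "(x, y) \<in> set_spmf pq" using x pq(2) by auto
  then have "snd (x, y) \<in> snd ` set_spmf pq" by (rule imageI)
  then have "y \<in> set_spmf q" by (simp add: pq(3))
  then show ?thesis using pq(1)[OF y] by blast
qed

text \<open>A coupling preserves total mass, so termination with probability one comes from the
  abstract side, whose distribution is a \<open>pmf\<close>.\<close>

lemma rel_spmf_prob_ge:
  assumes rel: "rel_spmf P p (spmf_of_pmf q)" and bad: "\<And>x y. P x y \<Longrightarrow> x \<notin> G \<Longrightarrow> y \<in> E"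
    and q: "measure_pmf.prob q E \<le> e"
  shows "lossless_spmf p" "1 - e \<le> measure (measure_spmf p) G"
proof -
  show l: "lossless_spmf p" using rel_spmf_weightD[OF rel] by (simp add: lossless_spmf_def)
  have "measure (measure_spmf p) (- G) \<le> measure (measure_spmf (spmf_of_pmf q)) {y. \<exists>x\<in>- G. P x y}"
    by (rule rel_spmf_measureD[OF rel])
  also have "\<dots> = measure_pmf.prob q {y. \<exists>x\<in>- G. P x y}" by simp
  also have "\<dots> \<le> measure_pmf.prob q E" by (rule measure_pmf.finite_measure_mono) (use bad in auto)
  finally have "measure (measure_spmf p) (- G) \<le> e" using q by simp
  moreover have "measure (measure_spmf p) (- G) = weight_spmf p - measure (measure_spmf p) G"
  proof -
    have e: "UNIV - G = space (measure_spmf p) - G" by (simp only: space_measure_spmf)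
    show ?thesis unfolding Compl_eq_Diff_UNIV e using measure_spmf.finite_measure_compl[of G p] by simp
  qed
  moreover have "weight_spmf p = 1" using l by (simp add: lossless_spmf_def)
  ultimately show "1 - e \<le> measure (measure_spmf p) G" by linarith
qed

lemma (in game) claims_time:
  assumes S: "sound s tr" and C: "claims B tr" and B: "1 \<le> B" "worst * (16 * real R * (real n)\<^sup>2) \<le> real B"
  shows "real (time_of (\<lambda>q. True) tr) \<le> 700 * real X * real (number_of is_Scale tr) + 100 * real d * real (number_of is_Exact tr)
    + real (length (past tr)) * (300 * real (n * L) + 1260 * real (n * K) + 2000 * real (n * X) / real R
    + 56001 * real K * real X / thr\<^sup>2 * energy Am x0 (past tr))"
proof -
  have "real (sum_list (query_costs tr)) = (\<Sum>k\<in>{1..length (past tr)}. real (query_costs tr ! (k - 1)))"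
    unfolding sum_list_nth1 length_query_costs[of tr g0] by (rule of_nat_sum)
  also have "\<dots> \<le> (\<Sum>k\<in>{1..length (past tr)}. cost_bound thr B (energies tr) k)"
  proof (rule sum_mono)
    fix k assume k: "k \<in> {1..length (past tr)}"
    then have "k - 1 < length (past tr)" "Suc (k - 1) = k" by auto
    then show "real (query_costs tr ! (k - 1)) \<le> cost_bound thr B (energies tr) k"
      using C unfolding claims_def by metis
  qed
  also have "\<dots> \<le> real (length (past tr)) * (300 * real (n * L) + 1260 * real (n * K) + 2000 * real (n * X) / real R
    + 56001 * real K * real X / thr\<^sup>2 * energy Am x0 (past tr))"
    unfolding past_energy[OF S] by (rule sum_cost_bound[OF row_energy_nonneg thr(1) B])
  finally have q: "real (sum_list (query_costs tr)) \<le> \<dots>" .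
  have "real (time_of (\<lambda>q. \<not> is_Query q) tr) \<le> real (700 * X * number_of is_Scale tr + 100 * d * number_of is_Exact tr)"
    using sound_time[OF S] by (simp only: of_nat_le_iff)
  then have "real (time_of (\<lambda>q. \<not> is_Query q) tr) \<le> 700 * real X * real (number_of is_Scale tr) + 100 * real d * real (number_of is_Exact tr)"
    by simp
  then show ?thesis using q unfolding time_of_split of_nat_add by (rule add_mono)
qed

lemma number_of_agree: "agree tr tr' \<Longrightarrow> number_of P tr = number_of P tr'"
  using agreeD(1)[of tr tr'] by (simp add: number_of_def)

text \<open>The number of sketches per rounded logarithm of \<open>n\<close>; the value comes from
  \<open>flaw_arith\<close>.\<close>

definition rate :: "nat \<Rightarrow> nat" where
  "rate c = 4 * (35 + c)"

definition cost_factor :: "nat \<Rightarrow> real" where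
  "cost_factor c = 10 ^ 12 * (real (rate c))\<^sup>2"

context
  fixes c n d :: nat and A :: "real mat" and g x0 :: "real vec" and \<epsilon> :: real and adv :: adversary
  assumes n2: "2 \<le> n" and A: "A \<in> carrier_mat n d" and nd: "nondegenerate A" and g: "g \<in> carrier_vec n"
    and x0: "x0 \<in> carrier_vec n" and eps: "0 < \<epsilon>" "\<epsilon> < 1/10" and adm: "admissible_adversary A g x0 adv"
begin

abbreviation "kap \<equiv> rate c"
definition "lg = nat \<lceil>log 2 (real n)\<rceil>"
definition "KK = kap * lg"
definition "DD = lg + 2"
definition "RR = (2::nat) ^ (lg + lg)"
definition "ww = word_length (kap + 10) n"
definition "tt = \<epsilon> / (8 * real (lg + lg))"
definition "PP m = logs (tree_structure kap) ww A g x0 \<epsilon> adv m"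
abbreviation "CC \<equiv> cost_factor c"

lemma ww: "ww = (kap + 10) * lg"
  by (simp add: ww_def word_length_def lg_def)

lemma kap1: "1 \<le> kap"
  by (simp add: rate_def)

lemmas lgs = ceil_log[OF n2, folded lg_def]

lemma n1: "1 \<le> n"
  using n2 by simp

lemmas dn = nondegenerate_sizes[OF A nd n1]

lemma szs: "sizes ww n d KK (lg + lg) DD RR"
proof
  show "16 * (2 * n * KK * (d + (lg + lg))) + 16 \<le> 2 ^ ww" "DD < 2 ^ ww" "RR < 2 ^ ww"
    using mem_arith[OF lgs(2) dn(2) lgs(3) kap1] by (simp_all add: ww KK_def DD_def RR_def)
  show "1 \<le> KK" using kap1 lgs(3) mult_le_mono[of 1 kap 1 lg] by (simp add: KK_def)
qed (use dn lgs(3) in \<open>simp_all add: DD_def RR_def\<close>)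

lemma gm: "game ww n d KK (lg + lg) DD RR A g x0 adv tt \<epsilon>"
proof -
  have "2 * n \<le> 2 * 2 ^ lg" using lgs(2) by simp
  also have "\<dots> \<le> 2 ^ DD" by (simp add: DD_def)
  finally show ?thesis
    by (intro game.intro szs game_axioms.intro A g x0 adm eps tt_def)
qed

interpretation G: game ww n d KK "lg + lg" DD RR A g x0 adv tt \<epsilon>
  by (rule gm)

abbreviation "init \<equiv> initialize (tree_structure kap) ww A g x0 \<epsilon>"

lemma init_sim:
  "rel_spmf (\<lambda>s' a'. G.sim tt G.Af s' a' \<and> clock s' \<le> 1000 * (nnz A * (DD * KK))) init
    (map_spmf (\<lambda>f. fst (G.start f)) (signs (KK * n)))"
proof -
  have Af: "G.Af = (\<lambda>i j. if i < n \<and> j < d then A $$ (i, j) else 0)" by (intro ext) (simp add: G.Af_def)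
  show ?thesis unfolding Af G.start_def fst_conv
    by (rule G.initialize_sim[OF lgs(1) KK_def refl DD_def A g x0 dn(3) tt_def[symmetric]])
qed

abbreviation "l \<equiv> real lg"
abbreviation "z \<equiv> ln (real n)"

lemma l1: "1 \<le> l" and k1: "1 \<le> real kap" and d1: "1 \<le> real d" "0 \<le> real d"
  using lgs(3) kap1 dn(1) by simp_all

text \<open>The three logarithms are the length of a path, the number of sketches and the window
  columns.\<close>

lemma X9: "real G.X \<le> 9 * real kap * real d * l ^ 3"
proof -
  have "d * 1 \<le> d * lg" "1 * lg \<le> d * lg" using lgs(3) dn(1) by (intro mult_le_mono; simp)+
  then have "d + (lg + lg) \<le> 3 * (d * lg)" by linarith
  moreover have "DD \<le> 3 * lg" using lgs(3) by (simp add: DD_def)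
  ultimately have "G.X \<le> (3 * (d * lg)) * ((3 * lg) * (kap * lg))"
    unfolding G.X_def unfolding KK_def by (intro mult_le_mono order_refl)
  also have "\<dots> = 9 * kap * d * lg ^ 3" by (simp add: power3_eq_cube)
  finally have "real G.X \<le> real (9 * kap * d * lg ^ 3)" by (simp only: of_nat_le_iff)
  then show ?thesis by simp
qed

text \<open>The choice \<open>L = 2 * lg\<close> is made for this: an epoch of
  \<open>2 ^ lg * 2 ^ lg\<close> queries turns the rebuild cost \<open>n * X\<close> into
  \<open>n * lg\<close> per query, up to constants.\<close>

lemma X6: "real G.X \<le> 6 * real kap * l * real RR"
proof -
  have e: "Suc lg \<le> 2 ^ lg" using less_exp[of lg] by (rule Suc_leI)
  have "d + (lg + lg) \<le> 3 * 2 ^ lg" using e dn(2) lgs(2) by linarith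
  moreover have "DD \<le> 2 * 2 ^ lg" using e by (simp add: DD_def)
  ultimately have "G.X \<le> (3 * 2 ^ lg) * ((2 * 2 ^ lg) * (kap * lg))"
    unfolding G.X_def unfolding KK_def by (intro mult_le_mono order_refl)
  also have "\<dots> = 6 * kap * lg * RR" by (simp add: RR_def power_add)
  finally have "real G.X \<le> real (6 * kap * lg * RR)" by (simp only: of_nat_le_iff)
  then show ?thesis by simp
qed

text \<open>The number of early epochs: large enough for \<open>sum_cost_bound\<close>, yet
  polynomial in \<open>n\<close>, so that the union bound over these epochs is affordable.\<close>

definition "BB = 16 * RR * n\<^sup>2 * (300 * (n * (lg + lg)) + (lg + lg) * (500 * (n * KK) + 260 * KK * d * n + 600 * ((d + (lg + lg)) * (DD * KK)) * n))"

lemma BB: "1 \<le> BB" "G.worst * (16 * real RR * (real n)\<^sup>2) \<le> real BB"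
proof -
  have "BB \<noteq> 0" using n1 lgs(3) by (simp add: BB_def RR_def)
  then show "1 \<le> BB" by simp
  show "G.worst * (16 * real RR * (real n)\<^sup>2) \<le> real BB"
    unfolding G.worst_def G.X_def BB_def of_nat_mult of_nat_power by (simp add: mult_ac)
qed

lemma flaw: "real BB * G.epoch_flaw \<le> 1 / real n ^ c" "G.epoch_flaw \<le> 1 / real n ^ c"
proof -
  let ?F = "RR * ((lg + lg) * (n * (DD + 4 * KK)))"
  have "BB * ?F * n ^ c \<le> 2 ^ KK"
    using flaw_arith[OF lgs(2) dn(2) lgs(3) n1, of c]
    unfolding BB_def KK_def DD_def RR_def rate_def .
  then have "real (BB * ?F * n ^ c) \<le> real (2 ^ KK)" by (simp only: of_nat_le_iff)
  then have h: "real BB * real ?F * real n ^ c \<le> 2 ^ KK" by simp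
  have e: "G.epoch_flaw = real ?F / 2 ^ KK"
    unfolding G.epoch_flaw_def G.flaw_prob_def by (simp add: power_one_over mult_ac)
  have nc: "0 < real n ^ c" using n1 by simp
  have "real BB * G.epoch_flaw = real BB * real ?F / 2 ^ KK" by (simp only: e times_divide_eq_right)
  also have "\<dots> \<le> 1 / real n ^ c"
    using h nc by (simp only: pos_divide_le_eq[OF zero_less_power[OF zero_less_numeral]] pos_le_divide_eq[OF nc] times_divide_eq_left mult_1_left)
  finally show f: "real BB * G.epoch_flaw \<le> 1 / real n ^ c" .
  have "1 * G.epoch_flaw \<le> real BB * G.epoch_flaw"
    using BB(1) G.epoch_flaw_nonneg by (intro mult_right_mono) simp_all
  then show "G.epoch_flaw \<le> 1 / real n ^ c" using f by linarith
qed

lemma init_bound: "s \<in> set_spmf init \<Longrightarrow> real (clock s) \<le> CC * (real (nnz A) * z ^ 5)"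
proof -
  assume "s \<in> set_spmf init"
  from rel_spmf_ex[OF init_sim this] have "clock s \<le> 1000 * (nnz A * (DD * KK))" by blast
  also have "\<dots> \<le> 1000 * (nnz A * ((3 * lg) * (kap * lg)))"
    using lgs(3) unfolding KK_def by (intro mult_le_mono order_refl) (simp add: DD_def)
  finally have "real (clock s) \<le> real (1000 * (nnz A * ((3 * lg) * (kap * lg))))" by (simp only: of_nat_le_iff)
  also have "\<dots> = real (nnz A) * (1000 * (3 * l * (real kap * l)))" by simp
  also have "\<dots> \<le> real (nnz A) * (10 ^ 12 * (real kap)\<^sup>2 * z ^ 5)"
    by (intro mult_left_mono small_arith(3)[OF l1 lgs(4,5) k1 d1(2)]) simp
  also have "\<dots> = CC * (real (nnz A) * z ^ 5)" by (simp add: cost_factor_def)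
  finally show ?thesis .
qed

lemma logs_rel:
  "rel_spmf (\<lambda>tr y. agree tr (snd y) \<and> G.sound (fst y) (snd y) \<and> length (snd y) = m) (PP m) (spmf_of_pmf (G.achain m))"
proof -
  have i: "rel_spmf (G.sim tt G.Af) init (map_spmf (\<lambda>f. fst (G.start f)) (signs (KK * n)))"
    by (rule rel_spmf_mono[OF init_sim]) simp
  show ?thesis unfolding PP_def logs_def spmf_rel_map
  proof (rule rel_spmf_mono_strong[OF G.play_sim[OF i, of m]])
    fix x y assume a: "(\<lambda>(s, tr) (a, tr'). G.sim tt G.Af s a \<and> agree tr tr') x y" and "y \<in> set_spmf (spmf_of_pmf (G.achain m))"
    then have "(fst y, snd y) \<in> set_pmf (G.achain m)" by simp
    then show "agree (snd x) (snd y) \<and> G.sound (fst y) (snd y) \<and> length (snd y) = m"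
      using G.sound_achain a by (auto split: prod.splits)
  qed
qed

lemma costs: "700 * real G.X \<le> CC * (real d * z ^ 5)" "100 * real d \<le> CC * (real d * z)"
  unfolding cost_factor_def using small_arith(1,2)[OF l1 lgs(4,5) k1 d1(2)] X9 by blast+

lemma scale_exact:
  "700 * real G.X * real a + 100 * real d * real b \<le> CC * (real a * (real d * z ^ 5) + real b * (real d * z))"
proof -
  have "700 * real G.X * real a + 100 * real d * real b \<le> CC * (real d * z ^ 5) * real a + CC * (real d * z) * real b"
    by (intro add_mono mult_right_mono costs) simp_all
  also have "\<dots> = CC * (real a * (real d * z ^ 5) + real b * (real d * z))" by (simp add: algebra_simps)
  finally show ?thesis .
qed

text \<open>Every log that can occur agrees with a sound abstract log, so these two claims hold
  surely and not only with high probability.\<close>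

lemma det_bounds:
  assumes "tr \<in> set_spmf (PP m)"
  shows "real (time_of (\<lambda>q. \<not> is_Query q) tr) \<le> CC * scale_exact_bound A tr"
    "j < m \<Longrightarrow> fst (tr ! j) = ComputeExact i \<Longrightarrow>
      fst (snd (tr ! j)) $ 0 = xvec A x0 (queries g (requests (take j tr))) (length (queries g (requests (take j tr)))) $ i"
proof -
  from rel_spmf_ex[OF logs_rel assms] obtain a tr' where ag: "agree tr tr'" and S: "G.sound a tr'" and len: "length tr' = m" by auto
  have "time_of (\<lambda>q. \<not> is_Query q) tr \<le> 700 * G.X * number_of is_Scale tr' + 100 * d * number_of is_Exact tr'"
    using order_trans[OF agreeD(4)[OF ag] G.sound_time[OF S]] .
  then have "real (time_of (\<lambda>q. \<not> is_Query q) tr) \<le> real (700 * G.X * number_of is_Scale tr + 100 * d * number_of is_Exact tr)"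
    unfolding number_of_agree[OF ag] by (simp only: of_nat_le_iff)
  also have "\<dots> = 700 * real G.X * real (number_of is_Scale tr) + 100 * real d * real (number_of is_Exact tr)" by simp
  also have "\<dots> \<le> CC * (real (number_of is_Scale tr) * (real d * z ^ 5) + real (number_of is_Exact tr) * (real d * z))" by (rule scale_exact)
  also have "\<dots> = CC * scale_exact_bound A tr" using A by (simp add: scale_exact_bound_def Let_def)
  finally show "real (time_of (\<lambda>q. \<not> is_Query q) tr) \<le> CC * scale_exact_bound A tr" .
  assume j: "j < m" and q: "fst (tr ! j) = ComputeExact i"
  have "(\<lambda>(q, y, c) (q', y', c'). q = q' \<and> y = y' \<and> c \<le> c') (tr ! j) (tr' ! j)"
    by (rule list_all2_nthD2[OF ag[unfolded agree_def]]) (use j len in simp)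
  then have e: "fst (tr' ! j) = ComputeExact i" "fst (snd (tr' ! j)) = fst (snd (tr ! j))" using q by (auto split: prod.splits)
  have t: "requests (take j tr) = requests (take j tr')" using agreeD(1)[OF ag] by (simp only: take_map[symmetric])
  have "G.entry_ok (take j tr') (tr' ! j)" using S j len by (auto simp: G.sound_def)
  then show "fst (snd (tr ! j)) $ 0 = xvec A x0 (queries g (requests (take j tr))) (length (queries g (requests (take j tr)))) $ i"
    unfolding t e(2)[symmetric] using e(1) by (auto simp: G.entry_ok_def split: prod.splits)
qed

lemma approx_bound:
  assumes k: "1 \<le> k"
  shows "lossless_spmf (PP m)" "1 - 1 / real n ^ c \<le> measure (measure_spmf (PP m))
    {tr. k \<le> length (query_outputs tr) \<longrightarrow> approx \<epsilon> (query_outputs tr ! (k - 1)) (xvec A x0 (queries g (requests tr)) k)}"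
proof -
  let ?G = "{tr. k \<le> length (query_outputs tr) \<longrightarrow> approx \<epsilon> (query_outputs tr ! (k - 1)) (xvec A x0 (queries g (requests tr)) k)}"
  let ?E = "{(s :: ast, tr). \<not> (k \<le> length (queries g (requests tr)) \<longrightarrow> approx \<epsilon> (query_outputs tr ! (k - 1)) (xvec A x0 (queries g (requests tr)) k))}"
  have bad: "y \<in> ?E" if a: "agree tr (snd y) \<and> G.sound (fst y) (snd y) \<and> length (snd y) = m" and b: "tr \<notin> ?G" for tr y
  proof -
    have ag: "agree tr (snd y)" using a by blast
    have "\<not> (k \<le> length (query_outputs tr) \<longrightarrow> approx \<epsilon> (query_outputs tr ! (k - 1)) (xvec A x0 (queries g (requests tr)) k))"
      using b by blast
    then show ?thesis unfolding agreeD(1)[OF ag] agreeD(3)[OF ag] length_query_outputs[of "snd y" g]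
      by (simp add: case_prod_beta)
  qed
  have p: "measure_pmf.prob (G.achain m) ?E \<le> 1 / real n ^ c" by (rule order_trans[OF G.prob_not_approx[OF k] flaw(2)])
  note r = rel_spmf_prob_ge[OF logs_rel, where G = ?G and E = ?E and e = "1 / real n ^ c", OF bad p]
  show "lossless_spmf (PP m)" by (rule r(1))
  show "1 - 1 / real n ^ c \<le> measure (measure_spmf (PP m)) ?G" by (rule r(2))
qed

lemma time_bound:
  "1 - 1 / real n ^ c \<le> measure (measure_spmf (PP m))
    {tr. real (time_of (\<lambda>q. True) tr) \<le> CC * (scale_exact_bound A tr + query_bound A g x0 \<epsilon> tr)}"
proof -
  let ?G = "{tr. real (time_of (\<lambda>q. True) tr) \<le> CC * (scale_exact_bound A tr + query_bound A g x0 \<epsilon> tr)}"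
  let ?E = "{(s :: ast, tr). \<not> G.claims BB tr}"
  have bad: "y \<in> ?E" if a: "agree tr (snd y) \<and> G.sound (fst y) (snd y) \<and> length (snd y) = m" and b: "tr \<notin> ?G" for tr y
  proof (rule ccontr)
    assume "y \<notin> ?E"
    then have C: "G.claims BB (snd y)" by (simp add: case_prod_beta)
    have ag: "agree tr (snd y)" and S: "G.sound (fst y) (snd y)" using a by blast+
    let ?qs = "queries g (requests tr)"
    let ?T = "real (length ?qs)" and ?en = "energy A x0 ?qs"
    have en0: "0 \<le> ?en" unfolding agreeD(1)[OF ag] G.past_energy[OF S] by (intro sum_nonneg row_energy_nonneg)
    have "real (time_of (\<lambda>q. True) tr) \<le> real (time_of (\<lambda>q. True) (snd y))" using agreeD(4)[OF ag] by (simp only: of_nat_le_iff)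
    also have "\<dots> \<le> (700 * real G.X * real (number_of is_Scale tr) + 100 * real d * real (number_of is_Exact tr))
      + ?T * (300 * real (n * (lg + lg)) + 1260 * real (n * KK) + 2000 * real (n * G.X) / real RR
      + 56001 * real KK * real G.X / tt\<^sup>2 * ?en)"
      using G.claims_time[OF S C BB] unfolding agreeD(1)[OF ag] number_of_agree[OF ag] .
    also have "\<dots> \<le> CC * scale_exact_bound A tr + ?T * (CC * (real n * z + ?en * (1 / \<epsilon>\<^sup>2) * real d * z ^ 6))"
    proof (intro add_mono mult_left_mono)
      show "700 * real G.X * real (number_of is_Scale tr) + 100 * real d * real (number_of is_Exact tr) \<le> CC * scale_exact_bound A tr"
        using scale_exact A by (simp add: scale_exact_bound_def Let_def)
      have R0: "0 < real RR" by (simp add: RR_def)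
      show "300 * real (n * (lg + lg)) + 1260 * real (n * KK) + 2000 * real (n * G.X) / real RR + 56001 * real KK * real G.X / tt\<^sup>2 * ?en
        \<le> CC * (real n * z + ?en * (1 / \<epsilon>\<^sup>2) * real d * z ^ 6)"
        using query_arith[OF l1 lgs(4) k1 d1(1) of_nat_0_le_iff eps(1) en0 X9 X6 R0, of n]
        unfolding cost_factor_def KK_def tt_def of_nat_mult of_nat_add mult_2 .
    qed simp
    also have "\<dots> = CC * (scale_exact_bound A tr + query_bound A g x0 \<epsilon> tr)"
      using A by (simp add: query_bound_def Let_def algebra_simps)
    finally show False using b by simp
  qed
  have p: "measure_pmf.prob (G.achain m) ?E \<le> 1 / real n ^ c" by (rule order_trans[OF G.prob_claims[OF BB(1)] flaw(1)])
  show ?thesis by (rule rel_spmf_prob_ge(2)[OF logs_rel, where G = ?G and E = ?E and e = "1 / real n ^ c", OF bad p])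
qed

end

theorem theorem8:
  shows "\<forall>c::nat. \<exists>(D::data_structure) (W::nat) (C::real). C > 0 \<and>
    (\<forall>(n::nat) (d::nat) (A::real mat) (g::real vec) (x0::real vec) (\<epsilon>::real) (adv::adversary).
       n \<ge> 2 \<and> A \<in> carrier_mat n d \<and> nondegenerate A \<and>
       g \<in> carrier_vec n \<and> x0 \<in> carrier_vec n \<and> 0 < \<epsilon> \<and> \<epsilon> < 1 / 10 \<and>
       admissible_adversary A g x0 adv \<longrightarrow>
       (\<forall>s \<in> set_spmf (initialize D (word_length W n) A g x0 \<epsilon>).
          real (clock s) \<le> C * (real (nnz A) * ln (real n) ^ 5)) \<and>
       (\<forall>m::nat.
          let P = logs D (word_length W n) A g x0 \<epsilon> adv m in
          lossless_spmf P \<and>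
          (\<forall>tr \<in> set_spmf P.
             real (time_of (\<lambda>q. \<not> is_Query q) tr) \<le> C * scale_exact_bound A tr \<and>
             (\<forall>j<m. \<forall>i. fst (tr ! j) = ComputeExact i \<longrightarrow>
                fst (snd (tr ! j)) $ 0 =
                  (let L = queries g (requests (take j tr)) in xvec A x0 L (length L) $ i))) \<and>
          (\<forall>t \<ge> 1. measure (measure_spmf P)
             {tr. t \<le> length (query_outputs tr) \<longrightarrow>
                  approx \<epsilon> (query_outputs tr ! (t - 1)) (xvec A x0 (queries g (requests tr)) t)}
             \<ge> 1 - 1 / real n ^ c) \<and>
          measure (measure_spmf P)
             {tr. real (time_of (\<lambda>q. True) tr)
                    \<le> C * (scale_exact_bound A tr + query_bound A g x0 \<epsilon> tr)}
             \<ge> 1 - 1 / real n ^ c))"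
proof
  fix c :: nat
  show "\<exists>(D::data_structure) (W::nat) (C::real). C > 0 \<and> (\<forall>(n::nat) (d::nat) (A::real mat) (g::real vec) (x0::real vec) (\<epsilon>::real) (adv::adversary).
       n \<ge> 2 \<and> A \<in> carrier_mat n d \<and> nondegenerate A \<and>
       g \<in> carrier_vec n \<and> x0 \<in> carrier_vec n \<and> 0 < \<epsilon> \<and> \<epsilon> < 1 / 10 \<and>
       admissible_adversary A g x0 adv \<longrightarrow>
       (\<forall>s \<in> set_spmf (initialize D (word_length W n) A g x0 \<epsilon>).
          real (clock s) \<le> C * (real (nnz A) * ln (real n) ^ 5)) \<and>
       (\<forall>m::nat.
          let P = logs D (word_length W n) A g x0 \<epsilon> adv m in
          lossless_spmf P \<and>
          (\<forall>tr \<in> set_spmf P.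
             real (time_of (\<lambda>q. \<not> is_Query q) tr) \<le> C * scale_exact_bound A tr \<and>
             (\<forall>j<m. \<forall>i. fst (tr ! j) = ComputeExact i \<longrightarrow>
                fst (snd (tr ! j)) $ 0 =
                  (let L = queries g (requests (take j tr)) in xvec A x0 L (length L) $ i))) \<and>
          (\<forall>t \<ge> 1. measure (measure_spmf P)
             {tr. t \<le> length (query_outputs tr) \<longrightarrow>
                  approx \<epsilon> (query_outputs tr ! (t - 1)) (xvec A x0 (queries g (requests tr)) t)}
             \<ge> 1 - 1 / real n ^ c) \<and>
          measure (measure_spmf P)
             {tr. real (time_of (\<lambda>q. True) tr)
                    \<le> C * (scale_exact_bound A tr + query_bound A g x0 \<epsilon> tr)}
             \<ge> 1 - 1 / real n ^ c))"
  proof (intro exI conjI allI impI)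
    \<comment> \<open>The witnesses depend on \<open>c\<close> alone:
      \<open>tree_structure (rate c)\<close>, word factor \<open>rate c + 10\<close> and
      \<open>cost_factor c\<close>.\<close>
    show "0 < cost_factor c" by (simp add: cost_factor_def rate_def)
    fix n d :: nat and A :: "real mat" and g x0 :: "real vec" and \<epsilon> :: real and adv :: adversary
    assume "n \<ge> 2 \<and> A \<in> carrier_mat n d \<and> nondegenerate A \<and>
       g \<in> carrier_vec n \<and> x0 \<in> carrier_vec n \<and> 0 < \<epsilon> \<and> \<epsilon> < 1 / 10 \<and> admissible_adversary A g x0 adv"
    then have h: "2 \<le> n" "A \<in> carrier_mat n d" "nondegenerate A" "g \<in> carrier_vec n" "x0 \<in> carrier_vec n"
      "0 < \<epsilon>" "\<epsilon> < 1 / 10" "admissible_adversary A g x0 adv" by blast+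
    show "\<forall>s \<in> set_spmf (initialize (tree_structure (rate c)) (word_length (rate c + 10) n) A g x0 \<epsilon>).
          real (clock s) \<le> cost_factor c * (real (nnz A) * ln (real n) ^ 5)"
      using init_bound[OF h, where c = c] unfolding ww_def[OF h] by blast
    fix m :: nat
    note P = PP_def[OF h, where c = c, unfolded ww_def[OF h]]
    show "let P = logs (tree_structure (rate c)) (word_length (rate c + 10) n) A g x0 \<epsilon> adv m in
          lossless_spmf P \<and>
          (\<forall>tr \<in> set_spmf P.
             real (time_of (\<lambda>q. \<not> is_Query q) tr) \<le> cost_factor c * scale_exact_bound A tr \<and>
             (\<forall>j<m. \<forall>i. fst (tr ! j) = ComputeExact i \<longrightarrow>
                fst (snd (tr ! j)) $ 0 =
                  (let L = queries g (requests (take j tr)) in xvec A x0 L (length L) $ i))) \<and>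
          (\<forall>t \<ge> 1. measure (measure_spmf P)
             {tr. t \<le> length (query_outputs tr) \<longrightarrow>
                  approx \<epsilon> (query_outputs tr ! (t - 1)) (xvec A x0 (queries g (requests tr)) t)}
             \<ge> 1 - 1 / real n ^ c) \<and>
          measure (measure_spmf P)
             {tr. real (time_of (\<lambda>q. True) tr)
                    \<le> cost_factor c * (scale_exact_bound A tr + query_bound A g x0 \<epsilon> tr)}
             \<ge> 1 - 1 / real n ^ c"
      unfolding Let_def P[symmetric]
      using approx_bound[OF h, where c = c and m = m] det_bounds[OF h, where c = c and m = m] time_bound[OF h, where c = c and m = m]
      by blast
  qed
qed

end
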